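(* Let $n>0$ and $k\ge1$. Let $t_1^{\delta(\cdot)}$ be the operator defined by putting $t_1^{\delta(\cdot)}\mathfrak{a}_\lambda=t_1^{\ell(\lambda^-)-\ell(\lambda^+)}\mathfrak{a}_\lambda$ for any generalized partition $\lambda$. Then $\mathfrak{a}_{-n}^{(k)}$ is equal to $$(-t_2)^k\,t_1^{\delta(\cdot)-1}\,\mathrm{Coeff}_{s_1\cdots s_kz_1^0\cdots z_k^0}\;\frac{(Q_1^n-1)T_1^{-n}z_1^{-n}}{\prod_{i=1}^k(1-Q_i)(1-T_i^{-1})}\prod_{j=2}^k\left(\prod_{i=1}^{j-1}f_{i,j}-\prod_{i=1}^{j-1}f_{j,i}\right)$$ $$\cdot\prod_{i=1}^k\Gamma_-(T_iz_i)\Gamma_-(z_i)^{-1}\cdot\prod_{i=1}^k\Gamma_+(Q_i^{-1}T_iz_i)\Gamma_+(T_iz_i)^{-1},$$ where $Q_i=e^{\alpha s_i}$ with $\alpha=-t_1/t_2$, $T_i=e^{s_i}$, and for $i\ne j$ $$f_{i,j}=\frac{1-(T_jz_j)^{-1}(T_iz_i)}{1-(Q_j^{-1}T_jz_j)^{-1}(T_iz_i)}\cdot\frac{1-(Q_j^{-1}T_jz_j)^{-1}z_i}{1-(T_jz_j)^{-1}z_i}.$$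
   Context: Setting. $X=\mathbb{C}^2$ with coordinate functions $u,v$; $\mathbb{T}=(\mathbb{C}^* )^2$ acts by $(a,b)\cdot(u,v)=(a^{-1}u,b^{-1}v)$. $H^*_{\mathbb{T}}(\mathrm{pt})=\mathbb{C}[t_1,t_2]$, $H^*_{\mathbb{T}}(\cdot)'=H^*_{\mathbb{T}}(\cdot)\otimes_{\mathbb{C}[t_1,t_2]}\mathbb{C}(t_1,t_2)$, $\mathbb{H}_X'=\bigoplus_{n\ge0}H^*_{\mathbb{T}}(X^{[n]})'$ with $X^{[n]}$ the Hilbert scheme of $n$ points on $X$. The $\mathbb{T}$-fixed points of $X^{[n]}$ are $\xi_\lambda$, $\lambda=(\lambda_1\ge\cdots\ge\lambda_k>0)\vdash n$, with ideal $\langle u^{\lambda_1},u^{\lambda_2}v,\ldots,u^{\lambda_k}v^{k-1},v^k\rangle$; the classes $[\xi_\lambda]$ form a basis of $\mathbb{H}_X'$. For a cell $\square$ of the Young diagram $D_\lambda$ (rows of lengths $\lambda_1,\lambda_2,\ldots$ from north to south), $a'(\square)$ and $\ell'(\square)$ are the numbers of cells strictly to the west, respectively north, of $\square$. The operator $\mathfrak{G}_1(t_1,t_2)\in\mathrm{End}(\mathbb{H}_X')$ is cup product with the first equivariant Chern character of the tautological bundles: $\mathfrak{G}_1(t_1,t_2)[\xi_\lambda]=-\sum_{\square\in D_\lambda}(a'(\square)t_1+\ell'(\square)t_2)[\xi_\lambda]$. Derivatives. For $\mathfrak{f}\in\mathrm{End}(\mathbb{H}_X')$, $\mathfrak{f}^{(0)}=\mathfrak{f}$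 and $\mathfrak{f}^{(k)}=[\mathfrak{G}_1(t_1,t_2),\mathfrak{f}^{(k-1)}]$ for $k\ge1$. Fock space. $\mathfrak{F}$ is freely generated over $\mathbb{C}$ by commuting creation operators $\mathfrak{a}_{-k}$ ($k>0$) acting on the vacuum $|0\rangle$; the annihilation operators $\mathfrak{a}_k$ ($k>0$) satisfy $\mathfrak{a}_k|0\rangle=0$ and $[\mathfrak{a}_k,\mathfrak{a}_\ell]=k\,\delta_{k,-\ell}\mathrm{Id}$. $\mathbb{H}_X'$ is identified with $\mathfrak{F}\otimes_{\mathbb{C}}\mathbb{C}(t_1,t_2)$ by sending, for each partition $\lambda=(1^{m_1}2^{m_2}\cdots)$, $\frac{1}{\prod_im_i!}\prod_i\mathfrak{a}_{-\lambda_i}|0\rangle$ to the equivariant class of the closed subvariety of $X^{[|\lambda|]}$ whose generic elements are unions of subschemes of lengths $\lambda_1,\ldots,\lambda_{\ell(\lambda)}$ supported at distinct points. Identifying $\mathfrak{F}$ with the ring of symmetric functions by $\prod_i\mathfrak{a}_{-\lambda_i}|0\rangle\leftrightarrow p_\lambda$, $[\xi_\lambda]$ corresponds to $t_2^{|\lambda|}t_1^{\ell(\cdot)}J_\lambda^{(\alpha)}|_{\alpha=-t_1/t_2}$, with $J_\lambda^{(\alpha)}$ the integral form of the Jack symmetric function and $t_1^{\ell(\cdot)}p_\mu=t_1^{\ell(\mu)}p_\mu$. Notation. $\Gamma_\pm(z)=\exp\big(\sum_{k>0}\frac{z^{\mp k}}{k}\mathfrak{a}_{\pm k}\big)$. A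 generalized partition $\lambda=(\cdots(-2)^{m_{-2}}(-1)^{m_{-1}}1^{m_1}2^{m_2}\cdots)$ has nonzero integer parts $i$ with multiplicities $m_i$ (finitely many nonzero); $\ell(\lambda)=\sum_im_i$, $\lambda^+=(1^{m_1}2^{m_2}\cdots)$, $\lambda^-=(\cdots(-2)^{m_{-2}}(-1)^{m_{-1}})$, $\mathfrak{a}_\lambda=\cdots\mathfrak{a}_{-2}^{m_{-2}}\mathfrak{a}_{-1}^{m_{-1}}\mathfrak{a}_1^{m_1}\mathfrak{a}_2^{m_2}\cdots$. $t_1^{\delta(\cdot)-1}$ means $t_1^{-1}$ times $t_1^{\delta(\cdot)}$, applied linearly to the resulting combination of the $\mathfrak{a}_\lambda$ after the coefficient is extracted. $\mathrm{Coeff}_{s_1\cdots s_kz_1^0\cdots z_k^0}$ takes the coefficient of $s_1^1\cdots s_k^1z_1^0\cdots z_k^0$; each $f_{i,j}$ is expanded in nonnegative powers of $z_iz_j^{-1}$ (with coefficients expanded as power series in $s_i,s_j$), and the prefactor is expanded as a Laurent series in the $s_i$. *)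

theory Defs
  imports
    Complex_Main
    "HOL-Library.Multiset"
    "HOL-Library.Poly_Mapping"
    "HOL-Library.Groups_Big_Fun"
    "HOL-Library.Product_Plus"
    "HOL-Computational_Algebra.Fraction_Field"
    "HOL-Computational_Algebra.Formal_Laurent_Series"
begin

section \<open>The field of rational functions in the two equivariant parameters\<close>

text \<open>\<open>\<complex>(t\<^sub>1,t\<^sub>2)\<close> as the fraction field of \<open>\<complex>[t\<^sub>1][t\<^sub>2]\<close>.\<close>

type_synonym ratfun = "complex poly poly fract"

definition t1 :: ratfun where "t1 = Fraction_Field.Fract [:[:0, 1:]:] 1"

definition t2 :: ratfun where "t2 = Fraction_Field.Fract [:0, 1:] 1"

definition jalpha :: ratfun where "jalpha = - t1 / t2"


section \<open>Partitions and Young diagrams\<close>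

typedef partition = "{M :: nat multiset. 0 \<notin># M}"
  morphisms parts Partition
  by (rule exI[of _ "{#}"]) simp

definition psize :: "partition \<Rightarrow> nat" where "psize l = sum_mset (parts l)"

definition plen :: "partition \<Rightarrow> nat" where "plen l = size (parts l)"

definition rows :: "partition \<Rightarrow> nat list" where
  "rows l = rev (sorted_list_of_multiset (parts l))"

text \<open>Cells are pairs (row, column), both counted from 0, rows from north to south and columns
  from west to east.\<close>

definition cells :: "partition \<Rightarrow> (nat \<times> nat) set" where
  "cells l = {(i, j). i < length (rows l) \<and> j < rows l ! i}"

definition arm :: "partition \<Rightarrow> nat \<times> nat \<Rightarrow> nat" where
  "arm l = (\<lambda>(i, j). card {j'. j < j' \<and> (i, j') \<in> cells l})"

definition leg :: "partition \<Rightarrow> nat \<times> nat \<Rightarrow> nat" where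
  "leg l = (\<lambda>(i, j). card {i'. i < i' \<and> (i', j) \<in> cells l})"

definition coarm :: "partition \<Rightarrow> nat \<times> nat \<Rightarrow> nat" where
  "coarm l = (\<lambda>(i, j). card {j'. j' < j \<and> (i, j') \<in> cells l})"

definition coleg :: "partition \<Rightarrow> nat \<times> nat \<Rightarrow> nat" where
  "coleg l = (\<lambda>(i, j). card {i'. i' < i \<and> (i', j) \<in> cells l})"

definition dominated :: "partition \<Rightarrow> partition \<Rightarrow> bool" where
  "dominated m l \<longleftrightarrow> psize m = psize l \<and>
     (\<forall>i. sum_list (take i (rows m)) \<le> sum_list (take i (rows l)))"


section \<open>Fock space\<close>

text \<open>The Fock space \<open>\<FF> \<otimes> \<complex>(t\<^sub>1,t\<^sub>2)\<close>, identified both with symmetric functions over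
  \<open>\<complex>(t\<^sub>1,t\<^sub>2)\<close> and with the localized equivariant cohomology of the Hilbert schemes of points.
  It has the basis \<open>p\<^sub>\<lambda> = \<Prod>\<^sub>i \<aa>\<^bsub>-\<lambda>\<^sub>i\<^esub>|0\<rangle>\<close>, \<open>\<lambda>\<close> a partition.\<close>

type_synonym fock = "partition \<Rightarrow>\<^sub>0 ratfun"

definition pbasis :: "partition \<Rightarrow> fock" where "pbasis l = Poly_Mapping.single l 1"

definition vacuum :: fock where "vacuum = pbasis (Partition {#})"

definition fscale :: "ratfun \<Rightarrow> fock \<Rightarrow> fock" where
  "fscale c v = Poly_Mapping.map (\<lambda>x. c * x) v"

definition lin_ext :: "(partition \<Rightarrow> fock) \<Rightarrow> fock \<Rightarrow> fock" where
  "lin_ext h v = (\<Sum>m\<in>Poly_Mapping.keys v. fscale (Poly_Mapping.lookup v m) (h m))"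

text \<open>\<open>heis k\<close> is \<open>\<aa>\<^sub>k\<close>: multiplication by \<open>p\<^bsub>-k\<^esub>\<close> for \<open>k < 0\<close> and
  \<open>k \<partial>/\<partial>p\<^sub>k\<close> for \<open>k > 0\<close>. There is no \<open>\<aa>\<^sub>0\<close>; \<open>heis 0\<close> is a dummy value.\<close>

definition heis :: "int \<Rightarrow> fock \<Rightarrow> fock" where
  "heis k =
    (if k < 0 then lin_ext (\<lambda>m. pbasis (Partition (add_mset (nat (- k)) (parts m))))
     else if k > 0 then
       lin_ext (\<lambda>m. fscale (of_int k * of_nat (count (parts m) (nat k)))
                     (pbasis (Partition (parts m - {#nat k#}))))
     else (\<lambda>v. 0))"


section \<open>Jack symmetric functions\<close>

text \<open>Polynomials in the variables \<open>x\<^sub>0, x\<^sub>1, \<dots>\<close>; exponent vectors are finitely supported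
  functions.\<close>

type_synonym xpoly = "(nat \<Rightarrow>\<^sub>0 nat) \<Rightarrow>\<^sub>0 ratfun"

definition xconst :: "ratfun \<Rightarrow> xpoly" where "xconst c = Poly_Mapping.single 0 c"

definition power_sum :: "nat \<Rightarrow> nat \<Rightarrow> xpoly" where
  "power_sum N r = (\<Sum>i<N. Poly_Mapping.single (Poly_Mapping.single i r) 1)"

text \<open>The specialization \<open>f(x\<^sub>0,\<dots>,x\<^bsub>N-1\<^esub>)\<close> of a symmetric function \<open>f\<close>, written in power
  sums, to \<open>N\<close> variables.\<close>

definition restrict_vars :: "nat \<Rightarrow> fock \<Rightarrow> xpoly" where
  "restrict_vars N f = (\<Sum>m\<in>Poly_Mapping.keys f.
     xconst (Poly_Mapping.lookup f m) * prod_mset (image_mset (power_sum N) (parts m)))"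

text \<open>The monomial symmetric polynomial \<open>m\<^sub>\<lambda>(x\<^sub>0,\<dots>,x\<^bsub>N-1\<^esub>)\<close>.\<close>

definition monomial_sym :: "nat \<Rightarrow> partition \<Rightarrow> xpoly" where
  "monomial_sym N l = (\<Sum>e\<in>{e. Poly_Mapping.keys e \<subseteq> {..<N} \<and>
       image_mset (Poly_Mapping.lookup e) (mset_set (Poly_Mapping.keys e)) = parts l}.
     Poly_Mapping.single e 1)"

definition zee :: "partition \<Rightarrow> nat" where
  "zee l = (\<Prod>i\<in>set_mset (parts l). i ^ count (parts l) i * fact (count (parts l) i))"

text \<open>The bilinear form with \<open>\<langle>p\<^sub>\<lambda>, p\<^sub>\<mu>\<rangle>\<^sub>\<alpha> = \<delta>\<^bsub>\<lambda>\<mu>\<^esub> z\<^sub>\<lambda> \<alpha>\<^bsup>\<ell>(\<lambda>)\<^esup>\<close>.\<close>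

definition jack_form :: "ratfun \<Rightarrow> fock \<Rightarrow> fock \<Rightarrow> ratfun" where
  "jack_form a f g = (\<Sum>m\<in>Poly_Mapping.keys f.
     Poly_Mapping.lookup f m * Poly_Mapping.lookup g m * of_nat (zee m) * a ^ plen m)"

text \<open>The monic Jack functions \<open>P\<^sub>\<lambda>\<^bsup>(\<alpha>)\<^esup>\<close>: \<open>P\<^sub>\<lambda> = m\<^sub>\<lambda> + \<Sum>\<^bsub>\<mu><\<lambda>\<^esub> u\<^bsub>\<lambda>\<mu>\<^esub> m\<^sub>\<mu>\<close> with respect
  to the dominance order, and \<open>P\<^sub>\<lambda>\<close>, \<open>P\<^sub>\<mu>\<close> orthogonal for \<open>\<lambda> \<noteq> \<mu>\<close>. An identity of symmetric
  functions is expressed as an identity in every finite number of variables.\<close>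

definition is_jackP_family :: "ratfun \<Rightarrow> (partition \<Rightarrow> fock) \<Rightarrow> bool" where
  "is_jackP_family a P \<longleftrightarrow>
     (\<forall>l. \<exists>u. \<forall>N. restrict_vars N (P l) =
        monomial_sym N l + (\<Sum>m | dominated m l \<and> m \<noteq> l. xconst (u m) * monomial_sym N m)) \<and>
     (\<forall>l m. l \<noteq> m \<longrightarrow> jack_form a (P l) (P m) = 0)"

definition jackP :: "ratfun \<Rightarrow> partition \<Rightarrow> fock" where
  "jackP a = (THE P. is_jackP_family a P)"

text \<open>The integral form \<open>J\<^sub>\<lambda>\<^bsup>(\<alpha>)\<^esup> = \<Prod>\<^sub>s (\<alpha> a(s) + \<ell>(s) + 1) \<cdot> P\<^sub>\<lambda>\<^bsup>(\<alpha>)\<^esup>\<close>.\<close>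

definition jackJ :: "ratfun \<Rightarrow> partition \<Rightarrow> fock" where
  "jackJ a l = fscale (\<Prod>s\<in>cells l. a * of_nat (arm l s) + of_nat (leg l s) + 1) (jackP a l)"


section \<open>Fixed point classes, the operator \<open>\<GG>\<^sub>1\<close> and derivatives\<close>

definition t1_len :: "fock \<Rightarrow> fock" where
  "t1_len v = Poly_Mapping.mapp (\<lambda>m c. t1 ^ plen m * c) v"

text \<open>The class \<open>[\<xi>\<^sub>\<lambda>]\<close> of the torus fixed point, as an element of Fock space.\<close>

definition fixed_point_class :: "partition \<Rightarrow> fock" where
  "fixed_point_class l = fscale (t2 ^ psize l) (t1_len (jackJ jalpha l))"

text \<open>\<open>\<GG>\<^sub>1\<close> is determined by its action on the classes \<open>[\<xi>\<^sub>\<lambda>]\<close> because they form a basis.\<close>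

definition G1 :: "fock \<Rightarrow> fock" where
  "G1 = (THE G. Vector_Spaces.linear fscale fscale G \<and>
     (\<forall>l. G (fixed_point_class l) =
        fscale (- (\<Sum>s\<in>cells l. of_nat (coarm l s) * t1 + of_nat (coleg l s) * t2))
          (fixed_point_class l)))"

definition commutator :: "(fock \<Rightarrow> fock) \<Rightarrow> (fock \<Rightarrow> fock) \<Rightarrow> fock \<Rightarrow> fock" where
  "commutator A B = (\<lambda>v. A (B v) - B (A v))"

primrec deriv_op :: "nat \<Rightarrow> (fock \<Rightarrow> fock) \<Rightarrow> fock \<Rightarrow> fock" where
  "deriv_op 0 f = f"
| "deriv_op (Suc k) f = commutator G1 (deriv_op k f)"


section \<open>Generalized partitions and infinite combinations of the \<open>\<aa>\<^sub>\<lambda>\<close>\<close>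

text \<open>A generalized partition is a finite multiset of nonzero integers. The type also contains
  multisets with the part 0; these do no harm since \<open>heis 0 = 0\<close>.\<close>

type_synonym gpartition = "int multiset"

text \<open>\<open>\<aa>\<^sub>\<lambda> = \<cdots>\<aa>\<^bsub>-2\<^esub>\<^bsup>m\<^esup>\<aa>\<^bsub>-1\<^esub>\<^bsup>m\<^esup>\<aa>\<^sub>1\<^bsup>m\<^esup>\<aa>\<^sub>2\<^bsup>m\<^esup>\<cdots>\<close>: the sorted list has the negative parts on
  the left.\<close>

definition heis_gpart :: "gpartition \<Rightarrow> fock \<Rightarrow> fock" where
  "heis_gpart l = foldr (\<lambda>i F. heis i \<circ> F) (sorted_list_of_multiset l) id"

text \<open>\<open>\<Sum>\<^sub>\<lambda> c\<^sub>\<lambda> \<aa>\<^sub>\<lambda>\<close>, an infinite combination of which only finitely many terms act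
  nontrivially on any given vector. Here and below \<^const>\<open>Sum_any\<close> sums the nonzero terms.\<close>

definition op_of_coeffs :: "(gpartition \<Rightarrow> ratfun) \<Rightarrow> fock \<Rightarrow> fock" where
  "op_of_coeffs c v = Sum_any (\<lambda>l. fscale (c l) (heis_gpart l v))"

definition len_neg :: "gpartition \<Rightarrow> nat" where "len_neg l = size (filter_mset (\<lambda>i. i < 0) l)"

definition len_pos :: "gpartition \<Rightarrow> nat" where "len_pos l = size (filter_mset (\<lambda>i. i > 0) l)"

text \<open>The operator \<open>t\<^sub>1\<^bsup>\<delta>(\<cdot>)\<^esup>\<close>.\<close>

definition t1_delta :: "(gpartition \<Rightarrow> ratfun) \<Rightarrow> gpartition \<Rightarrow> ratfun" where
  "t1_delta c l = t1 powi (int (len_neg l) - int (len_pos l)) * c l"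


section \<open>Formal series in \<open>s\<^sub>i\<close>, \<open>z\<^sub>i\<close> and the \<open>\<aa>\<^sub>\<lambda>\<close>\<close>

text \<open>A series assigns a coefficient to every triple (exponents of the \<open>s\<^sub>i\<close>, exponents of the
  \<open>z\<^sub>i\<close>, generalized partition). As usual for formal distributions, supports may be infinite in both
  directions; a product is the convolution, which is meaningful when every coefficient of it is a
  finite sum. The operator symbols are multiplied by \<open>\<aa>\<^sub>\<lambda> \<cdot> \<aa>\<^sub>\<mu> = \<aa>\<^bsub>\<lambda>\<union>\<mu>\<^esub>\<close>. This is the composition
  of operators whenever \<open>\<lambda>\<close> has no positive or \<open>\<mu>\<close> has no negative parts (cf. \<open>heis_gpart_add\<close>
  below), and all products formed here are of this kind.\<close>

type_synonym series = "(nat \<Rightarrow>\<^sub>0 int) \<times> (nat \<Rightarrow>\<^sub>0 int) \<times> gpartition \<Rightarrow> ratfun"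

definition smonom :: "(nat \<Rightarrow>\<^sub>0 int) \<times> (nat \<Rightarrow>\<^sub>0 int) \<times> gpartition \<Rightarrow> series" where
  "smonom e = (\<lambda>e'. if e' = e then 1 else 0)"

abbreviation sone :: series where "sone \<equiv> smonom 0"

definition smult :: "series \<Rightarrow> series \<Rightarrow> series"  (infixl \<open>\<star>\<close> 70) where
  "f \<star> g = (\<lambda>e. Sum_any (\<lambda>(d, d'). if d + d' = e then f d * g d' else 0))"

primrec spow :: "series \<Rightarrow> nat \<Rightarrow> series" where
  "spow f 0 = sone"
| "spow f (Suc m) = f \<star> spow f m"

definition sprod :: "(nat \<Rightarrow> series) \<Rightarrow> nat list \<Rightarrow> series" where
  "sprod f is = foldr (\<lambda>i g. f i \<star> g) is sone"

definition sexp :: "series \<Rightarrow> series" where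
  "sexp f = (\<lambda>e. Sum_any (\<lambda>m. spow f m e / of_nat (fact m)))"

text \<open>The expansion \<open>\<Sum>\<^bsub>m\<ge>0\<^esub> f\<^bsup>m\<^esup>\<close> of \<open>1/(1-f)\<close>.\<close>

definition sgeom :: "series \<Rightarrow> series" where
  "sgeom f = (\<lambda>e. Sum_any (\<lambda>m. spow f m e))"

text \<open>\<open>in_s i A\<close> is the Laurent series \<open>A\<close> in the variable \<open>s\<^sub>i\<close>.\<close>

definition in_s :: "nat \<Rightarrow> ratfun fls \<Rightarrow> series" where
  "in_s i A = (\<lambda>(a, b, l).
     if Poly_Mapping.keys a \<subseteq> {i} \<and> b = 0 \<and> l = {#} then fls_nth A (Poly_Mapping.lookup a i) else 0)"

definition zpow :: "nat \<Rightarrow> int \<Rightarrow> series" where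
  "zpow i m = smonom (0, Poly_Mapping.single i m, {#})"

definition asym :: "int \<Rightarrow> series" where
  "asym m = smonom (0, 0, {#m#})"

text \<open>\<open>Coeff\<close> of \<open>s\<^sub>1\<cdots>s\<^sub>kz\<^sub>1\<^sup>0\<cdots>z\<^sub>k\<^sup>0\<close>, a combination of the \<open>\<aa>\<^sub>\<lambda>\<close>.\<close>

definition coeff_s_z0 :: "nat \<Rightarrow> series \<Rightarrow> gpartition \<Rightarrow> ratfun" where
  "coeff_s_z0 k f l = f (\<Sum>i=1..k. Poly_Mapping.single i 1, 0, l)"


section \<open>Vertex operators and the functions \<open>f\<^bsub>i,j\<^esub>\<close>\<close>

text \<open>\<open>Q_ser = e\<^bsup>\<alpha>s\<^esup>\<close> and \<open>T_ser = e\<^sup>s\<close> in one variable; then \<open>Q\<^sub>i = in_s i Q_ser\<close> and \<open>T\<^sub>i = in_s i T_ser\<close>.\<close>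

definition Q_ser :: "ratfun fls" where "Q_ser = fps_to_fls (fps_exp jalpha)"

definition T_ser :: "ratfun fls" where "T_ser = fps_to_fls (fps_exp 1)"

text \<open>In the following, \<open>A\<close>, \<open>B\<close> are Laurent series in one variable, \<open>A\<^sub>i\<close> stands for
  \<open>in_s i A\<close>, and \<open>log_Gamma_plus i A\<close>, \<open>log_Gamma_minus i A\<close> are the exponents of
  \<open>\<Gamma>\<^sub>+(A\<^sub>iz\<^sub>i)\<close>, \<open>\<Gamma>\<^sub>-(A\<^sub>iz\<^sub>i)\<close>.\<close>

definition log_Gamma_minus :: "nat \<Rightarrow> ratfun fls \<Rightarrow> series" where
  "log_Gamma_minus i A = (\<lambda>e. Sum_any (\<lambda>m::nat. if m > 0 then
     (in_s i (A ^ m / of_nat m) \<star> zpow i (int m) \<star> asym (- int m)) e else 0))"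

definition log_Gamma_plus :: "nat \<Rightarrow> ratfun fls \<Rightarrow> series" where
  "log_Gamma_plus i A = (\<lambda>e. Sum_any (\<lambda>m::nat. if m > 0 then
     (in_s i (inverse A ^ m / of_nat m) \<star> zpow i (- int m) \<star> asym (int m)) e else 0))"

definition Gamma_minus :: "nat \<Rightarrow> ratfun fls \<Rightarrow> series" where
  "Gamma_minus i A = sexp (log_Gamma_minus i A)"

definition Gamma_minus_inv :: "nat \<Rightarrow> ratfun fls \<Rightarrow> series" where
  "Gamma_minus_inv i A = sexp (- log_Gamma_minus i A)"

definition Gamma_plus :: "nat \<Rightarrow> ratfun fls \<Rightarrow> series" where
  "Gamma_plus i A = sexp (log_Gamma_plus i A)"

definition Gamma_plus_inv :: "nat \<Rightarrow> ratfun fls \<Rightarrow> series" where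
  "Gamma_plus_inv i A = sexp (- log_Gamma_plus i A)"

text \<open>\<open>zratio i j B A\<close> is \<open>(A\<^sub>jz\<^sub>j)\<^bsup>-1\<^esup>(B\<^sub>iz\<^sub>i)\<close>.\<close>

definition zratio :: "nat \<Rightarrow> nat \<Rightarrow> ratfun fls \<Rightarrow> ratfun fls \<Rightarrow> series" where
  "zratio i j B A = in_s j (inverse A) \<star> zpow j (- 1) \<star> (in_s i B \<star> zpow i 1)"

text \<open>The quotients are expanded in nonnegative powers of \<open>z\<^sub>iz\<^sub>j\<^bsup>-1\<^esup>\<close>.\<close>

definition ff :: "nat \<Rightarrow> nat \<Rightarrow> series" where
  "ff i j = (sone - zratio i j T_ser T_ser) \<star> sgeom (zratio i j T_ser (inverse Q_ser * T_ser)) \<star>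
            ((sone - zratio i j 1 (inverse Q_ser * T_ser)) \<star> sgeom (zratio i j 1 T_ser))"


section \<open>Consistency of the conventions\<close>

lemma fscale_lookup [simp]: "Poly_Mapping.lookup (fscale c v) m = c * Poly_Mapping.lookup v m"
  by (simp add: fscale_def Poly_Mapping.map.rep_eq when_def)

interpretation fock: vector_space fscale
  by unfold_locales
    (auto intro!: poly_mapping_eqI simp: Poly_Mapping.lookup_add algebra_simps)

lemma lin_ext_superset:
  assumes "finite S" "Poly_Mapping.keys v \<subseteq> S"
  shows "lin_ext h v = (\<Sum>m\<in>S. fscale (Poly_Mapping.lookup v m) (h m))"
  unfolding lin_ext_def
  by (rule sum.mono_neutral_left) (use assms in \<open>auto simp: in_keys_iff\<close>)

lemma lin_ext_pbasis [simp]: "lin_ext h (pbasis l) = h l"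
  by (simp add: lin_ext_def pbasis_def)

lemma linear_lin_ext: "Vector_Spaces.linear fscale fscale (lin_ext h)"
proof (unfold Vector_Spaces.linear_iff, intro conjI allI)
  show "vector_space fscale" "vector_space fscale"
    by (rule fock.vector_space_axioms)+
next
  fix u v :: fock
  let ?S = "Poly_Mapping.keys u \<union> Poly_Mapping.keys v"
  have "lin_ext h (u + v) = (\<Sum>m\<in>?S. fscale (Poly_Mapping.lookup (u + v) m) (h m))"
    by (rule lin_ext_superset) (simp_all add: Poly_Mapping.keys_add)
  also have "\<dots> = lin_ext h u + lin_ext h v"
    by (simp add: lin_ext_superset[of ?S] Poly_Mapping.lookup_add fock.scale_left_distrib
        sum.distrib)
  finally show "lin_ext h (u + v) = lin_ext h u + lin_ext h v" .
next
  fix c and v :: fock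
  have "lin_ext h (fscale c v) =
      (\<Sum>m\<in>Poly_Mapping.keys v. fscale (Poly_Mapping.lookup (fscale c v) m) (h m))"
    by (rule lin_ext_superset) (auto simp: in_keys_iff)
  then show "lin_ext h (fscale c v) = fscale c (lin_ext h v)"
    by (simp add: lin_ext_def fock.scale_sum_right)
qed

lemma heis_lin_ext: "\<exists>h. heis k = lin_ext h"
proof -
  have "heis 0 = lin_ext (\<lambda>_. 0)"
    by (rule ext) (simp add: heis_def lin_ext_def)
  then show ?thesis
    by (cases "k < 0"; cases "k > 0") (auto simp: heis_def)
qed

lemma linear_heis: "Vector_Spaces.linear fscale fscale (heis k)"
  using heis_lin_ext[of k] linear_lin_ext by auto

lemma parts_Partition [simp]: "0 \<notin># M \<Longrightarrow> parts (Partition M) = M"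
  by (rule Partition_inverse) simp

lemma zero_notin_parts [simp]: "0 \<notin># parts l"
  using parts[of l] by simp

lemma heis_creation:
  "k > 0 \<Longrightarrow> heis (- int k) (pbasis l) = pbasis (Partition (add_mset k (parts l)))"
  by (simp add: heis_def)

lemma heis_annihilation:
  "k > 0 \<Longrightarrow> heis (int k) (pbasis l) =
     fscale (of_nat k * of_nat (count (parts l) k)) (pbasis (Partition (parts l - {#k#})))"
  by (simp add: heis_def)

lemma heis_vacuum: "k > 0 \<Longrightarrow> heis (int k) vacuum = 0"
  by (simp add: vacuum_def heis_annihilation)

lemma heisenberg_relation:
  assumes "k \<noteq> 0" "m \<noteq> 0"
  shows "commutator (heis k) (heis m) (pbasis l) = (if k = - m then fscale (of_int k) (pbasis l) else 0)"
proof -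
  have scale: "heis i (fscale c v) = fscale c (heis i v)" for i c v
    using linear_heis[of i] by (simp add: Vector_Spaces.linear_iff)
  have zero: "heis i 0 = 0" for i
    using scale[of i 0 0] by simp
  have not0: "0 \<notin># parts l - {#i#}" for i
    using zero_notin_parts[of l] in_diffD by fastforce
  have pos_pos: "commutator (heis (int i)) (heis (int j)) (pbasis l) = 0"
    if "i > 0" "j > 0" for i j
    using that not0
    by (auto simp: commutator_def heis_annihilation scale diff_right_commute algebra_simps)
  have neg_neg: "commutator (heis (- int i)) (heis (- int j)) (pbasis l) = 0"
    if "i > 0" "j > 0" for i j
    using that by (simp add: commutator_def heis_creation add_mset_commute)
  have pos_neg: "commutator (heis (int i)) (heis (- int j)) (pbasis l) =
      (if i = j then fscale (of_nat i) (pbasis l) else 0)" if "i > 0" "j > 0" for i j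
  proof (cases "i = j")
    case True
    show ?thesis
    proof (cases "i \<in># parts l")
      case True2: True
      then have "add_mset i (parts l - {#i#}) = parts l" by simp
      then show ?thesis
        using that True not0 by (simp add: commutator_def heis_annihilation heis_creation scale
            fock.scale_left_diff_distrib[symmetric] parts_inverse algebra_simps)
    next
      case False
      then show ?thesis
        using that True not0 by (simp add: commutator_def heis_annihilation heis_creation scale
            parts_inverse not_in_iff zero)
    qed
  next
    case False
    show ?thesis
    proof (cases "i \<in># parts l")
      case True
      then have "add_mset j (parts l) - {#i#} = add_mset j (parts l - {#i#})"
        by (simp add: False)
      then show ?thesis
        using that False not0
        by (simp add: commutator_def heis_annihilation heis_creation scale)
    next
      case F2: False
      then show ?thesis
        using that False not0 by (simp add: commutator_def heis_annihilation heis_creation scale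
            not_in_iff zero)
    qed
  qed
  have neg_pos: "commutator (heis (- int j)) (heis (int i)) (pbasis l) =
      (if i = j then fscale (- of_nat i) (pbasis l) else 0)" if "i > 0" "j > 0" for i j
    using pos_neg[OF that] by (simp add: commutator_def algebra_simps split: if_splits) 
  obtain i where i: "i > 0" "k = int i \<or> k = - int i"
    using assms(1) by (metis int_cases2 of_nat_0 of_nat_0_less_iff linorder_neqE_nat not_less0 minus_zero)
  obtain j where j: "j > 0" "m = int j \<or> m = - int j"
    using assms(2) by (metis int_cases2 of_nat_0 of_nat_0_less_iff linorder_neqE_nat not_less0 minus_zero)
  show ?thesis
    using i j pos_pos[OF i(1) j(1)] neg_neg[OF i(1) j(1)] pos_neg[OF i(1) j(1)] neg_pos[OF j(1) i(1)]
    by auto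
qed

lemma sorted_list_of_multiset_add:
  assumes "\<And>i j. i \<in># l \<Longrightarrow> j \<in># m \<Longrightarrow> i \<le> j"
  shows "sorted_list_of_multiset (l + m) = sorted_list_of_multiset l @ sorted_list_of_multiset m"
proof -
  have "sorted (sorted_list_of_multiset l @ sorted_list_of_multiset m)"
    using assms by (auto simp: sorted_append)
  then show ?thesis
    by (metis mset_append mset_sorted_list_of_multiset sorted_list_of_multiset_mset sort_key_id_if_sorted sorted_sort_id)
qed

lemma heis_gpart_add:
  assumes "\<And>i. i \<in># l \<Longrightarrow> i < 0" "\<And>j. j \<in># m \<Longrightarrow> j > 0"
  shows "heis_gpart (l + m) = heis_gpart l \<circ> heis_gpart m"
proof -
  have "foldr (\<lambda>i F. heis i \<circ> F) xs f = foldr (\<lambda>i F. heis i \<circ> F) xs id \<circ> f" for xs f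
    by (induction xs) (auto simp: o_assoc)
  moreover have "sorted_list_of_multiset (l + m) = sorted_list_of_multiset l @ sorted_list_of_multiset m"
    using assms by (intro sorted_list_of_multiset_add) force
  ultimately show ?thesis
    by (metis foldr_append comp_apply heis_gpart_def)
qed

end

theory Submission
  imports Defs "HOL-Library.FuncSet"
begin

text \<open>In the basis of power sums, the matrix elements of the right-hand side are values of a linear
  functional (the coefficient of \<open>\<Prod>\<^sub>i s\<^sub>i z\<^sub>i\<^sup>0\<close> after multiplication by \<open>\<Prod>\<^sub>i 1/((1 - Q\<^sub>i)(1 - T\<^sub>i\<^sup>-\<^sup>1))\<close>)
  on polynomials in exponentials. Composing with one more vertex operator
  \<open>E = Coeff \<Gamma>\<^sub>-(Tz)\<Gamma>\<^sub>-(z)\<^sup>-\<^sup>1\<Gamma>\<^sub>+(Q\<^sup>-\<^sup>1Tz)\<Gamma>\<^sub>+(Tz)\<^sup>-\<^sup>1/((1 - Q)(1 - T\<^sup>-\<^sup>1))\<close> on the left or on the right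
  produces the two products of the \<open>f\<^sub>i\<^sub>j\<close>, so that the right-hand side is a \<open>k\<close>-fold commutator with
  \<open>-t\<^sub>2 E\<close>, up to the powers of \<open>t\<^sub>1\<close>. In \<open>E\<close> only the terms of order at most 3 in \<open>s\<close> survive;
  hence \<open>-E\<close> is, up to a constant, the Laplace-Beltrami operator with parameter \<open>\<alpha>\<close>, whose
  eigenvectors are the Jack functions, with eigenvalues \<open>\<Sum>\<^sub>s (\<alpha> a'(s) - l'(s))\<close>.

  These eigenvalues do not separate the partitions of \<open>n\<close>. The Jack functions are therefore
  constructed as eigenvectors of the self-adjoint operators \<open>\<Sum>\<^sub>i (Y\<^sub>i - N)\<^sup>k Y\<^sub>i\<close>, where the
  \<open>Y\<^sub>i = \<alpha> x\<^sub>i \<partial>\<^sub>i + \<Sum>\<^sub>j x\<^sub>i (x\<^sub>i - x\<^sub>j)\<^sup>-\<^sup>1 (1 - s\<^sub>i\<^sub>j)\<close> act on \<open>N\<close> variables. They are triangular for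
  dominance, and for large \<open>k\<close> their eigenvalues are distinct because \<open>\<alpha>\<close> is transcendental.\<close>

text \<open>\<open>jackP\<close> and \<open>G1\<close> are definite descriptions, so nothing is
  known about either until an orthogonal triangular family is shown to exist and to be unique; hence
  the construction of the Jack functions. A single operator with distinct eigenvalues in each degree
  yields the family, and the Laplace-Beltrami operator is then diagonal on it because it is
  self-adjoint and triangular as well. The shape (Y_i - N)^k Y_i is forced by stability: on f x_i^t
  with f symmetric and t > 0 the operator Y_i depends explicitly on N only through the summand N,
  which is p_0, whereas on f itself this summand is absent.

  On the series side the obstacle is that the two products of the f_ij are expanded in opposite
  directions of z_j, so their difference is not the expansion of one rational function. Each product
  is truncated in its z_j-degree; a fixed matrix element involves finitely many degrees, and large
  truncations agree with the series. The bound 3 in s comes from the double pole of 1/((1 - Q)(1 -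
  1/T)), the coefficient of s^1 being taken, while every factor in the exponents vanishes at s =
  0.\<close>

abbreviation lookup :: "('a \<Rightarrow>\<^sub>0 'b::zero) \<Rightarrow> 'a \<Rightarrow> 'b" where "lookup \<equiv> Poly_Mapping.lookup"

abbreviation keys :: "('a \<Rightarrow>\<^sub>0 'b::zero) \<Rightarrow> 'a set" where "keys \<equiv> Poly_Mapping.keys"

abbreviation single :: "'a \<Rightarrow> 'b \<Rightarrow> ('a \<Rightarrow>\<^sub>0 'b::zero)" where "single \<equiv> Poly_Mapping.single"

type_synonym nms = "nat multiset"

type_synonym sexpt = "(nat \<Rightarrow>\<^sub>0 int) \<times> (nat \<Rightarrow>\<^sub>0 int) \<times> gpartition"

type_synonym lexpt = "(nat \<Rightarrow>\<^sub>0 ratfun) \<times> (nat \<Rightarrow>\<^sub>0 int)"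

section \<open>Multisets\<close>

lemma finite_submultisets: "finite {A. A \<subseteq># M}"
proof (induction M)
  case (add x M)
  have "{A. A \<subseteq># add_mset x M} \<subseteq> {A. A \<subseteq># M} \<union> add_mset x ` {A. A \<subseteq># M}"
  proof
    fix A assume A: "A \<in> {A. A \<subseteq># add_mset x M}"
    show "A \<in> {A. A \<subseteq># M} \<union> add_mset x ` {A. A \<subseteq># M}"
    proof (cases "x \<in># A")
      case True
      then have "A = add_mset x (A - {#x#})" by simp
      moreover have "A - {#x#} \<subseteq># M" using A by (simp add: subset_eq_diff_conv)
      ultimately show ?thesis by blast
    next
      case False
      then show ?thesis using A by (simp add: subset_mset.inf.absorb_iff2 inter_add_left1 inter_add_right1)
    qed
  qed
  then show ?case using add finite_subset by blast
qed simp

lemma sum_submultisets_add_mset: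
  fixes F :: "'a multiset \<Rightarrow> 'b::comm_monoid_add"
  shows "(\<Sum>A | A \<subseteq># add_mset x M \<and> x \<in># A. F A) = (\<Sum>A | A \<subseteq># M. F (add_mset x A))"
proof (rule sum.reindex_bij_witness[of _ "add_mset x" "\<lambda>A. A - {#x#}"])
qed (auto simp: subset_eq_diff_conv insert_subset_eq_iff)

text \<open>Partitions of \<open>c\<close> as bare multisets, so that parts can be added and removed
  without passing through the type \<open>partition\<close>.\<close>

definition multisets_of :: "nat \<Rightarrow> nms set" where
  "multisets_of c = {M. 0 \<notin># M \<and> sum_mset M = c}"

lemma size_le_sum_mset: "0 \<notin># M \<Longrightarrow> size M \<le> sum_mset (M :: nms)"
  by (induction M) auto

lemma count_le_sum_mset: "i > 0 \<Longrightarrow> count M i \<le> sum_mset (M :: nms)"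
  by (induction M) auto

lemma elem_le_sum_mset: "i \<in># M \<Longrightarrow> i \<le> sum_mset (M :: nms)"
  by (metis le_add1 multi_member_split sum_mset.add_mset)

lemma finite_multisets_of: "finite (multisets_of c)"
proof (rule finite_subset)
  let ?N = "\<Sum>i\<in>{1..c}. replicate_mset c i"
  have *: "count ?N j = (if j \<in> {1..c} then c else 0)" for j
    by (simp add: count_sum)
  show "multisets_of c \<subseteq> {A. A \<subseteq># ?N}"
  proof clarify
    fix M assume M: "M \<in> multisets_of c"
    show "M \<subseteq># ?N"
    proof (rule mset_subset_eqI)
      fix a
      show "count M a \<le> count ?N a"
      proof (cases "a \<in># M")
        case True
        then have "a > 0" using M by (metis (mono_tags, lifting) gr0I mem_Collect_eq multisets_of_def)
        then show ?thesis
          using M True count_le_sum_mset[of a M] elem_le_sum_mset[of a M]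
          unfolding * by (auto simp: multisets_of_def)
      qed (simp add: not_in_iff)
    qed
  qed
qed (rule finite_submultisets)

lemma multisets_of_0 [simp]: "multisets_of 0 = {{#}}"
proof (intro equalityI subsetI)
  fix M assume "M \<in> multisets_of 0"
  then show "M \<in> {{#}}" by (cases M) (auto simp: multisets_of_def)
qed (simp add: multisets_of_def)

text \<open>The number z_M with <p_M, p_M> = z_M at alpha = 1. It agrees with \<open>zee\<close> on
  partitions, but makes sense for bare multisets.\<close>

definition zmset :: "nms \<Rightarrow> nat" where
  "zmset M = (\<Prod>i\<in>set_mset M. i ^ count M i * fact (count M i))"

text \<open>The factor z_L / z_M arises when annihilation operators remove the parts L - M from
  p_L.\<close>

abbreviation zq :: "nms \<Rightarrow> nms \<Rightarrow> ratfun" where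
  "zq L M \<equiv> of_nat (zmset L) / of_nat (zmset M)"

lemma zmset_superset:
  assumes "finite S" "set_mset M \<subseteq> S"
  shows "zmset M = (\<Prod>i\<in>S. i ^ count M i * fact (count M i))"
  unfolding zmset_def by (rule prod.mono_neutral_left) (use assms in \<open>auto simp: not_in_iff\<close>)

lemma zmset_empty [simp]: "zmset {#} = 1" by (simp add: zmset_def)

lemma zmset_add_mset: "zmset (add_mset m M) = m * Suc (count M m) * zmset M"
proof -
  let ?S = "insert m (set_mset M)" and ?f = "\<lambda>i. i ^ count M i * fact (count M i)"
  have fin: "finite ?S" "m \<in> ?S" by auto
  have "zmset (add_mset m M) = (m * Suc (count M m) * ?f m) * prod ?f (?S - {m})"
    by (subst zmset_superset[of ?S], simp, simp, subst prod.remove[OF fin])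
       (auto simp: algebra_simps intro!: prod.cong)
  also have "\<dots> = m * Suc (count M m) * prod ?f ?S"
    unfolding prod.remove[OF fin, of ?f] by (simp only: mult.assoc)
  also have "prod ?f ?S = zmset M"
    by (subst zmset_superset[of ?S M]) auto
  finally show ?thesis .
qed

lemma zmset_pos: "0 \<notin># M \<Longrightarrow> zmset M > 0"
  unfolding zmset_def by (rule prod_pos) (metis fact_gt_zero gr0I mult_pos_pos zero_less_power)

lemma sum_multiset_elements:
  assumes "finite S" "set_mset M \<subseteq> S"
  shows "(\<Sum>m\<in>S. m * count M m) = sum_mset M"
  using assms
proof (induction M)
  case (add x M)
  have "(\<Sum>m\<in>S. m * count (add_mset x M) m) = (\<Sum>m\<in>S. m * count M m + (if m = x then x else 0))"
    by (rule sum.cong) auto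
  then show ?case using add by (simp add: sum.distrib)
qed simp

section \<open>The ring of exponents\<close>

text \<open>Characteristic 0 of the rational function field gives the laws of exponential series and
  the cancellation of natural numbers.\<close>

instance fract :: ("{idom, ring_char_0}") field_char_0
proof
  show "inj (of_nat :: nat \<Rightarrow> 'a fract)"
    by (rule injI) (simp add: of_nat_fract eq_fract)
qed

text \<open>The monomial with exponents \<open>(\<theta>, b)\<close> stands for \<open>\<Prod>\<^sub>i e\<^bsup>\<theta>\<^sub>i s\<^sub>i\<^esup> z\<^sub>i\<^bsup>b\<^sub>i\<^esup>\<close>; all the series that
  occur are expansions of elements of this ring, or infinite sums of such.\<close>

type_synonym lring = "lexpt \<Rightarrow>\<^sub>0 ratfun"

definition lconst :: "ratfun \<Rightarrow> lring" where "lconst c = single 0 c"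

lemma lconst_0 [simp]: "lconst 0 = 0" and lconst_1 [simp]: "lconst 1 = 1"
  and lconst_add: "lconst (c + d) = lconst c + lconst d"
  and lconst_mult: "lconst (c * d) = lconst c * lconst d"
  and lconst_of_nat [simp]: "lconst (of_nat n) = of_nat n"
  by (simp_all add: lconst_def single_add mult_single)

lemma lookup_lconst_mult [simp]: "lookup (lconst c * p) e = c * lookup p e"
  by (simp add: lconst_def mult_map_scale_conv_mult[symmetric] Poly_Mapping.map.rep_eq when_def)

lemma lring_of_nat_cancel:
  assumes "of_nat n * p = of_nat n * (q :: lring)" "n > 0"
  shows "p = q"
proof -
  have "lconst (1 / of_nat n) * (of_nat n * p) = p" for p
    unfolding lconst_of_nat[symmetric] mult.assoc[symmetric] lconst_mult[symmetric] using assms(2) by simp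
  then show ?thesis using assms(1) by metis
qed

section \<open>Vertex operators on symmetric functions with coefficients in the ring of exponents\<close>

text \<open>Expanding exp (sum x_m p_m / m) gives this as the coefficient of p_M; hence the division
  by z_M.\<close>

definition ee :: "(nat \<Rightarrow> lring) \<Rightarrow> nms \<Rightarrow> lring" where
  "ee x M = lconst (1 / of_nat (zmset M)) * prod_mset (image_mset x M)"

lemma ee_empty [simp]: "ee x {#} = 1" by (simp add: ee_def)

text \<open>Applying m d/dp_m to exp (sum x_m p_m / m) multiplies it by x_m; this is that identity
  read at p_M.\<close>

lemma ee_add_mset:
  assumes "m > 0"
  shows "of_nat (m * Suc (count M m)) * ee x (add_mset m M) = x m * ee x M"
proof -
  have "of_nat (m * Suc (count M m)) * lconst (1 / of_nat (zmset (add_mset m M))) = lconst (1 / of_nat (zmset M))"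
    unfolding lconst_of_nat[symmetric] lconst_mult[symmetric] zmset_add_mset
    by (rule arg_cong[of _ _ lconst]) (use assms in \<open>simp add: divide_simps del: of_nat_Suc of_nat_add\<close>)
  then show ?thesis by (simp add: ee_def algebra_simps del: of_nat_mult)
qed

lemma ee_remove:
  assumes "m \<in># M" "m > 0"
  shows "of_nat (m * count M m) * ee x M = x m * ee x (M - {#m#})"
  using ee_add_mset[OF assms(2), of "M - {#m#}" x] assms by simp

text \<open>Euler's identity: c is the sum of m times the multiplicity of m in the partition, and
  each multiplicity takes out one part m. The recursions for \<open>hh\<close> and \<open>Ep\<close>
  are instances.\<close>

lemma sum_ee_recursion:
  "of_nat c * (\<Sum>M\<in>multisets_of c. ee x M * F M) =
    (\<Sum>m=1..c. x m * (\<Sum>M\<in>multisets_of (c - m). ee x M * F (add_mset m M)))"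
proof -
  have "of_nat c * (\<Sum>M\<in>multisets_of c. ee x M * F M) =
      (\<Sum>M\<in>multisets_of c. \<Sum>m\<in>{1..c}. (of_nat (m * count M m) * ee x M) * F M)"
    unfolding sum_distrib_left
  proof (rule sum.cong[OF refl])
    fix M assume M: "M \<in> multisets_of c"
    have "set_mset M \<subseteq> {1..c}"
    proof
      fix m assume "m \<in># M"
      then show "m \<in> {1..c}" using M elem_le_sum_mset[of m M] by (cases m) (auto simp: multisets_of_def)
    qed
    then have "c = (\<Sum>m\<in>{1..c}. m * count M m)"
      using M sum_multiset_elements[of "{1..c}" M] by (simp add: multisets_of_def)
    then have "(of_nat c :: lring) = of_nat (\<Sum>m\<in>{1..c}. m * count M m)"
      by (rule arg_cong)
    then show "of_nat c * (ee x M * F M) = (\<Sum>m\<in>{1..c}. (of_nat (m * count M m) * ee x M) * F M)"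
      by (simp only: of_nat_sum mult.assoc sum_distrib_right)
  qed
  also have "\<dots> = (\<Sum>m\<in>{1..c}. \<Sum>M\<in>multisets_of c. (of_nat (m * count M m) * ee x M) * F M)"
    by (rule sum.swap)
  also have "\<dots> = (\<Sum>m=1..c. x m * (\<Sum>M\<in>multisets_of (c - m). ee x M * F (add_mset m M)))"
  proof (rule sum.cong[OF refl])
    fix m assume m: "m \<in> {1..c}"
    have "(\<Sum>M\<in>multisets_of c. (of_nat (m * count M m) * ee x M) * F M) =
        (\<Sum>M\<in>{M\<in>multisets_of c. m \<in># M}. (of_nat (m * count M m) * ee x M) * F M)"
      by (rule sum.mono_neutral_right) (auto simp: finite_multisets_of not_in_iff)
    also have "\<dots> = (\<Sum>M\<in>{M\<in>multisets_of c. m \<in># M}. x m * (ee x (M - {#m#}) * F M))"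
    proof (rule sum.cong[OF refl])
      fix M assume M: "M \<in> {M\<in>multisets_of c. m \<in># M}"
      then have "of_nat (m * count M m) * ee x M = x m * ee x (M - {#m#})"
        using m by (intro ee_remove) auto
      then show "of_nat (m * count M m) * ee x M * F M = x m * (ee x (M - {#m#}) * F M)"
        by (simp only: mult.assoc)
    qed
    also have "\<dots> = (\<Sum>M\<in>multisets_of (c - m). x m * (ee x M * F (add_mset m M)))"
      by (rule sum.reindex_bij_witness[of _ "add_mset m" "\<lambda>M. M - {#m#}"])
         (use m in \<open>auto simp: multisets_of_def sum_mset_diff dest: in_diffD\<close>)
    finally show "(\<Sum>M\<in>multisets_of c. (of_nat (m * count M m) * ee x M) * F M) =
        x m * (\<Sum>M\<in>multisets_of (c - m). ee x M * F (add_mset m M))"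
      by (simp add: sum_distrib_left)
  qed
  finally show ?thesis .
qed

text \<open>The law exp (x + y) = exp x exp y, proved by taking out one part with the Leibniz rule
  for m d/dp_m.\<close>

lemma ee_add: "0 \<notin># M \<Longrightarrow> ee (\<lambda>m. x m + y m) M = (\<Sum>A | A \<subseteq># M. ee x A * ee y (M - A))"
proof (induction M)
  case (add m M)
  then have m: "m > 0" by auto
  let ?c = "count M m"
  let ?y = "\<lambda>A. of_nat (m * (Suc ?c - count A m)) * ee y (add_mset m M - A)"
  let ?S = "{A. A \<subseteq># add_mset m M}"
  have fin: "finite ?S" by (rule finite_submultisets)
  have "of_nat (m * Suc ?c) * (\<Sum>A\<in>?S. ee x A * ee y (add_mset m M - A)) =
     (\<Sum>A\<in>?S. of_nat (m * count A m) * ee x A * ee y (add_mset m M - A))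
     + (\<Sum>A\<in>?S. ee x A * (?y A))"
    unfolding sum_distrib_left sum.distrib[symmetric]
  proof (rule sum.cong[OF refl])
    fix A assume "A \<in> ?S"
    then have "count A m \<le> Suc ?c" by (metis count_add_mset mem_Collect_eq mset_subset_eq_count)
    \<comment> \<open>The copies of \<open>m\<close> are divided between \<open>A\<close> and its
      complement: these are the two terms of the Leibniz rule.\<close>
    then have "m * Suc ?c = m * count A m + m * (Suc ?c - count A m)"
      by (metis add_mult_distrib2 le_add_diff_inverse)
    then have "of_nat (m * Suc ?c) = (of_nat (m * count A m) + of_nat (m * (Suc ?c - count A m)) :: lring)"
      by (metis of_nat_add)
    then show "of_nat (m * Suc ?c) * (ee x A * ee y (add_mset m M - A)) =
      of_nat (m * count A m) * ee x A * ee y (add_mset m M - A) +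
      ee x A * (?y A)"
      by (simp only: distrib_right) (simp only: ac_simps)
  qed
  also have "(\<Sum>A\<in>?S. of_nat (m * count A m) * ee x A * ee y (add_mset m M - A)) =
      (\<Sum>A | A \<subseteq># add_mset m M \<and> m \<in># A. of_nat (m * count A m) * ee x A * ee y (add_mset m M - A))"
    by (rule sum.mono_neutral_right) (auto simp: fin not_in_iff)
  also have "\<dots> = (\<Sum>A | A \<subseteq># add_mset m M \<and> m \<in># A. x m * ee x (A - {#m#}) * ee y (add_mset m M - A))"
    by (rule sum.cong[OF refl]) (simp add: ee_remove[OF _ m] del: of_nat_mult)
  also have "\<dots> = (\<Sum>A | A \<subseteq># M. x m * ee x A * ee y (M - A))"
    by (subst sum_submultisets_add_mset) simp
  also have "\<dots> = x m * ee (\<lambda>m. x m + y m) M"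
    using add by (simp add: sum_distrib_left mult.assoc)
  also have "(\<Sum>A\<in>?S. ee x A * (?y A)) =
     (\<Sum>A | A \<subseteq># M. ee x A * (?y A))"
  proof (rule sum.mono_neutral_right[OF fin])
    show "{A. A \<subseteq># M} \<subseteq> ?S" by (auto simp: subset_mset.order_trans)
    show "\<forall>A\<in>?S - {A. A \<subseteq># M}. ee x A * (?y A) = 0"
    proof
      fix A assume A: "A \<in> ?S - {A. A \<subseteq># M}"
      then have "count A m > ?c"
        unfolding subseteq_mset_def by (auto simp: not_le split: if_splits)
      then show "ee x A * (?y A) = 0" by simp
    qed
  qed
  also have "\<dots> = (\<Sum>A | A \<subseteq># M. ee x A * (y m * ee y (M - A)))"
  proof (rule sum.cong[OF refl])
    fix A assume A: "A \<in> {A. A \<subseteq># M}"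
    then have "add_mset m M - A = add_mset m (M - A)" by (intro multiset_eqI) (auto simp: Suc_diff_le mset_subset_eq_count)
    moreover have "Suc ?c - count A m = Suc (count (M - A) m)"
      using A by (simp add: Suc_diff_le mset_subset_eq_count)
    ultimately show "ee x A * (?y A) = ee x A * (y m * ee y (M - A))"
      using ee_add_mset[OF m, of "M - A" y] by (simp only:)
  qed
  also have "\<dots> = y m * ee (\<lambda>m. x m + y m) M"
    using add by (simp add: sum_distrib_left algebra_simps)
  also have "x m * ee (\<lambda>m. x m + y m) M + y m * ee (\<lambda>m. x m + y m) M =
     of_nat (m * Suc ?c) * ee (\<lambda>m. x m + y m) (add_mset m M)"
    by (subst ee_add_mset[OF m]) (simp add: distrib_right)
  finally have "(\<Sum>A\<in>?S. ee x A * ee y (add_mset m M - A)) = ee (\<lambda>m. x m + y m) (add_mset m M)"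
    by (rule lring_of_nat_cancel) (use m in simp)
  then show ?case by simp
qed simp

text \<open>\<open>hh w r\<close> is the coefficient of \<open>X\<^sup>r\<close> in \<open>exp (\<Sum>\<^sub>m w\<^sub>m X\<^sup>m / m)\<close>.\<close>

definition hh :: "(nat \<Rightarrow> lring) \<Rightarrow> nat \<Rightarrow> lring" where
  "hh w r = (\<Sum>M\<in>multisets_of r. ee w M)"

lemma hh_0 [simp]: "hh w 0 = 1" by (simp add: hh_def)

text \<open>Newton's identity, with \<open>w\<close> in the place of the power sums and
  \<open>hh w\<close> in that of the complete symmetric functions.\<close>

lemma hh_recursion: "of_nat r * hh w r = (\<Sum>m=1..r. w m * hh w (r - m))"
  unfolding hh_def using sum_ee_recursion[of r w "\<lambda>_. 1"] by (simp only: mult_1_right)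

text \<open>The recursion determines each value from the earlier ones because the factor r can be
  cancelled; closed forms of \<open>hh\<close> are verified through it.\<close>

lemma hh_uniqueI:
  assumes "h 0 = 1" "\<And>r. r > 0 \<Longrightarrow> of_nat r * h r = (\<Sum>m=1..r. w m * h (r - m))"
  shows "hh w r = h r"
proof (induction r rule: less_induct)
  case (less r)
  show ?case
  proof (cases "r = 0")
    case False
    have "of_nat r * hh w r = of_nat r * h r"
      unfolding hh_recursion using False assms(2)[of r]
      by (simp only: neq0_conv, intro sum.cong refl) (use less.IH in auto)
    then show ?thesis using lring_of_nat_cancel False by blast
  qed (simp add: assms)
qed

lemma hh_cong:
  assumes "\<And>m. m > 0 \<Longrightarrow> w m = w' m"
  shows "hh w r = hh w' r"
proof (rule hh_uniqueI)
  show "of_nat r * hh w' r = (\<Sum>m=1..r. w m * hh w' (r - m))"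
    for r
    unfolding hh_recursion by (rule sum.cong) (use assms in auto)
qed simp

text \<open>An element of the polynomial ring \<open>lring[p\<^sub>1, p\<^sub>2, \<dots>]\<close> or of its completion is represented by its
  coefficients with respect to the monomials \<open>p\<^sub>M\<close>. \<open>annih\<close> is \<open>m \<partial>/\<partial>p\<^sub>m\<close>, and \<open>Gm x\<close> is
  multiplication by \<open>exp (\<Sum>\<^sub>m x\<^sub>m p\<^sub>m / m)\<close>. The operator \<open>exp (\<Sum>\<^sub>m y\<^sub>m \<partial>/\<partial>p\<^sub>m)\<close> does not act
  on the completion, but its components \<open>Ep y c\<close> of degree \<open>-c\<close> do.\<close>

type_synonym lfun = "nms \<Rightarrow> lring"

definition annih :: "nat \<Rightarrow> lfun \<Rightarrow> lfun" where
  "annih m f = (\<lambda>M. of_nat (m * Suc (count M m)) * f (add_mset m M))"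

definition Gm :: "(nat \<Rightarrow> lring) \<Rightarrow> lfun \<Rightarrow> lfun" where
  "Gm x f = (\<lambda>M. \<Sum>A | A \<subseteq># M. ee x A * f (M - A))"

definition Ep :: "(nat \<Rightarrow> lring) \<Rightarrow> nat \<Rightarrow> lfun \<Rightarrow> lfun" where
  "Ep y c f = (\<lambda>M. \<Sum>A\<in>multisets_of c. ee y A * (lconst (zq (M + A) M) * f (M + A)))"

lemma Ep_0 [simp]: "0 \<notin># M \<Longrightarrow> Ep y 0 f M = f M"
  using zmset_pos[of M] by (simp add: Ep_def)

lemma Gm_mult: "Gm x (\<lambda>M. a * f M) M = a * Gm x f M"
  by (simp add: Gm_def sum_distrib_left mult.left_commute)

lemma Gm_sum: "Gm x (\<lambda>M. \<Sum>i\<in>I. f i M) M = (\<Sum>i\<in>I. Gm x (f i) M)"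
  unfolding Gm_def sum_distrib_left by (rule sum.swap)

lemma Ep_mult: "Ep y c (\<lambda>M. a * f M) M = a * Ep y c f M"
  by (simp add: Ep_def sum_distrib_left mult.left_commute)

lemma Ep_sum: "Ep y c (\<lambda>M. \<Sum>i\<in>I. f i M) M = (\<Sum>i\<in>I. Ep y c (f i) M)"
  unfolding Ep_def sum_distrib_left by (rule sum.swap)

lemma annih_sum: "annih m (\<lambda>M. \<Sum>i\<in>I. f i M) M = (\<Sum>i\<in>I. annih m (f i) M)"
  by (simp add: annih_def sum_distrib_left)

lemma annih_mult: "annih m (\<lambda>M. a * f M) M = a * annih m f M"
  by (simp add: annih_def mult.left_commute)

lemma Gm_cong: "0 \<notin># M \<Longrightarrow> (\<And>M. 0 \<notin># M \<Longrightarrow> f M = g M) \<Longrightarrow> Gm x f M = Gm x g M"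
  unfolding Gm_def by (rule sum.cong[OF refl]) (metis in_diffD)

lemma Ep_cong: "0 \<notin># M \<Longrightarrow> (\<And>M. 0 \<notin># M \<Longrightarrow> f M = g M) \<Longrightarrow> Ep y c f M = Ep y c g M"
  unfolding Ep_def by (rule sum.cong[OF refl]) (simp add: multisets_of_def)

lemma annih_cong: "0 \<notin># M \<Longrightarrow> m > 0 \<Longrightarrow> (\<And>M. 0 \<notin># M \<Longrightarrow> f M = g M) \<Longrightarrow> annih m f M = annih m g M"
  unfolding annih_def by simp

text \<open>The derivation m d/dp_m passes the exponential at the cost of the scalar x_m, again by
  dividing the copies of m between the exponential and f.\<close>

lemma annih_Gm:
  assumes m: "m > 0"
  shows "annih m (Gm x f) M = Gm x (annih m f) M + x m * Gm x f M"
proof -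
  let ?c = "count M m"
  let ?S = "{A. A \<subseteq># add_mset m M}"
  have fin: "finite ?S" by (rule finite_submultisets)
  have "annih m (Gm x f) M =
     (\<Sum>A\<in>?S. of_nat (m * count A m) * ee x A * f (add_mset m M - A))
     + (\<Sum>A\<in>?S. ee x A * (of_nat (m * (Suc ?c - count A m)) * f (add_mset m M - A)))"
    unfolding sum_distrib_left sum.distrib[symmetric] Gm_def annih_def
  proof (rule sum.cong[OF refl])
    fix A assume "A \<in> ?S"
    then have "count A m \<le> Suc ?c" by (metis count_add_mset mem_Collect_eq mset_subset_eq_count)
    then have "m * Suc ?c = m * count A m + m * (Suc ?c - count A m)"
      by (metis add_mult_distrib2 le_add_diff_inverse)
    then have "of_nat (m * Suc ?c) = (of_nat (m * count A m) + of_nat (m * (Suc ?c - count A m)) :: lring)"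
      by (metis of_nat_add)
    then show "of_nat (m * Suc ?c) * (ee x A * f (add_mset m M - A)) =
      of_nat (m * count A m) * ee x A * f (add_mset m M - A) +
      ee x A * (of_nat (m * (Suc ?c - count A m)) * f (add_mset m M - A))"
      by (simp only: distrib_right) (simp only: ac_simps)
  qed
  also have "(\<Sum>A\<in>?S. of_nat (m * count A m) * ee x A * f (add_mset m M - A)) =
      (\<Sum>A | A \<subseteq># add_mset m M \<and> m \<in># A. of_nat (m * count A m) * ee x A * f (add_mset m M - A))"
    by (rule sum.mono_neutral_right) (auto simp: fin not_in_iff)
  also have "\<dots> = (\<Sum>A | A \<subseteq># add_mset m M \<and> m \<in># A. x m * ee x (A - {#m#}) * f (add_mset m M - A))"
    by (rule sum.cong[OF refl]) (simp add: ee_remove[OF _ m] del: of_nat_mult)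
  also have "\<dots> = (\<Sum>A | A \<subseteq># M. x m * ee x A * f (M - A))"
    by (subst sum_submultisets_add_mset) simp
  also have "\<dots> = x m * Gm x f M"
    by (simp add: sum_distrib_left mult.assoc Gm_def)
  also have "(\<Sum>A\<in>?S. ee x A * (of_nat (m * (Suc ?c - count A m)) * f (add_mset m M - A))) =
     (\<Sum>A | A \<subseteq># M. ee x A * (of_nat (m * (Suc ?c - count A m)) * f (add_mset m M - A)))"
  proof (rule sum.mono_neutral_right[OF fin])
    show "{A. A \<subseteq># M} \<subseteq> ?S" by (auto simp: subset_mset.order_trans)
    show "\<forall>A\<in>?S - {A. A \<subseteq># M}. ee x A * (of_nat (m * (Suc ?c - count A m)) * f (add_mset m M - A)) = 0"
    proof
      fix A assume A: "A \<in> ?S - {A. A \<subseteq># M}"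
      then have "count A m > ?c"
        unfolding subseteq_mset_def by (auto simp: not_le split: if_splits)
      then show "ee x A * (of_nat (m * (Suc ?c - count A m)) * f (add_mset m M - A)) = 0" by simp
    qed
  qed
  also have "\<dots> = (\<Sum>A | A \<subseteq># M. ee x A * annih m f (M - A))"
  proof (rule sum.cong[OF refl])
    fix A assume A: "A \<in> {A. A \<subseteq># M}"
    then have "add_mset m M - A = add_mset m (M - A)"
      by (intro multiset_eqI) (auto simp: Suc_diff_le mset_subset_eq_count)
    moreover have "Suc ?c - count A m = Suc (count (M - A) m)"
      using A by (simp add: Suc_diff_le mset_subset_eq_count)
    ultimately show "ee x A * (of_nat (m * (Suc ?c - count A m)) * f (add_mset m M - A)) = ee x A * annih m f (M - A)"
      unfolding annih_def by (simp only:)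
  qed
  also have "\<dots> = Gm x (annih m f) M" by (simp add: Gm_def)
  finally show ?thesis by (simp only: add.commute)
qed

text \<open>The degree \<open>c\<close> is the size of the removed multiset, so Euler's identity
  also applies to the exponential of a derivation.\<close>

lemma Ep_recursion:
  assumes "0 \<notin># M"
  shows "of_nat c * Ep y c f M = (\<Sum>m=1..c. y m * annih m (Ep y (c - m) f) M)"
proof -
  have "annih m (Ep y (c - m) f) M = (\<Sum>A\<in>multisets_of (c - m). ee y A *
          (lconst (zq (M + add_mset m A) M) * f (M + add_mset m A)))" if "m > 0" for m
    unfolding annih_def Ep_def sum_distrib_left
  proof (rule sum.cong[OF refl])
    fix A
    let ?z = "of_nat (zmset (M + add_mset m A)) :: ratfun"
    have "zmset M > 0" using assms by (rule zmset_pos)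
    then have "lconst (of_nat (m * Suc (count M m))) * lconst (?z / of_nat (zmset (add_mset m M))) = lconst (?z / of_nat (zmset M))"
      unfolding lconst_mult[symmetric] zmset_add_mset
      by (intro arg_cong[of _ _ lconst]) (use that in \<open>simp add: divide_simps del: of_nat_Suc of_nat_add\<close>)
    then have *: "of_nat (m * Suc (count M m)) * lconst (?z / of_nat (zmset (add_mset m M))) = lconst (?z / of_nat (zmset M))"
      by (simp only: lconst_of_nat)
    show "of_nat (m * Suc (count M m)) * (ee y A * (lconst (zq (add_mset m M + A) (add_mset m M)) * f (add_mset m M + A))) =
      ee y A * (lconst (?z / of_nat (zmset M)) * f (M + add_mset m A))"
      unfolding *[symmetric] by (simp add: ac_simps)
  qed
  then have *: "annih m (Ep y (c - m) f) M = (\<Sum>A\<in>multisets_of (c - m). ee y A *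
          (lconst (zq (M + add_mset m A) M) * f (M + add_mset m A)))" if "m \<in> {1..c}" for m
    using that by simp
  show ?thesis
    using sum_ee_recursion[of c y "\<lambda>A. lconst (zq (M + A) M) * f (M + A)"]
    by (simp add: * Ep_def[of y c])
qed

text \<open>Moving exp (sum y_m d/dp_m) past exp (sum x_m p_m / m) produces the scalar exp (sum x_m
  y_m / m), whose degree r part is the \<open>hh\<close> here. This scalar is the origin of the
  factors f_ij.\<close>

lemma Ep_Gm:
  assumes "0 \<notin># M"
  shows "Ep y c (Gm x f) M = Gm x (\<lambda>M. \<Sum>r\<le>c. hh (\<lambda>m. x m * y m) r * Ep y (c - r) f M) M"
  using assms
proof (induction c arbitrary: M rule: less_induct)
  case (less c)
  let ?h = "hh (\<lambda>m. x m * y m)"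
  show ?case
  proof (cases "c = 0")
    case True
    then show ?thesis using less.prems by (simp, intro Gm_cong) auto
  next
    case False
    have Gm: "Gm x (\<lambda>M. \<Sum>r\<le>d. ?h r * F r M) M' = (\<Sum>r\<le>d. ?h r * Gm x (F r) M')" for d F M'
      unfolding Gm_sum by (simp add: Gm_mult)
    have "of_nat c * Ep y c (Gm x f) M = (\<Sum>m=1..c. y m * annih m (Ep y (c - m) (Gm x f)) M)"
      by (rule Ep_recursion) fact
    also have "\<dots> = (\<Sum>m=1..c. y m * annih m (\<lambda>M. \<Sum>r\<le>c - m. ?h r * Gm x (Ep y (c - m - r) f) M) M)"
      by (rule sum.cong[OF refl], rule arg_cong[of _ _ "(*) _"], rule annih_cong)
         (use less.prems False less.IH in \<open>auto simp: Gm\<close>)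
    also have "\<dots> = (\<Sum>m=1..c. \<Sum>r\<le>c - m. y m * (?h r * Gm x (annih m (Ep y (c - m - r) f)) M)
        + x m * y m * (?h r * Gm x (Ep y (c - m - r) f) M))"
      unfolding annih_sum annih_mult sum_distrib_left
      by (intro sum.cong refl) (auto simp: annih_Gm algebra_simps)
    also have "\<dots> = (\<Sum>m=1..c. \<Sum>r\<le>c - m. y m * (?h r * Gm x (annih m (Ep y (c - m - r) f)) M))
        + (\<Sum>m=1..c. \<Sum>r\<le>c - m. x m * y m * (?h r * Gm x (Ep y (c - m - r) f) M))"
      by (simp only: sum.distrib)
    also have "(\<Sum>m=1..c. \<Sum>r\<le>c - m. y m * (?h r * Gm x (annih m (Ep y (c - m - r) f)) M)) =
        (\<Sum>r\<le>c. \<Sum>m=1..c-r. y m * (?h r * Gm x (annih m (Ep y (c - m - r) f)) M))"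
      by (subst sum.Sigma, simp, simp, subst sum.Sigma, simp, simp, rule sum.reindex_bij_witness[of _ "\<lambda>(a, b). (b, a)" "\<lambda>(a, b). (b, a)"]) auto
    also have "\<dots> = (\<Sum>r\<le>c. ?h r * (of_nat (c - r) * Gm x (Ep y (c - r) f) M))"
    proof (rule sum.cong[OF refl])
      fix r
      have "of_nat (c - r) * Gm x (Ep y (c - r) f) M = Gm x (\<lambda>M. \<Sum>m=1..c-r. y m * annih m (Ep y (c - r - m) f) M) M"
        unfolding Gm_mult[symmetric] by (rule Gm_cong) (use less.prems Ep_recursion in auto)
      also have "\<dots> = (\<Sum>m=1..c-r. y m * Gm x (annih m (Ep y (c - m - r) f)) M)"
        unfolding Gm_sum by (simp add: Gm_mult diff_right_commute add.commute)
      finally show "(\<Sum>m=1..c-r. y m * (?h r * Gm x (annih m (Ep y (c - m - r) f)) M)) =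
          ?h r * (of_nat (c - r) * Gm x (Ep y (c - r) f) M)"
        by (simp only: sum_distrib_left mult.left_commute)
    qed
    \<comment> \<open>With t = m + r the scalar terms contract by Newton's identity to t times the
      degree t part of the scalar.\<close>
    also have "(\<Sum>m=1..c. \<Sum>r\<le>c - m. x m * y m * (?h r * Gm x (Ep y (c - m - r) f) M)) =
        (\<Sum>t\<le>c. \<Sum>m=1..t. x m * y m * (?h (t - m) * Gm x (Ep y (c - t) f) M))"
      by (subst sum.Sigma, simp, simp, subst sum.Sigma, simp, simp, rule sum.reindex_bij_witness[of _ "\<lambda>(t, m). (m, t - m)" "\<lambda>(m, r). (m + r, m)"])
         auto
    also have "\<dots> = (\<Sum>t\<le>c. of_nat t * ?h t * Gm x (Ep y (c - t) f) M)"
      unfolding hh_recursion by (simp add: sum_distrib_right mult.assoc)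
    also have "(\<Sum>r\<le>c. ?h r * (of_nat (c - r) * Gm x (Ep y (c - r) f) M)) + \<dots> =
        of_nat c * (\<Sum>r\<le>c. ?h r * Gm x (Ep y (c - r) f) M)"
      unfolding sum_distrib_left sum.distrib[symmetric]
      by (rule sum.cong[OF refl]) (simp add: of_nat_diff algebra_simps)
    finally have "Ep y c (Gm x f) M = (\<Sum>r\<le>c. ?h r * Gm x (Ep y (c - r) f) M)"
      by (rule lring_of_nat_cancel) (use False in simp)
    then show ?thesis unfolding Gm .
  qed
qed

lemma Gm_Gm:
  assumes "0 \<notin># M"
  shows "Gm x (Gm x' f) M = Gm (\<lambda>m. x m + x' m) f M"
proof -
  have "Gm x (Gm x' f) M = (\<Sum>(A, B)\<in>(SIGMA A:{A. A \<subseteq># M}. {B. B \<subseteq># M - A}). ee x A * (ee x' B * f (M - A - B)))"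
    unfolding Gm_def sum_distrib_left
    by (rule sum.Sigma) (auto intro: finite_submultisets)
  also have "\<dots> = (\<Sum>(C, A)\<in>(SIGMA C:{C. C \<subseteq># M}. {A. A \<subseteq># C}). ee x A * ee x' (C - A) * f (M - C))"
  proof (rule sum.reindex_bij_witness[of _ "\<lambda>(C, A). (A, C - A)" "\<lambda>(A, B). (A + B, A)"])
    fix a assume "a \<in> (SIGMA A:{A. A \<subseteq># M}. {B. B \<subseteq># M - A})"
    then show "(case a of (A, B) \<Rightarrow> (A + B, A)) \<in> (SIGMA C:{C. C \<subseteq># M}. {A. A \<subseteq># C})"
      by (auto simp: subset_mset.le_diff_conv2 add.commute)
  next
    fix b assume "b \<in> (SIGMA C:{C. C \<subseteq># M}. {A. A \<subseteq># C})"
    then show "(case b of (C, A) \<Rightarrow> (A, C - A)) \<in> (SIGMA A:{A. A \<subseteq># M}. {B. B \<subseteq># M - A})"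
      by (auto simp: subseteq_mset_def diff_le_mono intro: le_trans)
  qed (auto simp: mult.assoc)
  also have "\<dots> = (\<Sum>C | C \<subseteq># M. \<Sum>A | A \<subseteq># C. ee x A * ee x' (C - A) * f (M - C))"
    by (rule sum.Sigma[symmetric]) (auto intro: finite_submultisets)
  also have "\<dots> = Gm (\<lambda>m. x m + x' m) f M"
    unfolding Gm_def
    by (rule sum.cong[OF refl]) (subst ee_add, use assms in \<open>auto simp: sum_distrib_right dest: mset_subset_eqD\<close>)
  finally show ?thesis .
qed

text \<open>Both steps remove parts, and the multiset removed in total is divided in all possible
  ways; this is the exponential law \<open>ee_add\<close>.\<close>

lemma Ep_Ep:
  assumes "0 \<notin># M"
  shows "(\<Sum>c\<le>C. Ep y c (Ep y' (C - c) f) M) = Ep (\<lambda>m. y m + y' m) C f M"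
proof -
  let ?g = "\<lambda>A. lconst (zq (M + A) M) * f (M + A)"
  have *: "Ep y c (Ep y' d f) M = (\<Sum>A\<in>multisets_of c. \<Sum>B\<in>multisets_of d. ee y A * ee y' B * ?g (A + B))" for c d
    unfolding Ep_def sum_distrib_left
  proof (intro sum.cong refl)
    fix A B assume "A \<in> multisets_of c" "B \<in> multisets_of d"
    then have "zmset (M + A) > 0" "zmset M > 0" using assms by (auto simp: multisets_of_def intro!: zmset_pos)
    then have "lconst (zq (M + A) M) * lconst (zq (M + A + B) (M + A)) =
        lconst (of_nat (zmset (M + (A + B))) / of_nat (zmset M))"
      unfolding lconst_mult[symmetric] by (simp add: add.assoc)
    note eq = this
    show "ee y A * (lconst (zq (M + A) M) * (ee y' B *
         (lconst (zq (M + A + B) (M + A)) * f (M + A + B)))) = ee y A * ee y' B * ?g (A + B)"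
      unfolding eq[symmetric] by (simp add: ac_simps)
  qed
  have "(\<Sum>c\<le>C. Ep y c (Ep y' (C - c) f) M) =
      (\<Sum>c\<le>C. \<Sum>(A, B)\<in>multisets_of c \<times> multisets_of (C - c). ee y A * ee y' B * ?g (A + B))"
    unfolding * sum.cartesian_product ..
  also have "\<dots> = (\<Sum>(c, A, B)\<in>(SIGMA c:{..C}. multisets_of c \<times> multisets_of (C - c)). ee y A * ee y' B * ?g (A + B))"
    by (rule sum.Sigma) (auto simp: finite_multisets_of)
  also have "\<dots> = (\<Sum>(D, A)\<in>(SIGMA D:multisets_of C. {A. A \<subseteq># D}). ee y A * ee y' (D - A) * ?g D)"
  proof (rule sum.reindex_bij_witness[of _ "\<lambda>(D, A). (sum_mset A, A, D - A)" "\<lambda>(c, A, B). (A + B, A)"])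
    fix b assume "b \<in> (SIGMA D:multisets_of C. {A. A \<subseteq># D})"
    then show "(case b of (D, A) \<Rightarrow> (sum_mset A, A, D - A)) \<in> (SIGMA c:{..C}. multisets_of c \<times> multisets_of (C - c))"
      by (auto simp: multisets_of_def subset_mset.le_iff_add)
  qed (auto simp: multisets_of_def)
  also have "\<dots> = (\<Sum>D\<in>multisets_of C. \<Sum>A | A \<subseteq># D. ee y A * ee y' (D - A) * ?g D)"
    by (rule sum.Sigma[symmetric]) (auto intro: finite_submultisets finite_multisets_of)
  also have "\<dots> = Ep (\<lambda>m. y m + y' m) C f M"
    unfolding Ep_def
    by (rule sum.cong[OF refl]) (subst ee_add, auto simp: sum_distrib_right multisets_of_def)
  finally show ?thesis .
qed

section \<open>The exponents of the vertex operators and the coefficient functional\<close>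

definition xx :: "nat \<Rightarrow> nat \<Rightarrow> lring" where
  "xx i m = single (single i (of_nat m), single i (int m)) 1
    - single (0, single i (int m)) 1"

text \<open>While \<open>xx\<close> is (T_i^m - 1) z_i^m, this is (Q_i^m - 1) T_i^(-m) z_i^(-m): the
  coefficients of the creation and the annihilation part in the exponent of the i-th vertex
  operator. The numerator of the prefactor in the theorem is \<open>yy 1 n\<close>.\<close>

definition yy :: "nat \<Rightarrow> nat \<Rightarrow> lring" where
  "yy i m = single (single i (of_nat m * (jalpha - 1)), single i (- int m)) 1
    - single (single i (- of_nat m), single i (- int m)) 1"

definition Phi :: "ratfun fls" where "Phi = 1 / ((1 - Q_ser) * (1 - inverse T_ser))"

text \<open>The index 1 corresponds to the monomial s_1...s_k of the theorem. Since
  \<open>Phi\<close> has a double pole, only the Taylor terms of exp (c s) up to order 3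
  enter.\<close>

definition psi :: "ratfun \<Rightarrow> ratfun" where "psi c = fls_nth (Phi * fps_to_fls (fps_exp c)) 1"

text \<open>\<open>Psi I\<close> extracts the coefficient of \<open>\<Prod>\<^sub>i s\<^sub>i z\<^sub>i\<^sup>0\<close> after multiplication by
  \<open>\<Prod>\<^sub>i 1/((1 - Q\<^sub>i)(1 - T\<^sub>i\<^sup>-\<^sup>1))\<close>, the products being over \<open>i \<in> I\<close>.\<close>

definition Psi_mon :: "nat set \<Rightarrow> lexpt \<Rightarrow> ratfun" where
  "Psi_mon I e = (if snd e = 0 then \<Prod>i\<in>I. psi (lookup (fst e) i) else 0)"

definition Psi :: "nat set \<Rightarrow> lring \<Rightarrow> ratfun" where
  "Psi I g = (\<Sum>e\<in>keys g. lookup g e * Psi_mon I e)"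

lemma Psi_superset:
  assumes "finite S" "keys g \<subseteq> S"
  shows "Psi I g = (\<Sum>e\<in>S. lookup g e * Psi_mon I e)"
  unfolding Psi_def by (rule sum.mono_neutral_left) (use assms in \<open>auto simp: in_keys_iff\<close>)

lemma Psi_0 [simp]: "Psi I 0 = 0" by (simp add: Psi_def)

lemma Psi_add: "Psi I (g + h) = Psi I g + Psi I h"
  using keys_add[of g h]
  by (simp add: Psi_superset[of "keys g \<union> keys h"] lookup_add
      distrib_right sum.distrib)

lemma Psi_uminus: "Psi I (- g) = - Psi I g"
  using Psi_add[of I g "- g"] by (simp add: eq_neg_iff_add_eq_0 add.commute)

lemma Psi_diff: "Psi I (g - h) = Psi I g - Psi I h"
  using Psi_add[of I g "- h"] by (simp add: Psi_uminus)

lemma Psi_sum: "Psi I (\<Sum>a\<in>A. g a) = (\<Sum>a\<in>A. Psi I (g a))"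
  by (induction A rule: infinite_finite_induct) (simp_all add: Psi_add)

lemma Psi_single: "Psi I (single e c) = c * Psi_mon I e"
  by (simp add: Psi_def)

lemma Psi_lconst_mult: "Psi I (lconst c * g) = c * Psi I g"
proof -
  have "keys (lconst c * g) \<subseteq> keys g" by (auto simp: in_keys_iff)
  then show ?thesis
    by (subst Psi_superset[of "keys g"]) (simp_all add: Psi_def sum_distrib_left mult.assoc)
qed

lemma lring_eq_sum_single: "g = (\<Sum>e\<in>keys g. single e (lookup (g :: lring) e))"
proof (rule poly_mapping_eqI)
  fix k
  show "lookup g k = lookup (\<Sum>e\<in>keys g. single e (lookup g e)) k"
    by (simp add: lookup_sum lookup_single when_def in_keys_iff)
qed

lemma lring_mult_eq_sum:
  "g * h = (\<Sum>e\<in>keys g. \<Sum>e'\<in>keys h.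
     single (e + e') (lookup (g :: lring) e * lookup h e'))"
  by (rule trans[OF arg_cong2[of _ _ _ _ "(*)", OF lring_eq_sum_single lring_eq_sum_single]])
     (simp add: sum_product mult_single)

section \<open>Supports\<close>

text \<open>Supports are only bounded from above, so that cancellation never has to be
  discussed.\<close>

definition supp_in :: "lexpt set \<Rightarrow> lring \<Rightarrow> bool" where
  "supp_in S g \<longleftrightarrow> keys g \<subseteq> S"

lemma supp_in_0 [simp]: "supp_in S 0" by (simp add: supp_in_def)

lemma supp_in_add: "supp_in S g \<Longrightarrow> supp_in S h \<Longrightarrow> supp_in S (g + h)"
  using keys_add[of g h] by (auto simp: supp_in_def)

lemma supp_in_uminus: "supp_in S g \<Longrightarrow> supp_in S (- g)"
  by (simp add: supp_in_def in_keys_iff subset_iff)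

lemma supp_in_diff: "supp_in S g \<Longrightarrow> supp_in S h \<Longrightarrow> supp_in S (g - h)"
  using supp_in_add[of S g "- h"] supp_in_uminus by simp

lemma supp_in_sum: "(\<And>a. a \<in> A \<Longrightarrow> supp_in S (g a)) \<Longrightarrow> supp_in S (\<Sum>a\<in>A. g a)"
  by (induction A rule: infinite_finite_induct) (simp_all add: supp_in_add)

lemma supp_in_mult:
  assumes "supp_in S g" "supp_in S' h" "\<And>e e'. e \<in> S \<Longrightarrow> e' \<in> S' \<Longrightarrow> e + e' \<in> S''"
  shows "supp_in S'' (g * h)"
  using assms keys_mult[of g h] by (fastforce simp: supp_in_def)

lemma supp_in_lconst_mult: "supp_in S g \<Longrightarrow> supp_in S (lconst c * g)"
  by (auto simp: supp_in_def in_keys_iff)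

lemma supp_in_mono: "supp_in S g \<Longrightarrow> S \<subseteq> S' \<Longrightarrow> supp_in S' g"
  by (auto simp: supp_in_def)

lemma supp_in_single: "e \<in> S \<Longrightarrow> supp_in S (single e c)"
  by (auto simp: supp_in_def split: if_splits)

lemma supp_in_1: "0 \<in> S \<Longrightarrow> supp_in S 1"
  using supp_in_single[of 0 S 1] by (metis single_one)

text \<open>\<open>S\<close> is a family of exponent sets compatible with addition of the indices:
  constant for bounds on the variables, graded for bounds on degrees.\<close>

lemma supp_in_ee:
  assumes "\<And>m. supp_in (S m) (x m)" "0 \<in> S 0" "\<And>m n e e'. e \<in> S m \<Longrightarrow> e' \<in> S n \<Longrightarrow> e + e' \<in> S (m + n)"
  shows "supp_in (S (sum_mset M)) (ee x M)"
proof -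
  have "supp_in (S (sum_mset M)) (prod_mset (image_mset x M))"
  proof (induction M)
    case (add m M)
    then show ?case using supp_in_mult[OF assms(1)[of m] add.IH assms(3)] by simp
  qed (use assms in \<open>auto intro: supp_in_1\<close>)
  then show ?thesis unfolding ee_def by (rule supp_in_lconst_mult)
qed

lemma supp_in_hh:
  assumes "\<And>m. supp_in (S m) (x m)" "0 \<in> S 0" "\<And>m n e e'. e \<in> S m \<Longrightarrow> e' \<in> S n \<Longrightarrow> e + e' \<in> S (m + n)"
  shows "supp_in (S r) (hh x r)"
  unfolding hh_def
  by (rule supp_in_sum) (use supp_in_ee[of S x, OF assms] in \<open>auto simp: multisets_of_def\<close>)

definition vars_in :: "nat set \<Rightarrow> lexpt set" where
  "vars_in I = {e. keys (fst e) \<subseteq> I \<and> keys (snd e) \<subseteq> I}"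

text \<open>An interval of degrees, because sums such as \<open>x m + xx v m\<close> mix the degrees
  0 and m in z_v.\<close>

definition zdeg :: "nat \<Rightarrow> int \<Rightarrow> int \<Rightarrow> lexpt set" where
  "zdeg v lo hi = {e. lo \<le> lookup (snd e) v \<and> lookup (snd e) v \<le> hi}"

lemma vars_in_add: "e \<in> vars_in I \<Longrightarrow> e' \<in> vars_in I \<Longrightarrow> e + e' \<in> vars_in I"
  using keys_add[of "fst e" "fst e'"] keys_add[of "snd e" "snd e'"]
  by (auto simp: vars_in_def)

lemma vars_in_0 [simp]: "0 \<in> vars_in I" by (simp add: vars_in_def)

lemma vars_in_mono: "I \<subseteq> J \<Longrightarrow> vars_in I \<subseteq> vars_in J" by (auto simp: vars_in_def)

lemma zdeg_0 [simp]: "lo \<le> 0 \<Longrightarrow> 0 \<le> hi \<Longrightarrow> 0 \<in> zdeg v lo hi" by (simp add: zdeg_def)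

lemma zdeg_add: "e \<in> zdeg v lo hi \<Longrightarrow> e' \<in> zdeg v lo' hi' \<Longrightarrow> e + e' \<in> zdeg v (lo + lo') (hi + hi')"
  by (simp add: zdeg_def lookup_add)

lemma vars_in_zdeg: "v \<notin> I \<Longrightarrow> vars_in I \<subseteq> zdeg v 0 0"
proof
  fix e assume "v \<notin> I" "e \<in> vars_in I"
  then have "v \<notin> keys (snd e)" by (auto simp: vars_in_def)
  then show "e \<in> zdeg v 0 0" by (simp add: zdeg_def in_keys_iff)
qed

lemma zdeg_mono: "lo' \<le> lo \<Longrightarrow> hi \<le> hi' \<Longrightarrow> zdeg v lo hi \<subseteq> zdeg v lo' hi'"
  by (auto simp: zdeg_def)

lemma supp_vars_mult: "supp_in (vars_in I) g \<Longrightarrow> supp_in (vars_in I) h \<Longrightarrow> supp_in (vars_in I) (g * h)"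
  by (rule supp_in_mult[OF _ _ vars_in_add])

lemma supp_zdeg_mult:
  "supp_in (zdeg v lo hi) g \<Longrightarrow> supp_in (zdeg v lo' hi') h \<Longrightarrow> lo'' \<le> lo + lo' \<Longrightarrow> hi + hi' \<le> hi'' \<Longrightarrow>
    supp_in (zdeg v lo'' hi'') (g * h)"
  by (erule supp_in_mult, assumption, drule zdeg_add, assumption, erule subsetD[OF zdeg_mono, rotated 2])

text \<open>The functional takes the coefficient of z_v^0. The truncations of the scalar series rest
  on this.\<close>

lemma Psi_zdeg: "supp_in (zdeg v lo hi) g \<Longrightarrow> lo > 0 \<or> hi < 0 \<Longrightarrow> Psi I g = 0"
  unfolding Psi_def
proof (rule sum.neutral, rule ballI)
  fix e assume "supp_in (zdeg v lo hi) g" "lo > 0 \<or> hi < 0" "e \<in> keys g"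
  then have "lookup (snd e) v \<noteq> 0" by (auto simp: supp_in_def zdeg_def)
  then have "snd e \<noteq> 0" by auto
  then show "lookup g e * Psi_mon I e = 0" by (simp add: Psi_mon_def)
qed

lemma supp_vars_ee: "(\<And>m. supp_in (vars_in I) (x m)) \<Longrightarrow> supp_in (vars_in I) (ee x M)"
  by (rule supp_in_ee[of "\<lambda>_. vars_in I"]) (auto intro: vars_in_add)

lemma supp_vars_hh: "(\<And>m. supp_in (vars_in I) (x m)) \<Longrightarrow> supp_in (vars_in I) (hh x r)"
  by (rule supp_in_hh[of "\<lambda>_. vars_in I"]) (auto intro: vars_in_add)

lemma supp_zdeg_ee:
  assumes "\<And>m. supp_in (zdeg v (lo * int m) (hi * int m)) (x m)"
  shows "supp_in (zdeg v (lo * int (sum_mset M)) (hi * int (sum_mset M))) (ee x M)"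
  by (rule supp_in_ee[of "\<lambda>m. zdeg v (lo * int m) (hi * int m)"])
     (use assms in \<open>auto simp: distrib_left intro: zdeg_add\<close>)

lemma supp_zdeg_hh:
  assumes "\<And>m. supp_in (zdeg v (lo * int m) (hi * int m)) (x m)"
  shows "supp_in (zdeg v (lo * int r) (hi * int r)) (hh x r)"
  by (rule supp_in_hh[of "\<lambda>m. zdeg v (lo * int m) (hi * int m)"])
     (use assms in \<open>auto simp: distrib_left intro: zdeg_add\<close>)

lemma supp_xx [simp]: "supp_in (vars_in {i}) (xx i m)" "supp_in (zdeg i (int m) (int m)) (xx i m)"
  unfolding xx_def by (auto intro!: supp_in_diff supp_in_single simp: vars_in_def zdeg_def split: if_splits)

lemma supp_yy [simp]: "supp_in (vars_in {i}) (yy i m)" "supp_in (zdeg i (- int m) (- int m)) (yy i m)"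
  unfolding yy_def by (auto intro!: supp_in_diff supp_in_single simp: vars_in_def zdeg_def split: if_splits)

text \<open>The prefactor is a product over the variables, and exponents of z in disjoint sets of
  variables cannot cancel. A product of matrix elements thus becomes one value of the
  functional.\<close>

lemma Psi_mult:
  assumes "supp_in (vars_in I) g" "supp_in (vars_in J) h" "I \<inter> J = {}" "finite I" "finite J"
  shows "Psi (I \<union> J) (g * h) = Psi I g * Psi J h"
proof -
  have "Psi (I \<union> J) (g * h) = (\<Sum>e\<in>keys g. \<Sum>e'\<in>keys h.
      (lookup g e * lookup h e') * Psi_mon (I \<union> J) (e + e'))"
    by (subst lring_mult_eq_sum) (simp add: Psi_sum Psi_single)
  also have "\<dots> = (\<Sum>e\<in>keys g. \<Sum>e'\<in>keys h.
      (lookup g e * Psi_mon I e) * (lookup h e' * Psi_mon J e'))"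
  proof (intro sum.cong refl)
    fix e e' assume e: "e \<in> keys g" "e' \<in> keys h"
    then have v: "e \<in> vars_in I" "e' \<in> vars_in J" using assms by (auto simp: supp_in_def)
    have 0: "lookup (snd e') i = 0" if "i \<in> I" for i
      using that v assms(3) by (auto simp: vars_in_def in_keys_iff)
    have 1: "lookup (snd e) i = 0" if "i \<notin> I" for i
      using that v by (auto simp: vars_in_def in_keys_iff)
    have 2: "lookup (fst e') i = 0" if "i \<in> I" for i
      using that v assms(3) by (auto simp: vars_in_def in_keys_iff)
    have 3: "lookup (fst e) i = 0" if "i \<in> J" for i
      using that v assms(3) by (auto simp: vars_in_def in_keys_iff)
    have snd: "snd e + snd e' = 0 \<longleftrightarrow> snd e = 0 \<and> snd e' = 0"
    proof
      assume s: "snd e + snd e' = 0"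
      have "snd e = 0"
      proof (rule poly_mapping_eqI)
        fix i
        show "lookup (snd e) i = lookup 0 i"
          using 0[of i] 1[of i] arg_cong[OF s, of "\<lambda>p. lookup p i"]
          by (cases "i \<in> I") (auto simp: lookup_add)
      qed
      then show "snd e = 0 \<and> snd e' = 0" using s by simp
    qed simp
    have "(\<Prod>i\<in>I. psi (lookup (fst e + fst e') i)) = (\<Prod>i\<in>I. psi (lookup (fst e) i))"
      by (rule prod.cong) (simp_all add: lookup_add 2)
    moreover have "(\<Prod>i\<in>J. psi (lookup (fst e + fst e') i)) = (\<Prod>i\<in>J. psi (lookup (fst e') i))"
      by (rule prod.cong) (simp_all add: lookup_add 3)
    ultimately have "Psi_mon (I \<union> J) (e + e') = Psi_mon I e * Psi_mon J e'"
      using snd assms by (auto simp: Psi_mon_def prod.union_disjoint)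
    then show "(lookup g e * lookup h e') * Psi_mon (I \<union> J) (e + e') =
      (lookup g e * Psi_mon I e) * (lookup h e' * Psi_mon J e')"
      by simp
  qed
  also have "\<dots> = Psi I g * Psi J h" by (simp add: Psi_def sum_product)
  finally show ?thesis .
qed

section \<open>Matrix elements of vertex operators\<close>

text \<open>\<open>GG x y L N\<close> is the coefficient of \<open>p\<^sub>N\<close> in
  \<open>exp (\<Sum>\<^sub>m x\<^sub>m p\<^sub>m / m) exp (\<Sum>\<^sub>m y\<^sub>m \<partial>/\<partial>p\<^sub>m) p\<^sub>L\<close>.\<close>

definition GG :: "(nat \<Rightarrow> lring) \<Rightarrow> (nat \<Rightarrow> lring) \<Rightarrow> nms \<Rightarrow> nms \<Rightarrow> lring" where
  "GG x y L N = (\<Sum>M | M \<subseteq># N \<and> M \<subseteq># L. ee x (N - M) * (lconst (zq L M) * ee y (L - M)))"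

text \<open>The vector p_L as a coefficient function.\<close>

definition dl :: "nms \<Rightarrow> lfun" where "dl L M = (if M = L then 1 else 0)"

lemma Ep_dl:
  assumes "0 \<notin># L"
  shows "Ep y c (dl L) M = (if M \<subseteq># L \<and> sum_mset L = sum_mset M + c
     then lconst (zq L M) * ee y (L - M) else 0)"
proof (cases "M \<subseteq># L \<and> sum_mset L = sum_mset M + c")
  case True
  then obtain A where A: "L = M + A" by (auto simp: subset_mset.le_iff_add)
  have "Ep y c (dl L) M = (\<Sum>B\<in>multisets_of c. if B = A then ee y A * lconst (zq (M + A) M) else 0)"
    unfolding Ep_def dl_def A by (rule sum.cong) auto
  also have "\<dots> = ee y A * lconst (zq (M + A) M)"
    using A assms True by (simp add: finite_multisets_of) (auto simp: multisets_of_def)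
  finally show ?thesis using True A by (simp add: mult.commute)
next
  case False
  then show ?thesis unfolding Ep_def dl_def by (auto simp: multisets_of_def intro!: sum.neutral)
qed

text \<open>Lowering p_L by more than its degree gives 0, so the exponential of the derivation is a
  finite sum on it.\<close>

lemma GG_eq_sum_Ep:
  assumes "0 \<notin># L" "sum_mset L \<le> C"
  shows "GG x y L N = (\<Sum>c\<le>C. Gm x (Ep y c (dl L)) N)"
proof -
  let ?t = "\<lambda>M. if M \<subseteq># L then lconst (zq L M) * ee y (L - M) else 0"
  have *: "(\<Sum>c\<le>C. Ep y c (dl L) M) = ?t M" for M
  proof (cases "M \<subseteq># L")
    case True
    then have le: "sum_mset M \<le> sum_mset L" by (metis le_add1 subset_mset.le_iff_add sum_mset.union)
    have "(\<Sum>c\<le>C. Ep y c (dl L) M) = (\<Sum>c\<le>C. if c = sum_mset L - sum_mset M then ?t M else 0)"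
      by (rule sum.cong) (use le True in \<open>auto simp: Ep_dl assms\<close>)
    also have "\<dots> = ?t M" using assms(2) by (subst sum.delta) auto
    finally show ?thesis .
  qed (simp add: Ep_dl assms)
  have "(\<Sum>c\<le>C. Gm x (Ep y c (dl L)) N) = Gm x (\<lambda>M. \<Sum>c\<le>C. Ep y c (dl L) M) N"
    by (simp add: Gm_sum)
  also have "\<dots> = Gm x ?t N" unfolding * ..
  also have "\<dots> = (\<Sum>A\<in>{A. A \<subseteq># N \<and> N - A \<subseteq># L}. ee x A * ?t (N - A))"
    unfolding Gm_def by (rule sum.mono_neutral_right) (auto simp: finite_submultisets)
  also have "\<dots> = GG x y L N"
  proof -
    have dd: "N - (N - A) = A" if "A \<subseteq># N" for A
      using that by (simp add: subseteq_mset_def multiset_eq_iff)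
    show ?thesis
    unfolding GG_def
    by (rule sum.reindex_bij_witness[of _ "\<lambda>M. N - M" "\<lambda>A. N - A"])
       (auto simp: dd)
  qed
  finally show ?thesis ..
qed

text \<open>The operator exp (sum y_m d/dp_m) is the shift of each p_n by y_n, and the other factor
  commutes with p_n. This commutator starts the induction on k.\<close>

lemma GG_add_mset:
  assumes L: "0 \<notin># L" and N: "0 \<notin># N" and n: "n > 0"
  shows "GG x y (add_mset n L) N = y n * GG x y L N + (if n \<in># N then GG x y L (N - {#n#}) else 0)"
proof -
  define t where "t = (\<lambda>L M. if M \<subseteq># L then lconst (zq L M) * ee y (L - M) else 0)"
  have GG: "GG x y L N = (\<Sum>M | M \<subseteq># N. ee x (N - M) * t L M)" for L N
    unfolding GG_def by (rule sum.mono_neutral_cong_left) (auto simp: finite_submultisets t_def)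
  have t_add: "t (add_mset n L) M = y n * t L M + (if n \<in># M then t L (M - {#n#}) else 0)" if M: "0 \<notin># M" for M
  proof -
    have zM: "zmset M = n * count M n * zmset (M - {#n#})" if "n \<in># M"
      using zmset_add_mset[of n "M - {#n#}"] that by simp
    have zM': "zmset (M - {#n#}) > 0" using M by (metis in_diffD zmset_pos)
    \<comment> \<open>Either \<open>M\<close> fits into \<open>L\<close>, or it fits only with the
      help of the new part, or not at all. In the middle case \<open>M\<close> must contain all
      copies of \<open>n\<close>.\<close>
    consider "M \<subseteq># L" | "\<not> M \<subseteq># L" "M \<subseteq># add_mset n L" | "\<not> M \<subseteq># add_mset n L" by blast
    then show ?thesis
    proof cases
      case 1
      let ?e = "ee y (add_mset n (L - M))" and ?q = "zq L M :: ratfun"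
      have le: "count M n \<le> count L n" using 1 by (simp add: mset_subset_eq_count)
      have sub: "M \<subseteq># add_mset n L" using 1 by (simp add: subset_mset.order_trans)
      have diff: "add_mset n L - M = add_mset n (L - M)"
        using le by (intro multiset_eqI) (auto simp: Suc_diff_le)
      have rec: "of_nat (n * Suc (count L n - count M n)) * ?e = y n * ee y (L - M)"
        using ee_add_mset[OF n, of "L - M" y] by simp
      have second: "(if n \<in># M then t L (M - {#n#}) else 0) = lconst ?q * (of_nat (n * count M n) * ?e)"
      proof (cases "n \<in># M")
        case True
        have "L - (M - {#n#}) = add_mset n (L - M)"
          using 1 True by (simp add: multiset_eq_iff subseteq_mset_def) (metis Suc_diff_eq_diff_pred Suc_diff_le count_greater_zero_iff)
        moreover have "M - {#n#} \<subseteq># L" using 1 by (meson diff_subset_eq_self subset_mset.order_trans)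
        moreover have "(zq L (M - {#n#}) :: ratfun) = ?q * of_nat (n * count M n)"
          using zM[OF True] zM' True n by (simp add: divide_simps)
        ultimately show ?thesis
          unfolding t_def by (simp only: True if_True lconst_mult lconst_of_nat mult.assoc)
      next
        case False
        then have "count M n = 0" by (simp add: not_in_iff)
        with False show ?thesis by simp
      qed
      have "t (add_mset n L) M = lconst (zq (add_mset n L) M) * ?e"
        using sub by (simp add: t_def diff)
      also have "(zq (add_mset n L) M :: ratfun) = ?q * of_nat (n * Suc (count L n))"
        by (simp add: zmset_add_mset divide_simps)
      \<comment> \<open>The copies of \<open>n\<close> in the enlarged multiset lie outside or
        inside \<open>M\<close>: the former give the factor y_n, the latter the shifted
        term.\<close>
      also have "n * Suc (count L n) = n * Suc (count L n - count M n) + n * count M n"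
        using le by (metis Suc_diff_le add_mult_distrib2 le_SucI le_add_diff_inverse2)
      also have "lconst (?q * of_nat (n * Suc (count L n - count M n) + n * count M n)) * ?e =
          lconst ?q * (of_nat (n * Suc (count L n - count M n)) * ?e) + lconst ?q * (of_nat (n * count M n) * ?e)"
        unfolding lconst_mult lconst_of_nat of_nat_add lconst_add by (simp only: distrib_left distrib_right mult.assoc)
      also have "\<dots> = y n * t L M + (if n \<in># M then t L (M - {#n#}) else 0)"
        unfolding rec second using 1 by (simp add: t_def mult.left_commute)
      finally show ?thesis .
    next
      case 2
      obtain a where a: "count M a > count L a" using 2(1) by (auto simp: subseteq_mset_def not_le)
      have le: "count M b \<le> count (add_mset n L) b" for b using 2(2) by (rule mset_subset_eq_count)
      have "a = n" using a le[of a] by (cases "a = n") auto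
      then have cnt: "count M n = Suc (count L n)" using a le[of n] by simp
      then have in_M: "n \<in># M" by (metis count_greater_zero_iff zero_less_Suc)
      have sub: "M - {#n#} \<subseteq># L" using 2 by (simp add: subset_eq_diff_conv)
      have diff: "L - (M - {#n#}) = add_mset n L - M"
        using in_M by (metis add_mset_diff_bothsides insert_DiffM)
      have "(zq (add_mset n L) M :: ratfun) = zq L (M - {#n#})"
        unfolding zM[OF in_M] zmset_add_mset cnt of_nat_mult[of "n * Suc (count L n)"]
        by (rule mult_divide_mult_cancel_left) (subst of_nat_eq_0_iff, use n in simp)
      then show ?thesis using 2 in_M sub by (simp add: t_def diff)
    next
      case 3
      have "M \<subseteq># add_mset n L" if "M \<subseteq># L" using that by (simp add: subset_mset.order_trans)
      with 3 have "\<not> M \<subseteq># L" by blast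
      moreover have "\<not> M - {#n#} \<subseteq># L" if "n \<in># M"
        using 3 by (simp add: subset_eq_diff_conv)
      ultimately show ?thesis using 3 by (simp add: t_def)
    qed
  qed
  have "GG x y (add_mset n L) N = (\<Sum>M | M \<subseteq># N. ee x (N - M) * (y n * t L M + (if n \<in># M then t L (M - {#n#}) else 0)))"
    unfolding GG by (rule sum.cong[OF refl], subst t_add) (use N in \<open>auto dest: mset_subset_eqD\<close>)
  also have "\<dots> = y n * GG x y L N + (\<Sum>M | M \<subseteq># N. ee x (N - M) * (if n \<in># M then t L (M - {#n#}) else 0))"
    by (simp add: GG distrib_left sum.distrib sum_distrib_left mult.left_commute)
  also have "(\<Sum>M | M \<subseteq># N. ee x (N - M) * (if n \<in># M then t L (M - {#n#}) else 0)) =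
      (\<Sum>M | M \<subseteq># N \<and> n \<in># M. ee x (N - M) * t L (M - {#n#}))"
    by (rule sum.mono_neutral_cong_right) (auto simp: finite_submultisets)
  also have "\<dots> = (if n \<in># N then GG x y L (N - {#n#}) else 0)"
  proof (cases "n \<in># N")
    case True
    then obtain N' where N': "N = add_mset n N'" by (metis insert_DiffM)
    show ?thesis unfolding N' sum_submultisets_add_mset by (simp add: GG)
  next
    case False
    then have "{M. M \<subseteq># N \<and> n \<in># M} = {}" by (auto dest: mset_subset_eqD)
    then show ?thesis using False by (simp only: sum.empty if_False)
  qed
  finally show ?thesis .
qed

lemma supp_GG:
  assumes "\<And>m. supp_in (vars_in I) (x m)" "\<And>m. supp_in (vars_in I) (y m)"
  shows "supp_in (vars_in I) (GG x y L N)"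
  unfolding GG_def by (intro supp_in_sum supp_vars_mult supp_vars_ee supp_in_lconst_mult assms)

lemma zdeg_Gm:
  assumes "\<And>M. supp_in (zdeg v lo hi) (f M)" "\<And>m. supp_in (zdeg v 0 (int m)) (x m)"
  shows "supp_in (zdeg v lo (hi + int (sum_mset N))) (Gm x f N)"
  unfolding Gm_def
proof (rule supp_in_sum)
  fix A assume "A \<in> {A. A \<subseteq># N}"
  then have "sum_mset A \<le> sum_mset N" by (metis le_add1 mem_Collect_eq subset_mset.le_iff_add sum_mset.union)
  moreover have "supp_in (zdeg v 0 (int (sum_mset A))) (ee x A)"
    using supp_zdeg_ee[of v 0 1 x A] assms(2) by simp
  ultimately show "supp_in (zdeg v lo (hi + int (sum_mset N))) (ee x A * f (N - A))"
    by (elim supp_zdeg_mult[OF _ assms(1)]) (simp_all del: of_nat_sum_mset)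
qed

lemma zdeg_Ep:
  assumes "\<And>M. supp_in (zdeg v lo hi) (f M)" "\<And>m. supp_in (zdeg v (d * int m) (d * int m)) (y m)"
  shows "supp_in (zdeg v (lo + d * int c) (hi + d * int c)) (Ep y c f N)"
  unfolding Ep_def
proof (rule supp_in_sum)
  fix A assume "A \<in> multisets_of c"
  then have "sum_mset A = c" by (simp add: multisets_of_def)
  then have "supp_in (zdeg v (d * int c) (d * int c)) (ee y A)"
    using supp_zdeg_ee[of v d d y A] assms(2) by simp
  then show "supp_in (zdeg v (lo + d * int c) (hi + d * int c))
      (ee y A * (lconst (zq (N + A) N) * f (N + A)))"
    by (rule supp_zdeg_mult[OF _ supp_in_lconst_mult[OF assms(1)]]) auto
qed

text \<open>Together with the extraction of z_v^0, this homogeneity makes a single vertex operator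
  preserve the degree.\<close>

lemma zdeg_GG:
  assumes "\<And>m. supp_in (zdeg v (int m) (int m)) (x m)" "\<And>m. supp_in (zdeg v (- int m) (- int m)) (y m)"
  shows "supp_in (zdeg v (int (sum_mset N) - int (sum_mset L)) (int (sum_mset N) - int (sum_mset L))) (GG x y L N)"
  unfolding GG_def
proof (rule supp_in_sum)
  fix M assume "M \<in> {M. M \<subseteq># N \<and> M \<subseteq># L}"
  then obtain A B where AB: "N = M + A" "L = M + B" by (auto simp: subset_mset.le_iff_add)
  have A: "supp_in (zdeg v (int (sum_mset A)) (int (sum_mset A))) (ee x A)"
    using supp_zdeg_ee[of v 1 1 x A] assms(1) by simp
  have B: "supp_in (zdeg v (- int (sum_mset B)) (- int (sum_mset B))) (ee y B)"
    using supp_zdeg_ee[of v "-1" "-1" y B] assms(2) by simp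
  have "N - M = A" "L - M = B" using AB by simp_all
  then show "supp_in (zdeg v (int (sum_mset N) - int (sum_mset L)) (int (sum_mset N) - int (sum_mset L)))
       (ee x (N - M) * (lconst (zq L M) * ee y (L - M)))"
    by (simp only:) (rule supp_zdeg_mult[OF A supp_in_lconst_mult[OF B]], auto simp: AB)
qed

text \<open>Both sides run over triples (r, a, c), and their ranges differ only where the summand
  vanishes.\<close>

lemma sum_triangle_exchange:
  fixes P :: "nat \<Rightarrow> nat \<Rightarrow> nat \<Rightarrow> 'a::comm_monoid_add"
  assumes "\<And>r a c. r + a > S \<Longrightarrow> P r a c = 0" "\<And>r a c. a + c > C \<Longrightarrow> P r a c = 0" "S \<le> R"
  shows "(\<Sum>b\<le>S. \<Sum>c\<le>C. \<Sum>r\<le>b. P r (b - r) c) = (\<Sum>r\<le>R. \<Sum>d\<le>C. \<Sum>a\<le>d. P r a (d - a))"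
proof -
  let ?P = "\<lambda>(r, a, c). P r a c"
  have "(\<Sum>b\<le>S. \<Sum>c\<le>C. \<Sum>r\<le>b. P r (b - r) c) = (\<Sum>(b, c, r)\<in>(SIGMA b:{..S}. {..C} \<times> {..b}). P r (b - r) c)"
    by (simp add: sum.Sigma sum.cartesian_product)
  also have "\<dots> = sum ?P {(r, a, c). r + a \<le> S \<and> c \<le> C}"
    by (rule sum.reindex_bij_witness[of _ "\<lambda>(r, a, c). (r + a, c, r)" "\<lambda>(b, c, r). (r, b - r, c)"]) auto
  also have "\<dots> = sum ?P {(r, a, c). r + a \<le> S \<and> a + c \<le> C}"
  proof (rule sum.mono_neutral_right)
    have "{(r, a, c). r + a \<le> S \<and> c \<le> C} \<subseteq> {..S} \<times> {..S} \<times> {..C}" by auto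
    then show "finite {(r, a, c). r + a \<le> S \<and> c \<le> C}" by (rule finite_subset) simp
    show "\<forall>i\<in>{(r, a, c). r + a \<le> S \<and> c \<le> C} - {(r, a, c). r + a \<le> S \<and> a + c \<le> C}. ?P i = 0"
      by clarsimp (metis assms(2) not_le)
  qed auto
  also have "\<dots> = sum ?P {(r, a, c). r \<le> R \<and> a + c \<le> C}"
  proof (rule sum.mono_neutral_left)
    have "{(r, a, c). r \<le> R \<and> a + c \<le> C} \<subseteq> {..R} \<times> {..C} \<times> {..C}" by auto
    then show "finite {(r, a, c). r \<le> R \<and> a + c \<le> C}" by (rule finite_subset) simp
    show "\<forall>i\<in>{(r, a, c). r \<le> R \<and> a + c \<le> C} - {(r, a, c). r + a \<le> S \<and> a + c \<le> C}. ?P i = 0"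
      by clarsimp (metis assms(1) not_le)
  qed (use assms(3) in auto)
  also have "\<dots> = (\<Sum>(r, d, a)\<in>(SIGMA r:{..R}. SIGMA d:{..C}. {..d}). P r a (d - a))"
    by (rule sum.reindex_bij_witness[of _ "\<lambda>(r, d, a). (r, a, d - a)" "\<lambda>(r, a, c). (r, a + c, a)"]) auto
  also have "\<dots> = (\<Sum>r\<le>R. \<Sum>d\<le>C. \<Sum>a\<le>d. P r a (d - a))"
    by (simp add: sum.Sigma)
  finally show ?thesis .
qed

text \<open>Normal ordering of two vertex operators. The assumption \<open>kill\<close> bounds the
  degree r + a used up by the left operator, so the scalar series may be cut off at any
  \<open>R\<close> from \<open>S\<close> on.\<close>

lemma Psi_GG_compose:
  fixes x1 y1 x2 y2 :: "nat \<Rightarrow> lring" and L N :: "nms"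
  defines "T \<equiv> \<lambda>a c. Gm (\<lambda>m. x1 m + x2 m) (Ep y2 a (Ep y1 c (dl L))) N"
  assumes L: "0 \<notin># L" and N: "0 \<notin># N" and R: "S \<le> R"
    and kill: "\<And>r a c. r + a > S \<Longrightarrow> a + c \<le> sum_mset L \<Longrightarrow> Psi J (X * (hh (\<lambda>m. x1 m * y2 m) r * T a c)) = 0"
  shows "Psi J (X * (\<Sum>b\<le>S. Gm x2 (Ep y2 b (GG x1 y1 L)) N)) =
     Psi J (X * (\<Sum>r\<le>R. hh (\<lambda>m. x1 m * y2 m) r) * GG (\<lambda>m. x1 m + x2 m) (\<lambda>m. y1 m + y2 m) L N)"
proof -
  let ?h = "hh (\<lambda>m. x1 m * y2 m)" and ?C = "sum_mset L"
  define P where "P = (\<lambda>r a c. Psi J (X * (?h r * T a c)))"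
  have vanish: "T a c = 0" if "a + c > ?C" for a c
  proof -
    have "Ep y2 a (Ep y1 c (dl L)) M = 0" if M: "M \<subseteq># N" for M
    proof -
      have "Ep y1 c (dl L) (M + A) = 0" if "A \<in> multisets_of a" for A
        using \<open>a + c > ?C\<close> that by (simp add: Ep_dl[OF L] multisets_of_def)
      then show ?thesis by (simp add: Ep_def)
    qed
    then show ?thesis unfolding T_def Gm_def by (intro sum.neutral ballI) simp
  qed
  have "Gm x2 (Ep y2 b (GG x1 y1 L)) N = (\<Sum>c\<le>?C. \<Sum>r\<le>b. ?h r * T (b - r) c)" for b
  proof -
    have "Gm x2 (Ep y2 b (GG x1 y1 L)) N = Gm x2 (Ep y2 b (\<lambda>M. \<Sum>c\<le>?C. Gm x1 (Ep y1 c (dl L)) M)) N"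
      using GG_eq_sum_Ep[OF L order_refl, of x1 y1] by presburger
    also have "\<dots> = (\<Sum>c\<le>?C. Gm x2 (Ep y2 b (Gm x1 (Ep y1 c (dl L)))) N)"
      unfolding Ep_sum[abs_def] Gm_sum ..
    also have "\<dots> = (\<Sum>c\<le>?C. Gm x2 (Gm x1 (\<lambda>M. \<Sum>r\<le>b. ?h r * Ep y2 (b - r) (Ep y1 c (dl L)) M)) N)"
      by (intro sum.cong refl Gm_cong[OF N] Ep_Gm)
    also have "\<dots> = (\<Sum>c\<le>?C. \<Sum>r\<le>b. ?h r * T (b - r) c)"
      unfolding Gm_Gm[OF N] Gm_sum by (simp add: Gm_mult T_def add.commute)
    finally show ?thesis .
  qed
  then have "Psi J (X * (\<Sum>b\<le>S. Gm x2 (Ep y2 b (GG x1 y1 L)) N)) = (\<Sum>b\<le>S. \<Sum>c\<le>?C. \<Sum>r\<le>b. P r (b - r) c)"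
    by (simp add: sum_distrib_left Psi_sum P_def)
  also have "\<dots> = (\<Sum>r\<le>R. \<Sum>d\<le>?C. \<Sum>a\<le>d. P r a (d - a))"
  proof (rule sum_triangle_exchange[OF _ _ R])
    fix r a c :: nat
    show "P r a c = 0" if "a + c > ?C" using vanish[OF that] by (simp add: P_def)
    then show "P r a c = 0" if "r + a > S" using kill[OF that] by (cases "a + c \<le> ?C") (auto simp: P_def not_le)
  qed
  also have "\<dots> = Psi J (X * (\<Sum>r\<le>R. ?h r) * (\<Sum>d\<le>?C. \<Sum>a\<le>d. T a (d - a)))"
    unfolding mult.assoc sum_distrib_right by (simp add: P_def Psi_sum sum_distrib_left)
  also have "(\<Sum>d\<le>?C. \<Sum>a\<le>d. T a (d - a)) = (\<Sum>d\<le>?C. Gm (\<lambda>m. x1 m + x2 m) (Ep (\<lambda>m. y1 m + y2 m) d (dl L)) N)"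
  proof (rule sum.cong[OF refl])
    fix d
    have "(\<Sum>a\<le>d. T a (d - a)) = Gm (\<lambda>m. x1 m + x2 m) (\<lambda>M. \<Sum>a\<le>d. Ep y2 a (Ep y1 (d - a) (dl L)) M) N"
      by (simp add: T_def Gm_sum)
    also have "\<dots> = Gm (\<lambda>m. x1 m + x2 m) (Ep (\<lambda>m. y1 m + y2 m) d (dl L)) N"
      by (rule Gm_cong[OF N]) (simp add: Ep_Ep add.commute)
    finally show "(\<Sum>a\<le>d. T a (d - a)) = Gm (\<lambda>m. x1 m + x2 m) (Ep (\<lambda>m. y1 m + y2 m) d (dl L)) N" .
  qed
  also have "\<dots> = GG (\<lambda>m. x1 m + x2 m) (\<lambda>m. y1 m + y2 m) L N"
    by (rule GG_eq_sum_Ep[OF L order_refl, symmetric])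
  finally show ?thesis .
qed

text \<open>With the operator in z_v on the left, its annihilation part meets the creation part
  \<open>x\<close>; this gives the product of the f_iv. The intermediate states \<open>Q\<close>
  have the degree of \<open>N\<close> because the left operator preserves it.\<close>

lemma Psi_GG_left:
  assumes L: "0 \<notin># L" and N: "0 \<notin># N" and I: "finite I" "v \<notin> I" and R: "sum_mset N \<le> R"
    and x: "\<And>m. supp_in (vars_in I) (x m)" and y: "\<And>m. supp_in (vars_in I) (y m)" and X: "supp_in (vars_in I) X"
  shows "(\<Sum>Q\<in>multisets_of (sum_mset N). Psi I (X * GG x y L Q) * Psi {v} (GG (xx v) (yy v) Q N)) =
    Psi (insert v I) (X * (\<Sum>r\<le>R. hh (\<lambda>m. x m * yy v m) r) * GG (\<lambda>m. x m + xx v m) (\<lambda>m. y m + yy v m) L N)"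
proof -
  let ?S = "sum_mset N" and ?J = "insert v I" and ?f = "GG x y L"
  let ?f1 = "\<lambda>Q. if Q \<in> multisets_of ?S then ?f Q else 0"
  have z0: "supp_in (zdeg v 0 0) g" if "supp_in (vars_in I) g" for g
    using that vars_in_zdeg[OF I(2)] by (rule supp_in_mono)
  have f0: "supp_in (zdeg v 0 0) (?f Q)" for Q by (intro z0 supp_GG x y)
  have "(\<Sum>Q\<in>multisets_of ?S. Psi I (X * ?f Q) * Psi {v} (GG (xx v) (yy v) Q N)) =
      (\<Sum>Q\<in>multisets_of ?S. Psi ?J (X * ?f Q * (\<Sum>b\<le>?S. Gm (xx v) (Ep (yy v) b (dl Q)) N)))"
  proof (rule sum.cong[OF refl])
    fix Q assume "Q \<in> multisets_of ?S"
    then have Q: "0 \<notin># Q" "sum_mset Q \<le> ?S" by (auto simp: multisets_of_def)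
    have "Psi ?J (X * ?f Q * GG (xx v) (yy v) Q N) = Psi I (X * ?f Q) * Psi {v} (GG (xx v) (yy v) Q N)"
      using I Psi_mult[of I "X * ?f Q" "{v}" "GG (xx v) (yy v) Q N"]
      by (simp add: supp_vars_mult X supp_GG x y)
    then show "Psi I (X * ?f Q) * Psi {v} (GG (xx v) (yy v) Q N) = Psi ?J (X * ?f Q * (\<Sum>b\<le>?S. Gm (xx v) (Ep (yy v) b (dl Q)) N))"
      by (simp only: GG_eq_sum_Ep[OF Q])
  qed
  also have "\<dots> = (\<Sum>b\<le>?S. Psi ?J (X * (\<Sum>Q\<in>multisets_of ?S. ?f Q * Gm (xx v) (Ep (yy v) b (dl Q)) N)))"
    by (simp add: sum_distrib_left Psi_sum mult.assoc) (rule sum.swap)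
  also have "\<dots> = (\<Sum>b\<le>?S. Psi ?J (X * Gm (xx v) (Ep (yy v) b ?f) N))"
  proof (rule sum.cong[OF refl])
    fix b
    have "(\<Sum>Q\<in>multisets_of ?S. ?f Q * dl Q M) = ?f1 M" for M
    proof -
      have "(\<Sum>Q\<in>multisets_of ?S. ?f Q * dl Q M) = (\<Sum>Q\<in>multisets_of ?S. if Q = M then ?f M else 0)"
        by (rule sum.cong) (auto simp: dl_def)
      then show ?thesis by (simp add: finite_multisets_of)
    qed
    then have "(\<Sum>Q\<in>multisets_of ?S. ?f Q * Gm (xx v) (Ep (yy v) b (dl Q)) N) = Gm (xx v) (Ep (yy v) b ?f1) N"
      by (simp flip: Gm_mult Ep_mult Gm_sum Ep_sum)
    moreover have "Psi ?J (X * Gm (xx v) (Ep (yy v) b ?f) N) = Psi ?J (X * Gm (xx v) (Ep (yy v) b ?f1) N)"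
      unfolding Gm_def Ep_def sum_distrib_left Psi_sum
    proof (intro sum.cong refl)
      fix A B assume A: "A \<in> {A. A \<subseteq># N}" and B: "B \<in> multisets_of b"
      have N0: "0 \<notin># N - A + B" using N B by (auto simp: multisets_of_def dest: in_diffD)
      let ?c = "lconst (zq (N - A + B) (N - A))"
      show "Psi ?J (X * (ee (xx v) A * (ee (yy v) B * (?c * ?f (N - A + B))))) =
        Psi ?J (X * (ee (xx v) A * (ee (yy v) B * (?c * ?f1 (N - A + B)))))"
      proof (cases "N - A + B \<in> multisets_of ?S")
        case False
        have AN: "sum_mset N = sum_mset A + sum_mset (N - A)"
          using A by (metis mem_Collect_eq subset_mset.add_diff_inverse sum_mset.union)
        \<comment> \<open>For an intermediate state of another degree the amounts created and
          removed in z_v differ, and the term has nonzero z_v-degree.\<close>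
        have ne: "sum_mset A \<noteq> sum_mset B" using False N0 AN by (auto simp: multisets_of_def)
        have 1: "supp_in (zdeg v (int (sum_mset A)) (int (sum_mset A))) (ee (xx v) A)"
          using supp_zdeg_ee[of v 1 1 "xx v" A] by simp
        have 2: "supp_in (zdeg v (- int (sum_mset B)) (- int (sum_mset B))) (ee (yy v) B)"
          using supp_zdeg_ee[of v "-1" "-1" "yy v" B] by simp
        let ?d = "int (sum_mset A) - int (sum_mset B)"
        have "supp_in (zdeg v ?d ?d) (X * (ee (xx v) A * (ee (yy v) B * (?c * ?f (N - A + B)))))"
          by (rule supp_zdeg_mult[OF z0[OF X] supp_zdeg_mult[OF 1 supp_zdeg_mult[OF 2 supp_in_lconst_mult[OF f0]
               order_refl order_refl] order_refl order_refl]]) simp_all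
        then have "Psi ?J (X * (ee (xx v) A * (ee (yy v) B * (?c * ?f (N - A + B))))) = 0"
          by (rule Psi_zdeg) (use ne in linarith)
        then show ?thesis using False by simp
      qed simp
    qed
    ultimately show "Psi ?J (X * (\<Sum>Q\<in>multisets_of ?S. ?f Q * Gm (xx v) (Ep (yy v) b (dl Q)) N)) =
        Psi ?J (X * Gm (xx v) (Ep (yy v) b ?f) N)" by simp
  qed
  also have "\<dots> = Psi ?J (X * (\<Sum>b\<le>?S. Gm (xx v) (Ep (yy v) b ?f) N))"
    by (simp add: sum_distrib_left Psi_sum)
  also have "\<dots> = Psi ?J (X * (\<Sum>r\<le>R. hh (\<lambda>m. x m * yy v m) r) * GG (\<lambda>m. x m + xx v m) (\<lambda>m. y m + yy v m) L N)"
  proof (rule Psi_GG_compose[OF L N R])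
    \<comment> \<open>The z_v-degree is at most |N| - r - a: creation in z_v is bounded by the size
      of \<open>N\<close>, while the scalar and the lowering contribute -r and -a.\<close>
    fix r a c :: nat assume "r + a > ?S"
    have xs: "supp_in (zdeg v 0 (int m)) (x m + xx v m)" for m
      by (intro supp_in_add supp_in_mono[OF z0[OF x] zdeg_mono] supp_in_mono[OF supp_xx(2) zdeg_mono]) auto
    have "supp_in (zdeg v 0 0) (Ep y c (dl L) M)" for M
      using zdeg_Ep[of v 0 0 "dl L" 0 y c M] z0[OF y] by (simp add: dl_def supp_in_1)
    then have "supp_in (zdeg v (- int a) (- int a)) (Ep (yy v) a (Ep y c (dl L)) M)" for M
      using zdeg_Ep[of v 0 0 "Ep y c (dl L)" "-1" "yy v" a M] by simp
    note T = zdeg_Gm[OF this xs]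
    have "supp_in (zdeg v (- int m) (- int m)) (x m * yy v m)" for m
      by (rule supp_zdeg_mult[OF z0[OF x] supp_yy(2)]) auto
    then have h: "supp_in (zdeg v (- int r) (- int r)) (hh (\<lambda>m. x m * yy v m) r)"
      using supp_zdeg_hh[of v "-1" "-1" "\<lambda>m. x m * yy v m" r] by simp
    have "supp_in (zdeg v (- int r - int a) (int ?S - int r - int a))
       (X * (hh (\<lambda>m. x m * yy v m) r * Gm (\<lambda>m. x m + xx v m) (Ep (yy v) a (Ep y c (dl L))) N))"
      by (rule supp_zdeg_mult[OF z0[OF X] supp_zdeg_mult[OF h T order_refl order_refl]]) simp_all
    then show "Psi ?J (X * (hh (\<lambda>m. x m * yy v m) r * Gm (\<lambda>m. x m + xx v m) (Ep (yy v) a (Ep y c (dl L))) N)) = 0"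
      by (rule Psi_zdeg) (use \<open>r + a > ?S\<close> in linarith)
  qed
  finally show ?thesis .
qed

text \<open>The mirror image: the operator in z_v acts first, its creation part meets
  \<open>y\<close>, and the product of the f_vi appears.\<close>

lemma Psi_GG_right:
  assumes L: "0 \<notin># L" and N: "0 \<notin># N" and I: "finite I" "v \<notin> I" and R: "sum_mset L \<le> R"
    and x: "\<And>m. supp_in (vars_in I) (x m)" and y: "\<And>m. supp_in (vars_in I) (y m)" and X: "supp_in (vars_in I) X"
  shows "(\<Sum>Q\<in>multisets_of (sum_mset L). Psi {v} (GG (xx v) (yy v) L Q) * Psi I (X * GG x y Q N)) =
    Psi (insert v I) (X * (\<Sum>r\<le>R. hh (\<lambda>m. xx v m * y m) r) * GG (\<lambda>m. x m + xx v m) (\<lambda>m. y m + yy v m) L N)"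
proof -
  let ?S = "sum_mset L" and ?J = "insert v I" and ?f = "GG (xx v) (yy v) L"
  let ?f1 = "\<lambda>Q. if Q \<in> multisets_of ?S then ?f Q else 0"
  have z0: "supp_in (zdeg v 0 0) g" if "supp_in (vars_in I) g" for g
    using that vars_in_zdeg[OF I(2)] by (rule supp_in_mono)
  have f0: "supp_in (zdeg v (int (sum_mset Q) - int ?S) (int (sum_mset Q) - int ?S)) (?f Q)" for Q
    by (rule zdeg_GG) simp_all
  have "(\<Sum>Q\<in>multisets_of ?S. Psi {v} (?f Q) * Psi I (X * GG x y Q N)) =
      (\<Sum>Q\<in>multisets_of ?S. Psi ?J (X * ?f Q * (\<Sum>b\<le>?S. Gm x (Ep y b (dl Q)) N)))"
  proof (rule sum.cong[OF refl])
    fix Q assume "Q \<in> multisets_of ?S"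
    then have Q: "0 \<notin># Q" "sum_mset Q \<le> ?S" by (auto simp: multisets_of_def)
    have "Psi ?J (X * GG x y Q N * ?f Q) = Psi I (X * GG x y Q N) * Psi {v} (?f Q)"
      using I Psi_mult[of I "X * GG x y Q N" "{v}" "?f Q"]
      by (simp add: supp_vars_mult X supp_GG x y)
    then have "Psi {v} (?f Q) * Psi I (X * GG x y Q N) = Psi ?J (X * ?f Q * GG x y Q N)"
      by (simp add: ac_simps)
    then show "Psi {v} (?f Q) * Psi I (X * GG x y Q N) = Psi ?J (X * ?f Q * (\<Sum>b\<le>?S. Gm x (Ep y b (dl Q)) N))"
      by (simp only: GG_eq_sum_Ep[OF Q])
  qed
  also have "\<dots> = (\<Sum>b\<le>?S. Psi ?J (X * (\<Sum>Q\<in>multisets_of ?S. ?f Q * Gm x (Ep y b (dl Q)) N)))"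
    by (simp add: sum_distrib_left Psi_sum mult.assoc) (rule sum.swap)
  also have "\<dots> = (\<Sum>b\<le>?S. Psi ?J (X * Gm x (Ep y b ?f) N))"
  proof (rule sum.cong[OF refl])
    fix b
    have "(\<Sum>Q\<in>multisets_of ?S. ?f Q * dl Q M) = ?f1 M" for M
    proof -
      have "(\<Sum>Q\<in>multisets_of ?S. ?f Q * dl Q M) = (\<Sum>Q\<in>multisets_of ?S. if Q = M then ?f M else 0)"
        by (rule sum.cong) (auto simp: dl_def)
      then show ?thesis by (simp add: finite_multisets_of)
    qed
    then have "(\<Sum>Q\<in>multisets_of ?S. ?f Q * Gm x (Ep y b (dl Q)) N) = Gm x (Ep y b ?f1) N"
      by (simp flip: Gm_mult Ep_mult Gm_sum Ep_sum)
    moreover have "Psi ?J (X * Gm x (Ep y b ?f) N) = Psi ?J (X * Gm x (Ep y b ?f1) N)"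
      unfolding Gm_def Ep_def sum_distrib_left Psi_sum
    proof (intro sum.cong refl)
      fix A B assume A: "A \<in> {A. A \<subseteq># N}" and B: "B \<in> multisets_of b"
      have N0: "0 \<notin># N - A + B" using N B by (auto simp: multisets_of_def dest: in_diffD)
      let ?c = "lconst (zq (N - A + B) (N - A))"
      show "Psi ?J (X * (ee x A * (ee y B * (?c * ?f (N - A + B))))) =
        Psi ?J (X * (ee x A * (ee y B * (?c * ?f1 (N - A + B)))))"
      proof (cases "N - A + B \<in> multisets_of ?S")
        case False
        let ?d = "int (sum_mset (N - A + B)) - int ?S"
        have ne: "?d \<noteq> 0" using False N0 by (simp add: multisets_of_def del: of_nat_sum_mset)
        have "supp_in (zdeg v ?d ?d) (X * (ee x A * (ee y B * (?c * ?f (N - A + B)))))"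
          by (rule supp_zdeg_mult[OF z0[OF X] supp_zdeg_mult[OF z0[OF supp_vars_ee[OF x]]
              supp_zdeg_mult[OF z0[OF supp_vars_ee[OF y]] supp_in_lconst_mult[OF f0]
               order_refl order_refl] order_refl order_refl]]) simp_all
        then have "Psi ?J (X * (ee x A * (ee y B * (?c * ?f (N - A + B))))) = 0"
          by (rule Psi_zdeg) (use ne in linarith)
        then show ?thesis using False by simp
      qed simp
    qed
    ultimately show "Psi ?J (X * (\<Sum>Q\<in>multisets_of ?S. ?f Q * Gm x (Ep y b (dl Q)) N)) =
        Psi ?J (X * Gm x (Ep y b ?f) N)" by simp
  qed
  also have "\<dots> = Psi ?J (X * (\<Sum>b\<le>?S. Gm x (Ep y b ?f) N))"
    by (simp add: sum_distrib_left Psi_sum)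
  also have "\<dots> = Psi ?J (X * (\<Sum>r\<le>R. hh (\<lambda>m. xx v m * y m) r) * GG (\<lambda>m. xx v m + x m) (\<lambda>m. yy v m + y m) L N)"
  proof (rule Psi_GG_compose[OF L N R])
    \<comment> \<open>Here the z_v-degree is at least r - c, which is positive because a + c is at
      most |L| and r + a exceeds |L|.\<close>
    fix r a c :: nat assume "r + a > ?S" "a + c \<le> sum_mset L"
    have xs: "supp_in (zdeg v 0 (int m)) (xx v m + x m)" for m
      by (intro supp_in_add supp_in_mono[OF z0[OF x] zdeg_mono] supp_in_mono[OF supp_xx(2) zdeg_mono]) auto
    have "supp_in (zdeg v (- int c) (- int c)) (Ep (yy v) c (dl L) M)" for M
      using zdeg_Ep[of v 0 0 "dl L" "-1" "yy v" c M] by (simp add: dl_def supp_in_1)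
    then have "supp_in (zdeg v (- int c) (- int c)) (Ep y a (Ep (yy v) c (dl L)) M)" for M
      using zdeg_Ep[of v "- int c" "- int c" "Ep (yy v) c (dl L)" 0 y a M] z0[OF y] by simp
    note T = zdeg_Gm[OF this xs]
    have "supp_in (zdeg v (int m) (int m)) (xx v m * y m)" for m
      by (rule supp_zdeg_mult[OF supp_xx(2) z0[OF y]]) auto
    then have h: "supp_in (zdeg v (int r) (int r)) (hh (\<lambda>m. xx v m * y m) r)"
      using supp_zdeg_hh[of v 1 1 "\<lambda>m. xx v m * y m" r] by simp
    have "supp_in (zdeg v (int r - int c) (int r - int c + int (sum_mset N)))
       (X * (hh (\<lambda>m. xx v m * y m) r * Gm (\<lambda>m. xx v m + x m) (Ep y a (Ep (yy v) c (dl L))) N))"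
      by (rule supp_zdeg_mult[OF z0[OF X] supp_zdeg_mult[OF h T order_refl order_refl]]) simp_all
    then show "Psi ?J (X * (hh (\<lambda>m. xx v m * y m) r * Gm (\<lambda>m. xx v m + x m) (Ep y a (Ep (yy v) c (dl L))) N)) = 0"
      by (rule Psi_zdeg) (use \<open>r + a > ?S\<close> \<open>a + c \<le> sum_mset L\<close> in linarith)
  qed
  also have "(\<lambda>m. xx v m + x m) = (\<lambda>m. x m + xx v m)" by (simp add: add.commute)
  also have "(\<lambda>m. yy v m + y m) = (\<lambda>m. y m + yy v m)" by (simp add: add.commute)
  finally show ?thesis .
qed

section \<open>Expansion into series\<close>

text \<open>A sum of infinitely many nonzero terms counts as 0 in \<open>smult\<close>, so
  identities between products require this finiteness.\<close>

definition fin_conv :: "series \<Rightarrow> series \<Rightarrow> sexpt \<Rightarrow> bool" where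
  "fin_conv f g e \<longleftrightarrow> finite {(d, d'). d + d' = e \<and> f d \<noteq> 0 \<and> g d' \<noteq> 0}"

lemma smult_eq_sum:
  assumes "finite S" "{(d, d'). d + d' = e \<and> f d \<noteq> 0 \<and> g d' \<noteq> 0} \<subseteq> S"
  shows "(f \<star> g) e = (\<Sum>(d, d')\<in>S. if d + d' = e then f d * g d' else 0)"
  unfolding smult_def
  by (rule Sum_any.expand_superset) (use assms in \<open>auto split: if_splits\<close>)

text \<open>Bilinearity is required only on pairs adding up to \<open>e\<close>, which allows
  decompositions that depend on \<open>e\<close>.\<close>

lemma smult_sum_pairs:
  assumes "finite I" "\<And>i. i \<in> I \<Longrightarrow> fin_conv (f i) (g i) e"
    "\<And>d d'. d + d' = e \<Longrightarrow> F d * G d' = (\<Sum>i\<in>I. f i d * g i d')"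
  shows "(F \<star> G) e = (\<Sum>i\<in>I. (f i \<star> g i) e)"
proof -
  let ?S = "\<Union>i\<in>I. {(d, d'). d + d' = e \<and> f i d \<noteq> 0 \<and> g i d' \<noteq> 0}"
  have fin: "finite ?S" using assms(1,2) by (auto simp: fin_conv_def)
  have "(F \<star> G) e = (\<Sum>(d, d')\<in>?S. if d + d' = e then F d * G d' else 0)"
  proof (rule smult_eq_sum[OF fin])
    show "{(d, d'). d + d' = e \<and> F d \<noteq> 0 \<and> G d' \<noteq> 0} \<subseteq> ?S"
    proof clarify
      fix d d' assume *: "e = d + d'" "F d \<noteq> 0" "G d' \<noteq> 0"
      then have "(\<Sum>i\<in>I. f i d * g i d') \<noteq> 0" using assms(3)[of d d'] by (metis no_zero_divisors)
      then obtain i where "i \<in> I" "f i d * g i d' \<noteq> 0" by (meson sum.neutral)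
      then show "(d, d') \<in> (\<Union>i\<in>I. {(c, c'). c + c' = d + d' \<and> f i c \<noteq> 0 \<and> g i c' \<noteq> 0})" by auto
    qed
  qed
  also have "\<dots> = (\<Sum>(d, d')\<in>?S. \<Sum>i\<in>I. if d + d' = e then f i d * g i d' else 0)"
    by (rule sum.cong) (auto simp: assms(3))
  also have "\<dots> = (\<Sum>i\<in>I. \<Sum>(d, d')\<in>?S. if d + d' = e then f i d * g i d' else 0)"
    unfolding case_prod_unfold by (rule sum.swap)
  also have "\<dots> = (\<Sum>i\<in>I. (f i \<star> g i) e)"
    by (rule sum.cong[OF refl], rule smult_eq_sum[symmetric, OF fin]) auto
  finally show ?thesis .
qed

text \<open>The expansion of z^b times the product of the A_i(s_i). An index outside the displayed
  set contributes the constant coefficient of 1, so a finite product suffices.\<close>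

definition smon :: "(nat \<Rightarrow> ratfun fls) \<Rightarrow> (nat \<Rightarrow>\<^sub>0 int) \<Rightarrow> series" where
  "smon A b = (\<lambda>(a, b', l). if b' = b \<and> l = {#}
     then \<Prod>i\<in>{i. A i \<noteq> 1} \<union> keys a. fls_nth (A i) (lookup a i) else 0)"

lemma smon_superset:
  assumes "finite J" "{i. A i \<noteq> 1} \<union> keys a \<subseteq> J"
  shows "smon A b (a, b, {#}) = (\<Prod>i\<in>J. fls_nth (A i) (lookup a i))"
  unfolding smon_def prod.case
  by (simp, rule prod.mono_neutral_left) (use assms in \<open>auto simp: in_keys_iff\<close>)

lemma smon_neq_0D:
  assumes "smon A b e \<noteq> 0" "finite {i. A i \<noteq> 1}"
  shows "\<exists>a. e = (a, b, {#}) \<and> keys a \<subseteq> {i. A i \<noteq> 1} \<and>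
    (\<forall>i. A i \<noteq> 1 \<longrightarrow> fls_subdegree (A i) \<le> lookup a i)"
proof -
  obtain a b' l where e: "e = (a, b', l)" by (cases e)
  have bl: "b' = b" "l = {#}" using assms(1) by (auto simp: e smon_def split: if_splits)
  have fin: "finite ({i. A i \<noteq> 1} \<union> keys a)" using assms(2) by simp
  have nz: "fls_nth (A i) (lookup a i) \<noteq> 0" if "i \<in> {i. A i \<noteq> 1} \<union> keys a" for i
    using assms(1) fin that unfolding e bl smon_def prod.case by (simp add: prod_zero_iff)
  have "keys a \<subseteq> {i. A i \<noteq> 1}"
  proof
    fix i assume i: "i \<in> keys a"
    then show "i \<in> {i. A i \<noteq> 1}" using nz[of i] by (auto simp: in_keys_iff)
  qed
  moreover have "fls_subdegree (A i) \<le> lookup a i" if "A i \<noteq> 1" for i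
    using nz[of i] that by (simp add: fls_subdegree_leI)
  ultimately show ?thesis using e bl by blast
qed

lemma smon_mult:
  assumes finA: "finite {i. A i \<noteq> 1}" and finB: "finite {i. B i \<noteq> 1}"
  shows "smon A b \<star> smon B b' = smon (\<lambda>i. A i * B i) (b + b')" (is ?thesis1)
    and "fin_conv (smon A b) (smon B b') e" (is ?thesis2)
proof -
  have main: "fin_conv (smon A b) (smon B b') e \<and> (smon A b \<star> smon B b') e = smon (\<lambda>i. A i * B i) (b + b') e" for e
  proof -
    obtain a c l where e: "e = (a, c, l)" by (cases e)
    show ?thesis
    proof (cases "c = b + b' \<and> l = {#}")
      case False
      have *: "{(d, d'). d + d' = e \<and> smon A b d \<noteq> 0 \<and> smon B b' d' \<noteq> 0} = {}"
        using False smon_neq_0D[OF _ finA] smon_neq_0D[OF _ finB] unfolding e by fastforce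
      have "(smon A b \<star> smon B b') e = 0"
        by (subst smult_eq_sum[of "{}"]) (simp_all only: *, simp_all)
      moreover have "smon (\<lambda>i. A i * B i) (b + b') e = 0" using False by (auto simp: smon_def e)
      ultimately show ?thesis unfolding fin_conv_def * by simp
    next
      case True
      define J where "J = {i. A i \<noteq> 1} \<union> {i. B i \<noteq> 1} \<union> keys a"
      have J: "finite J" using finA finB by (simp add: J_def)
      \<comment> \<open>The exponent of s_i in the first factor is bounded below by its own
        subdegree and above through the subdegree of the second, so finitely many splittings
        remain.\<close>
      define I where "I i = {fls_subdegree (A i)..lookup a i - fls_subdegree (B i)}" for i
      define pm :: "(nat \<Rightarrow> int) \<Rightarrow> nat \<Rightarrow>\<^sub>0 int" where "pm f = Abs_poly_mapping (\<lambda>i. if i \<in> J then f i else 0)" for f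
      have lookup_pm: "lookup (pm f) i = (if i \<in> J then f i else 0)" for f i
        unfolding pm_def by (subst lookup_Abs_poly_mapping) (use J in auto)
      define q where "q f = ((pm f, b, {#} :: gpartition), (a - pm f, b', {#} :: gpartition))" for f
      have fin: "finite (q ` PiE J I)" using J by (auto simp: I_def intro!: finite_PiE)
      have sub: "{(d, d'). d + d' = e \<and> smon A b d \<noteq> 0 \<and> smon B b' d' \<noteq> 0} \<subseteq> q ` PiE J I"
      proof
        fix x assume x: "x \<in> {(d, d'). d + d' = e \<and> smon A b d \<noteq> 0 \<and> smon B b' d' \<noteq> 0}"
        obtain a1 b1 l1 a2 b2 l2 where xx: "x = ((a1, b1, l1), (a2, b2, l2))" by (metis prod.exhaust)
        from x have s: "(a1, b1, l1) + (a2, b2, l2) = e" and nz: "smon A b (a1, b1, l1) \<noteq> 0" "smon B b' (a2, b2, l2) \<noteq> 0"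
          unfolding xx by auto
        from smon_neq_0D[OF nz(1) finA] have 1: "b1 = b" "l1 = {#}" "keys a1 \<subseteq> {i. A i \<noteq> 1}"
          "\<And>i. A i \<noteq> 1 \<Longrightarrow> fls_subdegree (A i) \<le> lookup a1 i" by auto
        from smon_neq_0D[OF nz(2) finB] have 2: "b2 = b'" "l2 = {#}" "keys a2 \<subseteq> {i. B i \<noteq> 1}"
          "\<And>i. B i \<noteq> 1 \<Longrightarrow> fls_subdegree (B i) \<le> lookup a2 i" by auto
        have a: "a = a1 + a2" using s by (simp add: e)
        have b1: "fls_subdegree (A i) \<le> lookup a1 i" for i
        proof (cases "A i = 1")
          case True
          then have "i \<notin> keys a1" using 1(3) by blast
          then show ?thesis using True by (simp add: in_keys_iff)
        qed (rule 1(4))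
        have b2: "fls_subdegree (B i) \<le> lookup a2 i" for i
        proof (cases "B i = 1")
          case True
          then have "i \<notin> keys a2" using 2(3) by blast
          then show ?thesis using True by (simp add: in_keys_iff)
        qed (rule 2(4))
        define f where "f = restrict (lookup a1) J"
        have "pm f = a1"
        proof (rule poly_mapping_eqI)
          fix i
          have "i \<notin> keys a1" if "i \<notin> J" using that 1(3) by (auto simp: J_def)
          then show "lookup (pm f) i = lookup a1 i"
            by (auto simp: lookup_pm f_def in_keys_iff)
        qed
        then have "((a1, b1, l1), (a2, b2, l2)) = q f" using 1 2 a by (simp add: q_def)
        moreover have "f \<in> PiE J I"
          using b1 b2 by (auto simp: f_def I_def a lookup_add)
        ultimately show "x \<in> q ` PiE J I" unfolding xx by blast
      qed
      have inj: "inj_on q (PiE J I)"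
      proof (rule inj_onI)
        fix f g assume fg: "f \<in> PiE J I" "g \<in> PiE J I" "q f = q g"
        then have "lookup (pm f) i = lookup (pm g) i" for i by (simp add: q_def)
        then show "f = g" by (intro PiE_ext[OF fg(1,2)]) (metis lookup_pm)
      qed
      have "(smon A b \<star> smon B b') e = (\<Sum>(d, d')\<in>q ` PiE J I. if d + d' = e then smon A b d * smon B b' d' else 0)"
        by (rule smult_eq_sum[OF fin sub])
      also have "\<dots> = (\<Sum>f\<in>PiE J I. smon A b (pm f, b, {#}) * smon B b' (a - pm f, b', {#}))"
        by (subst sum.reindex[OF inj], rule sum.cong) (auto simp: q_def e True)
      also have "\<dots> = (\<Sum>f\<in>PiE J I. \<Prod>i\<in>J. fls_nth (A i) (f i) * fls_nth (B i) (lookup a i - f i))"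
      proof (rule sum.cong[OF refl])
        fix f assume "f \<in> PiE J I"
        have "keys (pm f) \<subseteq> J" by (auto simp: in_keys_iff lookup_pm split: if_splits)
        moreover have "keys (a - pm f) \<subseteq> J"
          by (auto simp: in_keys_iff lookup_pm lookup_minus J_def split: if_splits)
        ultimately have "smon A b (pm f, b, {#}) = (\<Prod>i\<in>J. fls_nth (A i) (lookup (pm f) i))"
          "smon B b' (a - pm f, b', {#}) = (\<Prod>i\<in>J. fls_nth (B i) (lookup (a - pm f) i))"
          by (intro smon_superset J; auto simp: J_def)+
        then show "smon A b (pm f, b, {#}) * smon B b' (a - pm f, b', {#}) =
          (\<Prod>i\<in>J. fls_nth (A i) (f i) * fls_nth (B i) (lookup a i - f i))"
          by (simp add: prod.distrib lookup_pm lookup_minus)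
      qed
      also have "\<dots> = (\<Prod>i\<in>J. \<Sum>m\<in>I i. fls_nth (A i) m * fls_nth (B i) (lookup a i - m))"
        by (rule prod_sum_PiE[symmetric]) (use J in \<open>auto simp: I_def\<close>)
      also have "\<dots> = (\<Prod>i\<in>J. fls_nth (A i * B i) (lookup a i))"
        by (simp add: I_def fls_times_nth(2))
      also have "\<dots> = smon (\<lambda>i. A i * B i) (b + b') (a, b + b', {#})"
        by (rule smon_superset[symmetric, OF J]) (auto simp: J_def)
      finally show ?thesis using True finite_subset[OF sub fin] by (simp add: e fin_conv_def)
    qed
  qed
  show ?thesis1 by (rule ext) (use main in blast)
  show ?thesis2 using main by blast
qed

definition eexp :: "ratfun \<Rightarrow> ratfun fls" where "eexp c = fps_to_fls (fps_exp c)"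

lemma eexp_0 [simp]: "eexp 0 = 1" by (simp add: eexp_def)

lemma eexp_add: "eexp (c + d) = eexp c * eexp d"
  by (simp add: eexp_def fps_exp_add_mult fls_times_fps_to_fls)

lemma eexp_inverse: "inverse (eexp c) = eexp (- c)"
  by (rule inverse_unique) (simp add: eexp_add[symmetric])

lemma eexp_power: "eexp c ^ n = eexp (of_nat n * c)"
  by (induction n) (simp_all add: eexp_add[symmetric] distrib_right)

text \<open>\<open>iota A g\<close> is the expansion of \<open>g\<close>, multiplied by \<open>\<Prod>\<^sub>i A\<^sub>i(s\<^sub>i)\<close>.\<close>

definition iota :: "(nat \<Rightarrow> ratfun fls) \<Rightarrow> lring \<Rightarrow> series" where
  "iota A g = (\<lambda>e. \<Sum>p\<in>keys g. lookup g p *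
     smon (\<lambda>i. A i * eexp (lookup (fst p) i)) (snd p) e)"

lemma iota_superset:
  assumes "finite S" "keys g \<subseteq> S"
  shows "iota A g e = (\<Sum>p\<in>S. lookup g p *
     smon (\<lambda>i. A i * eexp (lookup (fst p) i)) (snd p) e)"
  unfolding iota_def by (rule sum.mono_neutral_left) (use assms in \<open>auto simp: in_keys_iff\<close>)

lemma iota_0 [simp]: "iota A 0 e = 0" by (simp add: iota_def)

lemma iota_add: "iota A (g + h) e = iota A g e + iota A h e"
  using keys_add[of g h]
  by (simp add: iota_superset[of "keys g \<union> keys h"] lookup_add
      distrib_right sum.distrib)

lemma iota_uminus: "iota A (- g) e = - iota A g e"
  using iota_add[of A g "- g" e] by (simp add: eq_neg_iff_add_eq_0 add.commute)

lemma iota_diff: "iota A (g - h) e = iota A g e - iota A h e"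
  using iota_add[of A g "- h"] by (simp add: iota_uminus)

lemma iota_sum: "iota A (\<Sum>i\<in>I. g i) e = (\<Sum>i\<in>I. iota A (g i) e)"
  by (induction I rule: infinite_finite_induct) (simp_all add: iota_add)

lemma iota_single: "iota A (single p c) e =
   c * smon (\<lambda>i. A i * eexp (lookup (fst p) i)) (snd p) e"
  by (simp add: iota_def)

lemma iota_lconst_mult: "iota A (lconst c * g) e = c * iota A g e"
proof -
  have "keys (lconst c * g) \<subseteq> keys g" by (auto simp: in_keys_iff)
  then show ?thesis
    by (subst iota_superset[of "keys g"]) (simp_all add: iota_def sum_distrib_left mult.assoc)
qed

lemma iota_neq_0D:
  assumes "iota A g (a, b, l) \<noteq> 0"
  shows "b \<in> snd ` keys g \<and> l = {#}"
proof -
  from assms obtain p where "p \<in> keys g"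
    "lookup g p * smon (\<lambda>i. A i * eexp (lookup (fst p) i)) (snd p) (a, b, l) \<noteq> 0"
    unfolding iota_def by (meson sum.neutral)
  then show ?thesis by (auto simp: smon_def split: if_splits)
qed

lemma finite_eexp_neq_1:
  assumes "finite {i. A i \<noteq> 1}"
  shows "finite {i. A i * eexp (lookup t i) \<noteq> 1}"
proof (rule finite_subset)
  show "{i. A i * eexp (lookup t i) \<noteq> 1} \<subseteq> {i. A i \<noteq> 1} \<union> keys t"
    by (auto simp: in_keys_iff)
qed (use assms in simp)

text \<open>Expansion is multiplicative and its convolutions are finite. Series identities can
  therefore be proved in \<open>lring\<close>, where the ring laws hold.\<close>

lemma iota_mult:
  assumes "finite {i. A i \<noteq> 1}" "finite {i. B i \<noteq> 1}"
  shows "iota A g \<star> iota B h = iota (\<lambda>i. A i * B i) (g * h)"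
    and "fin_conv (iota A g) (iota B h) e"
proof -
  let ?m = "\<lambda>A p. smon (\<lambda>i. A i * eexp (lookup (fst p) i)) (snd p)"
  let ?I = "keys g \<times> keys h"
  have fin: "fin_conv (\<lambda>d. lookup g (fst i) * ?m A (fst i) d) (\<lambda>d. lookup h (snd i) * ?m B (snd i) d) e" for i e
    using smon_mult(2)[OF finite_eexp_neq_1[OF assms(1)] finite_eexp_neq_1[OF assms(2)], where e = e]
    unfolding fin_conv_def by (rule rev_finite_subset) auto
  have expand: "iota A g d * iota B h d' = (\<Sum>i\<in>?I. (lookup g (fst i) * ?m A (fst i) d) *
     (lookup h (snd i) * ?m B (snd i) d'))" for d d'
    unfolding iota_def sum_product sum.cartesian_product by (simp add: case_prod_unfold)
  show "iota A g \<star> iota B h = iota (\<lambda>i. A i * B i) (g * h)"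
  proof
    fix e
    have "(iota A g \<star> iota B h) e = (\<Sum>i\<in>?I. ((\<lambda>d. lookup g (fst i) * ?m A (fst i) d) \<star>
        (\<lambda>d. lookup h (snd i) * ?m B (snd i) d)) e)"
      by (rule smult_sum_pairs[OF _ fin expand]) simp
    also have "\<dots> = (\<Sum>i\<in>?I. lookup g (fst i) * lookup h (snd i) * (?m A (fst i) \<star> ?m B (snd i)) e)"
    proof (rule sum.cong[OF refl])
      fix i
      let ?c = "lookup g (fst i)" and ?d = "lookup h (snd i)"
      let ?S = "{(d, d'). d + d' = e \<and> ?m A (fst i) d \<noteq> 0 \<and> ?m B (snd i) d' \<noteq> 0}"
      have S: "finite ?S" using smon_mult(2)[OF finite_eexp_neq_1[OF assms(1)] finite_eexp_neq_1[OF assms(2)]]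
        unfolding fin_conv_def .
      have "((\<lambda>d. ?c * ?m A (fst i) d) \<star> (\<lambda>d. ?d * ?m B (snd i) d)) e =
          (\<Sum>(d, d')\<in>?S. if d + d' = e then (?c * ?m A (fst i) d) * (?d * ?m B (snd i) d') else 0)"
        by (rule smult_eq_sum[OF S]) auto
      also have "\<dots> = ?c * ?d * (\<Sum>(d, d')\<in>?S. if d + d' = e then ?m A (fst i) d * ?m B (snd i) d' else 0)"
        unfolding sum_distrib_left by (rule sum.cong) auto
      also have "(\<Sum>(d, d')\<in>?S. if d + d' = e then ?m A (fst i) d * ?m B (snd i) d' else 0) = (?m A (fst i) \<star> ?m B (snd i)) e"
        by (rule smult_eq_sum[OF S order_refl, symmetric])
      finally show "((\<lambda>d. ?c * ?m A (fst i) d) \<star> (\<lambda>d. ?d * ?m B (snd i) d)) e = ?c * ?d * (?m A (fst i) \<star> ?m B (snd i)) e" .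
    qed
    also have "\<dots> = (\<Sum>p\<in>keys g. \<Sum>q\<in>keys h. lookup g p * lookup h q *
        ?m (\<lambda>i. A i * B i) (p + q) e)"
      unfolding smon_mult(1)[OF finite_eexp_neq_1[OF assms(1)] finite_eexp_neq_1[OF assms(2)]]
      by (simp add: sum.cartesian_product case_prod_unfold lookup_add eexp_add ac_simps)
    also have "\<dots> = iota (\<lambda>i. A i * B i) (g * h) e"
      by (subst lring_mult_eq_sum) (simp add: iota_sum iota_single)
    finally show "(iota A g \<star> iota B h) e = iota (\<lambda>i. A i * B i) (g * h) e" .
  qed
  show "fin_conv (iota A g) (iota B h) e"
    unfolding fin_conv_def
  proof (rule finite_subset)
    show "{(d, d'). d + d' = e \<and> iota A g d \<noteq> 0 \<and> iota B h d' \<noteq> 0} \<subseteq>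
      (\<Union>i\<in>?I. {(d, d'). d + d' = e \<and> lookup g (fst i) * ?m A (fst i) d \<noteq> 0 \<and>
         lookup h (snd i) * ?m B (snd i) d' \<noteq> 0})"
    proof clarify
      fix d d' assume *: "e = d + d'" "iota A g d \<noteq> 0" "iota B h d' \<noteq> 0"
      then have "iota A g d * iota B h d' \<noteq> 0" by simp
      then obtain i where "i \<in> ?I" "(lookup g (fst i) * ?m A (fst i) d) *
     (lookup h (snd i) * ?m B (snd i) d') \<noteq> 0" unfolding expand by (meson sum.neutral)
      then show "(d, d') \<in> (\<Union>i\<in>?I. {(c, c'). c + c' = d + d' \<and> lookup g (fst i) * ?m A (fst i) c \<noteq> 0 \<and>
         lookup h (snd i) * ?m B (snd i) c' \<noteq> 0})" by (intro UN_I[of i]) auto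
    qed
    show "finite (\<Union>i\<in>?I. {(d, d'). d + d' = e \<and> lookup g (fst i) * ?m A (fst i) d \<noteq> 0 \<and>
         lookup h (snd i) * ?m B (snd i) d' \<noteq> 0})"
      using fin unfolding fin_conv_def by (intro finite_UN_I) auto
  qed
qed

lemmas iota_mult_1 = iota_mult[of "\<lambda>_. 1" "\<lambda>_. 1", simplified]

text \<open>\<open>gser A \<phi>\<close> is the expansion of \<open>\<Sum>\<^sub>l \<phi>\<^sub>l \<aa>\<^sub>l\<close>.\<close>

definition gser :: "(nat \<Rightarrow> ratfun fls) \<Rightarrow> (gpartition \<Rightarrow> lring) \<Rightarrow> series" where
  "gser A \<phi> = (\<lambda>(a, b, l). iota A (\<phi> l) (a, b, {#}))"

definition mconv :: "(gpartition \<Rightarrow> lring) \<Rightarrow> (gpartition \<Rightarrow> lring) \<Rightarrow> gpartition \<Rightarrow> lring" where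
  "mconv \<phi> \<phi>' l = (\<Sum>l1 | l1 \<subseteq># l. \<phi> l1 * \<phi>' (l - l1))"

text \<open>For fixed \<open>l\<close> only the finitely many splittings of \<open>l\<close> matter,
  and each slice reduces to \<open>iota_mult\<close>.\<close>

lemma gser_mult:
  assumes fA: "finite {i. A i \<noteq> 1}" and fB: "finite {i. B i \<noteq> 1}"
  shows "gser A \<phi> \<star> gser B \<phi>' = gser (\<lambda>i. A i * B i) (mconv \<phi> \<phi>')"
proof
  fix e :: "sexpt"
  obtain a b l where e: "e = (a, b, l)" by (cases e)
  let ?L = "{l1. l1 \<subseteq># l}"
  define f where "f l1 = (\<lambda>(a, b, l'). if l' = l1 then iota A (\<phi> l1) (a, b, {#}) else 0)" for l1
  define g where "g l1 = (\<lambda>(a, b, l'). if l' = l - l1 then iota B (\<phi>' (l - l1)) (a, b, {#}) else 0)" for l1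
  define S where "S l1 = {(d, d'). d + d' = (a, b, {#}) \<and> iota A (\<phi> l1) d \<noteq> 0 \<and> iota B (\<phi>' (l - l1)) d' \<noteq> 0}" for l1
  have finS: "finite (S l1)" for l1
    using iota_mult(2)[OF fA fB, of "\<phi> l1" "\<phi>' (l - l1)" "(a, b, {#})"] unfolding fin_conv_def S_def .
  have sub: "{(d, d'). d + d' = e \<and> f l1 d \<noteq> 0 \<and> g l1 d' \<noteq> 0} \<subseteq>
      (\<lambda>((a1, b1, k1), (a2, b2, k2)). ((a1, b1, l1), (a2, b2, l - l1))) ` S l1" for l1
  proof
    fix x assume x: "x \<in> {(d, d'). d + d' = e \<and> f l1 d \<noteq> 0 \<and> g l1 d' \<noteq> 0}"
    obtain a1 b1 k1 a2 b2 k2 where xx: "x = ((a1, b1, k1), (a2, b2, k2))" by (metis prod.exhaust)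
    from x have "k1 = l1" "k2 = l - l1" "((a1, b1, {#}), (a2, b2, {#})) \<in> S l1"
      by (auto simp: xx f_def g_def S_def e split: if_splits)
    then show "x \<in> (\<lambda>((a1, b1, k1), (a2, b2, k2)). ((a1, b1, l1), (a2, b2, l - l1))) ` S l1"
      unfolding xx by force
  qed
  have fin: "fin_conv (f l1) (g l1) e" for l1
    unfolding fin_conv_def by (rule finite_subset[OF sub]) (use finS in simp)
  have slice: "(f l1 \<star> g l1) e = (iota A (\<phi> l1) \<star> iota B (\<phi>' (l - l1))) (a, b, {#})" if l1: "l1 \<subseteq># l" for l1
  proof -
    let ?q = "\<lambda>((a1, b1, k1), (a2, b2, k2)). ((a1, b1, l1), (a2, b2, l - l1))"
    have inj: "inj_on ?q (S l1)"
      by (rule inj_onI) (auto simp: S_def dest!: iota_neq_0D)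
    have "(f l1 \<star> g l1) e = (\<Sum>(d, d')\<in>?q ` S l1. if d + d' = e then f l1 d * g l1 d' else 0)"
      by (rule smult_eq_sum[OF _ sub]) (use finS in simp)
    also have "\<dots> = (\<Sum>(d, d')\<in>S l1. if d + d' = (a, b, {#}) then iota A (\<phi> l1) d * iota B (\<phi>' (l - l1)) d' else 0)"
      by (subst sum.reindex[OF inj], rule sum.cong)
        (use l1 in \<open>auto simp: S_def f_def g_def e dest!: iota_neq_0D\<close>)
    also have "\<dots> = (iota A (\<phi> l1) \<star> iota B (\<phi>' (l - l1))) (a, b, {#})"
      by (rule smult_eq_sum[symmetric, OF finS]) (auto simp: S_def)
    finally show ?thesis .
  qed
  have "(gser A \<phi> \<star> gser B \<phi>') e = (\<Sum>l1\<in>?L. (f l1 \<star> g l1) e)"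
  proof (rule smult_sum_pairs[OF finite_submultisets fin])
    fix d d' assume dd: "d + d' = e"
    obtain a1 b1 k1 a2 b2 k2 where d: "d = (a1, b1, k1)" "d' = (a2, b2, k2)" by (cases d, cases d')
    have k: "k1 + k2 = l" using dd by (simp add: d e)
    have "(\<Sum>l1\<in>?L. f l1 d * g l1 d') = (\<Sum>l1\<in>?L. if l1 = k1 then gser A \<phi> d * gser B \<phi>' d' else 0)"
      by (rule sum.cong) (use k in \<open>auto simp: f_def g_def d gser_def\<close>)
    also have "\<dots> = gser A \<phi> d * gser B \<phi>' d'"
      using k by (simp add: finite_submultisets) (auto simp: subset_mset.le_iff_add)
    finally show "gser A \<phi> d * gser B \<phi>' d' = (\<Sum>l1\<in>?L. f l1 d * g l1 d')" ..
  qed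
  also have "\<dots> = (\<Sum>l1\<in>?L. iota (\<lambda>i. A i * B i) (\<phi> l1 * \<phi>' (l - l1)) (a, b, {#}))"
    by (rule sum.cong) (simp_all add: slice iota_mult(1)[OF fA fB])
  also have "\<dots> = gser (\<lambda>i. A i * B i) (mconv \<phi> \<phi>') e"
    by (simp add: gser_def e mconv_def iota_sum)
  finally show "(gser A \<phi> \<star> gser B \<phi>') e = gser (\<lambda>i. A i * B i) (mconv \<phi> \<phi>') e" .
qed

lemma iota_eq_gser: "iota A g = gser A (\<lambda>l. if l = {#} then g else 0)"
  by (rule ext) (use iota_neq_0D in \<open>fastforce simp: gser_def\<close>)

lemma mconv_empty_left: "mconv (\<lambda>l. if l = {#} then g else 0) \<phi> l = g * \<phi> l"
proof -
  have "mconv (\<lambda>l. if l = {#} then g else 0) \<phi> l = (\<Sum>l1 | l1 \<subseteq># l. if l1 = {#} then g * \<phi> l else 0)"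
    unfolding mconv_def by (rule sum.cong) auto
  then show ?thesis by (simp add: finite_submultisets)
qed

text \<open>\<open>dser v s H\<close> is the expansion of \<open>\<Sum>\<^sub>r H\<^sub>r\<close>, where \<open>H\<^sub>r\<close> is homogeneous of degree \<open>s r\<close> with
  respect to \<open>z\<^sub>v\<close>.\<close>

definition dser :: "nat \<Rightarrow> int \<Rightarrow> (nat \<Rightarrow> lring) \<Rightarrow> series" where
  "dser v s H = (\<lambda>(a, b, l). if s * lookup b v \<ge> 0
     then iota (\<lambda>_. 1) (H (nat (s * lookup b v))) (a, b, l) else 0)"

definition homog :: "nat \<Rightarrow> int \<Rightarrow> (nat \<Rightarrow> lring) \<Rightarrow> bool" where
  "homog v s H \<longleftrightarrow> (s = 1 \<or> s = -1) \<and> (\<forall>r. supp_in (zdeg v (s * int r) (s * int r)) (H r))"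

lemma homog_iota_neq_0D:
  assumes "homog v s H" "iota A (H r) (a, b, l) \<noteq> 0"
  shows "s * lookup b v = int r"
proof -
  from iota_neq_0D[OF assms(2)] obtain p where "p \<in> keys (H r)" "b = snd p" by blast
  then have "lookup b v = s * int r"
    using assms(1) by (fastforce simp: homog_def supp_in_def zdeg_def)
  then show ?thesis using assms(1) by (auto simp: homog_def)
qed

text \<open>The z_v-degrees of both factors have one sign, so a given degree splits in finitely many
  ways.\<close>

lemma dser_mult:
  assumes H: "homog v s H" and H': "homog v s H'"
  shows "dser v s H \<star> dser v s H' = dser v s (\<lambda>r. \<Sum>q\<le>r. H q * H' (r - q))"
proof
  fix e :: "sexpt"
  obtain a b l where e: "e = (a, b, l)" by (cases e)
  let ?t = "s * lookup b v"
  define r where "r = nat ?t"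
  let ?i = "iota (\<lambda>_. 1)"
  let ?Q = "if ?t \<ge> 0 then {..r} else {}"
  have "(dser v s H \<star> dser v s H') e = (\<Sum>q\<in>?Q. (?i (H q) \<star> ?i (H' (r - q))) e)"
  proof (rule smult_sum_pairs)
    fix d d' assume dd: "d + d' = e"
    obtain a1 b1 k1 a2 b2 k2 where d: "d = (a1, b1, k1)" "d' = (a2, b2, k2)" by (cases d, cases d')
    have b: "b = b1 + b2" using dd by (simp add: d e)
    let ?t1 = "s * lookup b1 v" and ?t2 = "s * lookup b2 v"
    have t: "?t = ?t1 + ?t2" by (simp add: b lookup_add distrib_left)
    have zero: "?i (H q) d * ?i (H' (r - q)) d' = 0" if "\<not> (?t1 = int q \<and> ?t2 = int (r - q))" for q
      using that homog_iota_neq_0D[OF H, of _ q a1 b1 k1] homog_iota_neq_0D[OF H', of _ "r - q" a2 b2 k2] by (auto simp: d)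
    show "dser v s H d * dser v s H' d' = (\<Sum>q\<in>?Q. ?i (H q) d * ?i (H' (r - q)) d')"
    proof (cases "?t1 \<ge> 0 \<and> ?t2 \<ge> 0")
      case True
      have q: "nat ?t1 \<in> ?Q" "r - nat ?t1 = nat ?t2" using True t by (auto simp: r_def)
      have "(\<Sum>q\<in>?Q. ?i (H q) d * ?i (H' (r - q)) d') =
        (\<Sum>q\<in>?Q. if q = nat ?t1 then ?i (H (nat ?t1)) d * ?i (H' (nat ?t2)) d' else 0)"
        by (rule sum.cong[OF refl]) (use q(2) zero True in auto)
      also have "\<dots> = ?i (H (nat ?t1)) d * ?i (H' (nat ?t2)) d'" using q(1) by (subst sum.delta) (auto split: if_splits)
      finally show ?thesis using True by (simp add: dser_def d)
    next
      case False
      then have "dser v s H d * dser v s H' d' = 0" by (auto simp: dser_def d)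
      moreover have "(\<Sum>q\<in>?Q. ?i (H q) d * ?i (H' (r - q)) d') = 0"
        by (rule sum.neutral, rule ballI, rule zero) (use False in auto)
      ultimately show ?thesis by simp
    qed
  qed (auto intro: iota_mult_1)
  also have "\<dots> = dser v s (\<lambda>r. \<Sum>q\<le>r. H q * H' (r - q)) e"
    by (simp add: iota_mult_1 dser_def e r_def iota_sum)
  finally show "(dser v s H \<star> dser v s H') e = dser v s (\<lambda>r. \<Sum>q\<le>r. H q * H' (r - q)) e" .
qed

section \<open>Approximation by polynomials\<close>

text \<open>The threshold depends on (b, l) but not on the s-exponents \<open>a\<close>: a
  coefficient of a product may involve infinitely many values of \<open>a\<close>, but in the cases
  below only finitely many pairs of z-exponents and symbols.\<close>

definition approx :: "series \<Rightarrow> (nat \<Rightarrow> series) \<Rightarrow> bool" where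
  "approx F FM \<longleftrightarrow> (\<forall>b l. \<exists>M0. \<forall>M\<ge>M0. \<forall>a. F (a, b, l) = FM M (a, b, l))"

lemma approx_const: "approx F (\<lambda>_. F)" by (auto simp: approx_def)

text \<open>With \<open>U\<close> and \<open>W\<close> containing all supports, finitely many
  thresholds matter for each coefficient of the product, and their maximum works.\<close>

lemma approx_mult:
  assumes F: "approx F FM" and G: "approx G GM"
    and U: "\<And>a b l. F (a, b, l) \<noteq> 0 \<Longrightarrow> (b, l) \<in> U" "\<And>M a b l. FM M (a, b, l) \<noteq> 0 \<Longrightarrow> (b, l) \<in> U"
    and W: "\<And>a b l. G (a, b, l) \<noteq> 0 \<Longrightarrow> (b, l) \<in> W" "\<And>M a b l. GM M (a, b, l) \<noteq> 0 \<Longrightarrow> (b, l) \<in> W"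
    and fin: "\<And>q. finite {(p, p'). p \<in> U \<and> p' \<in> W \<and> p + p' = q}"
  shows "approx (F \<star> G) (\<lambda>M. FM M \<star> GM M)"
  unfolding approx_def
proof (intro allI)
  fix b l
  let ?Q = "{(p, p'). p \<in> U \<and> p' \<in> W \<and> p + p' = (b, l)}"
  from F obtain m1 where m1: "\<And>b l M a. M \<ge> m1 b l \<Longrightarrow> F (a, b, l) = FM M (a, b, l)"
    unfolding approx_def by metis
  from G obtain m2 where m2: "\<And>b l M a. M \<ge> m2 b l \<Longrightarrow> G (a, b, l) = GM M (a, b, l)"
    unfolding approx_def by metis
  define M0 where "M0 = Max (insert 0 ((\<lambda>((b1, l1), (b2, l2)). max (m1 b1 l1) (m2 b2 l2)) ` ?Q))"
  show "\<exists>M0. \<forall>M\<ge>M0. \<forall>a. (F \<star> G) (a, b, l) = (FM M \<star> GM M) (a, b, l)"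
  proof (intro exI allI impI)
    fix M a assume M: "M \<ge> M0"
    have eq: "F d * G d' = FM M d * GM M d'" if dd: "d + d' = (a, b, l)" for d d'
    proof -
      obtain a1 b1 k1 a2 b2 k2 where d: "d = (a1, b1, k1)" "d' = (a2, b2, k2)" by (cases d, cases d')
      show ?thesis
      proof (cases "(b1, k1) \<in> U \<and> (b2, k2) \<in> W")
        case True
        then have "((b1, k1), (b2, k2)) \<in> ?Q" using dd by (simp add: d)
        then have "max (m1 b1 k1) (m2 b2 k2) \<le> M0"
          unfolding M0_def using fin[of "(b, l)"] by (intro Max_ge) (auto intro!: image_eqI)
        then show ?thesis using M m1[of b1 k1 M] m2[of b2 k2 M] by (simp add: d)
      next
        case False
        then show ?thesis using U W unfolding d by (metis mult_zero_left mult_zero_right)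
      qed
    qed
    have "(\<lambda>(d, d'). if d + d' = (a, b, l) then F d * G d' else 0) =
      (\<lambda>(d, d'). if d + d' = (a, b, l) then FM M d * GM M d' else 0)"
      using eq by (auto simp: fun_eq_iff)
    then show "(F \<star> G) (a, b, l) = (FM M \<star> GM M) (a, b, l)" by (simp only: smult_def)
  qed
qed

lemma gser_neq_0D: "gser A \<phi> (a, b, l) \<noteq> 0 \<Longrightarrow> b \<in> snd ` keys (\<phi> l)"
  by (auto simp: gser_def dest: iota_neq_0D)

text \<open>Each of the finitely many submultisets of \<open>l\<close> carries a polynomial, which
  has finitely many z-exponents.\<close>

lemma finite_gser_pairs:
  "finite {(p, p'). p \<in> UNIV \<and> p' \<in> {(b, l). b \<in> snd ` keys (\<phi> l)} \<and> p + p' = (q :: (nat \<Rightarrow>\<^sub>0 int) \<times> gpartition)}"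
proof -
  obtain b l where q: "q = (b, l)" by (cases q)
  let ?T = "SIGMA l':{l'. l' \<subseteq># l}. snd ` keys (\<phi> l')"
  have "{(p, p'). p \<in> UNIV \<and> p' \<in> {(b, l). b \<in> snd ` keys (\<phi> l)} \<and> p + p' = q} \<subseteq>
      (\<lambda>(l', b'). ((b - b', l - l'), (b', l'))) ` ?T"
  proof
    fix x assume x: "x \<in> {(p, p'). p \<in> UNIV \<and> p' \<in> {(b, l). b \<in> snd ` keys (\<phi> l)} \<and> p + p' = q}"
    obtain b1 l1 b2 l2 where xx: "x = ((b1, l1), (b2, l2))" by (metis prod.exhaust)
    from x have "x = (\<lambda>(l', b'). ((b - b', l - l'), (b', l'))) (l2, b2)" "(l2, b2) \<in> ?T"
      by (auto simp: q xx)
    then show "x \<in> (\<lambda>(l', b'). ((b - b', l - l'), (b', l'))) ` ?T" by (rule image_eqI)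
  qed
  moreover have "finite ?T" by (auto intro: finite_submultisets)
  ultimately show ?thesis by (meson finite_imageI finite_subset)
qed

lemma finite_swap_pairs:
  assumes "finite {(p, p'). p \<in> A \<and> p' \<in> B \<and> p + p' = (q :: 'a::ab_semigroup_add)}"
  shows "finite {(p, p'). p \<in> B \<and> p' \<in> A \<and> p + p' = q}"
proof (rule finite_subset)
  show "{(p, p'). p \<in> B \<and> p' \<in> A \<and> p + p' = q} \<subseteq> prod.swap ` {(p, p'). p \<in> A \<and> p' \<in> B \<and> p + p' = q}"
    by (auto simp: image_def add.commute)
qed (use assms in simp)

lemma approx_mult_gser:
  assumes "approx F FM"
  shows "approx (F \<star> gser A \<phi>) (\<lambda>M. FM M \<star> gser A \<phi>)"
  by (rule approx_mult[OF assms approx_const, where U = UNIV and W = "{(b, l). b \<in> snd ` keys (\<phi> l)}"])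
     (use gser_neq_0D finite_gser_pairs[of \<phi>] in auto)

lemma approx_gser_mult:
  assumes "approx F FM"
  shows "approx (gser A \<phi> \<star> F) (\<lambda>M. gser A \<phi> \<star> FM M)"
  by (rule approx_mult[OF approx_const assms, where U = "{(b, l). b \<in> snd ` keys (\<phi> l)}" and W = UNIV])
     (use gser_neq_0D finite_swap_pairs[OF finite_gser_pairs[of \<phi>]] in auto)

lemma approx_diff:
  assumes "approx F FM" "approx G GM"
  shows "approx (F - G) (\<lambda>M. FM M - GM M)"
  unfolding approx_def
proof (intro allI)
  fix b l
  obtain m1 m2 where m: "\<And>M a. M \<ge> m1 \<Longrightarrow> F (a, b, l) = FM M (a, b, l)" "\<And>M a. M \<ge> m2 \<Longrightarrow> G (a, b, l) = GM M (a, b, l)"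
    using assms unfolding approx_def by meson
  show "\<exists>M0. \<forall>M\<ge>M0. \<forall>a. (F - G) (a, b, l) = (FM M - GM M) (a, b, l)"
  proof (intro exI allI impI)
    fix M a assume "M \<ge> max m1 m2"
    then show "(F - G) (a, b, l) = (FM M - GM M) (a, b, l)"
      using m(1)[of M a] m(2)[of M a] by (simp only: minus_apply max.bounded_iff)
  qed
qed

text \<open>Homogeneity leaves at most one summand for each z-exponent, so a truncation beyond that
  degree is exact.\<close>

lemma approx_dser:
  assumes "homog v s H"
  shows "approx (dser v s H) (\<lambda>M. iota (\<lambda>_. 1) (\<Sum>r\<le>M. H r))"
  unfolding approx_def
proof (intro allI exI impI)
  fix b l M a assume M: "nat (s * lookup b v) \<le> M"
  let ?t = "s * lookup b v"
  have "iota (\<lambda>_. 1) (\<Sum>r\<le>M. H r) (a, b, l) = (\<Sum>r\<le>M. if r = nat ?t then dser v s H (a, b, l) else 0)"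
    unfolding iota_sum
  proof (rule sum.cong[OF refl])
    fix r
    show "iota (\<lambda>_. 1) (H r) (a, b, l) = (if r = nat ?t then dser v s H (a, b, l) else 0)"
    proof (cases "?t = int r")
      case True
      then show ?thesis by (simp add: dser_def)
    next
      case False
      then have "iota (\<lambda>_. 1) (H r) (a, b, l) = 0" using homog_iota_neq_0D[OF assms, of "\<lambda>_. 1" r a b l] by blast
      moreover have "dser v s H (a, b, l) = 0" if "r = nat ?t"
      proof -
        have "\<not> ?t \<ge> 0" using that False by auto
        then show ?thesis by (simp add: dser_def)
      qed
      ultimately show ?thesis by simp
    qed
  qed
  also have "\<dots> = dser v s H (a, b, l)" using M by simp
  finally show "dser v s H (a, b, l) = iota (\<lambda>_. 1) (\<Sum>r\<le>M. H r) (a, b, l)" ..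
qed

lemma in_s_eq: "in_s i A = iota (\<lambda>j. if j = i then A else 1) 1"
proof
  fix e :: "sexpt"
  obtain a b l where e: "e = (a, b, l)" by (cases e)
  let ?A = "\<lambda>j. if j = i then A else 1"
  have "iota ?A 1 e = smon ?A 0 e"
    using iota_single[of ?A 0 1 e] by simp
  also have "\<dots> = in_s i A e"
  proof (cases "b = 0 \<and> l = {#}")
    case True
    have fin: "finite (insert i (keys a))" by simp
    have "smon ?A 0 (a, 0, {#}) = (\<Prod>j\<in>insert i (keys a). fls_nth (?A j) (lookup a j))"
      by (rule smon_superset) auto
    also have "\<dots> = fls_nth A (lookup a i) * (\<Prod>j\<in>keys a - {i}. 0)"
      by (subst prod.insert_remove[OF finite_keys], rule arg_cong2[of _ _ _ _ "(*)"], simp, rule prod.cong) (auto simp: in_keys_iff)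
    also have "\<dots> = in_s i A (a, 0, {#})"
    proof (cases "keys a \<subseteq> {i}")
      case True
      then have "keys a - {i} = {}" by auto
      then show ?thesis using True by (simp only: prod.empty) (simp add: in_s_def)
    next
      case False
      then have "keys a - {i} \<noteq> {}" by auto
      then show ?thesis using False by (simp add: in_s_def card_gt_0_iff)
    qed
    finally show ?thesis using True by (simp add: e)
  qed (auto simp: smon_def in_s_def e)
  finally show "in_s i A e = iota ?A 1 e" ..
qed

lemma in_s_const_eexp: "in_s i (fls_const d * eexp c) = iota (\<lambda>_. 1) (single (single i c, 0) d)"
proof
  fix e :: "sexpt"
  have fn: "(\<lambda>j. 1 * eexp (lookup (single i c) j)) = (\<lambda>j. if j = i then eexp c else 1)"
    by (auto simp: fun_eq_iff lookup_single when_def)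
  have "in_s i (fls_const d * eexp c) e = d * in_s i (eexp c) e"
    by (cases e) (simp add: in_s_def)
  also have "\<dots> = d * smon (\<lambda>j. if j = i then eexp c else 1) 0 e"
    unfolding in_s_eq using iota_single[of "\<lambda>j. if j = i then eexp c else 1" 0 1 e] by simp
  also have "\<dots> = iota (\<lambda>_. 1) (single (single i c, 0) d) e"
    unfolding iota_single fst_conv snd_conv fn ..
  finally show "in_s i (fls_const d * eexp c) e = iota (\<lambda>_. 1) (single (single i c, 0) d) e" .
qed

lemma in_s_eexp: "in_s i (eexp c) = iota (\<lambda>_. 1) (single (single i c, 0) 1)"
  using in_s_const_eexp[of i 1 c] by simp

lemma smon_1_eq: "smon (\<lambda>_. 1) b = smonom (0, b, {#})"
proof
  fix e :: "sexpt"
  obtain a b' l where e: "e = (a, b', l)" by (cases e)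
  have "(\<Prod>i\<in>keys a. fls_nth (1 :: ratfun fls) (lookup a i)) = (\<Prod>i\<in>keys a. 0)"
    by (rule prod.cong) (auto simp: in_keys_iff)
  also have "\<dots> = (if a = 0 then 1 else 0)"
    by (simp add: card_gt_0_iff)
  finally show "smon (\<lambda>_. 1) b e = smonom (0, b, {#}) e"
    by (auto simp: smon_def smonom_def e)
qed

lemma zpow_eq: "zpow i m = iota (\<lambda>_. 1) (single (0, single i m) 1)"
  by (rule ext) (simp add: iota_single smon_1_eq zpow_def)

lemma sone_eq: "sone = iota (\<lambda>_. 1) 1"
proof
  fix e
  have 0: "(0 :: sexpt) = (0, 0, {#})" by (simp add: zero_prod_def)
  show "sone e = iota (\<lambda>_. 1) 1 e"
    using iota_single[of "\<lambda>_. 1" 0 1 e] by (simp add: smon_1_eq 0)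
qed

lemma asym_eq: "asym m = gser (\<lambda>_. 1) (\<lambda>l. if l = {#m#} then 1 else 0)"
proof
  fix e :: "sexpt"
  obtain a b l where e: "e = (a, b, l)" by (cases e)
  show "asym m e = gser (\<lambda>_. 1) (\<lambda>l. if l = {#m#} then 1 else 0) e"
    using sone_eq[THEN fun_cong, of "(a, b, {#})"] by (auto simp: asym_def gser_def e smonom_def zero_prod_def)
qed

lemma Q_ser_eq: "Q_ser = eexp jalpha" and T_ser_eq: "T_ser = eexp 1"
  by (simp_all add: Q_ser_def T_ser_def eexp_def)

subsection \<open>The functions f\<close>

text \<open>On the function 1/z_A, which represents exp (sum p_m / m), \<open>Ep\<close> acts by the
  scalars \<open>hh\<close>; the exponential law for \<open>Ep\<close> then gives the one for
  \<open>hh\<close>.\<close>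

lemma hh_add: "hh (\<lambda>m. w m + w' m) r = (\<Sum>q\<le>r. hh w q * hh w' (r - q))"
proof -
  define f :: lfun where "f A = lconst (1 / of_nat (zmset A))" for A
  have 1: "Ep y d f A = lconst (1 / of_nat (zmset A)) * hh y d" if "0 \<notin># A" for y d A
    unfolding Ep_def hh_def sum_distrib_left
  proof (rule sum.cong[OF refl])
    fix B assume "B \<in> multisets_of d"
    then have "zmset (A + B) > 0" using that by (intro zmset_pos) (auto simp: multisets_of_def)
    then have "lconst (zq (A + B) A) * f (A + B) = lconst (1 / of_nat (zmset A))"
      unfolding f_def lconst_mult[symmetric] by simp
    then show "ee y B * (lconst (zq (A + B) A) * f (A + B)) = lconst (1 / of_nat (zmset A)) * ee y B"
      by (simp only: mult.commute)
  qed
  have "Ep w c (Ep w' d f) {#} = hh w' d * Ep w c f {#}" for c d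
  proof -
    have "Ep w c (Ep w' d f) {#} = Ep w c (\<lambda>A. hh w' d * f A) {#}"
      by (rule Ep_cong) (auto simp: 1 f_def)
    then show ?thesis by (simp add: Ep_mult)
  qed
  then have "(\<Sum>q\<le>r. hh w q * hh w' (r - q)) = (\<Sum>q\<le>r. Ep w q (Ep w' (r - q) f) {#})"
    by (simp add: 1 mult.commute)
  also have "\<dots> = hh (\<lambda>m. w m + w' m) r" by (simp add: Ep_Ep 1)
  finally show ?thesis ..
qed

text \<open>exp (sum (g X)^m / m) is 1/(1 - g X), and the opposite sign below gives 1 - g X. So
  denominators and numerators of the f_ij become exponentials.\<close>

lemma hh_power: "hh (\<lambda>m. g ^ m) r = g ^ r"
proof (rule hh_uniqueI)
  fix r :: nat
  have "(\<Sum>m=1..r. g ^ m * g ^ (r - m)) = (\<Sum>m=1..r. g ^ r)"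
    by (rule sum.cong) (auto simp flip: power_add)
  then show "of_nat r * g ^ r = (\<Sum>m=1..r. g ^ m * g ^ (r - m))" by simp
qed simp

lemma hh_uminus_power: "hh (\<lambda>m. - (g ^ m)) r = (if r = 0 then 1 else if r = 1 then - g else 0)"
proof (rule hh_uniqueI)
  fix r :: nat assume r: "r > 0"
  let ?h = "\<lambda>r. if r = 0 then 1 else if r = 1 then - g else 0"
  show "of_nat r * ?h r = (\<Sum>m=1..r. - (g ^ m) * ?h (r - m))"
  proof (cases "r = 1")
    case False
    with r obtain t where t: "r = Suc (Suc t)" by (metis One_nat_def not0_implies_Suc not_gr0)
    have "(\<Sum>m=1..r. - (g ^ m) * ?h (r - m)) = (\<Sum>m\<in>{Suc t, r}. - (g ^ m) * ?h (r - m))"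
      by (rule sum.mono_neutral_right) (auto simp: t)
    then show ?thesis by (simp add: t)
  qed simp
qed simp

lemma homog_hh:
  assumes "s = 1 \<or> s = -1" "\<And>m. supp_in (zdeg v (s * int m) (s * int m)) (w m)"
  shows "homog v s (hh w)"
  unfolding homog_def using supp_zdeg_hh[of v s s w] assms by blast

lemma dser_hh_mult:
  assumes "s = 1 \<or> s = -1" "\<And>m. supp_in (zdeg v (s * int m) (s * int m)) (w m)"
    "\<And>m. supp_in (zdeg v (s * int m) (s * int m)) (w' m)"
  shows "dser v s (hh w) \<star> dser v s (hh w') = dser v s (hh (\<lambda>m. w m + w' m))"
  unfolding dser_mult[OF homog_hh[OF assms(1,2)] homog_hh[OF assms(1,3)]] hh_add[abs_def] ..

lemma zdeg_power:
  assumes "supp_in (zdeg v s s) g"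
  shows "supp_in (zdeg v (s * int m) (s * int m)) (g ^ m)"
proof (induction m)
  case (Suc m)
  show ?case unfolding power_Suc by (rule supp_zdeg_mult[OF assms Suc]) (simp_all add: algebra_simps)
qed (simp add: supp_in_1)

lemma spow_iota: "spow (iota (\<lambda>_. 1) g) m = iota (\<lambda>_. 1) (g ^ m)"
  by (induction m) (simp_all add: sone_eq iota_mult_1)

lemma sgeom_eq:
  assumes s: "s = 1 \<or> s = -1" and g: "supp_in (zdeg v s s) g"
  shows "sgeom (iota (\<lambda>_. 1) g) = dser v s (hh (\<lambda>m. g ^ m))"
proof
  fix e :: "sexpt"
  obtain a b l where e: "e = (a, b, l)" by (cases e)
  have H: "homog v s (\<lambda>m. g ^ m)" using s zdeg_power[OF g] by (auto simp: homog_def)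
  let ?t = "s * lookup b v"
  have "sgeom (iota (\<lambda>_. 1) g) e = Sum_any (\<lambda>m. iota (\<lambda>_. 1) (g ^ m) e)"
    by (simp add: sgeom_def spow_iota)
  also have "\<dots> = (\<Sum>m\<in>{nat ?t}. iota (\<lambda>_. 1) (g ^ m) e)"
    by (rule Sum_any.expand_superset) (use homog_iota_neq_0D[OF H, of "\<lambda>_. 1" _ a b l] in \<open>auto simp: e\<close>)
  also have "\<dots> = dser v s (hh (\<lambda>m. g ^ m)) e"
  proof (cases "?t \<ge> 0")
    case False
    then have "iota (\<lambda>_. 1) (g ^ nat ?t) (a, b, l) = 0"
      using homog_iota_neq_0D[OF H, of "\<lambda>_. 1" "nat ?t" a b l] by force
    then show ?thesis using False by (simp add: dser_def e)
  qed (simp add: dser_def e hh_power)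
  finally show "sgeom (iota (\<lambda>_. 1) g) e = dser v s (hh (\<lambda>m. g ^ m)) e" .
qed

lemma one_minus_eq:
  assumes s: "s = 1 \<or> s = -1" and g: "supp_in (zdeg v s s) g"
  shows "sone - iota (\<lambda>_. 1) g = dser v s (hh (\<lambda>m. - (g ^ m)))"
proof
  fix e :: "sexpt"
  obtain a b l where e: "e = (a, b, l)" by (cases e)
  let ?h = "hh (\<lambda>m. - (g ^ m))"
  have H: "homog v s ?h"
    by (rule homog_hh[OF s]) (rule supp_in_uminus[OF zdeg_power[OF g]])
  have h: "?h = (\<lambda>r. if r = 0 then 1 else if r = 1 then - g else 0)" by (rule ext) (rule hh_uminus_power)
  let ?t = "s * lookup b v"
  have 0: "iota (\<lambda>_. 1) 1 e = 0" if "?t \<noteq> 0"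
    using homog_iota_neq_0D[OF H, of "\<lambda>_. 1" 0 a b l] that by (auto simp: e)
  have 1: "iota (\<lambda>_. 1) g e = 0" if "?t \<noteq> 1"
    using homog_iota_neq_0D[OF H, of "\<lambda>_. 1" 1 a b l] that by (auto simp: e h iota_uminus)
  have "dser v s ?h e = (if ?t = 0 then iota (\<lambda>_. 1) 1 e else if ?t = 1 then - iota (\<lambda>_. 1) g e else 0)"
    unfolding h by (auto simp: dser_def e iota_uminus)
  then show "(sone - iota (\<lambda>_. 1) g) e = dser v s ?h e"
    using 0 1 by (auto simp: sone_eq)
qed

definition mono2 :: "nat \<Rightarrow> nat \<Rightarrow> ratfun \<Rightarrow> ratfun \<Rightarrow> int \<Rightarrow> int \<Rightarrow> lring" where
  "mono2 i j c d p q = single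
     (single i c + single j d, single i p + single j q) 1"

lemma mono2_mult: "mono2 i j c d p q * mono2 i j c' d' p' q' = mono2 i j (c + c') (d + d') (p + p') (q + q')"
  by (simp add: mono2_def mult_single single_add add_ac)

lemma mono2_power: "mono2 i j c d p q ^ m = mono2 i j (of_nat m * c) (of_nat m * d) (int m * p) (int m * q)"
  by (induction m) (simp_all add: mono2_mult algebra_simps, simp add: mono2_def zero_prod_def[symmetric])

lemma zratio_eq:
  "zratio i j (eexp c) (eexp d) = iota (\<lambda>_. 1) (mono2 i j c (- d) 1 (-1))"
  unfolding zratio_def eexp_inverse in_s_eexp zpow_eq iota_mult_1
  by (simp add: mult_single mono2_def add_ac)

text \<open>Expanding (T_i^m - 1)(Q_j^m - 1) T_j^(-m) (z_i/z_j)^m gives the m-th powers of the four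
  ratios in f_ij, with sign - for numerators and + for denominators.\<close>

lemma xx_mult_yy:
  "xx i m * yy j m = - (mono2 i j 1 (-1) 1 (-1) ^ m) + mono2 i j 1 (jalpha - 1) 1 (-1) ^ m
      + (- (mono2 i j 0 (jalpha - 1) 1 (-1) ^ m) + mono2 i j 0 (-1) 1 (-1) ^ m)"
  by (simp add: xx_def yy_def mono2_power) (simp add: mono2_def algebra_simps mult_single)

text \<open>f_ij is the exponential of the sum of \<open>xx i m * yy j m\<close> / m, graded by z_j
  downwards or by z_i upwards. Both gradings are needed, since the two products belonging to the
  index j are both sorted by their degree in z_j.\<close>

lemma ff_eq:
  assumes ij: "i \<noteq> j" and v: "v = j \<and> s = -1 \<or> v = i \<and> s = 1"
  shows "ff i j = dser v s (hh (\<lambda>m. xx i m * yy j m))"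
proof -
  have s: "s = 1 \<or> s = -1" using v by auto
  have z: "supp_in (zdeg v s s) (mono2 i j c d 1 (-1))" for c d
    unfolding mono2_def
    by (rule supp_in_single) (use ij v in \<open>auto simp: zdeg_def lookup_add lookup_single when_def\<close>)
  note p = zdeg_power[OF z] supp_in_uminus[OF zdeg_power[OF z]]
  have QT: "inverse Q_ser * eexp 1 = eexp (1 - jalpha)"
    by (simp add: Q_ser_eq eexp_inverse eexp_add[symmetric])
  have zr: "zratio i j 1 (eexp d) = iota (\<lambda>_. 1) (mono2 i j 0 (- d) 1 (-1))" for d
    using zratio_eq[of i j 0 d] by simp
  have "ff i j = (sone - iota (\<lambda>_. 1) (mono2 i j 1 (-1) 1 (-1))) \<star> sgeom (iota (\<lambda>_. 1) (mono2 i j 1 (jalpha - 1) 1 (-1)))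
      \<star> ((sone - iota (\<lambda>_. 1) (mono2 i j 0 (jalpha - 1) 1 (-1))) \<star> sgeom (iota (\<lambda>_. 1) (mono2 i j 0 (-1) 1 (-1))))"
    unfolding ff_def by (simp only: T_ser_eq QT zr zratio_eq minus_diff_eq)
  also have "\<dots> = dser v s (hh (\<lambda>m. xx i m * yy j m))"
    unfolding xx_mult_yy
    by (simp only: sgeom_eq[OF s z] one_minus_eq[OF s z] dser_hh_mult[OF s] p supp_in_add)
  finally show ?thesis .
qed

lemma sprod_Nil [simp]: "sprod f [] = sone" and sprod_Cons [simp]: "sprod f (i # is) = f i \<star> sprod f is"
  by (simp_all add: sprod_def)

lemma sprod_cong: "(\<And>i. i \<in> set is \<Longrightarrow> f i = g i) \<Longrightarrow> sprod f is = sprod g is"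
  by (induction "is") auto

lemma sone_eq_dser:
  assumes "s = 1 \<or> s = -1"
  shows "sone = dser v s (hh (\<lambda>m. 0))"
proof -
  have 0: "supp_in (zdeg v s s) 0" by simp
  have "sone - iota (\<lambda>_. 1) 0 = sone" by (rule ext) simp
  moreover have "hh (\<lambda>m. - (0 ^ m)) = hh (\<lambda>m. 0)" by (rule ext, rule hh_cong) (simp add: zero_power)
  ultimately show ?thesis using one_minus_eq[OF assms 0] by simp
qed

lemma sprod_dser:
  assumes s: "s = 1 \<or> s = -1" and w: "\<And>i m. i \<in> set is \<Longrightarrow> supp_in (zdeg v (s * int m) (s * int m)) (w i m)"
  shows "sprod (\<lambda>i. dser v s (hh (w i))) is = dser v s (hh (\<lambda>m. \<Sum>i\<leftarrow>is. w i m))"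
  using w
proof (induction "is")
  case (Cons i "is")
  have 1: "supp_in (zdeg v (s * int m) (s * int m)) (\<Sum>i\<leftarrow>is. w i m)" for m
    using Cons.prems by (induction "is") (auto intro!: supp_in_add)
  show ?case using Cons by (simp add: dser_hh_mult[OF s _ 1])
qed (simp add: sone_eq_dser[OF s])

definition XX :: "nat \<Rightarrow> nat \<Rightarrow> lring" where "XX k m = (\<Sum>i=1..k. xx i m)"

definition YY :: "nat \<Rightarrow> nat \<Rightarrow> lring" where "YY k m = (\<Sum>i=1..k. yy i m)"

text \<open>The difference of the two products belonging to the index j, both cut off at z_j-degree
  \<open>M\<close> in absolute value.\<close>

definition Dt :: "nat \<Rightarrow> nat \<Rightarrow> lring" where
  "Dt j M = (\<Sum>r\<le>M. hh (\<lambda>m. XX (j - 1) m * yy j m) r) - (\<Sum>r\<le>M. hh (\<lambda>m. xx j m * YY (j - 1) m) r)"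

lemma sum_list_upt: "(\<Sum>i\<leftarrow>[1..<j]. f i) = (\<Sum>i=1..j-1. f i :: 'a::comm_monoid_add)"
  unfolding sum_list_distinct_conv_sum_set[OF distinct_upt] by (rule sum.cong) auto

lemma vars_in_zdeg_diff: "i \<noteq> j \<Longrightarrow> supp_in (vars_in {i}) g \<Longrightarrow> supp_in (zdeg j 0 0) g"
  using vars_in_zdeg[of j "{i}"] by (auto intro: supp_in_mono)

lemma supp_ff:
  assumes "i \<noteq> j"
  shows "supp_in (zdeg j (-1 * int m) (-1 * int m)) (xx i m * yy j m)"
    "supp_in (zdeg j (1 * int m) (1 * int m)) (xx j m * yy i m)"
  by (rule supp_zdeg_mult[OF vars_in_zdeg_diff[OF assms supp_xx(1)] supp_yy(2)], simp, simp)
     (rule supp_zdeg_mult[OF supp_xx(2) vars_in_zdeg_diff[OF assms supp_yy(1)]], simp, simp)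

definition Diff :: "nat \<Rightarrow> series" where
  "Diff j = sprod (\<lambda>i. ff i j) [1..<j] - sprod (\<lambda>i. ff j i) [1..<j]"

lemma Diff_eq:
  "Diff j = dser j (-1) (hh (\<lambda>m. XX (j - 1) m * yy j m)) - dser j 1 (hh (\<lambda>m. xx j m * YY (j - 1) m))"
proof -
  have "sprod (\<lambda>i. ff i j) [1..<j] = sprod (\<lambda>i. dser j (-1) (hh (\<lambda>m. xx i m * yy j m))) [1..<j]"
    by (rule sprod_cong, rule ff_eq) auto
  moreover have "\<dots> = dser j (-1) (hh (\<lambda>m. \<Sum>i\<leftarrow>[1..<j]. xx i m * yy j m))"
    by (rule sprod_dser[of "-1"]) (simp, rule supp_ff, simp)
  moreover have "sprod (\<lambda>i. ff j i) [1..<j] = sprod (\<lambda>i. dser j 1 (hh (\<lambda>m. xx j m * yy i m))) [1..<j]"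
    by (rule sprod_cong, rule ff_eq) auto
  moreover have "\<dots> = dser j 1 (hh (\<lambda>m. \<Sum>i\<leftarrow>[1..<j]. xx j m * yy i m))"
    by (rule sprod_dser[of 1]) (simp, rule supp_ff, simp)
  ultimately show ?thesis
    by (simp only: Diff_def sum_list_upt XX_def YY_def sum_distrib_left sum_distrib_right)
qed

lemma supp_XX: "supp_in (vars_in {1..k}) (XX k m)" and supp_YY: "supp_in (vars_in {1..k}) (YY k m)"
  unfolding XX_def YY_def
  by (auto intro!: supp_in_sum supp_in_mono[OF supp_xx(1) vars_in_mono] supp_in_mono[OF supp_yy(1) vars_in_mono])

lemma homog_Diff:
  assumes "j \<ge> 1"
  shows "homog j (-1) (hh (\<lambda>m. XX (j - 1) m * yy j m))" "homog j 1 (hh (\<lambda>m. xx j m * YY (j - 1) m))"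
proof -
  have z: "supp_in (zdeg j 0 0) (XX (j - 1) m)" "supp_in (zdeg j 0 0) (YY (j - 1) m)" for m
    using supp_in_mono[OF supp_XX vars_in_zdeg] supp_in_mono[OF supp_YY vars_in_zdeg] assms by auto
  show "homog j (-1) (hh (\<lambda>m. XX (j - 1) m * yy j m))"
    by (rule homog_hh, simp) (rule supp_zdeg_mult[OF z(1) supp_yy(2)], simp_all)
  show "homog j 1 (hh (\<lambda>m. xx j m * YY (j - 1) m))"
    by (rule homog_hh, simp) (rule supp_zdeg_mult[OF supp_xx(2) z(2)], simp_all)
qed

lemma approx_Diff:
  assumes "j \<ge> 1"
  shows "approx (Diff j) (\<lambda>M. iota (\<lambda>_. 1) (Dt j M))"
proof -
  have "iota (\<lambda>_. 1) (Dt j M) = iota (\<lambda>_. 1) (\<Sum>r\<le>M. hh (\<lambda>m. XX (j - 1) m * yy j m) r)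
      - iota (\<lambda>_. 1) (\<Sum>r\<le>M. hh (\<lambda>m. xx j m * YY (j - 1) m) r)" for M
    by (rule ext) (simp add: Dt_def iota_diff)
  then show ?thesis unfolding Diff_eq
    using approx_diff[OF approx_dser[OF homog_Diff(1)[OF assms]] approx_dser[OF homog_Diff(2)[OF assms]]] by simp
qed

text \<open>The exponents of the \<open>z\<^sub>i\<close> in the \<open>j\<close>-th factor; finitely many of them have a given \<open>j\<close>-th entry.\<close>

definition zexps :: "nat \<Rightarrow> (nat \<Rightarrow>\<^sub>0 int) set" where
  "zexps j = {b. keys b \<subseteq> {1..j} \<and> (\<forall>i. \<bar>lookup b i\<bar> \<le> \<bar>lookup b j\<bar>)}"

lemma finite_bounded_exps:
  assumes "finite I"
  shows "finite {b :: nat \<Rightarrow>\<^sub>0 int. keys b \<subseteq> I \<and> (\<forall>i. \<bar>lookup b i\<bar> \<le> B)}"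
proof (rule finite_imageD)
  let ?S = "{b :: nat \<Rightarrow>\<^sub>0 int. keys b \<subseteq> I \<and> (\<forall>i. \<bar>lookup b i\<bar> \<le> B)}"
  let ?f = "\<lambda>b :: nat \<Rightarrow>\<^sub>0 int. restrict (lookup b) I"
  show "finite (?f ` ?S)"
  proof (rule finite_subset)
    show "?f ` ?S \<subseteq> PiE I (\<lambda>_. {- B..B})"
      by (auto simp: abs_le_iff minus_le_iff)
    show "finite (PiE I (\<lambda>_. {- B..B}))" using assms by (intro finite_PiE) auto
  qed
  show "inj_on ?f ?S"
  proof (rule inj_onI)
    fix b c assume bc: "b \<in> ?S" "c \<in> ?S" "?f b = ?f c"
    show "b = c"
    proof (rule poly_mapping_eqI)
      fix i
      show "lookup b i = lookup c i"
      proof (cases "i \<in> I")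
        case True
        then show ?thesis using fun_cong[OF bc(3), of i] by simp
      next
        case False
        then have "i \<notin> keys b" "i \<notin> keys c" using bc by auto
        then show ?thesis by (simp add: in_keys_iff)
      qed
    qed
  qed
qed

lemma finite_zexps: "finite {b \<in> zexps j. lookup b j = t}"
  by (rule finite_subset[OF _ finite_bounded_exps[of "{1..j}" "\<bar>t\<bar>"]]) (auto simp: zexps_def)

text \<open>In degree r each z_i with i < j has exponent at most r in absolute value, while the
  exponent of z_j is exactly r up to sign.\<close>

lemma zexps_hh:
  assumes "j \<ge> 1" "b \<in> snd ` keys (hh w r)" "\<And>m. w m = XX (j - 1) m * yy j m \<or> w m = xx j m * YY (j - 1) m"
    and H: "homog j s (hh w)"
  shows "b \<in> zexps j"
proof -
  define S where "S m = {e :: lexpt. keys (snd e) \<subseteq> {1..j} \<and> (\<forall>i. \<bar>lookup (snd e) i\<bar> \<le> int m)}" for m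
  define S1 where "S1 I m = {e :: lexpt. keys (snd e) \<subseteq> I \<and> (\<forall>i. \<bar>lookup (snd e) i\<bar> \<le> int m)}" for I :: "nat set" and m
  have 1: "supp_in (S1 {i} m) (xx i m)" "supp_in (S1 {i} m) (yy i m)" for i m
    unfolding xx_def yy_def S1_def
    by (auto intro!: supp_in_diff supp_in_single simp: lookup_single when_def split: if_splits)
  have 2: "supp_in (S1 {1..j-1} m) (XX (j - 1) m)" "supp_in (S1 {1..j-1} m) (YY (j - 1) m)" for m
    unfolding XX_def YY_def by (auto intro!: supp_in_sum supp_in_mono[OF 1(1)] supp_in_mono[OF 1(2)] simp: S1_def)
  \<comment> \<open>The two factors involve disjoint variables, so no exponent receives
    contributions from both.\<close>
  have 3: "e + e' \<in> S m" if e: "e \<in> S1 {1..j-1} m" "e' \<in> S1 {j} m" for e e' m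
  proof -
    have "\<bar>lookup (snd e + snd e') i\<bar> \<le> int m" for i
    proof (cases "i = j")
      case True
      then have "i \<notin> keys (snd e)" using e assms(1) by (auto simp: S1_def)
      then show ?thesis using e by (auto simp: S1_def lookup_add in_keys_iff)
    next
      case False
      then have "i \<notin> keys (snd e')" using e by (auto simp: S1_def)
      then show ?thesis using e by (auto simp: S1_def lookup_add in_keys_iff)
    qed
    moreover have "keys (snd e + snd e') \<subseteq> {1..j}"
      using e assms(1) keys_add[of "snd e" "snd e'"] by (fastforce simp: S1_def)
    ultimately show ?thesis by (simp add: S_def)
  qed
  have w: "supp_in (S m) (w m)" for m
    using assms(3)[of m] supp_in_mult[OF 2(1) 1(2) 3, of m] supp_in_mult[OF 2(2) 1(1) 3, of m] by (auto simp: mult.commute)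
  have "supp_in (S r) (hh w r)"
  proof (rule supp_in_hh[OF w])
    fix m n e e' assume e: "e \<in> S m" "e' \<in> S n"
    have "\<bar>lookup (snd e + snd e') i\<bar> \<le> int m + int n" for i
    proof -
      have "\<bar>lookup (snd e) i\<bar> \<le> int m" "\<bar>lookup (snd e') i\<bar> \<le> int n"
        using e by (auto simp: S_def)
      then show ?thesis unfolding lookup_add by linarith
    qed
    moreover have "keys (snd e + snd e') \<subseteq> {1..j}"
      by (rule order_trans[OF keys_add Un_least]) (use e in \<open>auto simp: S_def\<close>)
    ultimately show "e + e' \<in> S (m + n)" by (simp add: S_def)
  qed (simp add: S_def)
  moreover obtain e where e: "e \<in> keys (hh w r)" "b = snd e" using assms(2) by auto
  ultimately have "e \<in> S r" by (auto simp: supp_in_def)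
  moreover have "\<bar>lookup b j\<bar> = int r"
  proof -
    have "e \<in> zdeg j (s * int r) (s * int r)" "s = 1 \<or> s = -1"
      using H e(1) by (auto simp: homog_def supp_in_def)
    then show ?thesis by (auto simp: zdeg_def e(2))
  qed
  ultimately show ?thesis using e by (auto simp: S_def zexps_def)
qed

lemma iota_Dt_zexps:
  assumes "j \<ge> 1" "iota A (Dt j M) (a, b, l) \<noteq> 0"
  shows "b \<in> zexps j \<and> l = {#}"
proof -
  obtain r where "iota A (hh (\<lambda>m. XX (j - 1) m * yy j m) r) (a, b, l) \<noteq> 0 \<or> iota A (hh (\<lambda>m. xx j m * YY (j - 1) m) r) (a, b, l) \<noteq> 0"
    using assms(2) unfolding Dt_def iota_diff iota_sum by (metis (no_types, lifting) diff_zero sum.neutral)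
  then show ?thesis
  proof
    assume "iota A (hh (\<lambda>m. XX (j - 1) m * yy j m) r) (a, b, l) \<noteq> 0"
    from iota_neq_0D[OF this] show ?thesis
      using zexps_hh[OF assms(1) _ disjI1[OF refl] homog_Diff(1)[OF assms(1)]] by blast
  next
    assume "iota A (hh (\<lambda>m. xx j m * YY (j - 1) m) r) (a, b, l) \<noteq> 0"
    from iota_neq_0D[OF this] show ?thesis
      using zexps_hh[OF assms(1) _ disjI2[OF refl] homog_Diff(2)[OF assms(1)]] by blast
  qed
qed

lemma Diff_zexps:
  assumes "j \<ge> 1" "Diff j (a, b, l) \<noteq> 0"
  shows "b \<in> zexps j \<and> l = {#}"
proof -
  obtain M where "Diff j (a, b, l) = iota (\<lambda>_. 1) (Dt j M) (a, b, l)"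
    using approx_Diff[OF assms(1)] unfolding approx_def by blast
  then show ?thesis using iota_Dt_zexps[OF assms(1)] assms(2) by metis
qed

fun zexps_list :: "nat list \<Rightarrow> (nat \<Rightarrow>\<^sub>0 int) set" where
  "zexps_list [] = {0}"
| "zexps_list (j # js) = {b + b' |b b'. b \<in> zexps j \<and> b' \<in> zexps_list js}"

text \<open>Triangular elimination: factor j involves only z_1, ..., z_j. So the later factors are
  confined to finitely many exponents first, and then the exponent of z_j confines factor j.\<close>

lemma finite_zexps_list:
  assumes "sorted_wrt (<) js"
  shows "finite {b \<in> zexps_list js. \<forall>i\<in>set js. lookup b i = c i}"
  using assms
proof (induction js)
  case (Cons j js)
  let ?F = "{b \<in> zexps_list js. \<forall>i\<in>set js. lookup b i = c i}"
  let ?G = "\<lambda>b'. {b \<in> zexps j. lookup b j = c j - lookup b' j}"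
  have "{b \<in> zexps_list (j # js). \<forall>i\<in>set (j # js). lookup b i = c i} \<subseteq>
     (\<lambda>(b', b). b + b') ` (SIGMA b':?F. ?G b')"
  proof
    fix x assume x: "x \<in> {b \<in> zexps_list (j # js). \<forall>i\<in>set (j # js). lookup b i = c i}"
    then obtain b b' where b: "x = b + b'" "b \<in> zexps j" "b' \<in> zexps_list js" by auto
    have "lookup b i = 0" if "i \<in> set js" for i
    proof -
      have "i > j" using that Cons.prems by simp
      then have "i \<notin> keys b" using b(2) by (auto simp: zexps_def)
      then show ?thesis by (simp add: in_keys_iff)
    qed
    then have "b' \<in> ?F" using x b by (auto simp: lookup_add)
    moreover have "b \<in> ?G b'" using x b by (auto simp: lookup_add)
    ultimately show "x \<in> (\<lambda>(b', b). b + b') ` (SIGMA b':?F. ?G b')" using b(1) by force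
  qed
  moreover have "finite (SIGMA b':?F. ?G b')" using Cons finite_zexps by (intro finite_SigmaI) auto
  ultimately show ?case by (meson finite_imageI finite_subset)
qed simp

text \<open>The factors extend in both directions of z_j, yet by the elimination each coefficient of
  the product is a finite matter. Approximation and support bounds are proved together since
  \<open>approx_mult\<close> needs all of them for the tail of the list.\<close>

lemma approx_sprod_Diff:
  assumes "sorted_wrt (<) js" "\<forall>j\<in>set js. j \<ge> 1"
  shows "approx (sprod Diff js) (\<lambda>M. iota (\<lambda>_. 1) (\<Prod>j\<leftarrow>js. Dt j M)) \<and>
    (\<forall>a b l. sprod Diff js (a, b, l) \<noteq> 0 \<longrightarrow> b \<in> zexps_list js \<and> l = {#}) \<and>
    (\<forall>M a b l. iota (\<lambda>_. 1) (\<Prod>j\<leftarrow>js. Dt j M) (a, b, l) \<noteq> 0 \<longrightarrow> b \<in> zexps_list js \<and> l = {#})"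
  using assms
proof (induction js)
  case Nil
  have "b = 0 \<and> l = {#}" if "iota (\<lambda>_. 1) 1 (a, b, l) \<noteq> 0" for a b l
    using iota_neq_0D[OF that] by auto
  then show ?case by (auto simp: sone_eq approx_const)
next
  case (Cons j js)
  let ?P = "\<lambda>M. \<Prod>j\<leftarrow>js. Dt j M"
  have j: "j \<ge> 1" using Cons.prems by simp
  let ?U = "zexps j \<times> {{#} :: gpartition}" and ?W = "zexps_list js \<times> {{#} :: gpartition}"
  have IH: "approx (sprod Diff js) (\<lambda>M. iota (\<lambda>_. 1) (?P M))"
    "\<And>a b l. sprod Diff js (a, b, l) \<noteq> 0 \<Longrightarrow> (b, l) \<in> ?W"
    "\<And>M a b l. iota (\<lambda>_. 1) (?P M) (a, b, l) \<noteq> 0 \<Longrightarrow> (b, l) \<in> ?W"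
    using Cons by auto
  have D: "Diff j (a, b, l) \<noteq> 0 \<Longrightarrow> (b, l) \<in> ?U" "iota (\<lambda>_. 1) (Dt j M) (a, b, l) \<noteq> 0 \<Longrightarrow> (b, l) \<in> ?U" for M a b l
    using Diff_zexps[OF j] iota_Dt_zexps[OF j] by auto
  have fin: "finite {(p, p'). p \<in> ?U \<and> p' \<in> ?W \<and> p + p' = q}" for q
  proof -
    obtain c l where q: "q = (c, l)" by (cases q)
    let ?F = "{b \<in> zexps_list js. \<forall>i\<in>set js. lookup b i = lookup c i}"
    have "{(p, p'). p \<in> ?U \<and> p' \<in> ?W \<and> p + p' = q} \<subseteq> (\<lambda>b'. ((c - b', {#}), (b', {#}))) ` ?F"
    proof
      fix x assume x: "x \<in> {(p, p'). p \<in> ?U \<and> p' \<in> ?W \<and> p + p' = q}"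
      then obtain b b' where b: "x = ((b, {#}), (b', {#}))" "b \<in> zexps j" "b' \<in> zexps_list js" "c = b + b'"
        by (auto simp: q)
      have "lookup b i = 0" if "i \<in> set js" for i
      proof -
        have "i > j" using that Cons.prems by simp
        then have "i \<notin> keys b" using b(2) by (auto simp: zexps_def)
        then show ?thesis by (simp add: in_keys_iff)
      qed
      then have "b' \<in> ?F" using b by (auto simp: lookup_add)
      then show "x \<in> (\<lambda>b'. ((c - b', {#}), (b', {#}))) ` ?F" using b by (intro image_eqI[of _ _ b']) auto
    qed
    moreover have "finite ?F" using Cons.prems by (intro finite_zexps_list) simp
    ultimately show ?thesis by (meson finite_imageI finite_subset)
  qed
  have prod: "iota (\<lambda>_. 1) (\<Prod>j\<leftarrow>j # js. Dt j M) = iota (\<lambda>_. 1) (Dt j M) \<star> iota (\<lambda>_. 1) (?P M)" for M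
    by (simp add: iota_mult_1)
  have ap: "approx (sprod Diff (j # js)) (\<lambda>M. iota (\<lambda>_. 1) (\<Prod>j\<leftarrow>j # js. Dt j M))"
    unfolding prod sprod_Cons by (rule approx_mult[OF approx_Diff[OF j] IH(1) D IH(2,3) fin])
  have Z: "b \<in> zexps_list (j # js) \<and> l = {#}" if "iota (\<lambda>_. 1) (\<Prod>j\<leftarrow>j # js. Dt j M) (a, b, l) \<noteq> 0" for M a b l
  proof -
    have "(iota (\<lambda>_. 1) (Dt j M) \<star> iota (\<lambda>_. 1) (?P M)) (a, b, l) \<noteq> 0" using that unfolding prod .
    then have "{(d, d'). d + d' = (a, b, l) \<and> iota (\<lambda>_. 1) (Dt j M) d \<noteq> 0 \<and> iota (\<lambda>_. 1) (?P M) d' \<noteq> 0} \<noteq> {}"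
      (is "?S \<noteq> {}")
    proof (rule contrapos_nn)
      assume S: "?S = {}"
      show "(iota (\<lambda>_. 1) (Dt j M) \<star> iota (\<lambda>_. 1) (?P M)) (a, b, l) = 0"
        by (subst smult_eq_sum[of ?S]) (simp_all only: S, simp_all)
    qed
    then obtain d d' where d: "d + d' = (a, b, l)" "iota (\<lambda>_. 1) (Dt j M) d \<noteq> 0" "iota (\<lambda>_. 1) (?P M) d' \<noteq> 0"
      by auto
    obtain a1 b1 l1 a2 b2 l2 where dd: "d = (a1, b1, l1)" "d' = (a2, b2, l2)" by (cases d, cases d')
    show ?thesis using D(2) IH(3) d unfolding dd by fastforce
  qed
  moreover have "b \<in> zexps_list (j # js) \<and> l = {#}" if "sprod Diff (j # js) (a, b, l) \<noteq> 0" for a b l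
  proof -
    obtain M where "sprod Diff (j # js) (a, b, l) = iota (\<lambda>_. 1) (\<Prod>j\<leftarrow>j # js. Dt j M) (a, b, l)"
      using ap unfolding approx_def by blast
    then show ?thesis using Z that by metis
  qed
  ultimately show ?case using ap by blast
qed

subsection \<open>The vertex operators\<close>

text \<open>\<open>Esg \<sigma> g\<close> is the generating function \<open>exp (\<Sum>\<^bsub>m>0\<^esub> g\<^sub>m \<aa>\<^bsub>\<sigma>m\<^esub> / m)\<close>, where \<open>\<sigma> = \<plusminus>1\<close>.\<close>

definition Esg :: "int \<Rightarrow> (nat \<Rightarrow> lring) \<Rightarrow> gpartition \<Rightarrow> lring" where
  "Esg s g l = (if \<forall>j\<in>#l. s * j > 0 then ee g (image_mset (\<lambda>j. nat (s * j)) l) else 0)"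

text \<open>The part with exactly one symbol, that is, the exponent of the exponential.\<close>

definition Esg1 :: "int \<Rightarrow> (nat \<Rightarrow> lring) \<Rightarrow> gpartition \<Rightarrow> lring" where
  "Esg1 s g l = (if size l = 1 then Esg s g l else 0)"

lemma ee_single_mult:
  assumes "m > 0"
  shows "ee g {#m#} * ee g M = of_nat (Suc (count M m)) * ee g (add_mset m M)"
proof -
  have "of_nat m * (ee g {#m#} * ee g M) = g m * ee g M"
    using ee_add_mset[OF assms, of "{#}" g] by (simp add: mult.assoc[symmetric])
  also have "\<dots> = of_nat m * (of_nat (Suc (count M m)) * ee g (add_mset m M))"
    using ee_add_mset[OF assms, of M g] by (simp add: algebra_simps)
  finally show ?thesis by (rule lring_of_nat_cancel) fact
qed

lemma inj_on_signed: "s = 1 \<or> s = -1 \<Longrightarrow> inj_on (\<lambda>j. nat (s * j)) {j. s * j > 0}"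
  by (elim disjE) (auto simp: inj_on_def)

lemma count_image_mset_signed:
  assumes s: "s = 1 \<or> s = -1" and l: "\<forall>j\<in>#l. s * j > 0" and j: "s * j > 0"
  shows "count (image_mset (\<lambda>j. nat (s * j)) l) (nat (s * j)) = count l j"
  using l
proof (induction l)
  case (add i l)
  have "nat (s * i) = nat (s * j) \<longleftrightarrow> i = j"
    using inj_on_signed[OF s] add.prems j by (auto simp: inj_on_def)
  then show ?case using add by simp
qed simp

text \<open>Euler's identity for the number of parts: one part of \<open>l\<close> is taken out in
  all possible ways.\<close>

lemma Esg_split:
  assumes s: "s = 1 \<or> s = -1"
  shows "mconv (Esg1 s g) (Esg s g) l = of_nat (size l) * Esg s g l"
proof -
  have *: "l1 \<in> (\<lambda>j. {#j#}) ` set_mset l" if "l1 \<subseteq># l" "size l1 = 1" for l1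
    using that by (metis image_eqI size_1_singleton_mset mset_subset_eqD multi_member_last)
  have "mconv (Esg1 s g) (Esg s g) l = (\<Sum>l1\<in>(\<lambda>j. {#j#}) ` set_mset l. Esg s g l1 * Esg s g (l - l1))"
    unfolding mconv_def
    by (rule sum.mono_neutral_cong_right) (use * in \<open>auto simp: finite_submultisets Esg1_def\<close>)
  also have "\<dots> = (\<Sum>j\<in>set_mset l. Esg s g {#j#} * Esg s g (l - {#j#}))"
    by (subst sum.reindex) (simp_all add: inj_on_def)
  also have "\<dots> = (\<Sum>j\<in>set_mset l. of_nat (count l j) * Esg s g l)"
  proof (rule sum.cong[OF refl])
    fix j assume j: "j \<in># l"
    show "Esg s g {#j#} * Esg s g (l - {#j#}) = of_nat (count l j) * Esg s g l"
    proof (cases "\<forall>j\<in>#l. s * j > 0")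
      case True
      obtain l' where l': "l = add_mset j l'" using j by (metis insert_DiffM)
      have pos: "s * j > 0" and T': "\<forall>j\<in>#l'. s * j > 0" using True l' by auto
      have "Esg s g {#j#} * Esg s g l' = ee g {#nat (s * j)#} * ee g (image_mset (\<lambda>j. nat (s * j)) l')"
        using pos T' by (simp add: Esg_def)
      also have "\<dots> = of_nat (Suc (count (image_mset (\<lambda>j. nat (s * j)) l') (nat (s * j)))) * ee g (image_mset (\<lambda>j. nat (s * j)) l)"
        using pos l' by (subst ee_single_mult) auto
      also have "\<dots> = of_nat (count l j) * Esg s g l"
        using True l' pos by (simp add: Esg_def count_image_mset_signed[OF s T' pos])
      finally show ?thesis using l' by simp
    next
      case False
      then obtain i where i: "i \<in># l" "\<not> s * i > 0" by auto
      have "Esg s g {#j#} = 0 \<or> Esg s g (l - {#j#}) = 0"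
      proof (cases "i = j")
        case False
        then have "i \<in># l - {#j#}" using i by (simp add: in_diff_count)
        then show ?thesis using i by (auto simp: Esg_def)
      qed (use i in \<open>simp add: Esg_def\<close>)
      moreover have "Esg s g l = 0" using False by (auto simp: Esg_def)
      ultimately show ?thesis by auto
    qed
  qed
  also have "\<dots> = of_nat (size l) * Esg s g l"
    by (simp add: sum_distrib_right[symmetric] size_multiset_overloaded_eq)
  finally show ?thesis .
qed

text \<open>By \<open>Esg_split\<close> each further factor raises the number of parts by one and
  multiplies by the new number; hence the factorial. Different powers have disjoint
  supports.\<close>

lemma spow_gser_Esg1:
  assumes s: "s = 1 \<or> s = -1"
  shows "spow (gser (\<lambda>_. 1) (Esg1 s g)) m = gser (\<lambda>_. 1) (\<lambda>l. if size l = m then of_nat (fact m) * Esg s g l else 0)"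
proof (induction m)
  case 0
  show ?case unfolding spow.simps sone_eq iota_eq_gser
    by (rule arg_cong2[of _ _ _ _ gser], simp, rule ext) (simp add: Esg_def)
next
  case (Suc m)
  have "mconv (Esg1 s g) (\<lambda>l. if size l = m then of_nat (fact m) * Esg s g l else 0) l =
      (if size l = Suc m then of_nat (fact (Suc m)) * Esg s g l else 0)" for l
  proof -
    have *: "Esg1 s g l1 * (if size (l - l1) = m then of_nat (fact m) * Esg s g (l - l1) else 0) =
        (if size l = Suc m then of_nat (fact m) * (Esg1 s g l1 * Esg s g (l - l1)) else 0)" if "l1 \<subseteq># l" for l1
    proof (cases "size l1 = 1")
      case True
      have "size l = size l1 + size (l - l1)" using that by (metis size_union subset_mset.add_diff_inverse)
      then show ?thesis using True by (auto simp: mult.left_commute)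
    qed (auto simp: Esg1_def)
    have "mconv (Esg1 s g) (\<lambda>l. if size l = m then of_nat (fact m) * Esg s g l else 0) l =
       (\<Sum>l1 | l1 \<subseteq># l. if size l = Suc m then of_nat (fact m) * (Esg1 s g l1 * Esg s g (l - l1)) else 0)"
      unfolding mconv_def by (rule sum.cong[OF refl]) (use * in blast)
    also have "\<dots> = (if size l = Suc m then of_nat (fact m) * mconv (Esg1 s g) (Esg s g) l else 0)"
      by (simp add: mconv_def sum_distrib_left)
    also have "\<dots> = (if size l = Suc m then of_nat (fact (Suc m)) * Esg s g l else 0)"
      by (simp add: Esg_split[OF s] algebra_simps)
    finally show ?thesis .
  qed
  then have "mconv (Esg1 s g) (\<lambda>l. if size l = m then of_nat (fact m) * Esg s g l else 0) =
      (\<lambda>l. if size l = Suc m then of_nat (fact (Suc m)) * Esg s g l else 0)" by (rule ext)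
  then show ?case
    by (simp only: spow.simps Suc gser_mult[of "\<lambda>_. 1" "\<lambda>_. 1", simplified])
qed

lemma sexp_gser_Esg1:
  assumes s: "s = 1 \<or> s = -1"
  shows "sexp (gser (\<lambda>_. 1) (Esg1 s g)) = gser (\<lambda>_. 1) (Esg s g)"
proof
  fix e :: "sexpt"
  obtain a b l where e: "e = (a, b, l)" by (cases e)
  have "sexp (gser (\<lambda>_. 1) (Esg1 s g)) e =
      Sum_any (\<lambda>m. iota (\<lambda>_. 1) (if size l = m then of_nat (fact m) * Esg s g l else 0) (a, b, {#}) / of_nat (fact m))"
    by (simp only: sexp_def spow_gser_Esg1[OF s]) (simp add: gser_def e)
  also have "\<dots> = (\<Sum>m\<in>{size l}. iota (\<lambda>_. 1) (if size l = m then of_nat (fact m) * Esg s g l else 0) (a, b, {#}) / of_nat (fact m))"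
    by (rule Sum_any.expand_superset) (auto split: if_splits)
  also have "\<dots> = iota (\<lambda>_. 1) (of_nat (fact (size l)) * Esg s g l) (a, b, {#}) / of_nat (fact (size l))"
    by simp
  also have "\<dots> = gser (\<lambda>_. 1) (Esg s g) e"
    unfolding lconst_of_nat[symmetric] iota_lconst_mult by (simp add: gser_def e)
  finally show "sexp (gser (\<lambda>_. 1) (Esg1 s g)) e = gser (\<lambda>_. 1) (Esg s g) e" .
qed

lemma image_mset_submultisets:
  assumes "inj_on f (set_mset l)"
  shows "bij_betw (image_mset f) {l1. l1 \<subseteq># l} {M. M \<subseteq># image_mset f l}"
  unfolding bij_betw_def
proof
  show "inj_on (image_mset f) {l1. l1 \<subseteq># l}"
  proof (rule inj_onI)
    fix A B assume AB: "A \<in> {l1. l1 \<subseteq># l}" "B \<in> {l1. l1 \<subseteq># l}" "image_mset f A = image_mset f B"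
    let ?g = "inv_into (set_mset l) f"
    have g: "image_mset ?g (image_mset f X) = X" if "X \<subseteq># l" for X
    proof -
      have "image_mset ?g (image_mset f X) = image_mset (\<lambda>x. x) X"
        unfolding multiset.map_comp
        by (rule image_mset_cong) (use that assms in \<open>auto simp: inv_into_f_f dest: mset_subset_eqD\<close>)
      then show ?thesis by simp
    qed
    have "image_mset ?g (image_mset f A) = image_mset ?g (image_mset f B)"
      using AB(3) by (rule arg_cong)
    then show "A = B" using g[of A] g[of B] AB(1,2) unfolding mem_Collect_eq by argo
  qed
  show "image_mset f ` {l1. l1 \<subseteq># l} = {M. M \<subseteq># image_mset f l}"
  proof (intro equalityI subsetI)
    fix M assume "M \<in> {M. M \<subseteq># image_mset f l}"
    then obtain N where "image_mset f l = M + N" by (auto simp: subset_mset.le_iff_add)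
    then obtain A B where "l = A + B" "image_mset f A = M" by (metis image_mset_eq_plusD)
    then show "M \<in> image_mset f ` {l1. l1 \<subseteq># l}" by auto
  qed (auto simp: image_mset_subseteq_mono)
qed

text \<open>On parts of one sign the map to absolute values is injective and carries submultisets to
  submultisets, which reduces the claim to \<open>ee_add\<close>.\<close>

lemma mconv_Esg:
  assumes s: "s = 1 \<or> s = -1"
  shows "mconv (Esg s g) (Esg s h) = Esg s (\<lambda>m. g m + h m)"
proof
  fix l
  let ?f = "\<lambda>j. nat (s * j)"
  show "mconv (Esg s g) (Esg s h) l = Esg s (\<lambda>m. g m + h m) l"
  proof (cases "\<forall>j\<in>#l. s * j > 0")
    case True
    have inj: "inj_on ?f (set_mset l)"
      by (rule inj_on_subset[OF inj_on_signed[OF s]]) (use True in auto)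
    have "mconv (Esg s g) (Esg s h) l = (\<Sum>l1 | l1 \<subseteq># l. ee g (image_mset ?f l1) * ee h (image_mset ?f l - image_mset ?f l1))"
      unfolding mconv_def
    proof (rule sum.cong[OF refl])
      fix l1 assume "l1 \<in> {l1. l1 \<subseteq># l}"
      then have l1: "l1 \<subseteq># l" by simp
      then have "image_mset ?f (l - l1) = image_mset ?f l - image_mset ?f l1" by (rule image_mset_Diff)
      moreover have "\<forall>j\<in>#l1. s * j > 0" "\<forall>j\<in>#l - l1. s * j > 0"
        using l1 True by (auto dest: mset_subset_eqD in_diffD)
      ultimately show "Esg s g l1 * Esg s h (l - l1) = ee g (image_mset ?f l1) * ee h (image_mset ?f l - image_mset ?f l1)"
        by (simp add: Esg_def)
    qed
    also have "\<dots> = (\<Sum>M | M \<subseteq># image_mset ?f l. ee g M * ee h (image_mset ?f l - M))"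
      by (rule sum.reindex_bij_betw[OF image_mset_submultisets[OF inj]])
    also have "\<dots> = Esg s (\<lambda>m. g m + h m) l"
      using True by (subst ee_add[symmetric]) (auto simp: Esg_def)
    finally show ?thesis .
  next
    case False
    then obtain i where i: "i \<in># l" "\<not> s * i > 0" by auto
    have "Esg s g l1 * Esg s h (l - l1) = 0" if "l1 \<subseteq># l" for l1
    proof -
      have "i \<in># l1 \<or> i \<in># l - l1" using i(1) that by (metis subset_mset.add_diff_inverse union_iff)
      then show ?thesis using i(2) by (auto simp: Esg_def)
    qed
    then show ?thesis using False by (auto simp: mconv_def Esg_def intro: sum.neutral)
  qed
qed

definition emono :: "nat \<Rightarrow> ratfun \<Rightarrow> int \<Rightarrow> lring" where
  "emono i c p = single (single i c, single i p) 1"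

lemma in_s_zpow_asym:
  "in_s i (eexp c / of_nat m) \<star> zpow i p \<star> asym j =
    gser (\<lambda>_. 1) (\<lambda>l. if l = {#j#} then lconst (1 / of_nat m) * emono i c p else 0)"
proof -
  have "eexp c / of_nat m = fls_const (1 / of_nat m) * eexp c"
    by (simp add: divide_inverse fls_of_nat fls_inverse_const mult.commute)
  then have A: "in_s i (eexp c / of_nat m) \<star> zpow i p = iota (\<lambda>_. 1) (lconst (1 / of_nat m) * emono i c p)"
    by (simp add: in_s_const_eexp zpow_eq iota_mult_1 mult_single lconst_def emono_def)
  have "in_s i (eexp c / of_nat m) \<star> zpow i p \<star> asym j =
      gser (\<lambda>_. 1) (mconv (\<lambda>l. if l = {#} then lconst (1 / of_nat m) * emono i c p else 0) (\<lambda>l. if l = {#j#} then 1 else 0))"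
    unfolding A by (simp add: iota_eq_gser asym_eq gser_mult[of "\<lambda>_. 1" "\<lambda>_. 1", simplified])
  also have "mconv (\<lambda>l. if l = {#} then lconst (1 / of_nat m) * emono i c p else 0) (\<lambda>l. if l = {#j#} then 1 else 0) =
      (\<lambda>l. if l = {#j#} then lconst (1 / of_nat m) * emono i c p else 0)"
    by (rule ext) (simp add: mconv_empty_left)
  finally show ?thesis .
qed

lemma Sum_any_gser_Esg1:
  assumes s: "s = 1 \<or> s = -1"
  shows "(\<lambda>e. Sum_any (\<lambda>m. if m > 0 then gser (\<lambda>_. 1) (\<lambda>l. if l = {#s * int m#} then lconst (1 / of_nat m) * g m else 0) e else 0)) =
    gser (\<lambda>_. 1) (Esg1 s g)"
proof
  fix e :: "sexpt"
  obtain a b l where e: "e = (a, b, l)" by (cases e)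
  let ?h = "\<lambda>m. if m > 0 then gser (\<lambda>_. 1) (\<lambda>l. if l = {#s * int m#} then lconst (1 / of_nat m) * g m else 0) e else 0"
  show "Sum_any ?h = gser (\<lambda>_. 1) (Esg1 s g) e"
  proof (cases "\<exists>m>0. l = {#s * int m#}")
    case True
    then obtain m where m: "m > 0" "l = {#s * int m#}" by blast
    have eq: "m' = m" if "s * int m' = s * int m" for m' using that s by auto
    have "Sum_any ?h = (\<Sum>m\<in>{m}. ?h m)"
      by (rule Sum_any.expand_superset) (use m eq in \<open>auto simp: gser_def e split: if_splits\<close>)
    also have "\<dots> = iota (\<lambda>_. 1) (lconst (1 / of_nat m) * g m) (a, b, {#})"
      using m by (simp add: gser_def e)
    also have "lconst (1 / of_nat m) * g m = Esg1 s g l"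
    proof -
      have "Esg s g l = ee g {#m#}" using s m by (elim disjE) (simp_all add: Esg_def)
      also have "\<dots> = lconst (1 / of_nat m) * g m"
        using zmset_add_mset[of m "{#}"] by (simp add: ee_def)
      finally show ?thesis by (simp add: Esg1_def m)
    qed
    finally show ?thesis by (simp add: gser_def e)
  next
    case False
    then have "l \<noteq> {#s * int m#}" if "m > 0" for m using that by blast
    then have "?h = (\<lambda>_. 0)" by (intro ext) (simp add: gser_def e)
    then have h0: "Sum_any ?h = Sum_any (\<lambda>_ :: nat. 0)" by (rule arg_cong)
    have "Esg1 s g l = 0"
    proof (rule ccontr)
      assume "Esg1 s g l \<noteq> 0"
      then have "size l = 1" "Esg s g l \<noteq> 0" by (auto simp: Esg1_def split: if_splits)
      then obtain j where j: "l = {#j#}" "s * j > 0"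
        using size_1_singleton_mset[of l] by (auto simp: Esg_def split: if_splits)
      then have "l = {#s * int (nat (s * j))#}" "nat (s * j) > 0" using s by auto
      then show False using False by blast
    qed
    then show ?thesis unfolding h0 by (simp add: gser_def e)
  qed
qed

lemma uminus_gser_Esg1: "- gser (\<lambda>_. 1) (Esg1 s g) = gser (\<lambda>_. 1) (Esg1 s (\<lambda>m. - g m))"
proof
  fix e :: "sexpt"
  obtain a b l where e: "e = (a, b, l)" by (cases e)
  have "Esg1 s (\<lambda>m. - g m) l = - Esg1 s g l"
  proof (cases "size l = 1")
    case True
    then obtain j where "l = {#j#}" using size_1_singleton_mset by blast
    then show ?thesis by (simp add: Esg1_def Esg_def ee_def)
  qed (simp add: Esg1_def)
  then show "(- gser (\<lambda>_. 1) (Esg1 s g)) e = gser (\<lambda>_. 1) (Esg1 s (\<lambda>m. - g m)) e"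
    by (simp add: gser_def e iota_uminus)
qed

lemma log_Gamma_eq:
  "log_Gamma_minus i (eexp c) = gser (\<lambda>_. 1) (Esg1 (-1) (\<lambda>m. emono i (of_nat m * c) (int m)))"
  "log_Gamma_plus i (eexp c) = gser (\<lambda>_. 1) (Esg1 1 (\<lambda>m. emono i (of_nat m * - c) (- int m)))"
proof -
  show "log_Gamma_minus i (eexp c) = gser (\<lambda>_. 1) (Esg1 (-1) (\<lambda>m. emono i (of_nat m * c) (int m)))"
    unfolding log_Gamma_minus_def eexp_power in_s_zpow_asym
    by (rule Sum_any_gser_Esg1[of "-1", unfolded mult_minus1]) simp
  show "log_Gamma_plus i (eexp c) = gser (\<lambda>_. 1) (Esg1 1 (\<lambda>m. emono i (of_nat m * - c) (- int m)))"
    unfolding log_Gamma_plus_def eexp_inverse eexp_power in_s_zpow_asym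
    by (rule Sum_any_gser_Esg1[of 1, unfolded mult_1_left]) simp
qed

lemma Gamma_eq:
  "Gamma_minus i T_ser \<star> Gamma_minus_inv i 1 = gser (\<lambda>_. 1) (Esg (-1) (xx i))" (is ?A)
  "Gamma_plus i (inverse Q_ser * T_ser) \<star> Gamma_plus_inv i T_ser = gser (\<lambda>_. 1) (Esg 1 (yy i))" (is ?B)
proof -
  have G: "gser (\<lambda>_. 1) (Esg s g) \<star> gser (\<lambda>_. 1) (Esg s h) = gser (\<lambda>_. 1) (Esg s (\<lambda>m. g m + h m))" if "s = 1 \<or> s = -1" for s g h
    using gser_mult[of "\<lambda>_. 1" "\<lambda>_. 1" "Esg s g" "Esg s h"] by (simp add: mconv_Esg[OF that])
  have "Gamma_minus_inv i 1 = sexp (- log_Gamma_minus i (eexp 0))" by (simp add: Gamma_minus_inv_def)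
  then have "Gamma_minus i T_ser \<star> Gamma_minus_inv i 1 =
     gser (\<lambda>_. 1) (Esg (-1) (\<lambda>m. emono i (of_nat m * 1) (int m) + - emono i (of_nat m * 0) (int m)))"
    by (simp only: Gamma_minus_def T_ser_eq log_Gamma_eq uminus_gser_Esg1 sexp_gser_Esg1[of "-1", simplified] G[of "-1", simplified])
  then show ?A by (simp add: emono_def xx_def[abs_def])
  have "inverse Q_ser * T_ser = eexp (1 - jalpha)"
    by (simp add: Q_ser_eq T_ser_eq eexp_inverse eexp_add[symmetric])
  then have "Gamma_plus i (inverse Q_ser * T_ser) \<star> Gamma_plus_inv i T_ser =
     gser (\<lambda>_. 1) (Esg 1 (\<lambda>m. emono i (of_nat m * - (1 - jalpha)) (- int m) + - emono i (of_nat m * - 1) (- int m)))"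
    by (simp only: Gamma_plus_def Gamma_plus_inv_def T_ser_eq log_Gamma_eq uminus_gser_Esg1 sexp_gser_Esg1[of 1, simplified] G[of 1, simplified])
  then show ?B by (simp add: emono_def yy_def[abs_def] algebra_simps)
qed

lemma sprod_gser_Esg:
  assumes s: "s = 1 \<or> s = -1"
  shows "sprod (\<lambda>i. gser (\<lambda>_. 1) (Esg s (w i))) is = gser (\<lambda>_. 1) (Esg s (\<lambda>m. \<Sum>i\<leftarrow>is. w i m))"
proof (induction "is")
  case Nil
  have "Esg s (\<lambda>m. 0) l = (if l = {#} then 1 else 0)" for l
    by (cases l) (auto simp: Esg_def ee_def)
  then have "Esg s (\<lambda>m. 0) = (\<lambda>l. if l = {#} then 1 else 0)" by (rule ext)
  then show ?case by (simp add: sone_eq iota_eq_gser)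
next
  case (Cons i "is")
  then show ?case
    using gser_mult[of "\<lambda>_. 1" "\<lambda>_. 1" "Esg s (w i)" "Esg s (\<lambda>m. \<Sum>i\<leftarrow>is. w i m)"] by (simp add: mconv_Esg[OF s])
qed

section \<open>Extraction of the coefficient of s_1...s_k z_1^0...z_k^0\<close>

definition Phis :: "nat set \<Rightarrow> nat \<Rightarrow> ratfun fls" where "Phis I i = (if i \<in> I then Phi else 1)"

lemma finite_Phis: "finite I \<Longrightarrow> finite {i. Phis I i \<noteq> 1}"
  by (rule finite_subset[of _ I]) (auto simp: Phis_def)

lemma sprod_in_s_Phi: "distinct is \<Longrightarrow> sprod (\<lambda>i. in_s i Phi) is = iota (Phis (set is)) 1"
proof (induction "is")
  case Nil
  then show ?case by (simp add: sone_eq Phis_def[abs_def])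
next
  case (Cons i "is")
  have "in_s i Phi \<star> iota (Phis (set is)) 1 = iota (\<lambda>j. Phis {i} j * Phis (set is) j) (1 * 1)"
    unfolding in_s_eq using iota_mult(1)[OF finite_Phis[of "{i}"] finite_Phis[of "set is"]] by (simp add: Phis_def[abs_def])
  also have "(\<lambda>j. Phis {i} j * Phis (set is) j) = Phis (set (i # is))"
    using Cons.prems by (auto simp: Phis_def fun_eq_iff)
  finally show ?case using Cons by simp
qed

lemma iota_Phis_coeff:
  assumes "finite I" "supp_in (vars_in I) g"
  shows "iota (Phis I) g (\<Sum>i\<in>I. single i 1, 0, {#}) = Psi I g"
  unfolding iota_def Psi_def
proof (rule sum.cong[OF refl], rule arg_cong[of _ _ "(*) _"])
  fix p assume "p \<in> keys g"
  then have p: "p \<in> vars_in I" using assms by (auto simp: supp_in_def)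
  let ?a = "\<Sum>i\<in>I. single i 1 :: nat \<Rightarrow>\<^sub>0 int" and ?A = "\<lambda>i. Phis I i * eexp (lookup (fst p) i)"
  have a: "lookup ?a i = (if i \<in> I then 1 else 0)" for i
    using assms(1) by (simp add: lookup_sum lookup_single when_def)
  have "?A i = 1" if "i \<notin> I" for i
  proof -
    have "i \<notin> keys (fst p)" using p that by (auto simp: vars_in_def)
    then show ?thesis using that by (simp add: Phis_def in_keys_iff)
  qed
  then have sub: "{i. ?A i \<noteq> 1} \<union> keys ?a \<subseteq> I"
    by (auto simp: in_keys_iff a split: if_splits)
  show "smon ?A (snd p) (?a, 0, {#}) = Psi_mon I p"
  proof (cases "snd p = 0")
    case True
    have "smon ?A 0 (?a, 0, {#}) = (\<Prod>i\<in>I. fls_nth (?A i) (lookup ?a i))"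
      by (rule smon_superset[OF assms(1) sub])
    also have "\<dots> = (\<Prod>i\<in>I. psi (lookup (fst p) i))"
      by (rule prod.cong) (simp_all add: a Phis_def psi_def eexp_def)
    finally show ?thesis using True by (simp add: Psi_mon_def)
  qed (auto simp: smon_def Psi_mon_def)
qed

lemma pre_eq:
  "in_s i ((Q_ser ^ n - 1) * inverse T_ser ^ n) \<star> zpow i (- int n) = iota (\<lambda>_. 1) (yy i n)"
proof -
  have "(Q_ser ^ n - 1) * inverse T_ser ^ n = eexp (of_nat n * (jalpha - 1)) - eexp (- of_nat n)"
    by (simp add: Q_ser_eq T_ser_eq eexp_inverse eexp_power eexp_add[symmetric] algebra_simps)
  moreover have "in_s i (A - B) = in_s i A - in_s i B" for A B
    by (rule ext) (auto simp: in_s_def)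
  ultimately have "in_s i ((Q_ser ^ n - 1) * inverse T_ser ^ n) = iota (\<lambda>_. 1)
     (single (single i (of_nat n * (jalpha - 1)), 0) 1 - single (single i (- of_nat n), 0) 1)"
    by (simp add: in_s_eexp fun_eq_iff iota_diff)
  then show ?thesis
    by (simp add: zpow_eq iota_mult_1 yy_def left_diff_distrib mult_single)
qed

lemma supp_Dt: "j \<ge> 1 \<Longrightarrow> supp_in (vars_in {1..j}) (Dt j M)"
proof -
  assume j: "j \<ge> 1"
  have 1: "supp_in (vars_in {1..j}) (XX (j - 1) m)" "supp_in (vars_in {1..j}) (YY (j - 1) m)" for m
    by (rule supp_in_mono[OF supp_XX vars_in_mono], simp) (rule supp_in_mono[OF supp_YY vars_in_mono], simp)
  have 2: "supp_in (vars_in {1..j}) (xx j m)" "supp_in (vars_in {1..j}) (yy j m)" for m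
    using j by (auto intro: supp_in_mono[OF supp_xx(1) vars_in_mono] supp_in_mono[OF supp_yy(1) vars_in_mono])
  show ?thesis unfolding Dt_def
    by (intro supp_in_diff supp_in_sum supp_vars_hh supp_vars_mult 1 2)
qed

lemma supp_Esg: "(\<And>m. supp_in (vars_in I) (g m)) \<Longrightarrow> supp_in (vars_in I) (Esg s g l)"
  by (simp add: Esg_def supp_vars_ee)

definition Xpre :: "nat \<Rightarrow> nat \<Rightarrow> nat \<Rightarrow> lring" where
  "Xpre n k M = yy 1 n * (\<Prod>j\<leftarrow>[2..<Suc k]. Dt j M)"

lemma supp_Xpre: "k \<ge> 1 \<Longrightarrow> supp_in (vars_in {1..k}) (Xpre n k M)"
proof -
  assume k: "k \<ge> 1"
  have "supp_in (vars_in {1..k}) (\<Prod>j\<leftarrow>js. Dt j M)" if "set js \<subseteq> {1..k}" for js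
    using that
  proof (induction js)
    case (Cons j js)
    then show ?case
      by (auto intro!: supp_vars_mult supp_in_mono[OF supp_Dt vars_in_mono])
  qed (simp add: supp_in_1)
  moreover have "set [2..<Suc k] \<subseteq> {1..k}" by auto
  ultimately have "supp_in (vars_in {1..k}) (\<Prod>j\<leftarrow>[2..<Suc k]. Dt j M)" .
  moreover have "supp_in (vars_in {1..k}) (yy 1 n)"
    using k by (auto intro: supp_in_mono[OF supp_yy(1) vars_in_mono])
  ultimately show ?thesis unfolding Xpre_def by (intro supp_vars_mult)
qed

text \<open>At a given \<open>l\<close> the infinite products agree with their truncations from some
  \<open>M0\<close> on. This threshold depends on \<open>l\<close>, so a matrix element has to be
  evaluated at an \<open>M\<close> beyond several of them.\<close>

theorem coeff_vertex_series:
  assumes "k \<ge> 1"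
  shows "\<exists>M0. \<forall>M\<ge>M0. coeff_s_z0 k
      (in_s 1 ((Q_ser ^ n - 1) * inverse T_ser ^ n) \<star> zpow 1 (- int n)
         \<star> sprod (\<lambda>i. in_s i (1 / ((1 - Q_ser) * (1 - inverse T_ser)))) [1..<Suc k]
       \<star> sprod (\<lambda>j. sprod (\<lambda>i. ff i j) [1..<j] - sprod (\<lambda>i. ff j i) [1..<j]) [2..<Suc k]
       \<star> sprod (\<lambda>i. Gamma_minus i T_ser \<star> Gamma_minus_inv i 1) [1..<Suc k]
       \<star> sprod (\<lambda>i. Gamma_plus i (inverse Q_ser * T_ser) \<star> Gamma_plus_inv i T_ser) [1..<Suc k]) l
     = Psi {1..k} (Xpre n k M * mconv (Esg (-1) (XX k)) (Esg 1 (YY k)) l)"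
proof -
  let ?P = "Phis {1..k}" and ?js = "[2..<Suc k]"
  have fin: "finite {i. ?P i \<noteq> 1}" by (rule finite_Phis) simp
  have fin1: "finite {i. (\<lambda>_. 1 :: ratfun fls) i \<noteq> 1}" by simp
  have C: "in_s 1 ((Q_ser ^ n - 1) * inverse T_ser ^ n) \<star> zpow 1 (- int n)
         \<star> sprod (\<lambda>i. in_s i (1 / ((1 - Q_ser) * (1 - inverse T_ser)))) [1..<Suc k] = iota ?P (yy 1 n)"
    using iota_mult(1)[OF fin1 fin, of "yy 1 n" 1] sprod_in_s_Phi[of "[1..<Suc k]"]
    unfolding pre_eq Phi_def[symmetric] by (simp del: upt_Suc add: atLeastLessThanSuc_atLeastAtMost)
  have D: "sprod (\<lambda>j. sprod (\<lambda>i. ff i j) [1..<j] - sprod (\<lambda>i. ff j i) [1..<j]) ?js = sprod Diff ?js"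
    by (rule sprod_cong) (simp add: Diff_def)
  have Gm: "sprod (\<lambda>i. Gamma_minus i T_ser \<star> Gamma_minus_inv i 1) [1..<Suc k] = gser (\<lambda>_. 1) (Esg (-1) (XX k))"
    unfolding Gamma_eq sprod_gser_Esg[of "-1", simplified] sum_list_upt XX_def[abs_def] by simp
  have Gp: "sprod (\<lambda>i. Gamma_plus i (inverse Q_ser * T_ser) \<star> Gamma_plus_inv i T_ser) [1..<Suc k] = gser (\<lambda>_. 1) (Esg 1 (YY k))"
    unfolding Gamma_eq sprod_gser_Esg[of 1, simplified] sum_list_upt YY_def[abs_def] by simp
  let ?F = "gser ?P (\<lambda>l. if l = {#} then yy 1 n else 0) \<star> sprod Diff ?js \<star> gser (\<lambda>_. 1) (Esg (-1) (XX k)) \<star> gser (\<lambda>_. 1) (Esg 1 (YY k))"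
  have "approx (sprod Diff ?js) (\<lambda>M. gser (\<lambda>_. 1) (\<lambda>l. if l = {#} then \<Prod>j\<leftarrow>?js. Dt j M else 0))"
    using approx_sprod_Diff[of ?js] by (simp add: iota_eq_gser del: upt_Suc)
  then have "approx ?F (\<lambda>M. gser ?P (\<lambda>l. if l = {#} then yy 1 n else 0) \<star> gser (\<lambda>_. 1) (\<lambda>l. if l = {#} then \<Prod>j\<leftarrow>?js. Dt j M else 0)
      \<star> gser (\<lambda>_. 1) (Esg (-1) (XX k)) \<star> gser (\<lambda>_. 1) (Esg 1 (YY k)))"
    by (intro approx_mult_gser approx_gser_mult)
  moreover have "gser ?P (\<lambda>l. if l = {#} then yy 1 n else 0) \<star> gser (\<lambda>_. 1) (\<lambda>l. if l = {#} then \<Prod>j\<leftarrow>?js. Dt j M else 0)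
      \<star> gser (\<lambda>_. 1) (Esg (-1) (XX k)) \<star> gser (\<lambda>_. 1) (Esg 1 (YY k)) =
     gser ?P (\<lambda>l. Xpre n k M * mconv (Esg (-1) (XX k)) (Esg 1 (YY k)) l)" for M
  proof -
    have "mconv (mconv (mconv (\<lambda>l. if l = {#} then yy 1 n else 0) (\<lambda>l. if l = {#} then \<Prod>j\<leftarrow>?js. Dt j M else 0))
        (Esg (-1) (XX k))) (Esg 1 (YY k)) = (\<lambda>l. Xpre n k M * mconv (Esg (-1) (XX k)) (Esg 1 (YY k)) l)"
    proof -
      have "mconv (\<lambda>l. if l = {#} then yy 1 n else 0) (\<lambda>l. if l = {#} then \<Prod>j\<leftarrow>?js. Dt j M else 0) =
         (\<lambda>l. if l = {#} then Xpre n k M else 0)"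
        by (rule ext) (simp add: mconv_empty_left Xpre_def)
      moreover have "mconv (\<lambda>l. if l = {#} then Xpre n k M else 0) (Esg (-1) (XX k)) = (\<lambda>l. Xpre n k M * Esg (-1) (XX k) l)"
        by (rule ext) (rule mconv_empty_left)
      ultimately show ?thesis by (simp add: fun_eq_iff mconv_def sum_distrib_left mult.assoc)
    qed
    then show ?thesis
      by (simp add: gser_mult[OF fin fin1, simplified])
  qed
  ultimately have "approx ?F (\<lambda>M. gser ?P (\<lambda>l. Xpre n k M * mconv (Esg (-1) (XX k)) (Esg 1 (YY k)) l))" by simp
  then obtain M0 where M0: "\<And>M a. M \<ge> M0 \<Longrightarrow> ?F (a, 0, l) = gser ?P (\<lambda>l. Xpre n k M * mconv (Esg (-1) (XX k)) (Esg 1 (YY k)) l) (a, 0, l)"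
    unfolding approx_def by meson
  have supp: "supp_in (vars_in {1..k}) (Xpre n k M * mconv (Esg (-1) (XX k)) (Esg 1 (YY k)) l)" for M
    unfolding mconv_def
    by (intro supp_vars_mult supp_Xpre[OF assms] supp_in_sum supp_Esg supp_XX supp_YY)
  show ?thesis
  proof (intro exI allI impI)
    fix M assume M: "M \<ge> M0"
    show "coeff_s_z0 k
      (in_s 1 ((Q_ser ^ n - 1) * inverse T_ser ^ n) \<star> zpow 1 (- int n)
         \<star> sprod (\<lambda>i. in_s i (1 / ((1 - Q_ser) * (1 - inverse T_ser)))) [1..<Suc k]
       \<star> sprod (\<lambda>j. sprod (\<lambda>i. ff i j) [1..<j] - sprod (\<lambda>i. ff j i) [1..<j]) [2..<Suc k]
       \<star> sprod (\<lambda>i. Gamma_minus i T_ser \<star> Gamma_minus_inv i 1) [1..<Suc k]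
       \<star> sprod (\<lambda>i. Gamma_plus i (inverse Q_ser * T_ser) \<star> Gamma_plus_inv i T_ser) [1..<Suc k]) l
     = Psi {1..k} (Xpre n k M * mconv (Esg (-1) (XX k)) (Esg 1 (YY k)) l)"
      unfolding C D Gm Gp coeff_s_z0_def iota_eq_gser M0[OF M]
      using iota_Phis_coeff[OF _ supp] by (simp add: gser_def)
  qed
qed

section \<open>Matrix elements of operators on Fock space\<close>

abbreviation coef :: "fock \<Rightarrow> nms \<Rightarrow> ratfun" where
  "coef v M \<equiv> lookup v (Partition M)"

abbreviation pb :: "nms \<Rightarrow> fock" where "pb M \<equiv> pbasis (Partition M)"

abbreviation flinear :: "(fock \<Rightarrow> fock) \<Rightarrow> bool" where
  "flinear \<equiv> Vector_Spaces.linear fscale fscale"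

lemma Partition_parts [simp]: "Partition (parts l) = l" by (rule parts_inverse)

lemma Partition_eq_iff: "0 \<notin># M \<Longrightarrow> 0 \<notin># N \<Longrightarrow> Partition M = Partition N \<longleftrightarrow> M = N"
  by (metis parts_Partition)

lemma coef_pb: "0 \<notin># M \<Longrightarrow> 0 \<notin># N \<Longrightarrow> coef (pb M) N = (if M = N then 1 else 0)"
  by (simp add: pbasis_def lookup_single when_def Partition_eq_iff)

lemma fock_eqI: "(\<And>M. 0 \<notin># M \<Longrightarrow> coef v M = coef w M) \<Longrightarrow> v = w"
  by (rule poly_mapping_eqI) (metis Partition_parts zero_notin_parts)

lemma flinear_add: "flinear T \<Longrightarrow> T (v + w) = T v + T w"
  and flinear_scale: "flinear T \<Longrightarrow> T (fscale c v) = fscale c (T v)"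
  by (simp_all add: Vector_Spaces.linear_iff)

lemma flinear_0: "flinear T \<Longrightarrow> T 0 = 0"
  using flinear_scale[of T 0 0] by simp

lemma flinear_sum: "flinear T \<Longrightarrow> T (\<Sum>i\<in>I. f i) = (\<Sum>i\<in>I. T (f i))"
  by (induction I rule: infinite_finite_induct) (simp_all add: flinear_add flinear_0)

lemma flinearI:
  "(\<And>v w. T (v + w) = T v + T w) \<Longrightarrow> (\<And>c v. T (fscale c v) = fscale c (T v)) \<Longrightarrow> flinear T"
  by (auto simp: Vector_Spaces.linear_iff fock.vector_space_axioms)

lemma lin_ext_id: "lin_ext pbasis v = v"
proof (rule poly_mapping_eqI)
  fix l
  show "lookup (lin_ext pbasis v) l = lookup v l"
    by (simp add: lin_ext_def lookup_sum pbasis_def lookup_single when_def in_keys_iff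
        if_distrib[of "(*) _"] cong: if_cong)
qed

lemma flinear_lin_ext_eq:
  assumes "flinear T"
  shows "T v = lin_ext (\<lambda>l. T (pbasis l)) v"
proof -
  have "T v = T (lin_ext pbasis v)" by (simp add: lin_ext_id)
  then show ?thesis using assms by (simp add: lin_ext_def flinear_sum flinear_scale)
qed

lemma flinear_eqI:
  assumes "flinear T" "flinear T'" "\<And>M. 0 \<notin># M \<Longrightarrow> T (pb M) = T' (pb M)"
  shows "T = T'"
proof
  fix v
  have "T (pbasis l) = T' (pbasis l)" for l using assms(3)[of "parts l"] by simp
  then show "T v = T' v" using flinear_lin_ext_eq[OF assms(1), of v] flinear_lin_ext_eq[OF assms(2), of v] by simp
qed

lemma coef_flinear:
  assumes "flinear T" "\<And>Q. 0 \<notin># Q \<Longrightarrow> coef v Q \<noteq> 0 \<Longrightarrow> sum_mset Q = d"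
  shows "coef (T v) N = (\<Sum>Q\<in>multisets_of d. coef v Q * coef (T (pb Q)) N)"
proof -
  let ?S = "Partition ` multisets_of d"
  have "T v = (\<Sum>l\<in>?S. fscale (lookup v l) (T (pbasis l)))"
    unfolding flinear_lin_ext_eq[OF assms(1), of v]
  proof (rule lin_ext_superset)
    show "keys v \<subseteq> ?S"
    proof
      fix l assume "l \<in> keys v"
      then have "parts l \<in> multisets_of d"
        using assms(2)[of "parts l"] by (simp add: in_keys_iff multisets_of_def)
      then show "l \<in> ?S" by (metis Partition_parts image_eqI)
    qed
  qed (simp add: finite_multisets_of)
  also have "\<dots> = (\<Sum>Q\<in>multisets_of d. fscale (coef v Q) (T (pb Q)))"
    by (subst sum.reindex) (auto simp: inj_on_def multisets_of_def Partition_eq_iff)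
  finally show ?thesis by (simp add: lookup_sum)
qed

lemma commutator_flinear:
  assumes "flinear A" "flinear B"
  shows "flinear (commutator A B)"
  by (rule flinearI)
     (simp_all add: commutator_def flinear_add[OF assms(1)] flinear_add[OF assms(2)] flinear_scale[OF assms(1)]
       flinear_scale[OF assms(2)] fock.scale_right_diff_distrib)

text \<open>\<open>A\<close> lists the creation indices and \<open>B\<close> the annihilation
  indices of a generalized partition.\<close>

definition gp :: "nms \<Rightarrow> nms \<Rightarrow> gpartition" where
  "gp A B = image_mset (\<lambda>j. - int j) A + image_mset int B"

fun hfold :: "int list \<Rightarrow> fock \<Rightarrow> fock" where
  "hfold [] v = v"
| "hfold (i # is) v = heis i (hfold is v)"

lemma heis_gpart_eq_hfold: "heis_gpart l = hfold (sorted_list_of_multiset l)"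
proof -
  have "foldr (\<lambda>i F. heis i \<circ> F) xs id = hfold xs" for xs
    by (induction xs) (simp_all add: fun_eq_iff)
  then show ?thesis by (simp only: heis_gpart_def)
qed

lemma flinear_hfold: "flinear (hfold is)"
proof (induction "is")
  case Nil show ?case by (rule flinearI) simp_all
next
  case (Cons i "is")
  show ?case
    by (rule flinearI) (simp_all add: flinear_add[OF Cons.IH] flinear_scale[OF Cons.IH]
        flinear_add[OF linear_heis] flinear_scale[OF linear_heis])
qed

text \<open>Sorting puts the annihilation operators to the right, where they act first; their
  factors, each a part times its multiplicity, telescope to z_L / z_(L-B).\<close>

lemma heis_gpart_pb_aux:
  assumes "sorted xs" "0 \<notin> set xs" "0 \<notin># L" "mset xs = gp A B"
  shows "hfold xs (pb L) =
    (if B \<subseteq># L then fscale (zq L (L - B)) (pb (L - B + A)) else 0)"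
  using assms(1,2,4)
proof (induction xs arbitrary: A B)
  case Nil
  then have "A = {#}" "B = {#}" by (auto simp: gp_def)
  then show ?case using zmset_pos[OF assms(3)] by simp
next
  case (Cons x xs)
  have sc: "heis i (fscale c v) = fscale c (heis i v)" for i c v
    using linear_heis by (rule flinear_scale)
  have A0: "0 \<notin># A" "0 \<notin># B"
  proof -
    have n0: "0 \<notin># gp A B" using Cons.prems(2,3) by (metis set_mset_mset)
    show "0 \<notin># A"
    proof
      assume "0 \<in># A"
      then have "- int 0 \<in># gp A B" unfolding gp_def by (metis image_eqI set_image_mset union_iff)
      then show False using n0 by simp
    qed
    show "0 \<notin># B"
    proof
      assume "0 \<in># B"
      then have "int 0 \<in># gp A B" unfolding gp_def by (metis image_eqI set_image_mset union_iff)
      then show False using n0 by simp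
    qed
  qed
  have LB: "0 \<notin># L - B" using assms(3) by (metis in_diffD)
  show ?case
  proof (cases "x < 0")
    case True
    have "x \<in># gp A B" using Cons.prems(3) by (metis list.set_intros(1) set_mset_mset)
    then obtain j where j: "j \<in># A" "x = - int j" using True by (auto simp: gp_def)
    then obtain A' where A': "A = add_mset j A'" by (metis insert_DiffM)
    have "mset xs = gp A' B" using Cons.prems(3) j by (simp add: gp_def A')
    then have IH: "hfold xs (pb L) =
       (if B \<subseteq># L then fscale (zq L (L - B)) (pb (L - B + A')) else 0)"
      by (intro Cons.IH) (use Cons.prems in auto)
    have j0: "j > 0" using j A0 by (metis gr0I)
    have "0 \<notin># L - B + A'" using LB A0 A' by auto
    then have hx: "heis x (pb (L - B + A')) = pb (L - B + A)"
      using j0 by (simp add: j(2) heis_creation A')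
    show ?thesis
    proof (cases "B \<subseteq># L")
      case True
      show ?thesis by (simp only: hfold.simps IH True if_True sc hx)
    qed (simp add: IH flinear_0[OF linear_heis])
  next
    case False
    then have x: "x > 0" using Cons.prems(2) by (metis linorder_neqE list.set_intros(1))
    have A: "A = {#}"
    proof (rule ccontr)
      assume "A \<noteq> {#}"
      then obtain j where "j \<in># A" by (meson multiset_nonemptyE)
      then have "- int j \<in> set (x # xs)" using Cons.prems(3) unfolding set_mset_mset[symmetric] by (simp add: gp_def)
      then have "x \<le> - int j" using Cons.prems(1) by (metis eq_iff list.set_cases set_ConsD sorted_simps(2))
      then show False using x by simp
    qed
    have "x \<in># gp A B" using Cons.prems(3) by (metis list.set_intros(1) set_mset_mset)
    then obtain j where j: "j \<in># B" "x = int j" using x A by (auto simp: gp_def)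
    then obtain B' where B': "B = add_mset j B'" by (metis insert_DiffM)
    have "mset xs = gp A B'" using Cons.prems(3) j by (simp add: gp_def B')
    then have IH: "hfold xs (pb L) =
       (if B' \<subseteq># L then fscale (zq L (L - B')) (pb (L - B')) else 0)"
      using Cons.IH[of A B'] Cons.prems A by simp
    have j0: "j > 0" using x j by simp
    have LB': "0 \<notin># L - B'" using assms(3) by (metis in_diffD)
    have hx: "heis x (pb (L - B')) = fscale (of_nat j * of_nat (count (L - B') j)) (pb (L - B' - {#j#}))"
      using heis_annihilation[OF j0, of "Partition (L - B')"] LB' by (simp add: j(2))
    show ?thesis
    proof (cases "B \<subseteq># L")
      case True
      have "Suc (count B' j) \<le> count L j" using mset_subset_eq_count[OF True, of j] by (simp add: B')
      then have sub: "B' \<subseteq># L" "j \<in># L - B'"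
        using True mset_subset_eq_insertD[of j B' L] by (auto simp: B' in_diff_count intro: subset_mset.less_imp_le)
      have LL: "L - B = L - B' - {#j#}" by (simp add: B')
      have "zmset (L - B') = j * count (L - B') j * zmset (L - B)"
      proof -
        have "L - B' = add_mset j (L - B)" using sub(2) LL by (metis insert_DiffM)
        then show ?thesis by (simp only: zmset_add_mset count_add_mset if_True simp_thms)
      qed
      then have "zq L (L - B') * (of_nat j * of_nat (count (L - B') j)) = (zq L (L - B) :: ratfun)"
        using zmset_pos[OF LB] zmset_pos[OF LB'] by (simp add: divide_simps)
      then show ?thesis using True sub by (simp add: IH sc hx A LL)
    next
      case False
      have "count (L - B') j = 0" if "B' \<subseteq># L"
      proof (rule ccontr)
        assume "count (L - B') j \<noteq> 0"
        then have "{#j#} \<subseteq># L - B'" by (simp add: in_diff_count)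
        then have "{#j#} + B' \<subseteq># L" by (simp only: subset_mset.le_diff_conv2[OF that])
        then show False using False by (simp add: B')
      qed
      then show ?thesis using False flinear_0[OF linear_heis] by (auto simp: IH sc hx)
    qed
  qed
qed

lemma heis_gpart_pb:
  assumes "0 \<notin># L" "0 \<notin># A" "0 \<notin># B"
  shows "heis_gpart (gp A B) (pb L) =
    (if B \<subseteq># L then fscale (zq L (L - B)) (pb (L - B + A)) else 0)"
  unfolding heis_gpart_eq_hfold
  by (rule heis_gpart_pb_aux) (use assms in \<open>auto simp: gp_def\<close>)

lemma gp_cases:
  assumes "0 \<notin># l"
  obtains A B where "0 \<notin># A" "0 \<notin># B" "l = gp A B"
proof -
  let ?A = "image_mset (\<lambda>j. nat (- j)) (filter_mset (\<lambda>j. j < 0) l)"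
  let ?B = "image_mset nat (filter_mset (\<lambda>j. \<not> j < 0) l)"
  have "image_mset (\<lambda>j. - int j) ?A = filter_mset (\<lambda>j. j < 0) l"
    by (simp add: multiset.map_comp comp_def) (rule trans[OF image_mset_cong[of _ _ "\<lambda>j. j"]], auto)
  moreover have "image_mset int ?B = filter_mset (\<lambda>j. \<not> j < 0) l"
    by (simp add: multiset.map_comp comp_def) (rule trans[OF image_mset_cong[of _ _ "\<lambda>j. j"]], auto)
  ultimately have "l = gp ?A ?B" by (simp add: gp_def flip: multiset_partition)
  moreover have "0 \<notin># ?A" "0 \<notin># ?B" using assms by auto
  ultimately show ?thesis using that by blast
qed

lemma gp_inject:
  assumes "0 \<notin># A" "0 \<notin># B" "0 \<notin># A'" "0 \<notin># B'" "gp A B = gp A' B'"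
  shows "A = A' \<and> B = B'"
proof -
  have neg: "filter_mset (\<lambda>j. j < 0) (gp A B) = image_mset (\<lambda>j. - int j) A"
    if "0 \<notin># A" for A B
  proof -
    have "filter_mset (\<lambda>j. j < 0) (image_mset (\<lambda>j. - int j) A) = image_mset (\<lambda>j. - int j) A"
      by (subst filter_mset_eq_conv) (use that in \<open>auto intro: gr0I\<close>)
    moreover have "filter_mset (\<lambda>j. j < 0) (image_mset int B) = {#}" by (induction B) auto
    ultimately show ?thesis by (simp add: gp_def)
  qed
  have 1: "image_mset (\<lambda>j. - int j) A = image_mset (\<lambda>j. - int j) A'" using neg assms by metis
  then have "image_mset (\<lambda>j. nat (- j)) (image_mset (\<lambda>j. - int j) A) = image_mset (\<lambda>j. nat (- j)) (image_mset (\<lambda>j. - int j) A')"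
    by (rule arg_cong)
  then have A: "A = A'" by (simp add: multiset.map_comp comp_def)
  have "image_mset int B = image_mset int B'" using assms(5) A by (simp add: gp_def)
  then have "image_mset nat (image_mset int B) = image_mset nat (image_mset int B')" by (rule arg_cong)
  then show ?thesis using A by (simp add: multiset.map_comp comp_def)
qed

lemma flinear_heis_gpart: "flinear (heis_gpart l)"
  unfolding heis_gpart_eq_hfold by (rule flinear_hfold)

lemma sum_mset_gp: "sum_mset (gp A B) = int (sum_mset B) - int (sum_mset A)"
proof -
  have "sum_mset (image_mset (\<lambda>j. - int j) A) = - int (sum_mset A)" by (induction A) simp_all
  then show ?thesis by (simp add: gp_def)
qed

text \<open>The pairs (B, A) for which a normally ordered product of degree \<open>n\<close> can act
  nontrivially on p_L.\<close>

definition op_supp :: "nat \<Rightarrow> nms \<Rightarrow> (nms \<times> nms) set" where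
  "op_supp n L = (SIGMA B:{B. B \<subseteq># L}. multisets_of (n + sum_mset B))"

lemma finite_op_supp: "finite (op_supp n L)"
  unfolding op_supp_def by (intro finite_SigmaI finite_submultisets finite_multisets_of)

lemma diff_diff_submultiset: "M \<subseteq># L \<Longrightarrow> L - (L - M) = M"
  by (simp add: subseteq_mset_def multiset_eq_iff)

text \<open>Homogeneity leaves finitely many terms of the formal infinite sum acting on each vector,
  so that it defines a linear operator.\<close>

locale homogeneous_coeffs =
  fixes c :: "gpartition \<Rightarrow> ratfun" and n :: nat
  assumes nonzero: "c l \<noteq> 0 \<Longrightarrow> 0 \<notin># l \<and> sum_mset l = - int n"
begin

lemma supp_pb:
  assumes L: "0 \<notin># L" and nz: "fscale (c l) (heis_gpart l (pb L)) \<noteq> 0"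
  shows "l \<in> (\<lambda>(B, A). gp A B) ` op_supp n L"
proof -
  have c: "c l \<noteq> 0" using nz by auto
  obtain A B where AB: "0 \<notin># A" "0 \<notin># B" "l = gp A B" using gp_cases nonzero[OF c] by blast
  have "B \<subseteq># L" using nz heis_gpart_pb[OF L AB(1,2)] by (auto simp: AB(3) split: if_splits)
  moreover have "sum_mset A = n + sum_mset B"
    using nonzero[OF c] unfolding AB(3) sum_mset_gp by linarith
  ultimately have "(B, A) \<in> op_supp n L" using AB by (simp add: op_supp_def multisets_of_def)
  then show ?thesis using AB(3) by force
qed

lemma finite_supp: "finite {l. fscale (c l) (heis_gpart l v) \<noteq> 0}"
proof (rule finite_subset)
  show "{l. fscale (c l) (heis_gpart l v) \<noteq> 0} \<subseteq> (\<Union>m\<in>keys v. (\<lambda>(B, A). gp A B) ` op_supp n (parts m))"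
  proof
    fix l assume "l \<in> {l. fscale (c l) (heis_gpart l v) \<noteq> 0}"
    then have "fscale (c l) (lin_ext (\<lambda>m. heis_gpart l (pbasis m)) v) \<noteq> 0"
      using flinear_lin_ext_eq[OF flinear_heis_gpart, of l v] by simp
    then have "(\<Sum>m\<in>keys v. fscale (c l) (fscale (lookup v m) (heis_gpart l (pbasis m)))) \<noteq> 0"
      unfolding lin_ext_def fock.scale_sum_right .
    then obtain m where m: "m \<in> keys v" "fscale (c l) (fscale (lookup v m) (heis_gpart l (pbasis m))) \<noteq> 0"
      by (meson sum.neutral)
    then have "fscale (c l) (heis_gpart l (pb (parts m))) \<noteq> 0" by auto
    then show "l \<in> (\<Union>m\<in>keys v. (\<lambda>(B, A). gp A B) ` op_supp n (parts m))"
      using supp_pb[of "parts m" l] m(1) by auto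
  qed
qed (simp add: finite_op_supp)

lemma flinear_op_of_coeffs: "flinear (op_of_coeffs c)"
proof (rule flinearI)
  fix v w
  show "op_of_coeffs c (v + w) = op_of_coeffs c v + op_of_coeffs c w"
    unfolding op_of_coeffs_def flinear_add[OF flinear_heis_gpart] fock.scale_right_distrib
    by (rule Sum_any.distrib) (rule finite_supp)+
next
  fix a v
  let ?S = "{l. fscale (c l) (heis_gpart l v) \<noteq> 0}"
  have "op_of_coeffs c (fscale a v) = (\<Sum>l\<in>?S. fscale (c l) (heis_gpart l (fscale a v)))"
    unfolding op_of_coeffs_def
    by (rule Sum_any.expand_superset[OF finite_supp])
       (auto simp: flinear_scale[OF flinear_heis_gpart] mult.commute)
  also have "\<dots> = fscale a (\<Sum>l\<in>?S. fscale (c l) (heis_gpart l v))"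
    by (simp add: flinear_scale[OF flinear_heis_gpart] fock.scale_sum_right mult.commute)
  finally show "op_of_coeffs c (fscale a v) = fscale a (op_of_coeffs c v)"
    by (simp add: op_of_coeffs_def Sum_any.expand_set)
qed

text \<open>A term contributes when L - B + A = N; the multiset M = L - B of untouched parts then
  parametrizes the terms.\<close>

lemma coef_op_of_coeffs:
  assumes L: "0 \<notin># L" and N: "0 \<notin># N"
  shows "coef (op_of_coeffs c (pb L)) N =
    (\<Sum>M | M \<subseteq># N \<and> M \<subseteq># L. c (gp (N - M) (L - M)) * (zq L M))"
proof -
  let ?S = "op_supp n L"
  let ?f = "\<lambda>(B, A). c (gp A B) * (zq L (L - B))"
  have no0: "0 \<notin># A" "0 \<notin># B" "B \<subseteq># L" "sum_mset A = n + sum_mset B" if "(B, A) \<in> ?S" for A B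
    using that L by (auto simp: op_supp_def multisets_of_def dest: mset_subset_eqD)
  have inj: "inj_on (\<lambda>(B, A). gp A B) ?S"
  proof (rule inj_onI)
    fix p q assume pq: "p \<in> ?S" "q \<in> ?S" "(\<lambda>(B, A). gp A B) p = (\<lambda>(B, A). gp A B) q"
    obtain B A B' A' where x: "p = (B, A)" "q = (B', A')" by (cases p, cases q)
    have "A = A' \<and> B = B'"
      by (rule gp_inject) (use pq no0[of B A] no0[of B' A'] in \<open>auto simp: x\<close>)
    then show "p = q" by (simp add: x)
  qed
  have "op_of_coeffs c (pb L) = (\<Sum>l\<in>(\<lambda>(B, A). gp A B) ` ?S. fscale (c l) (heis_gpart l (pb L)))"
    unfolding op_of_coeffs_def
    by (rule Sum_any.expand_superset) (use supp_pb[OF L] finite_op_supp in auto)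
  also have "\<dots> = (\<Sum>(B, A)\<in>?S. fscale (c (gp A B)) (heis_gpart (gp A B) (pb L)))"
    by (subst sum.reindex[OF inj]) (simp add: case_prod_unfold)
  also have "\<dots> = (\<Sum>(B, A)\<in>?S. fscale (?f (B, A)) (pb (L - B + A)))"
    by (rule sum.cong[OF refl]) (use no0 heis_gpart_pb[OF L] in \<open>auto\<close>)
  finally have "coef (op_of_coeffs c (pb L)) N = (\<Sum>(B, A)\<in>?S. ?f (B, A) * coef (pb (L - B + A)) N)"
    by (simp add: lookup_sum case_prod_unfold)
  also have "\<dots> = (\<Sum>(B, A)\<in>?S. if L - B + A = N then ?f (B, A) else 0)"
  proof (rule sum.cong[OF refl])
    fix p assume p: "p \<in> ?S"
    obtain B A where BA: "p = (B, A)" by (cases p)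
    have "0 \<notin># L - B + A" using no0[of B A] p BA L by (auto dest: in_diffD)
    then show "(case p of (B, A) \<Rightarrow> ?f (B, A) * coef (pb (L - B + A)) N) = (case p of (B, A) \<Rightarrow> if L - B + A = N then ?f (B, A) else 0)"
      using coef_pb[OF _ N] by (simp add: BA)
  qed
  also have "\<dots> = (\<Sum>p\<in>{p \<in> ?S. L - fst p + snd p = N}. ?f p)"
    by (rule sum.mono_neutral_cong_right) (auto simp: finite_op_supp split: if_splits)
  also have "\<dots> = (\<Sum>M | M \<subseteq># N \<and> M \<subseteq># L. c (gp (N - M) (L - M)) * (zq L M))"
  proof (cases "sum_mset N = sum_mset L + n")
    case True
    show ?thesis
    proof (rule sum.reindex_bij_witness[of _ "\<lambda>M. (L - M, N - M)" "\<lambda>p. L - fst p"])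
      fix M assume "M \<in> {M. M \<subseteq># N \<and> M \<subseteq># L}"
      then have M: "M \<subseteq># N" "M \<subseteq># L" by auto
      have "sum_mset L = sum_mset M + sum_mset (L - M)" "sum_mset N = sum_mset M + sum_mset (N - M)"
        using M by (metis subset_mset.add_diff_inverse sum_mset.union)+
      then show "(L - M, N - M) \<in> {p \<in> ?S. L - fst p + snd p = N}"
        using M N True by (simp add: op_supp_def multisets_of_def diff_diff_submultiset del: of_nat_sum_mset) (metis in_diffD)
      show "L - fst (L - M, N - M) = M" using M by (simp add: diff_diff_submultiset)
    next
      fix p assume p: "p \<in> {p \<in> ?S. L - fst p + snd p = N}"
      have *: "fst p \<subseteq># L" "L - fst p + snd p = N" using p no0[of "fst p" "snd p"] by auto
      have NA: "N - (L - fst p) = snd p" unfolding *(2)[symmetric] by simp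
      show "(L - (L - fst p), N - (L - fst p)) = p"
        unfolding NA diff_diff_submultiset[OF *(1)] by simp
      have "L - fst p \<subseteq># N" unfolding *(2)[symmetric] by simp
      then show "L - fst p \<in> {M. M \<subseteq># N \<and> M \<subseteq># L}" by simp
      show "c (gp (N - (L - fst p)) (L - (L - fst p))) * (zq L (L - fst p)) = ?f p"
        unfolding NA diff_diff_submultiset[OF *(1)] by (simp add: case_prod_unfold)
    qed
  next
    \<comment> \<open>The degrees do not match: no pair leads to \<open>N\<close> on the left, and
      the coefficients vanish on the right.\<close>
    case False
    have "sum_mset (L - B + A) = sum_mset L + n" if "(B, A) \<in> ?S" for B A
    proof -
      have "sum_mset L = sum_mset B + sum_mset (L - B)"
        using no0[OF that] by (metis subset_mset.add_diff_inverse sum_mset.union)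
      then show ?thesis unfolding sum_mset.union using no0(4)[OF that] by linarith
    qed
    then have empty: "{p \<in> ?S. L - fst p + snd p = N} = {}" using False by auto
    have zero: "c (gp (N - M) (L - M)) = 0" if M: "M \<subseteq># N" "M \<subseteq># L" for M
    proof (rule ccontr)
      assume "c (gp (N - M) (L - M)) \<noteq> 0"
      then have "sum_mset (gp (N - M) (L - M)) = - int n" using nonzero by blast
      then have "int (sum_mset (L - M)) - int (sum_mset (N - M)) = - int n" unfolding sum_mset_gp .
      moreover have "sum_mset L = sum_mset M + sum_mset (L - M)" "sum_mset N = sum_mset M + sum_mset (N - M)"
        using M by (metis subset_mset.add_diff_inverse sum_mset.union)+
      ultimately show False using False by linarith
    qed
    show ?thesis unfolding empty sum.empty by (rule sym, rule sum.neutral) (use zero in simp)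
  qed
  finally show ?thesis .
qed

end

section \<open>Iterated commutators with the vertex operator E\<close>

abbreviation tpow :: "nms \<Rightarrow> nms \<Rightarrow> ratfun" where
  "tpow L N \<equiv> t1 powi (int (size N) - int (size L))"

text \<open>The matrix of E. The index of the variable remains a parameter, since each commutator
  brings in a new variable.\<close>

definition Emat :: "nat \<Rightarrow> nms \<Rightarrow> nms \<Rightarrow> ratfun" where
  "Emat v L N = Psi {v} (GG (xx v) (yy v) L N)"

lemma Emat_degree:
  assumes "Emat v L N \<noteq> 0"
  shows "sum_mset N = sum_mset L"
proof (rule ccontr)
  assume "sum_mset N \<noteq> sum_mset L"
  moreover have "supp_in (zdeg v (int (sum_mset N) - int (sum_mset L)) (int (sum_mset N) - int (sum_mset L))) (GG (xx v) (yy v) L N)"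
    by (rule zdeg_GG) simp_all
  ultimately show False using assms Psi_zdeg unfolding Emat_def by (metis eq_iff_diff_eq_0 linorder_neqE_linordered_idom of_nat_eq_iff)
qed

definition tdeg :: "int \<Rightarrow> lexpt set" where
  "tdeg d = {e. Sum_any (lookup (snd e)) = d}"

lemma tdeg_add: "e \<in> tdeg d \<Longrightarrow> e' \<in> tdeg d' \<Longrightarrow> e + e' \<in> tdeg (d + d')"
  by (simp add: tdeg_def plus_poly_mapping.rep_eq Sum_any.distrib)

lemma tdeg_0: "0 \<in> tdeg 0" by (simp add: tdeg_def zero_poly_mapping.rep_eq)

lemma Psi_tdeg: "supp_in (tdeg d) g \<Longrightarrow> d \<noteq> 0 \<Longrightarrow> Psi I g = 0"
  unfolding Psi_def
proof (rule sum.neutral, rule ballI)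
  fix e assume "supp_in (tdeg d) g" "d \<noteq> 0" "e \<in> keys g"
  then have "snd e \<noteq> 0" by (auto simp: supp_in_def tdeg_def zero_poly_mapping.rep_eq)
  then show "lookup g e * Psi_mon I e = 0" by (simp add: Psi_mon_def)
qed

lemma tdeg_single: "(c, single i d) \<in> tdeg d"
proof -
  have "lookup (single i d) = (\<lambda>j. if j = i then d else 0)"
    by (auto simp: fun_eq_iff lookup_single when_def)
  then show ?thesis by (simp add: tdeg_def)
qed

lemma supp_tdeg_mult: "supp_in (tdeg d) g \<Longrightarrow> supp_in (tdeg d') h \<Longrightarrow> supp_in (tdeg (d + d')) (g * h)"
  by (rule supp_in_mult[OF _ _ tdeg_add])

lemma supp_tdeg: "supp_in (tdeg (int m)) (XX k m)" "supp_in (tdeg (- int m)) (YY k m)"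
  "supp_in (tdeg (int m)) (xx i m)" "supp_in (tdeg (- int m)) (yy i m)"
proof -
  show 1: "supp_in (tdeg (int m)) (xx i m)" "supp_in (tdeg (- int m)) (yy i m)" for i
    unfolding xx_def yy_def by (intro supp_in_diff supp_in_single tdeg_single)+
  show "supp_in (tdeg (int m)) (XX k m)" "supp_in (tdeg (- int m)) (YY k m)"
    unfolding XX_def YY_def by (intro supp_in_sum 1)+
qed

lemma supp_tdeg_ee: "supp_in (tdeg (int (sum_mset A))) (ee (XX k) A)" "supp_in (tdeg (- int (sum_mset A))) (ee (YY k) A)"
proof -
  show "supp_in (tdeg (int (sum_mset A))) (ee (XX k) A)"
  proof (rule supp_in_ee[of "\<lambda>m. tdeg (int m)"])
    show "e + e' \<in> tdeg (int (m + n))" if "e \<in> tdeg (int m)" "e' \<in> tdeg (int n)" for e e' m n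
      using tdeg_add[OF that] by simp
  qed (use supp_tdeg tdeg_0 in simp_all)
  show "supp_in (tdeg (- int (sum_mset A))) (ee (YY k) A)"
  proof (rule supp_in_ee[of "\<lambda>m. tdeg (- int m)"])
    show "e + e' \<in> tdeg (- int (m + n))" if "e \<in> tdeg (- int m)" "e' \<in> tdeg (- int n)" for e e' m n
      using tdeg_add[OF that] by simp
  qed (use supp_tdeg tdeg_0 in simp_all)
qed

lemma supp_tdeg_Xpre: "supp_in (tdeg (- int n)) (Xpre n k M)"
proof -
  have hh: "supp_in (tdeg 0) (hh w r)" if "\<And>m. supp_in (tdeg 0) (w m)" for w r
    by (rule supp_in_hh[of "\<lambda>_. tdeg 0"]) (use that tdeg_0 tdeg_add[of _ 0 _ 0] in auto)
  have "supp_in (tdeg 0) (XX (j - 1) m * yy j m)" "supp_in (tdeg 0) (xx j m * YY (j - 1) m)" for j m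
    using supp_tdeg_mult[OF supp_tdeg(1) supp_tdeg(4)] supp_tdeg_mult[OF supp_tdeg(3) supp_tdeg(2)] by (metis add.right_inverse)+
  then have D: "supp_in (tdeg 0) (Dt j M)" for j
    unfolding Dt_def by (intro supp_in_diff supp_in_sum hh)
  have "supp_in (tdeg 0) (\<Prod>j\<leftarrow>js. Dt j M)" for js
  proof (induction js)
    case (Cons j js)
    then show ?case using supp_tdeg_mult[OF D, of 0] by simp
  qed (simp add: supp_in_1 tdeg_0)
  then show ?thesis unfolding Xpre_def using supp_tdeg_mult[OF supp_tdeg(4), of 0] by simp
qed

lemma supp_tdeg_GG: "supp_in (tdeg (int (sum_mset N) - int (sum_mset L))) (GG (XX k) (YY k) L N)"
  unfolding GG_def
proof (rule supp_in_sum)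
  fix M assume "M \<in> {M. M \<subseteq># N \<and> M \<subseteq># L}"
  then obtain A B where AB: "N = M + A" "L = M + B" by (auto simp: subset_mset.le_iff_add)
  have "supp_in (tdeg (int (sum_mset A) + - int (sum_mset B))) (ee (XX k) A * (lconst (zq L M) * ee (YY k) B))"
    by (intro supp_tdeg_mult supp_in_lconst_mult supp_tdeg_ee)
  moreover have "int (sum_mset N) - int (sum_mset L) = int (sum_mset A) + - int (sum_mset B)" unfolding AB by simp
  ultimately show "supp_in (tdeg (int (sum_mset N) - int (sum_mset L))) (ee (XX k) (N - M) * (lconst (zq L M) * ee (YY k) (L - M)))"
    using AB by (simp del: of_nat_sum_mset)
qed

text \<open>The functional sees only total z-degree 0, and the prefactor has degree -n; so the
  iterated commutator raises the degree by n.\<close>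

lemma Psi_Xpre_GG_degree:
  assumes "Psi I (Xpre n k M * GG (XX k) (YY k) L N) \<noteq> 0"
  shows "sum_mset N = sum_mset L + n"
proof (rule ccontr)
  assume "sum_mset N \<noteq> sum_mset L + n"
  then have "- int n + (int (sum_mset N) - int (sum_mset L)) \<noteq> 0" by linarith
  then show False using assms Psi_tdeg[OF supp_tdeg_mult[OF supp_tdeg_Xpre supp_tdeg_GG]] by blast
qed

lemma t1_neq_0: "t1 \<noteq> 0" and t2_neq_0: "t2 \<noteq> 0"
  by (simp_all add: t1_def t2_def Zero_fract_def eq_fract)

lemma XX_Suc: "XX (Suc k) m = XX k m + xx (Suc k) m" and YY_Suc: "YY (Suc k) m = YY k m + yy (Suc k) m"
  by (simp_all add: XX_def YY_def)

lemma Xpre_Suc: "k \<ge> 1 \<Longrightarrow> Xpre n (Suc k) M = Xpre n k M * Dt (Suc k) M"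
  by (simp add: Xpre_def mult.assoc)

text \<open>Any sufficiently large truncation \<open>M\<close> gives the same result.\<close>

lemma Psi_commutator:
  assumes k: "k \<ge> 1" and L: "0 \<notin># L" and N: "0 \<notin># N" and M: "sum_mset L \<le> M" "sum_mset N \<le> M"
  shows "Psi {1..Suc k} (Xpre n (Suc k) M * GG (XX (Suc k)) (YY (Suc k)) L N) =
    (\<Sum>Q\<in>multisets_of (sum_mset N). Psi {1..k} (Xpre n k M * GG (XX k) (YY k) L Q) * Emat (Suc k) Q N) -
    (\<Sum>Q\<in>multisets_of (sum_mset L). Emat (Suc k) L Q * Psi {1..k} (Xpre n k M * GG (XX k) (YY k) Q N))"
proof -
  have I: "finite {1..k}" "Suc k \<notin> {1..k}" "insert (Suc k) {1..k} = {1..Suc k}" by auto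
  have G: "GG (\<lambda>m. XX k m + xx (Suc k) m) (\<lambda>m. YY k m + yy (Suc k) m) L N = GG (XX (Suc k)) (YY (Suc k)) L N"
    by (simp add: XX_Suc[abs_def] YY_Suc[abs_def])
  show ?thesis
    unfolding Emat_def Psi_GG_left[OF L N I(1,2) M(2) supp_XX supp_YY supp_Xpre[OF k]]
      Psi_GG_right[OF L N I(1,2) M(1) supp_XX supp_YY supp_Xpre[OF k]] I(3) G Psi_diff[symmetric]
    by (simp add: Xpre_Suc[OF k] Dt_def algebra_simps)
qed

text \<open>For k = 1 the product over j is empty and the prefactor is y_n, which is the remainder
  in \<open>GG_add_mset\<close>.\<close>

lemma GG_commutator_creation:
  assumes "0 \<notin># L" "0 \<notin># N" "n > 0"
  shows "Emat 1 (add_mset n L) N - (if n \<in># N then Emat 1 L (N - {#n#}) else 0) = Psi {1..1} (Xpre n 1 M * GG (XX 1) (YY 1) L N)"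
proof -
  have "XX 1 = xx 1" "YY 1 = yy 1" by (simp_all add: XX_def YY_def fun_eq_iff)
  then show ?thesis
    by (simp add: Emat_def GG_add_mset[OF assms] Psi_add Xpre_def)
qed

lemma heis_coef:
  assumes n: "n > 0" and N: "0 \<notin># N"
  shows "coef (heis (- int n) v) N = (if n \<in># N then coef v (N - {#n#}) else 0)"
proof -
  have "heis (- int n) (pb L) = pb (add_mset n L)" if "0 \<notin># L" for L
    using n that by (simp add: heis_creation)
  then have h: "heis (- int n) (pbasis l) = pb (add_mset n (parts l))" for l
    using zero_notin_parts[of l] by (metis Partition_parts)
  have "coef (heis (- int n) v) N = (\<Sum>l\<in>keys v. lookup v l * coef (pb (add_mset n (parts l))) N)"
    unfolding flinear_lin_ext_eq[OF linear_heis, of _ v] by (simp add: lin_ext_def h lookup_sum)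
  also have "\<dots> = (\<Sum>l\<in>keys v. if add_mset n (parts l) = N then lookup v l else 0)"
    by (rule sum.cong[OF refl]) (use n N in \<open>simp add: coef_pb\<close>)
  also have "\<dots> = (if n \<in># N then coef v (N - {#n#}) else 0)"
  proof (cases "n \<in># N")
    case True
    have N0: "0 \<notin># N - {#n#}" using N by (metis in_diffD)
    have "add_mset n (parts l) = N \<longleftrightarrow> l = Partition (N - {#n#})" for l
      using True N0 by (metis Partition_parts add_mset_remove_trivial insert_DiffM parts_Partition)
    then show ?thesis using True by (simp add: in_keys_iff)
  next
    case False
    then have "add_mset n (parts l) \<noteq> N" for l by (metis union_single_eq_member add_mset_add_single)
    then show ?thesis using False by simp
  qed
  finally show ?thesis .
qed

text \<open>The properties of \<open>G1\<close> on which the induction on k is based; they are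
  established further below. The constant \<open>kap\<close> belongs to a scalar operator and
  cancels in commutators.\<close>

context
  fixes kap :: ratfun
  assumes lin: "flinear G1"
    and E: "\<And>v L N. 0 \<notin># L \<Longrightarrow> 0 \<notin># N \<Longrightarrow> Emat v L N = Emat 1 L N"
    and mat: "\<And>L N. 0 \<notin># L \<Longrightarrow> 0 \<notin># N \<Longrightarrow> coef (G1 (pb L)) N =
      t2 * tpow L N * ((if L = N then kap else 0) - Emat 1 L N)"
begin

lemma flinear_deriv_op: "flinear (deriv_op k (heis j))"
  by (induction k) (simp_all add: linear_heis commutator_flinear lin)

lemma G1_degree:
  assumes "0 \<notin># L" "0 \<notin># N" "coef (G1 (pb L)) N \<noteq> 0"
  shows "sum_mset N = sum_mset L"
  using assms Emat_degree[of 1 L N] by (auto simp: mat split: if_splits)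

lemma coef_deriv_op:
  assumes n: "n > 0" and k: "k \<ge> 1"
  shows "0 \<notin># L \<Longrightarrow> 0 \<notin># N \<Longrightarrow> max (sum_mset L) (sum_mset N) \<le> M \<Longrightarrow>
    coef (deriv_op k (heis (- int n)) (pb L)) N =
      (- t2) ^ k * inverse t1 * tpow L N * Psi {1..k} (Xpre n k M * GG (XX k) (YY k) L N)"
  using k
proof (induction k arbitrary: L N M rule: nat_induct_at_least)
  case base
  let ?L = "add_mset n L"
  have L: "0 \<notin># ?L" using base n by simp
  have hL: "heis (- int n) (pb L) = pb ?L" using base n by (simp add: heis_creation)
  have "coef (deriv_op 1 (heis (- int n)) (pb L)) N = coef (G1 (pb ?L)) N - coef (heis (- int n) (G1 (pb L))) N"
    by (simp add: commutator_def hL lookup_minus)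
  also have "\<dots> = coef (G1 (pb ?L)) N - (if n \<in># N then coef (G1 (pb L)) (N - {#n#}) else 0)"
    using heis_coef[OF n] base by simp
  also have "coef (G1 (pb ?L)) N = t2 * (tpow L N * inverse t1) * ((if ?L = N then kap else 0) - Emat 1 ?L N)"
  proof -
    \<comment> \<open>The creation operator adds one part; this is the source of the factor 1/t1 in
      the theorem.\<close>
    have eq: "int (size N) - int (size ?L) = (int (size N) - int (size L)) + - 1" by simp
    have "tpow ?L N = tpow L N * inverse t1"
      unfolding eq by (subst power_int_add) (use t1_neq_0 in simp_all)
    then show ?thesis using mat[OF L] base by simp
  qed
  also have "(if n \<in># N then coef (G1 (pb L)) (N - {#n#}) else 0) =
      t2 * (tpow L N * inverse t1) * ((if ?L = N then kap else 0) - (if n \<in># N then Emat 1 L (N - {#n#}) else 0))"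
  proof (cases "n \<in># N")
    case True
    have N0: "0 \<notin># N - {#n#}" using base by (metis in_diffD)
    have "L = N - {#n#} \<longleftrightarrow> ?L = N" using True by (metis add_mset_remove_trivial insert_DiffM)
    moreover have "size N = Suc (size (N - {#n#}))" using True by (metis insert_DiffM size_add_mset)
    then have eq: "int (size (N - {#n#})) - int (size L) = int (size N) - int (size L) + - 1" by simp
    have "tpow L (N - {#n#}) = tpow L N * inverse t1"
      unfolding eq by (subst power_int_add) (use t1_neq_0 in simp_all)
    ultimately show ?thesis using True mat[OF base(1) N0] by simp
  next
    case False
    then have "?L \<noteq> N" by (metis union_single_eq_member add_mset_add_single)
    then show ?thesis using False by simp
  qed
  also have "t2 * (tpow L N * inverse t1) * ((if ?L = N then kap else 0) - Emat 1 ?L N) -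
      t2 * (tpow L N * inverse t1) * ((if ?L = N then kap else 0) - (if n \<in># N then Emat 1 L (N - {#n#}) else 0)) =
     (- t2) ^ 1 * inverse t1 * tpow L N * (Emat 1 ?L N - (if n \<in># N then Emat 1 L (N - {#n#}) else 0))"
    by (simp add: algebra_simps)
  finally show ?case using GG_commutator_creation[OF base(1,2) n, of M] by simp
next
  case (Suc k)
  let ?D = "deriv_op k (heis (- int n))" and ?P = "\<lambda>L Q. Psi {1..k} (Xpre n k M * GG (XX k) (YY k) L Q)"
  let ?c = "(- t2) ^ k * inverse t1" and ?t = "\<lambda>L N. tpow L N"
  have L: "0 \<notin># L" and N: "0 \<notin># N" and M: "sum_mset L \<le> M" "sum_mset N \<le> M" using Suc.prems by auto
  \<comment> \<open>The powers of t1 depend only on numbers of parts and telescope along L, Q,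
    N.\<close>
  have tt: "?t L Q * ?t Q N = ?t L N" for Q
    using t1_neq_0 by (simp add: power_int_add[symmetric])
  have D: "coef (?D (pb L')) N' = ?c * ?t L' N' * Psi {1..k} (Xpre n k (max (sum_mset L') (sum_mset N')) * GG (XX k) (YY k) L' N')"
    if "0 \<notin># L'" "0 \<notin># N'" for L' N' using Suc.IH[OF that order_refl] .
  have degD: "sum_mset N' = sum_mset L' + n" if "0 \<notin># L'" "0 \<notin># N'" "coef (?D (pb L')) N' \<noteq> 0" for L' N'
    using that(3) unfolding D[OF that(1,2)] by (intro Psi_Xpre_GG_degree) auto
  have left: "coef (G1 (?D (pb L))) N = ?c * ?t L N * t2 * (kap * ?P L N - (\<Sum>Q\<in>multisets_of (sum_mset N). ?P L Q * Emat (Suc k) Q N))"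
  proof (cases "sum_mset N = sum_mset L + n")
    case True
    have "coef (G1 (?D (pb L))) N = (\<Sum>Q\<in>multisets_of (sum_mset N). coef (?D (pb L)) Q * coef (G1 (pb Q)) N)"
      unfolding True by (rule coef_flinear[OF lin]) (use degD L in blast)
    also have "\<dots> = (\<Sum>Q\<in>multisets_of (sum_mset N). ?c * ?t L N * t2 * ((if Q = N then kap * ?P L N else 0) - ?P L Q * Emat (Suc k) Q N))"
    proof (rule sum.cong[OF refl])
      fix Q assume "Q \<in> multisets_of (sum_mset N)"
      then have Q: "0 \<notin># Q" "sum_mset Q = sum_mset N" by (auto simp: multisets_of_def)
      have A: "coef (?D (pb L)) Q = ?c * ?t L Q * ?P L Q" using Suc.IH[OF L Q(1), of M] M Q by simp
      have B: "coef (G1 (pb Q)) N = t2 * ?t Q N * ((if Q = N then kap else 0) - Emat (Suc k) Q N)"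
        using mat[OF Q(1) N] E[OF Q(1) N, of "Suc k"] by simp
      show "coef (?D (pb L)) Q * coef (G1 (pb Q)) N = ?c * ?t L N * t2 * ((if Q = N then kap * ?P L N else 0) - ?P L Q * Emat (Suc k) Q N)"
        unfolding A B tt[of Q, symmetric] by (cases "Q = N") (simp_all add: algebra_simps)
    qed
    also have "\<dots> = ?c * ?t L N * t2 * (kap * ?P L N - (\<Sum>Q\<in>multisets_of (sum_mset N). ?P L Q * Emat (Suc k) Q N))"
      using N by (simp add: sum_distrib_left[symmetric] sum_subtractf finite_multisets_of) (simp add: multisets_of_def)
    finally show ?thesis .
  next
    case False
    have "coef (?D (pb L)) Q * coef (G1 (pb Q)) N = 0" if "0 \<notin># Q" for Q
      using degD[OF L that] G1_degree[OF that N] False by (metis mult_zero_left mult_zero_right)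
    moreover have "coef (G1 (?D (pb L))) N = (\<Sum>Q\<in>multisets_of (sum_mset L + n). coef (?D (pb L)) Q * coef (G1 (pb Q)) N)"
      by (rule coef_flinear[OF lin]) (use degD L in blast)
    ultimately have "coef (G1 (?D (pb L))) N = 0" by (simp only:) (rule sum.neutral, auto simp: multisets_of_def)
    moreover have "?P L Q = 0" if "Q \<in> multisets_of (sum_mset N)" for Q
      using Psi_Xpre_GG_degree[of "{1..k}" n k M L Q] that False by (auto simp: multisets_of_def)
    ultimately show ?thesis using N by (simp add: multisets_of_def)
  qed
  have right: "coef (?D (G1 (pb L))) N = ?c * ?t L N * t2 * (kap * ?P L N - (\<Sum>Q\<in>multisets_of (sum_mset L). Emat (Suc k) L Q * ?P Q N))"
  proof -
    have "coef (?D (G1 (pb L))) N = (\<Sum>Q\<in>multisets_of (sum_mset L). coef (G1 (pb L)) Q * coef (?D (pb Q)) N)"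
      by (rule coef_flinear[OF flinear_deriv_op]) (use G1_degree L in blast)
    also have "\<dots> = (\<Sum>Q\<in>multisets_of (sum_mset L). ?c * ?t L N * t2 * ((if Q = L then kap * ?P L N else 0) - Emat (Suc k) L Q * ?P Q N))"
    proof (rule sum.cong[OF refl])
      fix Q assume "Q \<in> multisets_of (sum_mset L)"
      then have Q: "0 \<notin># Q" "sum_mset Q = sum_mset L" by (auto simp: multisets_of_def)
      have A: "coef (?D (pb Q)) N = ?c * ?t Q N * ?P Q N" using Suc.IH[OF Q(1) N, of M] M Q by simp
      have B: "coef (G1 (pb L)) Q = t2 * ?t L Q * ((if Q = L then kap else 0) - Emat (Suc k) L Q)"
        using mat[OF L Q(1)] E[OF L Q(1), of "Suc k"] by simp
      show "coef (G1 (pb L)) Q * coef (?D (pb Q)) N = ?c * ?t L N * t2 * ((if Q = L then kap * ?P L N else 0) - Emat (Suc k) L Q * ?P Q N)"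
        unfolding A B tt[of Q, symmetric] by (cases "Q = L") (auto simp: algebra_simps)
    qed
    also have "\<dots> = ?c * ?t L N * t2 * (kap * ?P L N - (\<Sum>Q\<in>multisets_of (sum_mset L). Emat (Suc k) L Q * ?P Q N))"
      using L by (simp add: sum_distrib_left[symmetric] sum_subtractf finite_multisets_of) (simp add: multisets_of_def)
    finally show ?thesis .
  qed
  have "coef (deriv_op (Suc k) (heis (- int n)) (pb L)) N = coef (G1 (?D (pb L))) N - coef (?D (G1 (pb L))) N"
    by (simp add: commutator_def lookup_minus)
  also have "\<dots> = (- t2) ^ Suc k * inverse t1 * ?t L N * ((\<Sum>Q\<in>multisets_of (sum_mset N). ?P L Q * Emat (Suc k) Q N)
       - (\<Sum>Q\<in>multisets_of (sum_mset L). Emat (Suc k) L Q * ?P Q N))"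
    unfolding left right by (simp add: algebra_simps)
  finally show ?case unfolding Psi_commutator[OF Suc.hyps L N M] .
qed

end

section \<open>Exponent vectors and dominance\<close>

lemma submultiset_sum_le_take:
  assumes "sorted_wrt (\<ge>) xs" "A \<subseteq># mset xs" "size A \<le> i"
  shows "sum_mset A \<le> sum_list (take i (xs :: nat list))"
  using assms
proof (induction xs arbitrary: A i)
  case (Cons x xs)
  show ?case
  proof (cases "A = {#}")
    case False
    then obtain i' where i: "i = Suc i'" using Cons.prems(3) by (cases i) auto
    \<comment> \<open>Removing the head if it occurs in \<open>A\<close>, and an arbitrary element
      otherwise, keeps the rest of \<open>A\<close> inside the tail.\<close>
    define a where "a = (if x \<in># A then x else (SOME a. a \<in># A))"
    have aA: "a \<in># A" using False by (auto simp: a_def) (meson multiset_nonemptyE someI_ex)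
    have "a \<in> set (x # xs)" using aA Cons.prems(2) by (metis mset_subset_eqD set_mset_mset)
    then have ax: "a \<le> x" using Cons.prems(1) by auto
    have "A - {#a#} \<subseteq># mset xs"
    proof (cases "x \<in># A")
      case True
      then show ?thesis using Cons.prems(2) by (simp add: a_def subset_eq_diff_conv)
    next
      case False
      have "count A v \<le> count (mset xs) v" for v
      proof (cases "v = x")
        case True then show ?thesis using \<open>x \<notin># A\<close> by (simp add: not_in_iff)
      next
        case False then show ?thesis using mset_subset_eq_count[OF Cons.prems(2), of v] by simp
      qed
      then have "A \<subseteq># mset xs" by (simp add: subseteq_mset_def)
      then show ?thesis by (meson diff_subset_eq_self subset_mset.order_trans)
    qed
    moreover have "size (A - {#a#}) \<le> i'" using Cons.prems(3) aA i by (simp add: size_Diff_singleton)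
    ultimately have "sum_mset (A - {#a#}) \<le> sum_list (take i' xs)" using Cons.IH Cons.prems(1) by simp
    moreover have "sum_mset A = a + sum_mset (A - {#a#})" using aA by (metis insert_DiffM sum_mset.add_mset)
    ultimately show ?thesis using ax i by simp
  qed simp
qed simp

lemma sorted_rows: "sorted_wrt (\<ge>) (rows l)"
  by (simp add: rows_def sorted_wrt_rev)

lemma mset_rows: "mset (rows l) = parts l"
  by (simp add: rows_def)

lemma psize_eq_sum_rows: "psize l = sum_list (rows l)"
  by (simp add: psize_def mset_rows[symmetric] sum_mset_sum_list)

lemma dominated_refl: "dominated l l" by (simp add: dominated_def)

lemma dominated_trans: "dominated a b \<Longrightarrow> dominated b c \<Longrightarrow> dominated a c"
  unfolding dominated_def by (metis order_trans)

lemma dominated_antisym: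
  assumes "dominated a b" "dominated b a"
  shows "a = b"
proof -
  have take: "sum_list (take i (rows a)) = sum_list (take i (rows b))" for i
    using assms by (simp add: dominated_def le_antisym)
  have nth: "(if i < length (rows a) then rows a ! i else 0) = (if i < length (rows b) then rows b ! i else 0)" for i
  proof -
    have "sum_list (take (Suc i) xs) = sum_list (take i xs) + (if i < length xs then xs ! i else 0)" for xs :: "nat list"
      by (simp add: take_Suc_conv_app_nth)
    from this[of "rows a"] this[of "rows b"] show ?thesis using take[of i] take[of "Suc i"] by linarith
  qed
  have pos: "rows l ! i > 0" if "i < length (rows l)" for l i
  proof -
    have "rows l ! i \<in># parts l" using that by (metis mset_rows nth_mem set_mset_mset)
    then show ?thesis by (metis gr0I zero_notin_parts)
  qed
  have len: "i < length (rows a) \<longleftrightarrow> i < length (rows b)" for i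
    using nth[of i] pos[of i a] pos[of i b] by (auto split: if_splits)
  have "length (rows a) = length (rows b)" using len[of "length (rows a)"] len[of "length (rows b)"] by auto
  then have "rows a = rows b"
  proof (rule nth_equalityI)
    fix i assume "i < length (rows a)"
    then show "rows a ! i = rows b ! i" using nth[of i] len[of i] by simp
  qed
  then have "parts a = parts b" by (metis mset_rows)
  then show ?thesis by (metis Partition_parts)
qed

definition nz :: "nms \<Rightarrow> nms" where "nz M = filter_mset (\<lambda>v. v \<noteq> 0) M"

lemma zero_notin_nz [simp]: "0 \<notin># nz M" by (simp add: nz_def)

lemma sum_mset_nz: "sum_mset (nz M) = sum_mset M"
  by (induction M) (auto simp: nz_def)

lemma nz_add: "nz (M + N) = nz M + nz N" by (simp add: nz_def)

lemma submultiset_unionE: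
  assumes "A \<subseteq># R + S"
  obtains A1 A2 where "A = A1 + A2" "A1 \<subseteq># R" "A2 \<subseteq># S"
proof
  show "A = (A \<inter># R) + (A - R)" by (metis diff_intersect_left_idem subset_mset.add_diff_inverse subset_mset.inf.cobounded1)
  show "A - R \<subseteq># S" using assms by (simp add: subset_eq_diff_conv add.commute)
qed simp

text \<open>The i largest new parts are compared with at most i old ones: those from
  \<open>R\<close> are kept, and those among c, d are replaced by equally many of a, b with no
  smaller sum.\<close>

lemma dominated_transfer:
  assumes cd: "c + d = a + b" "max c d \<le> max a b"
  shows "dominated (Partition (nz (R + {#c, d#}))) (Partition (nz (R + {#a, b#})))"
  unfolding dominated_def
proof (intro conjI allI)
  show "psize (Partition (nz (R + {#c, d#}))) = psize (Partition (nz (R + {#a, b#})))"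
    using cd by (simp add: psize_def sum_mset_nz)
  fix i
  let ?r = "rows (Partition (nz (R + {#c, d#})))" and ?r' = "rows (Partition (nz (R + {#a, b#})))"
  have sub: "mset (take i ?r) \<subseteq># nz (R + {#c, d#})"
    using mset_rows[of "Partition (nz (R + {#c, d#}))"] by (metis append_take_drop_id mset_append mset_subset_eq_add_left parts_Partition zero_notin_nz)
  then have "mset (take i ?r) \<subseteq># R + {#c, d#}" unfolding nz_def by (meson multiset_filter_subset subset_mset.order_trans)
  then obtain A1 A2 where A: "mset (take i ?r) = A1 + A2" "A1 \<subseteq># R" "A2 \<subseteq># {#c, d#}" by (rule submultiset_unionE)
  have size: "size A1 + size A2 \<le> i" using A(1) by (metis length_take min.cobounded2 size_mset size_union)
  have "\<exists>B2. B2 \<subseteq># {#a, b#} \<and> size B2 = size A2 \<and> sum_mset A2 \<le> sum_mset B2"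
  proof -
    consider "A2 = {#}" | "A2 = {#c#}" | "A2 = {#d#}" | "A2 = {#c, d#}"
    proof -
      have "size A2 \<le> 2" using size_mset_mono[OF A(3)] by simp
      then consider "size A2 = 0" | "size A2 = 1" | "size A2 = 2" by linarith
      then show ?thesis
      proof cases
        case 1 then show ?thesis using that by simp
      next
        case 2
        then obtain v where "A2 = {#v#}" using size_1_singleton_mset by blast
        then show ?thesis using A(3) that by (auto simp: insert_subset_eq_iff)
      next
        case 3
        then have "A2 = {#c, d#}" using A(3) by (metis One_nat_def Suc_1 mset_subset_size nat_less_le size_add_mset size_single subset_mset.le_neq_trans)
        then show ?thesis using that by simp
      qed
    qed
    then show ?thesis
    proof cases
      case 1 then show ?thesis by (intro exI[of _ "{#}"]) simp
    next
      case 2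
      then show ?thesis using cd(2) by (intro exI[of _ "{#max a b#}"]) (auto simp: max_def split: if_splits)
    next
      case 3
      then show ?thesis using cd(2) by (intro exI[of _ "{#max a b#}"]) (auto simp: max_def split: if_splits)
    next
      case 4 then show ?thesis using cd(1) by (intro exI[of _ "{#a, b#}"]) simp
    qed
  qed
  then obtain B2 where B2: "B2 \<subseteq># {#a, b#}" "size B2 = size A2" "sum_mset A2 \<le> sum_mset B2" by blast
  have "sum_list (take i ?r) = sum_mset (A1 + A2)" using A(1) by (metis sum_mset_sum_list)
  also have "\<dots> \<le> sum_mset (A1 + B2)" using B2 by simp
  also have "\<dots> = sum_mset (nz (A1 + B2))" by (simp add: sum_mset_nz)
  also have "\<dots> \<le> sum_list (take i ?r')"
  proof (rule submultiset_sum_le_take[OF sorted_rows])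
    have "A1 + B2 \<subseteq># R + {#a, b#}" using A(2) B2(1) by (rule subset_mset.add_mono)
    then have "nz (A1 + B2) \<subseteq># nz (R + {#a, b#})" unfolding nz_def by (rule multiset_filter_mono)
    then show "nz (A1 + B2) \<subseteq># mset ?r'" unfolding mset_rows parts_Partition[OF zero_notin_nz] .
    have "size (nz (A1 + B2)) \<le> size (A1 + B2)" unfolding nz_def by (rule size_filter_mset_lesseq)
    then show "size (nz (A1 + B2)) \<le> i" using size B2(2) by simp
  qed
  finally show "sum_list (take i ?r) \<le> sum_list (take i ?r')" .
qed

text \<open>The partition whose monomial symmetric function contains the monomial with exponent
  \<open>e\<close>.\<close>

definition ty :: "(nat \<Rightarrow>\<^sub>0 nat) \<Rightarrow> nms" where
  "ty e = image_mset (lookup e) (mset_set (keys e))"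

lemma zero_notin_ty [simp]: "0 \<notin># ty e" by (auto simp: ty_def in_keys_iff)

lemma ty_superset:
  assumes "finite K" "keys e \<subseteq> K"
  shows "ty e = nz (image_mset (lookup e) (mset_set K))"
proof -
  have "mset_set K = mset_set (keys e) + mset_set (K - keys e)"
    using assms by (metis finite_Diff finite_keys mset_set_Union Diff_disjoint Un_Diff_cancel sup.absorb2)
  moreover have "nz (image_mset (lookup e) (mset_set (K - keys e))) = {#}"
  proof -
    have "image_mset (lookup e) (mset_set (K - keys e)) = image_mset (\<lambda>_. 0) (mset_set (K - keys e))"
      by (rule image_mset_cong) (use assms(1) in \<open>simp add: in_keys_iff\<close>)
    then show ?thesis unfolding nz_def by (simp only: filter_mset_image_mset) (simp add: filter_mset_False)
  qed
  moreover have "nz (ty e) = ty e" unfolding nz_def by (rule filter_mset_eq_conv[THEN iffD2]) (auto simp: ty_def in_keys_iff)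
  ultimately show ?thesis by (simp add: nz_add) (simp add: ty_def)
qed

definition upd :: "nat \<Rightarrow> nat \<Rightarrow> nat \<Rightarrow> nat \<Rightarrow> (nat \<Rightarrow>\<^sub>0 nat) \<Rightarrow> nat \<Rightarrow>\<^sub>0 nat" where
  "upd i j c d e = Poly_Mapping.update i c (Poly_Mapping.update j d e)"

lemma lookup_upd: "lookup (upd i j c d e) k = (if k = i then c else if k = j then d else lookup e k)"
  by (simp add: upd_def lookup_update)

lemma keys_upd:
  assumes "keys e \<subseteq> K" "i \<in> K" "j \<in> K"
  shows "keys (upd i j c d e) \<subseteq> K"
proof
  fix x assume x: "x \<in> keys (upd i j c d e)"
  show "x \<in> K"
  proof (rule ccontr)
    assume "x \<notin> K"
    then have "x \<noteq> i" "x \<noteq> j" "x \<notin> keys e" using assms by auto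
    then have "lookup (upd i j c d e) x = 0" unfolding lookup_upd by (simp add: in_keys_iff)
    then show False using x by (simp add: in_keys_iff)
  qed
qed

lemma upd_same: "i \<noteq> j \<Longrightarrow> upd i j (lookup e i) (lookup e j) e = e"
  by (rule poly_mapping_eqI) (simp add: lookup_upd)

lemma ty_upd:
  assumes "i \<noteq> j"
  obtains R where "\<And>c d. ty (upd i j c d e) = nz (R + {#c, d#})"
proof
  fix c d
  let ?K = "insert i (insert j (keys e))"
  let ?R = "image_mset (lookup e) (mset_set (keys e - {i, j}))"
  have K: "?K = insert i (insert j (keys e - {i, j}))" by auto
  have "image_mset (lookup (upd i j c d e)) (mset_set (keys e - {i, j})) = ?R"
    by (rule image_mset_cong) (auto simp: lookup_upd)
  then have "image_mset (lookup (upd i j c d e)) (mset_set ?K) = ?R + {#c, d#}"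
    using assms unfolding K by (simp add: lookup_upd)
  moreover have "ty (upd i j c d e) = nz (image_mset (lookup (upd i j c d e)) (mset_set ?K))"
    by (rule ty_superset) (simp, rule keys_upd, auto)
  ultimately show "ty (upd i j c d e) = nz (?R + {#c, d#})" by simp
qed

text \<open>Equal types have equal sums of squares, and two numbers are determined up to order by
  their sum and their sum of squares.\<close>

lemma sum_squares_upd:
  assumes "ty (upd i j c d e) = ty (upd i j a b e)" "i \<noteq> j" "c + d = a + b"
  shows "c = a \<or> c = b"
proof -
  obtain R where R: "\<And>c d. ty (upd i j c d e) = nz (R + {#c, d#})" using ty_upd[OF assms(2)] by blast
  have sq: "sum_mset (image_mset (\<lambda>v. v * v) (nz M)) = sum_mset (image_mset (\<lambda>v. v * v) M)" for M :: "nms"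
    by (induction M) (auto simp: nz_def)
  have "sum_mset (image_mset (\<lambda>v. v * v) (R + {#c, d#})) = sum_mset (image_mset (\<lambda>v. v * v) (R + {#a, b#}))"
    using assms(1) sq unfolding R by metis
  then have "int c * int c + int d * int d = int a * int a + int b * int b" by (simp flip: of_nat_mult of_nat_add)
  moreover have "int d = int a + int b - int c" using assms(3) by simp
  ultimately have "(int c - int a) * (int c - int b) = 0" by (simp add: algebra_simps)
  then show ?thesis by simp
qed

section \<open>Dunkl-type operators on polynomials\<close>

lemma xconst_0 [simp]: "xconst 0 = 0" and xconst_1 [simp]: "xconst 1 = 1"
  and xconst_add: "xconst (c + d) = xconst c + xconst d"
  and xconst_mult: "xconst (c * d) = xconst c * xconst d"
  and xconst_of_nat [simp]: "xconst (of_nat n) = of_nat n"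
  by (simp_all add: xconst_def single_add mult_single)

lemma xconst_diff: "xconst (c - d) = xconst c - xconst d"
  by (simp add: xconst_def single_diff)

lemma lookup_xconst_mult [simp]: "lookup (xconst c * p) e = c * lookup p e"
  by (simp add: xconst_def mult_map_scale_conv_mult[symmetric] Poly_Mapping.map.rep_eq when_def)

abbreviation mono :: "(nat \<Rightarrow>\<^sub>0 nat) \<Rightarrow> xpoly" where "mono e \<equiv> single e 1"

abbreviation xv :: "nat \<Rightarrow> nat \<Rightarrow> xpoly" where "xv i t \<equiv> mono (single i t)"

lemma mono_mult: "mono d * mono e = mono (d + e)" by (simp add: mult_single)

lemma xv_mult: "xv i s * xv i t = xv i (s + t)" by (simp add: mult_single single_add)

lemma xpoly_eq_sum: "p = (\<Sum>e\<in>keys p. xconst (lookup p e) * mono e)"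
  by (rule poly_mapping_eqI)
     (simp add: lookup_sum lookup_single when_def in_keys_iff
       if_distrib[of "(*) _"] cong: if_cong)

definition xlin :: "((nat \<Rightarrow>\<^sub>0 nat) \<Rightarrow> xpoly) \<Rightarrow> xpoly \<Rightarrow> xpoly" where
  "xlin h p = (\<Sum>e\<in>keys p. xconst (lookup p e) * h e)"

lemma xlin_superset:
  assumes "finite S" "keys p \<subseteq> S"
  shows "xlin h p = (\<Sum>e\<in>S. xconst (lookup p e) * h e)"
  unfolding xlin_def by (rule sum.mono_neutral_left) (use assms in \<open>auto simp: in_keys_iff\<close>)

lemma xlin_add: "xlin h (p + q) = xlin h p + xlin h q"
  using keys_add[of p q]
  by (simp add: xlin_superset[of "keys p \<union> keys q"] lookup_add
      xconst_add distrib_right sum.distrib)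

lemma xlin_xconst: "xlin h (xconst c * p) = xconst c * xlin h p"
proof -
  have "keys (xconst c * p) \<subseteq> keys p" by (auto simp: in_keys_iff)
  then show ?thesis
    by (subst xlin_superset[of "keys p"]) (simp_all add: xlin_def sum_distrib_left mult.assoc xconst_mult)
qed

lemma xlin_mono [simp]: "xlin h (mono e) = h e" by (simp add: xlin_def)

definition xlinear :: "(xpoly \<Rightarrow> xpoly) \<Rightarrow> bool" where
  "xlinear T \<longleftrightarrow> (\<forall>p q. T (p + q) = T p + T q) \<and> (\<forall>c p. T (xconst c * p) = xconst c * T p)"

lemma xlinear_xlin: "xlinear (xlin h)" by (simp add: xlinear_def xlin_add xlin_xconst)

lemma xlinear_add: "xlinear T \<Longrightarrow> T (p + q) = T p + T q"
  and xlinear_xconst: "xlinear T \<Longrightarrow> T (xconst c * p) = xconst c * T p"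
  by (simp_all add: xlinear_def)

lemma xlinear_0: "xlinear T \<Longrightarrow> T 0 = 0"
  using xlinear_xconst[of T 0 0] by simp

lemma xlinear_sum: "xlinear T \<Longrightarrow> T (\<Sum>a\<in>A. f a) = (\<Sum>a\<in>A. T (f a))"
  by (induction A rule: infinite_finite_induct) (simp_all add: xlinear_add xlinear_0)

lemma xlinear_eqI:
  assumes "xlinear T" "xlinear T'" "\<And>e. T (mono e) = T' (mono e)"
  shows "T p = T' p"
  by (subst (1 2) xpoly_eq_sum)
     (simp add: xlinear_sum[OF assms(1)] xlinear_sum[OF assms(2)] xlinear_xconst[OF assms(1)]
       xlinear_xconst[OF assms(2)] assms(3))

lemma xlinear_mult_left: "xlinear (\<lambda>p. q * p)"
  by (simp add: xlinear_def algebra_simps)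

lemma xlinear_compose: "xlinear S \<Longrightarrow> xlinear T \<Longrightarrow> xlinear (\<lambda>p. S (T p))"
  by (simp add: xlinear_def)

lemma xlinear_plus: "xlinear S \<Longrightarrow> xlinear T \<Longrightarrow> xlinear (\<lambda>p. S p + T p)"
  by (simp add: xlinear_def algebra_simps)

lemma xlinear_sum_fun: "(\<And>a. a \<in> A \<Longrightarrow> xlinear (T a)) \<Longrightarrow> xlinear (\<lambda>p. \<Sum>a\<in>A. T a p)"
  by (simp add: xlinear_def sum.distrib sum_distrib_left)

definition Eu :: "nat \<Rightarrow> xpoly \<Rightarrow> xpoly" where
  "Eu i = xlin (\<lambda>e. of_nat (lookup e i) * mono e)"

text \<open>\<open>Del i j\<close> is the operator \<open>x\<^sub>i (x\<^sub>i - x\<^sub>j)\<^sup>-\<^sup>1 (1 - s\<^sub>i\<^sub>j)\<close>.\<close>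

definition Fs :: "nat \<Rightarrow> nat \<Rightarrow> (nat \<Rightarrow>\<^sub>0 nat) \<Rightarrow> nat \<Rightarrow> nat \<Rightarrow> xpoly" where
  "Fs i j e s a = (\<Sum>c=1..a. mono (upd i j c (s - c) e))"

definition Del :: "nat \<Rightarrow> nat \<Rightarrow> xpoly \<Rightarrow> xpoly" where
  "Del i j = xlin (\<lambda>e. Fs i j e (lookup e i + lookup e j) (lookup e i)
     - Fs i j e (lookup e i + lookup e j) (lookup e j))"

lemma power_sum_mult: "power_sum N m * p = (\<Sum>l<N. xv l m * p)"
  by (simp add: power_sum_def sum_distrib_right)

lemma Eu_power_sum:
  assumes "i < N"
  shows "Eu i (power_sum N m * p) = of_nat m * xv i m * p + power_sum N m * Eu i p"
proof (rule xlinear_eqI[of "\<lambda>p. Eu i (power_sum N m * p)" "\<lambda>p. of_nat m * xv i m * p + power_sum N m * Eu i p"])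
  show "xlinear (\<lambda>p. Eu i (power_sum N m * p))"
    unfolding Eu_def by (rule xlinear_compose[OF xlinear_xlin xlinear_mult_left])
  show "xlinear (\<lambda>p. of_nat m * xv i m * p + power_sum N m * Eu i p)"
    unfolding Eu_def by (rule xlinear_plus[OF xlinear_mult_left xlinear_compose[OF xlinear_mult_left xlinear_xlin]])
  fix e
  have "Eu i (xv l m * mono e) = (if l = i then of_nat m * xv i m * mono e else 0) + xv l m * Eu i (mono e)" for l
    by (simp add: Eu_def mono_mult lookup_add lookup_single when_def algebra_simps)
  then have "(\<Sum>l<N. Eu i (xv l m * mono e)) = (\<Sum>l<N. if l = i then of_nat m * xv i m * mono e else 0) + power_sum N m * Eu i (mono e)"
    by (simp add: sum.distrib power_sum_mult)
  then show "Eu i (power_sum N m * mono e) = of_nat m * xv i m * mono e + power_sum N m * Eu i (mono e)"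
    using assms by (simp add: power_sum_mult xlinear_sum[OF xlinear_xlin[of "\<lambda>e. of_nat (lookup e i) * mono e", folded Eu_def]])
qed

lemma upd_add_i: "i \<noteq> j \<Longrightarrow> single i m + upd i j c d e = upd i j (c + m) d e"
  and upd_add_j: "i \<noteq> j \<Longrightarrow> single j m + upd i j c d e = upd i j c (d + m) e"
  and upd_add_other: "l \<noteq> i \<Longrightarrow> l \<noteq> j \<Longrightarrow> single l m + upd i j c d e = upd i j c d (single l m + e)"
  and upd_base: "upd i j c d (single i m + e) = upd i j c d e"
    "upd i j c d (single j m + e) = upd i j c d e"
    "upd i j c d (e + single i m) = upd i j c d e"
    "upd i j c d (e + single j m) = upd i j c d e"
  by (auto intro!: poly_mapping_eqI simp: lookup_add lookup_upd lookup_single when_def)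

lemma Fs_mult_j: "i \<noteq> j \<Longrightarrow> a \<le> s \<Longrightarrow> xv j m * Fs i j e s a = Fs i j e (s + m) a"
  unfolding Fs_def sum_distrib_left mono_mult
  by (rule sum.cong[OF refl]) (simp add: upd_add_j)

text \<open>Multiplication by x_i^m shifts the range of the summation, so the first m terms have to
  be subtracted.\<close>

lemma Fs_mult_i:
  assumes "i \<noteq> j"
  shows "xv i m * Fs i j e s a = Fs i j e (s + m) (a + m) - Fs i j e (s + m) m"
proof -
  have "Fs i j e (s + m) (a + m) = (\<Sum>c=1..m. mono (upd i j c (s + m - c) e)) + (\<Sum>c=m+1..a+m. mono (upd i j c (s + m - c) e))"
    unfolding Fs_def using sum.ub_add_nat[of 1 m "\<lambda>c. mono (upd i j c (s + m - c) e)" a] by (simp add: add.commute)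
  moreover have "(\<Sum>c=m+1..a+m. mono (upd i j c (s + m - c) e)) = xv i m * Fs i j e s a"
  proof -
    have "(\<Sum>c=m+1..a+m. mono (upd i j c (s + m - c) e)) = (\<Sum>c=1..a. mono (upd i j (c + m) (s + m - (c + m)) e))"
      using sum.shift_bounds_cl_nat_ivl[of "\<lambda>c. mono (upd i j c (s + m - c) e)" 1 m a] by (simp add: add.commute)
    then show ?thesis unfolding Fs_def sum_distrib_left mono_mult upd_add_i[OF assms] by simp
  qed
  ultimately show ?thesis by (simp add: Fs_def)
qed

text \<open>A power sum is invariant under the exchange of x_i and x_j and so passes the divided
  difference. On monomials the two terms x_i^m and x_j^m have to be treated together.\<close>

lemma Del_power_sum:
  assumes "i < N" "j < N" "i \<noteq> j"
  shows "Del i j (power_sum N m * p) = power_sum N m * Del i j p"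
proof (rule xlinear_eqI[of "\<lambda>p. Del i j (power_sum N m * p)" "\<lambda>p. power_sum N m * Del i j p"])
  show "xlinear (\<lambda>p. Del i j (power_sum N m * p))"
    unfolding Del_def by (rule xlinear_compose[OF xlinear_xlin xlinear_mult_left])
  show "xlinear (\<lambda>p. power_sum N m * Del i j p)"
    unfolding Del_def by (rule xlinear_compose[OF xlinear_mult_left xlinear_xlin])
  fix e :: "nat \<Rightarrow>\<^sub>0 nat"
  define a b where "a = lookup e i" and "b = lookup e j"
  have De: "Del i j (mono e) = Fs i j e (a + b) a - Fs i j e (a + b) b"
    by (simp add: Del_def a_def b_def)
  have i: "Del i j (xv i m * mono e) = Fs i j e (a + b + m) (a + m) - Fs i j e (a + b + m) b"
    using assms(3) by (simp add: Del_def mono_mult lookup_add lookup_single a_def b_def Fs_def upd_base add_ac)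
  have j: "Del i j (xv j m * mono e) = Fs i j e (a + b + m) a - Fs i j e (a + b + m) (b + m)"
    using assms(3) by (simp add: Del_def mono_mult lookup_add lookup_single a_def b_def Fs_def upd_base add_ac)
  have ij: "Del i j (xv i m * mono e) + Del i j (xv j m * mono e) = (xv i m + xv j m) * Del i j (mono e)"
    unfolding i j De distrib_right right_diff_distrib Fs_mult_i[OF assms(3)]
    using Fs_mult_j[OF assms(3), of a "a + b" m e] Fs_mult_j[OF assms(3), of b "a + b" m e] by simp
  have other: "Del i j (xv l m * mono e) = xv l m * Del i j (mono e)" if "l \<noteq> i" "l \<noteq> j" for l
    using that unfolding De
    by (simp add: Del_def mono_mult lookup_add lookup_single a_def b_def Fs_def
        right_diff_distrib sum_distrib_left upd_add_other)
  have split: "sum f {..<N} = f i + f j + sum f ({..<N} - {i, j})" for f :: "nat \<Rightarrow> xpoly"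
  proof -
    have "sum f {..<N} = sum f ({..<N} - {i, j}) + sum f {i, j}"
      by (rule sum.subset_diff) (use assms in auto)
    then show ?thesis using assms(3) by simp
  qed
  have "Del i j (power_sum N m * mono e) = (\<Sum>l<N. Del i j (xv l m * mono e))"
    unfolding power_sum_mult Del_def by (rule xlinear_sum[OF xlinear_xlin])
  also have "\<dots> = (xv i m + xv j m) * Del i j (mono e) + (\<Sum>l\<in>{..<N} - {i, j}. xv l m * Del i j (mono e))"
    unfolding split ij by (simp add: other)
  also have "\<dots> = power_sum N m * Del i j (mono e)"
    unfolding power_sum_mult split by (simp add: distrib_right)
  finally show "Del i j (power_sum N m * mono e) = power_sum N m * Del i j (mono e)" .
qed

lemma Del_xv: "i \<noteq> j \<Longrightarrow> Del i j (xv i t) = (\<Sum>c=1..t. xv i c * xv j (t - c))"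
proof -
  assume "i \<noteq> j"
  then have "upd i j c d (single i t) = single i c + single j d" for c d
    by (auto intro!: poly_mapping_eqI simp: lookup_add lookup_upd lookup_single when_def)
  then show ?thesis using \<open>i \<noteq> j\<close> by (simp add: Del_def Fs_def mono_mult lookup_single)
qed

definition Yop :: "nat \<Rightarrow> nat \<Rightarrow> xpoly \<Rightarrow> xpoly" where
  "Yop N i p = xconst jalpha * Eu i p + (\<Sum>j\<in>{..<N} - {i}. Del i j p)"

lemma xlinear_Yop: "xlinear (Yop N i)"
  unfolding Yop_def[abs_def] Eu_def Del_def
  by (intro xlinear_plus xlinear_sum_fun xlinear_xlin xlinear_compose[OF xlinear_mult_left])

section \<open>Graded Fock space and specialization of variables\<close>

text \<open>Degrees are integers because annihilation may lead below 0, where only the zero vector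
  is homogeneous.\<close>

definition hom :: "int \<Rightarrow> fock \<Rightarrow> bool" where
  "hom d f \<longleftrightarrow> (\<forall>Q. 0 \<notin># Q \<longrightarrow> coef f Q \<noteq> 0 \<longrightarrow> int (sum_mset Q) = d)"

lemma hom_0 [simp]: "hom d 0" by (simp add: hom_def)

lemma hom_add: "hom d f \<Longrightarrow> hom d g \<Longrightarrow> hom d (f + g)"
  unfolding hom_def lookup_add by (metis add_0)

lemma hom_scale: "hom d f \<Longrightarrow> hom d (fscale c f)" by (simp add: hom_def)

lemma hom_diff: "hom d f \<Longrightarrow> hom d g \<Longrightarrow> hom d (f - g)"
  unfolding hom_def lookup_minus by (metis diff_zero)

lemma hom_sum: "(\<And>a. a \<in> A \<Longrightarrow> hom d (f a)) \<Longrightarrow> hom d (\<Sum>a\<in>A. f a)"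
  by (induction A rule: infinite_finite_induct) (simp_all add: hom_add)

lemma hom_pb: "0 \<notin># L \<Longrightarrow> d = int (sum_mset L) \<Longrightarrow> hom d (pb L)"
  by (simp add: hom_def coef_pb)

lemma hom_induct [consumes 1, case_names zero add scale pb]:
  assumes "hom d f" "P 0" "\<And>f g. P f \<Longrightarrow> P g \<Longrightarrow> P (f + g)" "\<And>c f. P f \<Longrightarrow> P (fscale c f)"
    "\<And>L. 0 \<notin># L \<Longrightarrow> int (sum_mset L) = d \<Longrightarrow> P (pb L)"
  shows "P f"
proof -
  have "P (\<Sum>l\<in>K. fscale (lookup f l) (pbasis l))" if "K \<subseteq> keys f" "finite K" for K
    using that(2,1)
  proof (induction K)
    case (insert l K)
    have "coef f (parts l) \<noteq> 0" using insert.prems by (simp add: in_keys_iff)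
    then have "int (sum_mset (parts l)) = d" using assms(1) unfolding hom_def by (metis zero_notin_parts)
    then have "P (pbasis l)" using assms(5)[of "parts l"] by simp
    then show ?case using insert assms(3,4) by simp
  qed (use assms(2) in simp)
  from this[of "keys f"] show ?thesis using lin_ext_id[of f] by (simp add: lin_ext_def)
qed

lemma hom_heis:
  assumes "hom d f"
  shows "hom (d - k) (heis k f)"
  using assms
proof (induction rule: hom_induct)
  case zero show ?case by (simp add: flinear_0[OF linear_heis])
next
  case (add f g) then show ?case by (simp add: flinear_add[OF linear_heis] hom_add)
next
  case (scale c f) then show ?case by (simp add: flinear_scale[OF linear_heis] hom_scale)
next
  case (pb L)
  consider "k = 0" | m where "m > 0" "k = - int m" | m where "m > 0" "k = int m"
  proof (cases "k = 0")
    case False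
    then show ?thesis using that(2)[of "nat (- k)"] that(3)[of "nat k"] by (cases "k < 0") simp_all
  qed
  then show ?case
  proof cases
    case 1 then show ?thesis by (simp add: heis_def)
  next
    case 2
    then show ?thesis using pb heis_creation[of m "Partition L"] by (auto intro!: hom_pb)
  next
    case 3
    have L0: "0 \<notin># L - {#m#}" using pb(1) by (metis in_diffD)
    show ?thesis
    proof (cases "m \<in># L")
      case True
      have "sum_mset L = m + sum_mset (L - {#m#})" using True by (metis insert_DiffM sum_mset.add_mset)
      then show ?thesis using pb 3 heis_annihilation[of m "Partition L"] L0
        by (auto intro!: hom_scale hom_pb simp del: of_nat_sum_mset)
    next
      case False
      then show ?thesis using pb(1) 3 heis_annihilation[of m "Partition L"] by (simp add: not_in_iff)
    qed
  qed
qed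

abbreviation rho :: "nat \<Rightarrow> fock \<Rightarrow> xpoly" where "rho \<equiv> restrict_vars"

abbreviation psm :: "nat \<Rightarrow> nms \<Rightarrow> xpoly" where
  "psm N M \<equiv> prod_mset (image_mset (power_sum N) M)"

lemma rho_superset:
  assumes "finite S" "keys f \<subseteq> S"
  shows "rho N f = (\<Sum>l\<in>S. xconst (lookup f l) * psm N (parts l))"
  unfolding restrict_vars_def by (rule sum.mono_neutral_left) (use assms in \<open>auto simp: in_keys_iff\<close>)

lemma rho_add: "rho N (f + g) = rho N f + rho N g"
  using keys_add[of f g]
  by (simp add: rho_superset[of "keys f \<union> keys g"] lookup_add
      xconst_add distrib_right sum.distrib)

lemma rho_scale: "rho N (fscale c f) = xconst c * rho N f"
proof -
  have "keys (fscale c f) \<subseteq> keys f" by (auto simp: in_keys_iff)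
  then show ?thesis
    by (subst rho_superset[of "keys f"]) (simp_all add: restrict_vars_def sum_distrib_left mult.assoc xconst_mult)
qed

lemma rho_0 [simp]: "rho N 0 = 0" by (simp add: restrict_vars_def)

lemma rho_sum: "rho N (\<Sum>a\<in>A. f a) = (\<Sum>a\<in>A. rho N (f a))"
  by (induction A rule: infinite_finite_induct) (simp_all add: rho_add)

lemma rho_pb: "0 \<notin># L \<Longrightarrow> rho N (pb L) = psm N L"
  by (simp add: restrict_vars_def pbasis_def)

lemma rho_creation:
  assumes "m > 0"
  shows "rho N (heis (- int m) f) = power_sum N m * rho N f"
proof -
  have "rho N (heis (- int m) (pbasis l)) = power_sum N m * rho N (pbasis l)" for l
    using rho_pb[of "add_mset m (parts l)" N] rho_pb[of "parts l" N] assms by (simp add: heis_creation)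
  then have "rho N (lin_ext (\<lambda>l. heis (- int m) (pbasis l)) f) = power_sum N m * rho N (lin_ext pbasis f)"
    by (simp add: lin_ext_def rho_sum rho_scale sum_distrib_left mult.left_commute)
  then show ?thesis using flinear_lin_ext_eq[OF linear_heis, of "- int m" f] by (simp add: lin_ext_id)
qed

lemma Del_rho:
  assumes "i < N" "j < N" "i \<noteq> j"
  shows "Del i j (rho N f * p) = rho N f * Del i j p"
proof -
  have D: "xlinear (Del i j)" unfolding Del_def by (rule xlinear_xlin)
  have psm: "Del i j (psm N M * p) = psm N M * Del i j p" for M
    by (induction M) (simp_all add: mult.assoc Del_power_sum[OF assms])
  show ?thesis
    unfolding restrict_vars_def sum_distrib_right xlinear_sum[OF D] mult.assoc xlinear_xconst[OF D] psm ..
qed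

lemma commutator_heis_pb:
  assumes "k \<noteq> 0" "m \<noteq> 0"
  shows "heis k (heis m f) = heis m (heis k f) + (if k = - m then fscale (of_int k) f else 0)"
proof -
  have "commutator (heis k) (heis m) = (\<lambda>f. if k = - m then fscale (of_int k) f else 0)"
  proof (rule flinear_eqI)
    show "flinear (\<lambda>f. if k = - m then fscale (of_int k) f else 0)"
      by (rule flinearI) (simp_all add: fock.scale_right_distrib mult.commute)
  qed (simp_all add: commutator_flinear linear_heis heisenberg_relation[OF assms])
  from fun_cong[OF this, of f] show ?thesis by (simp add: commutator_def algebra_simps)
qed

text \<open>The operator x_i d/dx_i sends p_m to m x_i^m, so it acts on a symmetric f as the sum of
  x_i^m times m df/dp_m. The degree bound \<open>D\<close> makes this sum finite.\<close>

lemma Eu_rho: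
  assumes "hom d f" "d \<le> int D" "i < N"
  shows "Eu i (rho N f * xv i t) = of_nat t * (rho N f * xv i t) + (\<Sum>m=1..D. rho N (heis (int m) f) * xv i (m + t))"
proof -
  have E: "xlinear (Eu i)" unfolding Eu_def by (rule xlinear_xlin)
  have base: "Eu i (psm N L * xv i t) = of_nat t * (psm N L * xv i t) + (\<Sum>m=1..D. rho N (heis (int m) (pb L)) * xv i (m + t))"
    if "sum_mset L \<le> D" "0 \<notin># L" for L
    using that
  proof (induction L)
    case empty
    have "rho N (heis (int m) (pb {#})) = 0" if "m \<in> {1..D}" for m
      using that heis_vacuum[of m] by (simp add: vacuum_def)
    then have s0: "(\<Sum>m=1..D. rho N (heis (int m) (pb {#})) * xv i (m + t)) = 0" by simp
    have "Eu i (xv i t) = of_nat t * xv i t" by (simp add: Eu_def lookup_single)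
    then show ?case unfolding s0 by simp
  next
    case (add r L)
    have r: "r > 0" "r \<le> D" "0 \<notin># L" "sum_mset L \<le> D" using add.prems by (auto intro: gr0I)
    have pbr: "pb (add_mset r L) = heis (- int r) (pb L)" using heis_creation[of r "Partition L"] r by simp
    have h: "rho N (heis (int m) (pb (add_mset r L))) * xv i (m + t) =
        power_sum N r * (rho N (heis (int m) (pb L)) * xv i (m + t)) + (if m = r then of_nat r * xv i r * (psm N L * xv i t) else 0)"
      if "m \<in> {1..D}" for m
    proof -
      have "heis (int m) (pb (add_mset r L)) = heis (- int r) (heis (int m) (pb L)) + (if m = r then fscale (of_nat r) (pb L) else 0)"
        unfolding pbr using commutator_heis_pb[of "int m" "- int r" "pb L"] that r by auto
      then show ?thesis
        using r by (cases "m = r") (simp_all add: rho_add rho_creation rho_scale rho_pb xv_mult[symmetric] algebra_simps)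
    qed
    have "(\<Sum>m=1..D. rho N (heis (int m) (pb (add_mset r L))) * xv i (m + t)) =
        power_sum N r * (\<Sum>m=1..D. rho N (heis (int m) (pb L)) * xv i (m + t)) + of_nat r * xv i r * (psm N L * xv i t)"
      (is "?l = _")
    proof -
      have "?l = (\<Sum>m=1..D. power_sum N r * (rho N (heis (int m) (pb L)) * xv i (m + t)) + (if m = r then of_nat r * xv i r * (psm N L * xv i t) else 0))"
        by (rule sum.cong[OF refl]) (rule h)
      then show ?thesis using r by (simp add: sum.distrib sum_distrib_left)
    qed
    then show ?case using add.IH[OF r(4,3)] Eu_power_sum[OF assms(3), of r "psm N L * xv i t"]
      by (simp add: mult.assoc distrib_left mult.left_commute)
  qed
  show ?thesis using assms(1)
  proof (induction rule: hom_induct)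
    case zero show ?case by (simp add: xlinear_0[OF E] flinear_0[OF linear_heis])
  next
    case (add f g)
    then show ?case by (simp add: rho_add distrib_right distrib_left xlinear_add[OF E] flinear_add[OF linear_heis] sum.distrib)
  next
    case (scale c f)
    then show ?case by (simp add: rho_scale mult.assoc xlinear_xconst[OF E] flinear_scale[OF linear_heis] distrib_left sum_distrib_left mult.left_commute)
  next
    case (pb L)
    then have "sum_mset L \<le> D" using assms(2) by linarith
    then show ?case using base[of L] pb by (simp add: rho_pb)
  qed
qed

text \<open>Symmetric factors pass the exchange terms, which vanish for t = 0. For t > 0 the sum
  over j turns x_j^(t-c) into p_(t-c) - x_i^(t-c); here c = t yields p_0 = N, the only explicit
  dependence on N.\<close>

lemma Yop_rho:
  assumes f: "hom d f" "d \<le> int D" "i < N"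
  shows "Yop N i (rho N f * xv i t) = xconst jalpha * (of_nat t * (rho N f * xv i t) + (\<Sum>m=1..D. rho N (heis (int m) f) * xv i (m + t)))
     + (if t = 0 then 0 else (of_nat N - of_nat t) * (rho N f * xv i t) + (\<Sum>c=1..<t. rho N (heis (- int (t - c)) f) * xv i c))"
proof -
  have ps: "(\<Sum>j\<in>{..<N} - {i}. xv j r) = power_sum N r - xv i r" for r
    using f(3) by (simp add: power_sum_def sum_diff)
  have "(\<Sum>j\<in>{..<N} - {i}. Del i j (rho N f * xv i t)) = (\<Sum>j\<in>{..<N} - {i}. rho N f * (\<Sum>c=1..t. xv i c * xv j (t - c)))"
    by (rule sum.cong[OF refl]) (use f(3) in \<open>auto simp: Del_rho Del_xv\<close>)
  also have "\<dots> = rho N f * (\<Sum>c=1..t. \<Sum>j\<in>{..<N} - {i}. xv i c * xv j (t - c))"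
    by (simp add: sum_distrib_left) (rule sum.swap)
  also have "\<dots> = rho N f * (\<Sum>c=1..t. xv i c * (power_sum N (t - c) - xv i (t - c)))"
    by (simp add: sum_distrib_left[symmetric] ps)
  also have "(\<Sum>c=1..t. xv i c * (power_sum N (t - c) - xv i (t - c))) = (\<Sum>c=1..t. xv i c * power_sum N (t - c)) - of_nat t * xv i t"
  proof -
    have "(\<Sum>c=1..t. xv i c * xv i (t - c)) = (\<Sum>c=1..t. xv i t)" by (rule sum.cong[OF refl]) (simp add: xv_mult)
    then show ?thesis by (simp add: right_diff_distrib sum_subtractf)
  qed
  finally have A: "(\<Sum>j\<in>{..<N} - {i}. Del i j (rho N f * xv i t)) = rho N f * ((\<Sum>c=1..t. xv i c * power_sum N (t - c)) - of_nat t * xv i t)" .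
  have B: "rho N f * ((\<Sum>c=1..t. xv i c * power_sum N (t - c)) - of_nat t * xv i t) =
     (of_nat N - of_nat t) * (rho N f * xv i t) + (\<Sum>c=1..<t. rho N (heis (- int (t - c)) f) * xv i c)" if "t \<noteq> 0"
  proof -
    have "{1..t} = insert t {1..<t}" using that by auto
    then have e1: "(\<Sum>c=1..t. xv i c * power_sum N (t - c)) = xv i t * power_sum N 0 + (\<Sum>c=1..<t. xv i c * power_sum N (t - c))" by simp
    have e2: "power_sum N 0 = of_nat N" by (simp add: power_sum_def)
    have e3: "(\<Sum>c=1..<t. rho N (heis (- int (t - c)) f) * xv i c) = rho N f * (\<Sum>c=1..<t. xv i c * power_sum N (t - c))"
      unfolding sum_distrib_left
    proof (rule sum.cong[OF refl])
      fix c assume "c \<in> {1..<t}"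
      then have "t - c > 0" by simp
      from rho_creation[OF this] show "rho N (heis (- int (t - c)) f) * xv i c = rho N f * (xv i c * power_sum N (t - c))"
        by (simp only: mult_ac)
    qed
    show ?thesis unfolding e1 e2 e3 by (simp only: algebra_simps)
  qed
  show ?thesis
  proof (cases "t = 0")
    case False
    show ?thesis unfolding Yop_def A Eu_rho[OF f] B[OF False] using False by simp
  next
    case True
    show ?thesis unfolding Yop_def A Eu_rho[OF f] using True by simp
  qed
qed

section \<open>Self-adjoint operators on Fock space from the Dunkl operators\<close>

text \<open>With \<open>\<theta>\<^sub>i f = \<Sum>\<^sub>t f\<^sub>t x\<^sub>i\<^sup>t\<close>, the operator \<open>Lop\<close> satisfies \<open>(Y\<^sub>i - N) \<theta>\<^sub>i = \<theta>\<^sub>i Lop\<close> for every number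
  \<open>N\<close> of variables. Hence \<open>Hop k\<close> specializes to \<open>\<Sum>\<^sub>i (Y\<^sub>i - N)\<^sup>k Y\<^sub>i\<close>, and it is self-adjoint because \<open>Lop\<close> is.\<close>

definition Lop :: "nat \<Rightarrow> (nat \<Rightarrow> fock) \<Rightarrow> nat \<Rightarrow> fock" where
  "Lop n f t = fscale ((jalpha - 1) * of_nat t) (f t) + (\<Sum>s=1..n-t. heis (- int s) (f (t + s)))
     + fscale jalpha (\<Sum>m=1..<t. heis (int m) (f (t - m)))"

text \<open>The first application of Y_i, which turns a symmetric function into a combination of
  x_i^t with t > 0.\<close>

definition Dvec :: "fock \<Rightarrow> nat \<Rightarrow> fock" where "Dvec f = (\<lambda>t. fscale jalpha (heis (int t) f))"

definition Hop :: "nat \<Rightarrow> nat \<Rightarrow> fock \<Rightarrow> fock" where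
  "Hop k n f = (\<Sum>t=1..n. heis (- int t) ((Lop n ^^ k) (Dvec f) t))"

definition theta :: "nat \<Rightarrow> nat \<Rightarrow> nat \<Rightarrow> (nat \<Rightarrow> fock) \<Rightarrow> xpoly" where
  "theta N n i f = (\<Sum>t=1..n. rho N (f t) * xv i t)"

text \<open>Total degree n leaves no room for t > n, so the truncations at \<open>n\<close> in
  \<open>Lop\<close> and \<open>theta\<close> lose nothing.\<close>

definition homv :: "nat \<Rightarrow> (nat \<Rightarrow> fock) \<Rightarrow> bool" where
  "homv n f \<longleftrightarrow> (\<forall>t\<in>{1..n}. hom (int n - int t) (f t))"

lemma sum_triangle_swap1:
  "(\<Sum>t=1..n. \<Sum>c=1..<t. g t c) = (\<Sum>t=1..n. \<Sum>s=1..n-t. g (t + s) (t::nat))"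
  for g :: "nat \<Rightarrow> nat \<Rightarrow> 'b::comm_monoid_add"
proof -
  have "(\<Sum>t=1..n. \<Sum>c=1..<t. g t c) = (\<Sum>p\<in>(SIGMA t:{1..n}. {1..<t}). g (fst p) (snd p))"
    by (subst sum.Sigma) (auto simp: case_prod_unfold)
  also have "\<dots> = (\<Sum>p\<in>(SIGMA t:{1..n}. {1..n-t}). g (fst p + snd p) (fst p))"
    by (rule sum.reindex_bij_witness[of _ "\<lambda>p. (fst p + snd p, fst p)" "\<lambda>p. (snd p, fst p - snd p)"]) auto
  also have "\<dots> = (\<Sum>t=1..n. \<Sum>s=1..n-t. g (t + s) t)"
    by (subst sum.Sigma) (auto simp: case_prod_unfold)
  finally show ?thesis .
qed

lemma sum_triangle_swap2:
  "(\<Sum>t=1..n. \<Sum>m=1..n-t. h m t) = (\<Sum>t=1..n. \<Sum>m=1..<t. h m (t - m :: nat))"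
  for h :: "nat \<Rightarrow> nat \<Rightarrow> 'b::comm_monoid_add"
proof -
  have "(\<Sum>t=1..n. \<Sum>m=1..n-t. h m t) = (\<Sum>p\<in>(SIGMA t:{1..n}. {1..n-t}). h (snd p) (fst p))"
    by (subst sum.Sigma) (auto simp: case_prod_unfold)
  also have "\<dots> = (\<Sum>p\<in>(SIGMA t:{1..n}. {1..<t}). h (snd p) (fst p - snd p))"
    by (rule sum.reindex_bij_witness[of _ "\<lambda>p. (fst p - snd p, snd p)" "\<lambda>p. (fst p + snd p, snd p)"]) auto
  also have "\<dots> = (\<Sum>t=1..n. \<Sum>m=1..<t. h m (t - m))"
    by (subst sum.Sigma) (auto simp: case_prod_unfold)
  finally show ?thesis .
qed

lemma homv_Dvec: "hom (int n) f \<Longrightarrow> homv n (Dvec f)"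
  by (simp add: homv_def Dvec_def hom_scale hom_heis)

lemma homv_Lop:
  assumes "homv n f"
  shows "homv n (Lop n f)"
  unfolding homv_def
proof
  fix t assume t: "t \<in> {1..n}"
  have f: "hom (int n - int t) (f t)" if "t \<in> {1..n}" for t using assms that by (simp add: homv_def)
  have "hom (int n - int t) (heis (- int s) (f (t + s)))" if "s \<in> {1..n-t}" for s
  proof -
    have "t + s \<in> {1..n}" using that t by auto
    from hom_heis[OF f[OF this], of "- int s"] show ?thesis by simp
  qed
  moreover have "hom (int n - int t) (heis (int m) (f (t - m)))" if "m \<in> {1..<t}" for m
  proof -
    have "t - m \<in> {1..n}" using that t by auto
    from hom_heis[OF f[OF this], of "int m"] show ?thesis using that by (simp add: of_nat_diff)
  qed
  ultimately show "hom (int n - int t) (Lop n f t)"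
    unfolding Lop_def by (intro hom_add hom_scale hom_sum f[OF t])
qed

definition Yh :: "nat \<Rightarrow> nat \<Rightarrow> xpoly \<Rightarrow> xpoly" where
  "Yh N i p = Yop N i p - of_nat N * p"

lemma Yh_theta:
  assumes f: "homv n f" and i: "i < N"
  shows "Yh N i (theta N n i f) = theta N n i (Lop n f)"
proof -
  let ?c = "xconst jalpha"
  have "Yop N i (theta N n i f) = (\<Sum>t=1..n. Yop N i (rho N (f t) * xv i t))"
    unfolding theta_def by (rule xlinear_sum[OF xlinear_Yop])
  also have "\<dots> = (\<Sum>t=1..n. of_nat N * (rho N (f t) * xv i t) + xconst ((jalpha - 1) * of_nat t) * (rho N (f t) * xv i t)
      + ?c * (\<Sum>m=1..n-t. rho N (heis (int m) (f t)) * xv i (m + t)) + (\<Sum>c=1..<t. rho N (heis (- int (t - c)) (f t)) * xv i c))"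
  proof (rule sum.cong[OF refl])
    fix t assume t: "t \<in> {1..n}"
    have h: "hom (int n - int t) (f t)" using f t by (simp add: homv_def)
    have d: "int n - int t \<le> int (n - t)" "t \<noteq> 0" using t by auto
    show "Yop N i (rho N (f t) * xv i t) = of_nat N * (rho N (f t) * xv i t) + xconst ((jalpha - 1) * of_nat t) * (rho N (f t) * xv i t)
      + ?c * (\<Sum>m=1..n-t. rho N (heis (int m) (f t)) * xv i (m + t)) + (\<Sum>c=1..<t. rho N (heis (- int (t - c)) (f t)) * xv i c)"
      unfolding Yop_rho[OF h d(1) i] if_not_P[OF d(2)] xconst_mult xconst_diff xconst_of_nat xconst_1
      by (simp only: algebra_simps mult_1_left mult_1_right)
  qed
  also have "\<dots> = of_nat N * theta N n i f + (\<Sum>t=1..n. xconst ((jalpha - 1) * of_nat t) * (rho N (f t) * xv i t))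
      + ?c * (\<Sum>t=1..n. \<Sum>m=1..n-t. rho N (heis (int m) (f t)) * xv i (m + t))
      + (\<Sum>t=1..n. \<Sum>c=1..<t. rho N (heis (- int (t - c)) (f t)) * xv i c)"
    unfolding theta_def sum.distrib sum_distrib_left ..
  also have "(\<Sum>t=1..n. \<Sum>m=1..n-t. rho N (heis (int m) (f t)) * xv i (m + t)) =
      (\<Sum>t=1..n. \<Sum>m=1..<t. rho N (heis (int m) (f (t - m))) * xv i (m + (t - m)))"
    by (rule sum_triangle_swap2)
  also have "\<dots> = (\<Sum>t=1..n. \<Sum>m=1..<t. rho N (heis (int m) (f (t - m))) * xv i t)"
    by (intro sum.cong refl) simp
  also have "(\<Sum>t=1..n. \<Sum>c=1..<t. rho N (heis (- int (t - c)) (f t)) * xv i c) =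
      (\<Sum>t=1..n. \<Sum>s=1..n-t. rho N (heis (- int (t + s - t)) (f (t + s))) * xv i t)"
    by (rule sum_triangle_swap1)
  also have "\<dots> = (\<Sum>t=1..n. \<Sum>s=1..n-t. rho N (heis (- int s) (f (t + s))) * xv i t)"
    by (intro sum.cong refl) simp
  finally have Y: "Yop N i (theta N n i f) = of_nat N * theta N n i f
      + (\<Sum>t=1..n. xconst ((jalpha - 1) * of_nat t) * (rho N (f t) * xv i t))
      + ?c * (\<Sum>t=1..n. \<Sum>m=1..<t. rho N (heis (int m) (f (t - m))) * xv i t)
      + (\<Sum>t=1..n. \<Sum>s=1..n-t. rho N (heis (- int s) (f (t + s))) * xv i t)" .
  have "theta N n i (Lop n f) = (\<Sum>t=1..n. xconst ((jalpha - 1) * of_nat t) * (rho N (f t) * xv i t)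
      + (\<Sum>s=1..n-t. rho N (heis (- int s) (f (t + s))) * xv i t) + ?c * (\<Sum>m=1..<t. rho N (heis (int m) (f (t - m))) * xv i t))"
    unfolding theta_def Lop_def rho_add rho_scale rho_sum distrib_right sum_distrib_right mult.assoc ..
  then show ?thesis unfolding Yh_def Y sum.distrib sum_distrib_left[symmetric] by (simp only: algebra_simps)
qed

lemma Yop_rho_Dvec:
  assumes f: "hom (int n) f" and i: "i < N"
  shows "Yop N i (rho N f) = theta N n i (Dvec f)"
  using Yop_rho[OF f order_refl i, of 0]
  by (simp add: theta_def Dvec_def rho_scale sum_distrib_left mult.assoc)

lemma sum_theta: "(\<Sum>i<N. theta N n i f) = rho N (\<Sum>t=1..n. heis (- int t) (f t))"
proof -
  have "(\<Sum>i<N. theta N n i f) = (\<Sum>t=1..n. \<Sum>i<N. rho N (f t) * xv i t)"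
    unfolding theta_def by (rule sum.swap)
  also have "\<dots> = (\<Sum>t=1..n. rho N (heis (- int t) (f t)))"
    by (rule sum.cong[OF refl])
       (simp add: rho_creation power_sum_def sum_distrib_left[symmetric] mult.commute)
  finally show ?thesis by (simp add: rho_sum)
qed

lemma homv_Lop_power: "homv n f \<Longrightarrow> homv n ((Lop n ^^ k) f)"
  by (induction k) (simp_all add: homv_Lop)

lemma rho_Hop:
  assumes "hom (int n) f"
  shows "rho N (Hop k n f) = (\<Sum>i<N. (Yh N i ^^ k) (Yop N i (rho N f)))"
proof -
  have "(Yh N i ^^ k) (theta N n i (Dvec f)) = theta N n i ((Lop n ^^ k) (Dvec f))" if "i < N" for i
    by (induction k) (simp_all add: Yh_theta[OF homv_Lop_power[OF homv_Dvec[OF assms]] that])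
  then have "(\<Sum>i<N. (Yh N i ^^ k) (Yop N i (rho N f))) = (\<Sum>i<N. theta N n i ((Lop n ^^ k) (Dvec f)))"
    by (intro sum.cong refl) (simp add: Yop_rho_Dvec[OF assms])
  then show ?thesis unfolding Hop_def sum_theta by simp
qed

lemma hom_Hop:
  assumes "hom (int n) f"
  shows "hom (int n) (Hop k n f)"
  unfolding Hop_def
proof (rule hom_sum)
  fix t assume "t \<in> {1..n}"
  then have "hom (int n - int t) ((Lop n ^^ k) (Dvec f) t)"
    using homv_Lop_power[OF homv_Dvec[OF assms], of k] by (simp add: homv_def)
  from hom_heis[OF this, of "- int t"] show "hom (int n) (heis (- int t) ((Lop n ^^ k) (Dvec f) t))" by simp
qed

lemma Lop_add: "Lop n (\<lambda>t. f t + g t) = (\<lambda>t. Lop n f t + Lop n g t)"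
  by (rule ext) (simp add: Lop_def flinear_add[OF linear_heis] sum.distrib fock.scale_right_distrib)

lemma Lop_scale: "Lop n (\<lambda>t. fscale c (f t)) = (\<lambda>t. fscale c (Lop n f t))"
  by (rule ext) (simp add: Lop_def flinear_scale[OF linear_heis] fock.scale_sum_right fock.scale_right_distrib mult.commute)

lemma flinear_Hop: "flinear (Hop k n)"
proof (rule flinearI)
  fix v w
  have "(Lop n ^^ k) (\<lambda>t. f t + g t) = (\<lambda>t. (Lop n ^^ k) f t + (Lop n ^^ k) g t)" for f g
    by (induction k) (simp_all add: Lop_add)
  then show "Hop k n (v + w) = Hop k n v + Hop k n w"
    by (simp add: Hop_def Dvec_def[abs_def] flinear_add[OF linear_heis] fock.scale_right_distrib sum.distrib)
next
  fix c v
  have "(Lop n ^^ k) (\<lambda>t. fscale c (f t)) = (\<lambda>t. fscale c ((Lop n ^^ k) f t))" for f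
    by (induction k) (simp_all add: Lop_scale)
  from this[of "\<lambda>t. fscale jalpha (heis (int t) v)"] show "Hop k n (fscale c v) = fscale c (Hop k n v)"
    by (simp add: Hop_def Dvec_def[abs_def] flinear_scale[OF linear_heis] fock.scale_sum_right mult.commute)
qed

lemma fock_induct [case_names zero add scale pb]:
  assumes "P 0" "\<And>f g. P f \<Longrightarrow> P g \<Longrightarrow> P (f + g)" "\<And>c f. P f \<Longrightarrow> P (fscale c f)"
    "\<And>L. 0 \<notin># L \<Longrightarrow> P (pb L)"
  shows "P f"
proof -
  have "P (pbasis l)" for l using assms(4)[of "parts l"] by simp
  then have "P (\<Sum>l\<in>K. fscale (lookup f l) (pbasis l))" for K
    by (induction K rule: infinite_finite_induct) (simp_all add: assms(1-3))
  from this[of "keys f"] show ?thesis using lin_ext_id[of f] by (simp add: lin_ext_def)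
qed

section \<open>The Jack form and self-adjointness\<close>

abbreviation jf :: "fock \<Rightarrow> fock \<Rightarrow> ratfun" where "jf \<equiv> jack_form jalpha"

lemma jf_superset:
  assumes "finite S" "keys f \<subseteq> S"
  shows "jf f g = (\<Sum>m\<in>S. lookup f m * lookup g m * of_nat (zee m) * jalpha ^ plen m)"
  unfolding jack_form_def by (rule sum.mono_neutral_left) (use assms in \<open>auto simp: in_keys_iff\<close>)

lemma jf_commute: "jf f g = jf g f"
proof -
  let ?S = "keys f \<union> keys g"
  show ?thesis by (simp add: jf_superset[of ?S] mult.commute[of "lookup f _"])
qed

lemma jf_add_right: "jf f (g + h) = jf f g + jf f h"
  by (simp add: jack_form_def lookup_add distrib_right distrib_left sum.distrib)

lemma jf_scale_right: "jf f (fscale c g) = c * jf f g"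
  by (simp add: jack_form_def sum_distrib_left mult_ac)

lemma jf_add_left: "jf (f + g) h = jf f h + jf g h"
  and jf_scale_left: "jf (fscale c f) h = c * jf f h"
  by (simp_all add: jf_commute[of _ h] jf_add_right jf_scale_right)

lemma jf_0 [simp]: "jf f 0 = 0" "jf 0 f = 0" by (simp_all add: jack_form_def)

lemma jf_sum_right: "jf f (\<Sum>a\<in>A. g a) = (\<Sum>a\<in>A. jf f (g a))"
  by (induction A rule: infinite_finite_induct) (simp_all add: jf_add_right)

lemma jf_sum_left: "jf (\<Sum>a\<in>A. g a) f = (\<Sum>a\<in>A. jf (g a) f)"
  by (simp add: jf_commute[of _ f] jf_sum_right)

lemma zee_Partition: "0 \<notin># L \<Longrightarrow> zee (Partition L) = zmset L"
  by (simp add: zee_def zmset_def)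

lemma jf_pb_right: "0 \<notin># M \<Longrightarrow> jf f (pb M) = coef f M * of_nat (zmset M) * jalpha ^ size M"
  by (subst jf_commute) (simp add: jack_form_def pbasis_def zee_Partition plen_def)

text \<open>On basis vectors the recursion of z_M for a new part m, together with one factor alpha
  per part, gives exactly this adjoint.\<close>

lemma jf_creation:
  assumes "m > 0"
  shows "jf (heis (- int m) f) g = jf f (fscale jalpha (heis (int m) g))"
proof (induction g rule: fock_induct)
  case zero show ?case by (simp add: flinear_0[OF linear_heis])
next
  case (add g h) then show ?case by (simp add: flinear_add[OF linear_heis] fock.scale_right_distrib jf_add_right)
next
  case (scale c g) then show ?case by (simp add: flinear_scale[OF linear_heis] jf_scale_right mult.left_commute)
next
  case (pb M)
  have c: "coef (heis (- int m) f) M = (if m \<in># M then coef f (M - {#m#}) else 0)"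
    by (rule heis_coef[OF assms pb])
  have a: "heis (int m) (pb M) = fscale (of_nat m * of_nat (count M m)) (pb (M - {#m#}))"
    using heis_annihilation[OF assms, of "Partition M"] pb by simp
  show ?case
  proof (cases "m \<in># M")
    case True
    then obtain M' where M': "M = add_mset m M'" by (metis insert_DiffM)
    have "0 \<notin># M'" using pb by (simp add: M')
    then show ?thesis using pb c a
      by (simp add: jf_pb_right jf_scale_right zmset_add_mset M' mult_ac) (simp add: distrib_left)
  next
    case False
    then have "count M m = 0" by (simp add: not_in_iff)
    then have "heis (int m) (pb M) = 0" "coef (heis (- int m) f) M = 0" using False c a by simp_all
    then show ?thesis using pb by (simp add: jf_pb_right)
  qed
qed

lemma jf_annihilation:
  assumes "m > 0"
  shows "jf (fscale jalpha (heis (int m) f)) g = jf f (heis (- int m) g)"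
  using jf_creation[OF assms, of g f] by (simp add: jf_commute)

definition vform :: "nat \<Rightarrow> (nat \<Rightarrow> fock) \<Rightarrow> (nat \<Rightarrow> fock) \<Rightarrow> ratfun" where
  "vform n f g = (\<Sum>t=1..n. jf (f t) (g t))"

text \<open>The diagonal term is symmetric, and the raising and the lowering sum are exchanged by
  the adjunction \<open>jf_creation\<close>.\<close>

lemma vform_Lop: "vform n (Lop n f) g = vform n f (Lop n g)"
proof -
  have c2: "(\<Sum>t=1..n. \<Sum>s=1..n-t. jf (heis (- int s) (f (t + s))) (g t)) =
      (\<Sum>t=1..n. \<Sum>m=1..<t. jf (f t) (fscale jalpha (heis (int m) (g (t - m)))))"
  proof -
    have "(\<Sum>t=1..n. \<Sum>s=1..n-t. jf (heis (- int s) (f (t + s))) (g t)) =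
        (\<Sum>t=1..n. \<Sum>s=1..n-t. jf (f (t + s)) (fscale jalpha (heis (int s) (g t))))"
      by (intro sum.cong refl jf_creation) simp
    also have "\<dots> = (\<Sum>t=1..n. \<Sum>m=1..<t. jf (f (t - m + m)) (fscale jalpha (heis (int m) (g (t - m)))))"
      by (rule sum_triangle_swap2)
    also have "\<dots> = (\<Sum>t=1..n. \<Sum>m=1..<t. jf (f t) (fscale jalpha (heis (int m) (g (t - m)))))"
      by (intro sum.cong refl) simp
    finally show ?thesis .
  qed
  have c3: "(\<Sum>t=1..n. \<Sum>m=1..<t. jf (fscale jalpha (heis (int m) (f (t - m)))) (g t)) =
      (\<Sum>t=1..n. \<Sum>s=1..n-t. jf (f t) (heis (- int s) (g (t + s))))"
  proof -
    have "(\<Sum>t=1..n. \<Sum>m=1..<t. jf (fscale jalpha (heis (int m) (f (t - m)))) (g t)) =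
        (\<Sum>t=1..n. \<Sum>m=1..<t. jf (f (t - m)) (heis (- int m) (g (t - m + m))))"
      by (intro sum.cong refl) (simp add: jf_annihilation)
    also have "\<dots> = (\<Sum>t=1..n. \<Sum>s=1..n-t. jf (f t) (heis (- int s) (g (t + s))))"
      by (rule sum_triangle_swap2[symmetric])
    finally show ?thesis .
  qed
  have "vform n (Lop n f) g = (\<Sum>t=1..n. jf (f t) (fscale ((jalpha - 1) * of_nat t) (g t)))
      + (\<Sum>t=1..n. \<Sum>s=1..n-t. jf (heis (- int s) (f (t + s))) (g t))
      + (\<Sum>t=1..n. \<Sum>m=1..<t. jf (fscale jalpha (heis (int m) (f (t - m)))) (g t))"
    by (simp only: vform_def Lop_def jf_add_left jf_sum_left fock.scale_sum_right sum.distrib jf_scale_left[of "_ * _"] jf_scale_right[of _ "_ * _"])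
  also have "\<dots> = vform n f (Lop n g)"
    unfolding c2 c3
    by (simp only: vform_def Lop_def jf_add_right jf_sum_right fock.scale_sum_right sum.distrib add_ac)
  finally show ?thesis .
qed

text \<open>The final sum of the p_t f_t is the adjoint D' of D = \<open>Dvec\<close>, so
  \<open>Hop\<close> has the form D' L^k D with L self-adjoint.\<close>

lemma jf_Hop: "jf (Hop k n f) g = jf f (Hop k n g)"
proof -
  have 1: "jf (Hop k n f) g = vform n ((Lop n ^^ k) (Dvec f)) (Dvec g)" for f g
    unfolding Hop_def vform_def jf_sum_left Dvec_def[of g]
    by (rule sum.cong[OF refl]) (simp add: jf_creation)
  have 2: "vform n ((Lop n ^^ k) u) v = vform n u ((Lop n ^^ k) v)" for u v
    by (induction k arbitrary: u v) (simp_all add: vform_Lop funpow_swap1)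
  have "vform n u v = vform n v u" for u v by (simp add: vform_def jf_commute)
  then show ?thesis using 1[of f g] 1[of g f] 2 by (metis jf_commute)
qed

lemma jalpha_neq_0: "jalpha \<noteq> 0"
  using t1_neq_0 t2_neq_0 by (simp add: jalpha_def)

lemma jf_nondegenerate:
  assumes "\<And>M. 0 \<notin># M \<Longrightarrow> jf f (pb M) = 0"
  shows "f = 0"
proof (rule fock_eqI)
  fix M :: "nms" assume M: "0 \<notin># M"
  then show "coef f M = coef 0 M"
    using assms[OF M] zmset_pos[OF M] jalpha_neq_0 by (simp add: jf_pb_right)
qed

lemma jf_hom_0:
  assumes "hom d f" "hom d' g" "d \<noteq> d'"
  shows "jf f g = 0"
  unfolding jack_form_def
proof (rule sum.neutral, rule ballI)
  fix l
  have "coef f (parts l) = 0 \<or> coef g (parts l) = 0" using assms unfolding hom_def by (metis zero_notin_parts)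
  then show "lookup f l * lookup g l * of_nat (zee l) * jalpha ^ plen l = 0" by auto
qed

section \<open>Coefficients in the monomial basis\<close>

lemma lookup_mono_mult: "lookup (mono d * q) (d + e) = lookup q e"
  and lookup_mono_mult_0: "(\<And>e'. e \<noteq> d + e') \<Longrightarrow> lookup (mono d * q) e = 0"
proof -
  have *: "mono d * q = (\<Sum>e'\<in>keys q. xconst (lookup q e') * mono (d + e'))"
    by (subst (1) xpoly_eq_sum[of q]) (simp only: sum_distrib_left mult.left_commute[of "mono d"] mono_mult)
  show "lookup (mono d * q) (d + e) = lookup q e"
    unfolding * by (simp add: lookup_sum lookup_single when_def in_keys_iff
       if_distrib[of "(*) _"] cong: if_cong)
  show "lookup (mono d * q) e = 0" if "\<And>e'. e \<noteq> d + e'"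
  proof -
    have "d + x \<noteq> e" for x using that[of x] by blast
    then show ?thesis unfolding * by (simp add: lookup_sum lookup_single when_def)
  qed
qed

lemma lookup_xv_mult:
  "lookup (xv i m * q) e =
    (if m \<le> lookup e i then lookup q (Poly_Mapping.update i (lookup e i - m) e) else 0)"
proof (cases "m \<le> lookup e i")
  case True
  have "e = single i m + Poly_Mapping.update i (lookup e i - m) e"
    by (rule poly_mapping_eqI) (use True in \<open>auto simp: lookup_add lookup_update lookup_single when_def\<close>)
  from arg_cong[OF this, of "lookup (xv i m * q)"] show ?thesis
    using True by (simp add: lookup_mono_mult)
next
  case False
  have "e \<noteq> single i m + e'" for e'
  proof
    assume "e = single i m + e'"
    then have "lookup e i = m + lookup e' i" by (simp add: lookup_add)
    then show False using False by simp
  qed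
  then show ?thesis using False by (simp add: lookup_mono_mult_0)
qed

lemma keys_update_subset:
  assumes "i \<in> K"
  shows "keys (Poly_Mapping.update i c e) \<subseteq> K \<longleftrightarrow> keys e \<subseteq> K"
proof -
  have "x \<in> keys (Poly_Mapping.update i c e) \<longleftrightarrow> x \<in> keys e" if "x \<noteq> i" for x
    using that by (simp add: in_keys_iff lookup_update)
  then have "keys (Poly_Mapping.update i c e) - {i} = keys e - {i}" by auto
  moreover have "A \<subseteq> K \<longleftrightarrow> A - {i} \<subseteq> K" for A using assms by auto
  ultimately show ?thesis by metis
qed

lemma ty_remove:
  assumes "i \<in> keys e"
  shows "ty e = add_mset (lookup e i) (image_mset (lookup e) (mset_set (keys e - {i})))"
proof -
  have "mset_set (keys e) = add_mset i (mset_set (keys e - {i}))"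
    using assms by (simp add: mset_set.remove)
  then show ?thesis by (simp add: ty_def)
qed

lemma ty_update:
  assumes "i \<in> keys e"
  shows "ty (Poly_Mapping.update i c e) = nz (add_mset c (ty e - {#lookup e i#}))"
proof -
  let ?K = "keys e"
  have "ty (Poly_Mapping.update i c e) = nz (image_mset (lookup (Poly_Mapping.update i c e)) (mset_set ?K))"
    by (rule ty_superset) (simp, simp only: keys_update_subset[OF assms] order_refl)
  also have "mset_set ?K = add_mset i (mset_set (?K - {i}))" using assms by (simp add: mset_set.remove)
  also have "image_mset (lookup (Poly_Mapping.update i c e)) (mset_set (?K - {i})) = image_mset (lookup e) (mset_set (?K - {i}))"
    by (rule image_mset_cong) (auto simp: lookup_update)
  then have "image_mset (lookup (Poly_Mapping.update i c e)) (add_mset i (mset_set (?K - {i}))) = add_mset c (image_mset (lookup e) (mset_set (?K - {i})))"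
    by (simp add: lookup_update)
  finally show ?thesis by (simp add: ty_remove[OF assms])
qed

lemma sum_mset_ty: "sum_mset (image_mset g (ty e)) = (\<Sum>i\<in>keys e. g (lookup e i))"
  by (simp add: ty_def multiset.map_comp comp_def sum_unfold_sum_mset)

lemma ty_eq_empty: "ty e = {#} \<longleftrightarrow> e = 0"
  by (auto simp: ty_def mset_set_empty_iff)

lemma nz_id: "0 \<notin># M \<Longrightarrow> nz M = M"
  unfolding nz_def by (subst filter_mset_eq_conv) (auto intro: gr0I)

text \<open>If phi gives the coefficients of a symmetric polynomial by type, this gives those of its
  product with p_m: one exponent v is lowered by m, and for v = m it disappears, hence
  \<open>nz\<close>.\<close>

definition mstep :: "nat \<Rightarrow> (nms \<Rightarrow> nat) \<Rightarrow> nms \<Rightarrow> nat" where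
  "mstep m \<phi> \<nu> = sum_mset (image_mset (\<lambda>v. if m \<le> v then \<phi> (nz (add_mset (v - m) (\<nu> - {#v#}))) else 0) \<nu>)"

lemma lookup_power_sum_mult:
  assumes m: "m > 0" and q: "\<And>e. lookup q e = (if keys e \<subseteq> {..<N} then of_nat (\<phi> (ty e)) else 0)"
  shows "lookup (power_sum N m * q) e = (if keys e \<subseteq> {..<N} then of_nat (mstep m \<phi> (ty e)) else 0)"
proof -
  let ?g = "\<lambda>i. if m \<le> lookup e i then lookup q (Poly_Mapping.update i (lookup e i - m) e) else 0"
  let ?h = "\<lambda>v. if m \<le> v then \<phi> (nz (add_mset (v - m) (ty e - {#v#}))) else 0"
  have "lookup (power_sum N m * q) e = (\<Sum>i<N. ?g i)"
    unfolding power_sum_mult lookup_sum lookup_xv_mult ..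
  also have "\<dots> = (if keys e \<subseteq> {..<N} then of_nat (mstep m \<phi> (ty e)) else 0)"
  proof (cases "keys e \<subseteq> {..<N}")
    case False
    have "?g i = 0" if "i < N" for i
    proof -
      have "\<not> keys (Poly_Mapping.update i (lookup e i - m) e) \<subseteq> {..<N}"
        using False that by (subst keys_update_subset) auto
      then show ?thesis unfolding q by simp
    qed
    then have "(\<Sum>i<N. ?g i) = 0" by (intro sum.neutral) simp
    then show ?thesis using False by simp
  next
    case True
    have "(\<Sum>i<N. ?g i) = (\<Sum>i\<in>keys e. of_nat (?h (lookup e i)))"
    proof (rule sum.mono_neutral_cong_right)
      show "\<forall>i\<in>{..<N} - keys e. ?g i = 0" using m by (simp add: in_keys_iff)
      fix i assume i: "i \<in> keys e"
      then have "i \<in> {..<N}" using True by blast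
      then have "keys (Poly_Mapping.update i (lookup e i - m) e) \<subseteq> {..<N}"
        using True by (subst keys_update_subset)
      then show "?g i = of_nat (?h (lookup e i))"
        unfolding q ty_update[OF i] by simp
    qed (use True in auto)
    also have "\<dots> = of_nat (\<Sum>i\<in>keys e. ?h (lookup e i))" by (rule of_nat_sum[symmetric])
    also have "(\<Sum>i\<in>keys e. ?h (lookup e i)) = mstep m \<phi> (ty e)"
      unfolding mstep_def by (rule sum_mset_ty[symmetric])
    finally show ?thesis using True by simp
  qed
  finally show ?thesis .
qed

text \<open>A factor p_m either raises an existing exponent or occupies a new variable, so every
  type other than \<open>L\<close> has fewer parts. The coefficients do not depend on N, which
  permits the passage from polynomials to symmetric functions.\<close>

lemma psm_coefficients:
  assumes "0 \<notin># L"
  shows "\<exists>\<phi>::nms \<Rightarrow> nat.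
    (\<forall>N e. lookup (psm N L) e = (if keys e \<subseteq> {..<N} then of_nat (\<phi> (ty e)) else 0)) \<and>
    (\<forall>\<nu>. 0 \<notin># \<nu> \<longrightarrow> \<phi> \<nu> \<noteq> 0 \<longrightarrow> (\<nu> = L \<or> size \<nu> < size L) \<and> sum_mset \<nu> = sum_mset L) \<and> \<phi> L > 0"
  using assms
proof (induction L)
  case empty
  show ?case
    by (rule exI[of _ "\<lambda>\<nu>. if \<nu> = {#} then 1 else 0"]) (auto simp: ty_eq_empty lookup_one when_def)
next
  case (add m L)
  have m: "m > 0" and L: "0 \<notin># L" using add.prems by (auto intro: gr0I)
  obtain \<phi> :: "nms \<Rightarrow> nat" where
    A: "\<And>N e. lookup (psm N L) e = (if keys e \<subseteq> {..<N} then of_nat (\<phi> (ty e)) else 0)"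
    and B: "\<And>\<nu>. 0 \<notin># \<nu> \<Longrightarrow> \<phi> \<nu> \<noteq> 0 \<Longrightarrow> (\<nu> = L \<or> size \<nu> < size L) \<and> sum_mset \<nu> = sum_mset L"
    and C: "\<phi> L > 0"
    using add.IH[OF L] by blast
  have 1: "lookup (psm N (add_mset m L)) e = (if keys e \<subseteq> {..<N} then of_nat (mstep m \<phi> (ty e)) else 0)" for N e
    using lookup_power_sum_mult[OF m A] by simp
  have 2: "(\<nu> = add_mset m L \<or> size \<nu> < size (add_mset m L)) \<and> sum_mset \<nu> = sum_mset (add_mset m L)"
    if "0 \<notin># \<nu>" "mstep m \<phi> \<nu> \<noteq> 0" for \<nu>
  proof -
    have "\<exists>v. v \<in># \<nu> \<and> m \<le> v \<and> \<phi> (nz (add_mset (v - m) (\<nu> - {#v#}))) \<noteq> 0"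
    proof (rule ccontr)
      assume "\<not> ?thesis"
      then have "image_mset (\<lambda>v. if m \<le> v then \<phi> (nz (add_mset (v - m) (\<nu> - {#v#}))) else 0) \<nu> = image_mset (\<lambda>v. 0) \<nu>"
        by (intro image_mset_cong) auto
      then have "mstep m \<phi> \<nu> = 0" unfolding mstep_def by (simp only:) simp
      then show False using that(2) by simp
    qed
    then obtain v where v: "v \<in># \<nu>" "m \<le> v" "\<phi> (nz (add_mset (v - m) (\<nu> - {#v#}))) \<noteq> 0" by blast
    then obtain R where R: "\<nu> = add_mset v R" by (metis insert_DiffM)
    have R0: "0 \<notin># R" using that(1) R by simp
    have BB: "(nz (add_mset (v - m) R) = L \<or> size (nz (add_mset (v - m) R)) < size L) \<and> sum_mset (nz (add_mset (v - m) R)) = sum_mset L"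
      using B[OF zero_notin_nz] v(3) unfolding R by simp
    have s: "sum_mset \<nu> = sum_mset (add_mset m L)" using conjunct2[OF BB] v(2) unfolding sum_mset_nz R sum_mset.add_mset by linarith
    show ?thesis
    proof (cases "v = m")
      case True
      then have "nz (add_mset (v - m) R) = R" using nz_id[OF R0] by (simp add: nz_def)
      then show ?thesis using BB s True R by auto
    next
      case False
      then have "nz (add_mset (v - m) R) = add_mset (v - m) R" using v(2) R0 by (intro nz_id) auto
      then have "size \<nu> \<le> size L" using BB R by auto
      then show ?thesis using s by simp
    qed
  qed
  have 3: "mstep m \<phi> (add_mset m L) > 0"
    using C nz_id[OF L] by (simp add: mstep_def nz_def)
  show ?case using 1 2 3 by (intro exI[of _ "mstep m \<phi>"]) blast
qed

definition monc :: "nms \<Rightarrow> nms \<Rightarrow> nat" where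
  "monc L = (SOME \<phi>.
    (\<forall>N e. lookup (psm N L) e = (if keys e \<subseteq> {..<N} then of_nat (\<phi> (ty e)) else 0)) \<and>
    (\<forall>\<nu>. 0 \<notin># \<nu> \<longrightarrow> \<phi> \<nu> \<noteq> 0 \<longrightarrow> (\<nu> = L \<or> size \<nu> < size L) \<and> sum_mset \<nu> = sum_mset L) \<and> \<phi> L > 0)"

lemma lookup_psm: "0 \<notin># L \<Longrightarrow> lookup (psm N L) e = (if keys e \<subseteq> {..<N} then of_nat (monc L (ty e)) else 0)"
  and monc_neq_0: "0 \<notin># L \<Longrightarrow> 0 \<notin># \<nu> \<Longrightarrow> monc L \<nu> \<noteq> 0 \<Longrightarrow> (\<nu> = L \<or> size \<nu> < size L) \<and> sum_mset \<nu> = sum_mset L"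
  and monc_pos: "0 \<notin># L \<Longrightarrow> monc L L > 0"
  using someI_ex[OF psm_coefficients, of L, folded monc_def] by blast+

text \<open>The coefficient of the monomial symmetric function of type \<nu> in
  \<open>f\<close>.\<close>

definition mon :: "fock \<Rightarrow> nms \<Rightarrow> ratfun" where
  "mon f \<nu> = (\<Sum>l\<in>keys f. lookup f l * of_nat (monc (parts l) \<nu>))"

lemma mon_superset:
  assumes "finite S" "keys f \<subseteq> S"
  shows "mon f \<nu> = (\<Sum>l\<in>S. lookup f l * of_nat (monc (parts l) \<nu>))"
  unfolding mon_def by (rule sum.mono_neutral_left) (use assms in \<open>auto simp: in_keys_iff\<close>)

lemma mon_add: "mon (f + g) \<nu> = mon f \<nu> + mon g \<nu>"
  using keys_add[of f g]
  by (simp add: mon_superset[of "keys f \<union> keys g"] lookup_add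
      distrib_right sum.distrib)

lemma mon_scale: "mon (fscale c f) \<nu> = c * mon f \<nu>"
proof -
  have "keys (fscale c f) \<subseteq> keys f" by (auto simp: in_keys_iff)
  then show ?thesis
    by (subst mon_superset[of "keys f"]) (simp_all add: mon_def sum_distrib_left mult.assoc)
qed

lemma mon_0 [simp]: "mon 0 \<nu> = 0" by (simp add: mon_def)

lemma mon_diff: "mon (f - g) \<nu> = mon f \<nu> - mon g \<nu>"
  using mon_add[of "f - g" g \<nu>] by simp

lemma mon_sum: "mon (\<Sum>a\<in>A. f a) \<nu> = (\<Sum>a\<in>A. mon (f a) \<nu>)"
  by (induction A rule: infinite_finite_induct) (simp_all add: mon_add)

lemma mon_pb: "0 \<notin># L \<Longrightarrow> mon (pb L) \<nu> = of_nat (monc L \<nu>)"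
  by (simp add: mon_def pbasis_def)

lemma lookup_rho: "lookup (rho N f) e = (if keys e \<subseteq> {..<N} then mon f (ty e) else 0)"
  unfolding restrict_vars_def mon_def by (simp add: lookup_sum lookup_psm)

lemma hom_mon:
  assumes "hom d f" "0 \<notin># \<nu>" "mon f \<nu> \<noteq> 0"
  shows "int (sum_mset \<nu>) = d"
proof -
  obtain l where l: "l \<in> keys f" "monc (parts l) \<nu> \<noteq> 0"
    using assms(3) unfolding mon_def by (metis (mono_tags, lifting) mult_zero_right of_nat_0 sum.neutral)
  have "int (sum_mset (parts l)) = d"
    using assms(1) l(1) unfolding hom_def by (metis Partition_parts in_keys_iff zero_notin_parts)
  then show ?thesis using monc_neq_0[OF zero_notin_parts assms(2) l(2)] by simp
qed

text \<open>Among the power sum products in \<open>f\<close>, one with the largest number of parts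
  is the only one that contains its own monomial.\<close>

lemma mon_injective:
  assumes "\<And>\<nu>. 0 \<notin># \<nu> \<Longrightarrow> mon f \<nu> = 0"
  shows "f = 0"
proof (rule ccontr)
  assume "f \<noteq> 0"
  then have ne: "keys f \<noteq> {}" by simp
  define M where "M = Max (plen ` keys f)"
  have "M \<in> plen ` keys f" unfolding M_def using ne by (intro Max_in) auto
  then obtain l where l: "l \<in> keys f" "plen l = M" by auto
  have "mon f (parts l) = (\<Sum>l'\<in>keys f. if l' = l then lookup f l * of_nat (monc (parts l) (parts l)) else 0)"
    unfolding mon_def
  proof (rule sum.cong[OF refl])
    fix l' assume l': "l' \<in> keys f"
    have "plen l' \<le> M" unfolding M_def using l' by (intro Max_ge) auto
    then have "monc (parts l') (parts l) = 0" if "l' \<noteq> l"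
      using monc_neq_0[of "parts l'" "parts l"] that l(2) unfolding plen_def
      by (metis Partition_parts linorder_not_le zero_notin_parts)
    then show "lookup f l' * of_nat (monc (parts l') (parts l)) = (if l' = l then lookup f l * of_nat (monc (parts l) (parts l)) else 0)"
      by auto
  qed
  also have "\<dots> = lookup f l * of_nat (monc (parts l) (parts l))" using l(1) by simp
  finally show False using assms[of "parts l"] l(1) monc_pos[of "parts l"] by (simp add: in_keys_iff)
qed

lemma mon_eqI: "(\<And>\<nu>. 0 \<notin># \<nu> \<Longrightarrow> mon f \<nu> = mon g \<nu>) \<Longrightarrow> f = g"
  using mon_injective[of "f - g"] by (simp add: mon_diff)

definition is_mono :: "nms \<Rightarrow> fock \<Rightarrow> bool" where
  "is_mono L f \<longleftrightarrow> hom (int (sum_mset L)) f \<and> (\<forall>\<nu>. 0 \<notin># \<nu> \<longrightarrow> mon f \<nu> = (if \<nu> = L then 1 else 0))"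

text \<open>The matrix \<open>monc\<close> is triangular for the number of parts and is inverted by
  induction.\<close>

lemma is_mono_exists: "0 \<notin># L \<Longrightarrow> \<exists>f. is_mono L f"
proof (induction "size L" arbitrary: L rule: less_induct)
  case less
  let ?S = "{\<nu> \<in> multisets_of (sum_mset L). size \<nu> < size L}"
  have S0: "0 \<notin># \<nu>" "sum_mset \<nu> = sum_mset L" "size \<nu> < size L" if "\<nu> \<in> ?S" for \<nu> using that by (auto simp: multisets_of_def)
  have "\<exists>f. is_mono \<nu> f" if "\<nu> \<in> ?S" for \<nu> using less.hyps[OF S0(3,1)[OF that]] .
  then obtain g where g: "\<And>\<nu>. \<nu> \<in> ?S \<Longrightarrow> is_mono \<nu> (g \<nu>)" by metis
  let ?r = "pb L - (\<Sum>\<nu>\<in>?S. fscale (of_nat (monc L \<nu>)) (g \<nu>))"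
  have fin: "finite ?S" by (simp add: finite_multisets_of)
  have hg: "hom (int (sum_mset L)) (g \<nu>)" if "\<nu> \<in> ?S" for \<nu>
    using g[OF that] S0(2)[OF that] by (simp only: is_mono_def)
  have "hom (int (sum_mset L)) ?r"
    by (intro hom_diff hom_pb hom_sum hom_scale hg refl less.prems)
  moreover have "mon ?r \<nu> = (if \<nu> = L then of_nat (monc L L) else 0)" if n: "0 \<notin># \<nu>" for \<nu>
  proof -
    have "(\<Sum>\<mu>\<in>?S. of_nat (monc L \<mu>) * mon (g \<mu>) \<nu>) = (\<Sum>\<mu>\<in>?S. if \<mu> = \<nu> then of_nat (monc L \<nu>) else 0)"
      using g n by (intro sum.cong refl) (simp add: is_mono_def)
    also have "\<dots> = (if \<nu> \<in> ?S then of_nat (monc L \<nu>) else 0)" using fin by simp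
    finally have "mon ?r \<nu> = of_nat (monc L \<nu>) - (if \<nu> \<in> ?S then of_nat (monc L \<nu>) else 0)"
      by (simp only: mon_diff mon_sum mon_scale mon_pb[OF less.prems])
    moreover have "monc L \<nu> = 0" if "\<nu> \<noteq> L" "\<nu> \<notin> ?S"
      using monc_neq_0[OF less.prems n] that n by (auto simp: multisets_of_def)
    ultimately show ?thesis by auto
  qed
  ultimately have "is_mono L (fscale (1 / of_nat (monc L L)) ?r)"
    using monc_pos[OF less.prems] by (simp add: is_mono_def hom_scale mon_scale)
  then show ?case by blast
qed

definition MM :: "nms \<Rightarrow> fock" where "MM L = (SOME f. is_mono L f)"

lemma is_mono_MM: "0 \<notin># L \<Longrightarrow> is_mono L (MM L)"
  unfolding MM_def by (rule someI_ex[OF is_mono_exists])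

lemma hom_MM: "0 \<notin># L \<Longrightarrow> hom (int (sum_mset L)) (MM L)"
  and mon_MM: "0 \<notin># L \<Longrightarrow> 0 \<notin># \<nu> \<Longrightarrow> mon (MM L) \<nu> = (if \<nu> = L then 1 else 0)"
  using is_mono_MM[of L] by (simp_all add: is_mono_def)

lemma MM_expansion:
  assumes "hom (int n) f"
  shows "f = (\<Sum>\<nu>\<in>multisets_of n. fscale (mon f \<nu>) (MM \<nu>))"
proof (rule mon_eqI)
  fix \<nu> :: "nms" assume n: "0 \<notin># \<nu>"
  have "mon (\<Sum>\<nu>\<in>multisets_of n. fscale (mon f \<nu>) (MM \<nu>)) \<nu> = (\<Sum>\<mu>\<in>multisets_of n. if \<mu> = \<nu> then mon f \<nu> else 0)"
    unfolding mon_sum mon_scale by (intro sum.cong refl) (auto simp: mon_MM[OF _ n] multisets_of_def)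
  also have "\<dots> = (if \<nu> \<in> multisets_of n then mon f \<nu> else 0)" by (simp add: finite_multisets_of)
  also have "\<dots> = mon f \<nu>"
  proof -
    have "\<nu> \<in> multisets_of n" if "mon f \<nu> \<noteq> 0"
    proof -
      have "sum_mset \<nu> = n" using hom_mon[OF assms n that] by (simp only: of_nat_eq_iff)
      then show ?thesis using n by (simp add: multisets_of_def)
    qed
    then show ?thesis by auto
  qed
  finally show "mon f \<nu> = mon (\<Sum>\<nu>\<in>multisets_of n. fscale (mon f \<nu>) (MM \<nu>)) \<nu>" by simp
qed

lemma lookup_monomial_sym:
  "lookup (monomial_sym N l) e = (if keys e \<subseteq> {..<N} \<and> ty e = parts l then 1 else 0)"
proof -
  let ?E = "{e. keys e \<subseteq> {..<N} \<and> ty e = parts l}"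
  \<comment> \<open>This gives finiteness of the index set, without which the defining sum would be
    0: all its exponents occur in one polynomial.\<close>
  have "?E \<subseteq> keys (rho N (MM (parts l)))"
  proof
    fix e assume "e \<in> ?E"
    then have "lookup (rho N (MM (parts l))) e = 1" by (simp add: lookup_rho mon_MM)
    then show "e \<in> keys (rho N (MM (parts l)))" by (simp add: in_keys_iff)
  qed
  then have "finite ?E" by (rule finite_subset) simp
  moreover have "monomial_sym N l = (\<Sum>e\<in>?E. mono e)" by (simp add: monomial_sym_def ty_def)
  ultimately show ?thesis by (simp add: lookup_sum lookup_single when_def)
qed

lemma ty_nth: "ty (Poly_Mapping.nth xs) = nz (mset xs)"
proof -
  have k: "keys (Poly_Mapping.nth xs) \<subseteq> {..<length xs}"
  proof
    fix i assume "i \<in> keys (Poly_Mapping.nth xs)"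
    then have "nth_default 0 xs i \<noteq> 0" by (simp only: in_keys_iff nth.rep_eq not_False_eq_True)
    then show "i \<in> {..<length xs}" by (simp add: nth_default_def split: if_splits)
  qed
  have "image_mset (lookup (Poly_Mapping.nth xs)) (mset_set {..<length xs}) = image_mset (nth xs) (mset_set {..<length xs})"
    by (rule image_mset_cong) (simp add: nth.rep_eq nth_default_def)
  also have "\<dots> = mset xs"
  proof -
    have "mset_set {..<length xs} = mset [0..<length xs]" by (simp add: atLeast0LessThan[symmetric])
    then show ?thesis by (simp only: mset_map[symmetric] map_nth)
  qed
  finally show ?thesis using ty_superset[OF _ k] by simp
qed

section \<open>Triangularity with respect to dominance\<close>

lemma upd_upd: "upd i j a b (upd i j c d e) = upd i j a b e"
  by (rule poly_mapping_eqI) (simp add: lookup_upd)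

abbreviation lk :: "(nat \<Rightarrow>\<^sub>0 nat) \<Rightarrow> nat \<Rightarrow> nat" where "lk \<equiv> lookup"

text \<open>By the geometric series, x_i (x_i - x_j)^(-1) (1 - s_ij) sends x_i^a x_j^b with a > b to
  the sum of the x_i^c x_j^(a+b-c) over b < c \<le> a. The difference of two partial sums also gives
  the correct sign for a < b.\<close>

definition Delm :: "nat \<Rightarrow> nat \<Rightarrow> (nat \<Rightarrow>\<^sub>0 nat) \<Rightarrow> xpoly" where
  "Delm i j e = Fs i j e (lk e i + lk e j) (lk e i) - Fs i j e (lk e i + lk e j) (lk e j)"

lemma lookup_Del: "lookup (Del i j p) e = (\<Sum>e'\<in>keys p. lookup p e' * lookup (Delm i j e') e)"
  by (simp add: Del_def xlin_def lookup_sum Delm_def)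

lemma lookup_Fs_neq_0:
  assumes "lookup (Fs i j e' s a) e \<noteq> 0" "i \<noteq> j"
  shows "1 \<le> lk e i \<and> lk e i \<le> a \<and> e = upd i j (lk e i) (s - lk e i) e'"
proof -
  have "\<exists>c\<in>{1..a}. upd i j c (s - c) e' = e"
  proof (rule ccontr)
    assume "\<not> ?thesis"
    then have "lookup (Fs i j e' s a) e = 0"
      unfolding Fs_def lookup_sum by (intro sum.neutral) (simp add: lookup_single)
    then show False using assms(1) by simp
  qed
  then obtain c where c: "c \<in> {1..a}" "upd i j c (s - c) e' = e" by blast
  have "lk e i = c" using lookup_upd[of i j c "s - c" e' i] c(2) by simp
  then show ?thesis using c by auto
qed

lemma lookup_Fs:
  assumes "i \<noteq> j" "e = upd i j (lk e i) (s - lk e i) e'"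
  shows "lookup (Fs i j e' s a) e = (if 1 \<le> lk e i \<and> lk e i \<le> a then 1 else 0)"
proof -
  have "upd i j c (s - c) e' = e \<longleftrightarrow> c = lk e i" for c
    using assms lookup_upd[of i j c "s - c" e' i] by auto
  then show ?thesis
    unfolding Fs_def lookup_sum lookup_single when_def by simp
qed

lemma Delm_neq_0:
  assumes "lookup (Delm i j e') e \<noteq> 0" "i \<noteq> j"
  shows "e = upd i j (lk e i) (lk e j) e' \<and> lk e i + lk e j = lk e' i + lk e' j \<and> max (lk e i) (lk e j) \<le> max (lk e' i) (lk e' j)"
proof -
  let ?a = "lk e' i" and ?b = "lk e' j"
  let ?s = "?a + ?b"
  have 1: "1 \<le> lk e i \<and> lk e i \<le> max ?a ?b \<and> e = upd i j (lk e i) (?s - lk e i) e'"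
  proof -
    have "lookup (Fs i j e' ?s ?a) e \<noteq> 0 \<or> lookup (Fs i j e' ?s ?b) e \<noteq> 0"
      using assms(1) by (auto simp: Delm_def lookup_minus)
    then show ?thesis using lookup_Fs_neq_0[OF _ assms(2)] by (metis le_max_iff_disj)
  qed
  \<comment> \<open>Up to the smaller exponent both partial sums contain the same terms, which
    cancel. Thus the new exponent of x_i exceeds the minimum, so that of x_j stays below the
    maximum.\<close>
  have 2: "lk e i > min ?a ?b"
  proof (rule ccontr)
    assume "\<not> ?thesis"
    then have "lk e i \<le> ?a" "lk e i \<le> ?b" by auto
    then have "lookup (Delm i j e') e = 0"
      using 1 by (simp add: Delm_def lookup_minus lookup_Fs[OF assms(2)])
    then show False using assms(1) by simp
  qed
  have "lk e j = ?s - lk e i" using 1 assms(2) lookup_upd[of i j "lk e i" "?s - lk e i" e' j] by auto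
  then show ?thesis using 1 2 by auto
qed

text \<open>Two exponents are replaced by a pair with the same sum and no larger maximum, which goes
  down in dominance; the same type returns only for the exponent itself and its
  transposition.\<close>

lemma dominated_Delm:
  assumes "lookup (Delm i j e') e \<noteq> 0" "i \<noteq> j"
  shows "dominated (Partition (ty e)) (Partition (ty e'))"
    and "ty e = ty e' \<Longrightarrow> e' = e \<or> e' = upd i j (lk e j) (lk e i) e"
proof -
  note D = Delm_neq_0[OF assms]
  obtain R where R: "\<And>c d. ty (upd i j c d e') = nz (R + {#c, d#})" using ty_upd[OF assms(2)] by blast
  have te: "ty e = nz (R + {#lk e i, lk e j#})" using R D by metis
  have te': "ty e' = nz (R + {#lk e' i, lk e' j#})" using R upd_same[OF assms(2), of e'] by metis
  show "dominated (Partition (ty e)) (Partition (ty e'))"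
    unfolding te te' by (rule dominated_transfer) (use D in auto)
  assume eq: "ty e = ty e'"
  have "ty (upd i j (lk e i) (lk e j) e') = ty (upd i j (lk e' i) (lk e' j) e')"
    using eq te te' R by metis
  then have "lk e i = lk e' i \<or> lk e i = lk e' j"
    by (rule sum_squares_upd[OF _ assms(2)]) (use D in auto)
  then show "e' = e \<or> e' = upd i j (lk e j) (lk e i) e"
  proof
    assume a: "lk e i = lk e' i"
    then have "lk e j = lk e' j" using D by simp
    then have "e = e'" using D a upd_same[OF assms(2), of e'] by metis
    then show ?thesis by simp
  next
    assume a: "lk e i = lk e' j"
    then have b: "lk e j = lk e' i" using D by simp
    have "upd i j (lk e j) (lk e i) e = upd i j (lk e j) (lk e i) e'" using D upd_upd by metis
    also have "\<dots> = e'" unfolding a b by (rule upd_same[OF assms(2)])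
    finally show ?thesis by simp
  qed
qed

definition tri :: "nms \<Rightarrow> xpoly \<Rightarrow> bool" where
  "tri L p \<longleftrightarrow> (\<forall>e. lookup p e \<noteq> 0 \<longrightarrow> dominated (Partition (ty e)) (Partition L))"

lemma tri_add: "tri L p \<Longrightarrow> tri L q \<Longrightarrow> tri L (p + q)"
  unfolding tri_def lookup_add by (metis add_0)

lemma tri_diff: "tri L p \<Longrightarrow> tri L q \<Longrightarrow> tri L (p - q)"
  unfolding tri_def lookup_minus by (metis diff_zero)

lemma tri_xconst: "tri L p \<Longrightarrow> tri L (xconst c * p)"
  by (simp add: tri_def)

lemma tri_sum: "(\<And>a. a \<in> A \<Longrightarrow> tri L (f a)) \<Longrightarrow> tri L (\<Sum>a\<in>A. f a)"
  by (induction A rule: infinite_finite_induct) (simp_all add: tri_add, simp_all add: tri_def)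

lemma lookup_Eu: "lookup (Eu i p) e = of_nat (lk e i) * lookup p e"
proof -
  have "lookup (Eu i p) e = (\<Sum>e'\<in>keys p. lookup p e' * (of_nat (lk e' i) * lookup (mono e') e))"
    unfolding Eu_def xlin_def lookup_sum lookup_xconst_mult xconst_of_nat[symmetric] ..
  also have "\<dots> = (\<Sum>e'\<in>keys p. if e' = e then of_nat (lk e i) * lookup p e else 0)"
    by (intro sum.cong refl) (simp add: lookup_single when_def)
  finally show ?thesis by (simp add: in_keys_iff)
qed

lemma tri_Eu: "tri L p \<Longrightarrow> tri L (Eu i p)"
  by (simp add: tri_def lookup_Eu)

lemma tri_Del:
  assumes "tri L p" "i \<noteq> j"
  shows "tri L (Del i j p)"
  unfolding tri_def
proof (intro allI impI)
  fix e assume "lookup (Del i j p) e \<noteq> 0"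
  then obtain e' where "lookup p e' * lookup (Delm i j e') e \<noteq> 0"
    unfolding lookup_Del by (meson sum.neutral)
  then have "lookup p e' \<noteq> 0" "lookup (Delm i j e') e \<noteq> 0" by auto
  then show "dominated (Partition (ty e)) (Partition L)"
    using assms(1) dominated_Delm(1)[OF _ assms(2)] dominated_trans unfolding tri_def by metis
qed

text \<open>Exchange terms never go up in dominance, so at the leading type only \<open>e\<close>
  and its transposition contribute.\<close>

lemma lookup_Del_diagonal:
  assumes p: "tri L p" and ij: "i \<noteq> j" and e: "ty e = L"
  shows "lookup (Del i j p) e =
    (if lk e j < lk e i then lookup p e - lookup p (upd i j (lk e j) (lk e i) e) else 0)"
proof -
  let ?s = "upd i j (lk e j) (lk e i) e"
  let ?f = "\<lambda>e'. lookup p e' * lookup (Delm i j e') e"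
  have "?f e' = 0" if "e' \<notin> {e, ?s}" for e'
  proof (rule ccontr)
    assume "?f e' \<noteq> 0"
    then have nz: "lookup p e' \<noteq> 0" "lookup (Delm i j e') e \<noteq> 0" by auto
    have "dominated (Partition (ty e')) (Partition (ty e))" using p nz(1) e by (simp add: tri_def)
    then have "Partition (ty e) = Partition (ty e')"
      using dominated_Delm(1)[OF nz(2) ij] by (intro dominated_antisym)
    then have "ty e = ty e'" by (simp add: Partition_eq_iff)
    then show False using dominated_Delm(2)[OF nz(2) ij] that by simp
  qed
  then have L: "lookup (Del i j p) e = sum ?f {e, ?s}"
    unfolding lookup_Del
    by (intro sum.mono_neutral_cong) (auto simp: in_keys_iff)
  have le: "lookup (Delm i j e) e = (if lk e j < lk e i then 1 else 0)"
  proof -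
    have "e = upd i j (lk e i) (lk e i + lk e j - lk e i) e" using upd_same[OF ij, of e] by simp
    note F = lookup_Fs[OF ij this]
    show ?thesis unfolding Delm_def lookup_minus F by auto
  qed
  have ls: "lk ?s i = lk e j" "lk ?s j = lk e i" using ij by (simp_all add: lookup_upd)
  have l2: "lookup (Delm i j ?s) e = (if lk e j < lk e i then - 1 else 0)" if "lk e i \<noteq> lk e j"
  proof -
    have "e = upd i j (lk e i) (lk e j + lk e i - lk e i) ?s" unfolding upd_upd using upd_same[OF ij, of e] by simp
    note F = lookup_Fs[OF ij this]
    show ?thesis unfolding Delm_def lookup_minus ls F using that by auto
  qed
  show ?thesis
  proof (cases "lk e i = lk e j")
    case True
    then have "?s = e" using upd_same[OF ij, of e] by simp
    then show ?thesis unfolding L using True le by simp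
  next
    case False
    then have "?s \<noteq> e" using ls by metis
    then show ?thesis unfolding L using le l2[OF False] by simp
  qed
qed

lemma tri_Yop: "tri L p \<Longrightarrow> tri L (Yop N i p)"
  unfolding Yop_def by (intro tri_add tri_xconst tri_Eu tri_sum tri_Del) auto

lemma lookup_Yop_diagonal:
  assumes "tri L p" "ty e = L"
  shows "lookup (Yop N i p) e = jalpha * of_nat (lk e i) * lookup p e +
    (\<Sum>j\<in>{..<N} - {i}. if lk e j < lk e i then lookup p e - lookup p (upd i j (lk e j) (lk e i) e) else 0)"
  unfolding Yop_def lookup_add lookup_sum lookup_xconst_mult lookup_Eu
  by (simp add: lookup_Del_diagonal[OF assms(1) _ assms(2)] mult.assoc)

lemma tri_Yh: "tri L p \<Longrightarrow> tri L (Yh N i p)"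
  unfolding Yh_def xconst_of_nat[symmetric] by (intro tri_diff tri_xconst tri_Yop)

lemma ty_swap: "i \<noteq> j \<Longrightarrow> ty (upd i j (lk e j) (lk e i) e) = ty e"
proof -
  assume ij: "i \<noteq> j"
  obtain R where R: "\<And>c d. ty (upd i j c d e) = nz (R + {#c, d#})" using ty_upd[OF ij] by blast
  have "ty (upd i j (lk e j) (lk e i) e) = nz (R + {#lk e i, lk e j#})" unfolding R by (simp add: add_mset_commute)
  then show ?thesis using R upd_same[OF ij, of e] by metis
qed

section \<open>Polynomials in the transcendental parameter\<close>

text \<open>Integer polynomials in alpha of degree below \<open>d\<close>; they serve as error
  terms.\<close>

definition Ial :: "nat \<Rightarrow> ratfun \<Rightarrow> bool" where
  "Ial d x \<longleftrightarrow> (\<exists>c::nat \<Rightarrow> int. x = (\<Sum>i<d. of_int (c i) * jalpha ^ i))"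

lemma Ial_0 [simp]: "Ial d 0"
  unfolding Ial_def by (rule exI[of _ "\<lambda>_. 0"]) simp

lemma Ial_add: "Ial d x \<Longrightarrow> Ial d y \<Longrightarrow> Ial d (x + y)"
proof -
  assume "Ial d x" "Ial d y"
  then obtain c c' :: "nat \<Rightarrow> int" where c: "x = (\<Sum>i<d. of_int (c i) * jalpha ^ i)" "y = (\<Sum>i<d. of_int (c' i) * jalpha ^ i)"
    by (auto simp: Ial_def)
  show ?thesis unfolding Ial_def
    by (rule exI[of _ "\<lambda>i. c i + c' i"]) (simp add: c distrib_right sum.distrib)
qed

lemma Ial_scale: "Ial d x \<Longrightarrow> Ial d (of_int z * x)"
proof -
  assume "Ial d x"
  then obtain c :: "nat \<Rightarrow> int" where c: "x = (\<Sum>i<d. of_int (c i) * jalpha ^ i)" by (auto simp: Ial_def)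
  show ?thesis unfolding Ial_def
    by (rule exI[of _ "\<lambda>i. z * c i"]) (simp add: c sum_distrib_left mult.assoc)
qed

lemma Ial_diff: "Ial d x \<Longrightarrow> Ial d y \<Longrightarrow> Ial d (x - y)"
  using Ial_add[of d x "- y"] Ial_scale[of d y "- 1"] by simp

lemma Ial_sum: "(\<And>a. a \<in> A \<Longrightarrow> Ial d (f a)) \<Longrightarrow> Ial d (\<Sum>a\<in>A. f a)"
  by (induction A rule: infinite_finite_induct) (simp_all add: Ial_add)

lemma Ial_power: "Ial (Suc d) (of_int z * jalpha ^ d)"
  unfolding Ial_def by (rule exI[of _ "\<lambda>i. if i = d then z else 0"]) simp

lemma Ial_Suc: "Ial d x \<Longrightarrow> Ial (Suc d) x"
proof -
  assume "Ial d x"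
  then obtain c :: "nat \<Rightarrow> int" where c: "x = (\<Sum>i<d. of_int (c i) * jalpha ^ i)" by (auto simp: Ial_def)
  show ?thesis unfolding Ial_def
    by (rule exI[of _ "\<lambda>i. if i < d then c i else 0"]) (simp add: c)
qed

lemma Ial_mult: "Ial d x \<Longrightarrow> Ial (Suc d) (jalpha * x)"
proof -
  assume "Ial d x"
  then obtain c :: "nat \<Rightarrow> int" where c: "x = (\<Sum>i<d. of_int (c i) * jalpha ^ i)" by (auto simp: Ial_def)
  show ?thesis unfolding Ial_def
    by (rule exI[of _ "\<lambda>i. case i of 0 \<Rightarrow> 0 | Suc i \<Rightarrow> c i"])
       (simp add: c sum.lessThan_Suc_shift sum_distrib_left mult.left_commute del: sum.lessThan_Suc)
qed

text \<open>After multiplication by t2^d the powers of alpha become, up to sign, the distinct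
  monomials t1^i t2^(d-i).\<close>

lemma jalpha_transcendental:
  fixes c :: "nat \<Rightarrow> int"
  assumes "(\<Sum>i<d. of_int (c i) * jalpha ^ i) = 0" "j < d"
  shows "c j = 0"
proof -
  define m where "m = (\<lambda>i. of_int (c i) * ([:[:0, -1:]:] ^ i * [:0, 1:] ^ (d - i)) :: complex poly poly)"
  have t: "Fraction_Field.Fract (m i) 1 = of_int (c i) * jalpha ^ i * t2 ^ d" if "i < d" for i
  proof -
    have pow: "Fraction_Field.Fract p 1 ^ k = Fraction_Field.Fract (p ^ k) 1" for p :: "complex poly poly" and k
      by (induction k) (simp_all add: One_fract_def)
    have nat: "of_nat k = Fraction_Field.Fract (of_nat k :: complex poly poly) 1" for k
      by (induction k) (simp_all add: Zero_fract_def One_fract_def)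
    have oi: "of_int z = Fraction_Field.Fract (of_int z :: complex poly poly) 1" for z
      by (cases z) (simp_all add: nat One_fract_def del: of_nat_Suc)
    have "t2 ^ d = t2 ^ i * t2 ^ (d - i)" using that by (simp flip: power_add)
    then have "jalpha ^ i * t2 ^ d = (jalpha * t2) ^ i * t2 ^ (d - i)" by (simp add: power_mult_distrib mult.assoc)
    moreover have "jalpha * t2 = - t1" using t2_neq_0 by (simp add: jalpha_def)
    ultimately have "jalpha ^ i * t2 ^ d = (- t1) ^ i * t2 ^ (d - i)" by simp
    moreover have "- t1 = Fraction_Field.Fract [:[:0, -1:]:] 1" by (simp add: t1_def)
    ultimately have "jalpha ^ i * t2 ^ d = Fraction_Field.Fract ([:[:0, -1:]:] ^ i * [:0, 1:] ^ (d - i)) 1"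
      by (simp add: t2_def pow)
    then show ?thesis by (simp add: m_def oi mult.assoc)
  qed
  have coeff: "coeff (m i) k = (if k = d - i then of_int (c i) * [:0, -1:] ^ i else 0)" for i k
  proof -
    have "[:p:] ^ i = [:p ^ i:]" for p :: "complex poly" by (induction i) simp_all
    moreover have "[:0, 1:] ^ (d - i) = monom (1 :: complex poly) (d - i)" by (simp add: monom_altdef)
    ultimately show ?thesis by (simp add: m_def of_int_poly coeff_monom)
  qed
  have "Fraction_Field.Fract (\<Sum>i<k. m i) 1 = (\<Sum>i<k. of_int (c i) * jalpha ^ i * t2 ^ d)" if "k \<le> d" for k
    using that
  proof (induction k)
    case (Suc k)
    have "Fraction_Field.Fract (\<Sum>i<Suc k. m i) 1 = Fraction_Field.Fract (\<Sum>i<k. m i) 1 + Fraction_Field.Fract (m k) 1" by simp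
    then show ?case using Suc t[of k] by simp
  qed (simp add: Zero_fract_def)
  from this[of d] have "Fraction_Field.Fract (\<Sum>i<d. m i) 1 = (\<Sum>i<d. of_int (c i) * jalpha ^ i) * t2 ^ d"
    by (simp add: sum_distrib_right)
  then have "Fraction_Field.Fract (\<Sum>i<d. m i) 1 = 0" using assms(1) by simp
  then have "(\<Sum>i<d. m i) = 0" by (simp add: Zero_fract_def eq_fract)
  then have "(\<Sum>i<d. coeff (m i) (d - j)) = 0" by (simp flip: coeff_sum)
  also have "(\<Sum>i<d. coeff (m i) (d - j)) = (\<Sum>i<d. if i = j then of_int (c j) * [:0, -1:] ^ j else 0)"
    unfolding coeff by (rule sum.cong[OF refl]) (use assms(2) in auto)
  finally show ?thesis using assms(2) by simp
qed

text \<open>After d steps the coefficients at the leading type are (alpha e_i)^d up to lower powers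
  of alpha.\<close>

definition diag_near :: "nat \<Rightarrow> nms \<Rightarrow> nat \<Rightarrow> nat \<Rightarrow> xpoly \<Rightarrow> bool" where
  "diag_near N L d i p \<longleftrightarrow> tri L p \<and> (\<forall>e. ty e = L \<longrightarrow> keys e \<subseteq> {..<N} \<longrightarrow>
     Ial d (lookup p e - jalpha ^ d * of_nat (lk e i ^ d)))"

text \<open>Only the term alpha x_i d/dx_i raises the power of alpha; the exchange terms and the
  subtraction of N go into the error.\<close>

lemma diag_near_Yop:
  assumes "diag_near N L d i p" "i < N"
  shows "diag_near N L (Suc d) i (Yop N i p)" and "diag_near N L (Suc d) i (Yh N i p)"
proof -
  have p: "tri L p" and I: "\<And>e. ty e = L \<Longrightarrow> keys e \<subseteq> {..<N} \<Longrightarrow> Ial d (lookup p e - jalpha ^ d * of_nat (lk e i ^ d))"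
    using assms(1) by (auto simp: diag_near_def)
  have I': "Ial (Suc d) (lookup p e)" if "ty e = L" "keys e \<subseteq> {..<N}" for e
    using Ial_add[OF Ial_Suc[OF I[OF that]] Ial_power[of d "int (lk e i ^ d)"]] by (simp add: mult.commute)
  have Y: "Ial (Suc d) (lookup (Yop N i p) e - jalpha ^ Suc d * of_nat (lk e i ^ Suc d))"
    if e: "ty e = L" "keys e \<subseteq> {..<N}" for e
  proof -
    let ?S = "\<Sum>j\<in>{..<N} - {i}. if lk e j < lk e i then lookup p e - lookup p (upd i j (lk e j) (lk e i) e) else 0"
    have a: "Ial (Suc d) ?S"
    proof (rule Ial_sum)
      fix j assume j: "j \<in> {..<N} - {i}"
      have "ty (upd i j (lk e j) (lk e i) e) = L" using ty_swap[of i j e] j e by auto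
      moreover have "keys (upd i j (lk e j) (lk e i) e) \<subseteq> {..<N}" by (rule keys_upd) (use e j assms(2) in auto)
      ultimately show "Ial (Suc d) (if lk e j < lk e i then lookup p e - lookup p (upd i j (lk e j) (lk e i) e) else 0)"
        using Ial_diff[OF I'[OF e] I'] by simp
    qed
    have b: "Ial (Suc d) (jalpha * (of_int (int (lk e i)) * (lookup p e - jalpha ^ d * of_nat (lk e i ^ d))))"
      by (intro Ial_mult Ial_scale I e)
    have c: "lookup (Yop N i p) e - jalpha ^ Suc d * of_nat (lk e i ^ Suc d) =
        jalpha * (of_int (int (lk e i)) * (lookup p e - jalpha ^ d * of_nat (lk e i ^ d))) + ?S"
      unfolding lookup_Yop_diagonal[OF p e(1)] by (simp add: algebra_simps)
    show ?thesis unfolding c by (rule Ial_add[OF b a])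
  qed
  show "diag_near N L (Suc d) i (Yop N i p)"
    unfolding diag_near_def using tri_Yop[OF p] Y by blast
  have "Ial (Suc d) (lookup (Yh N i p) e - jalpha ^ Suc d * of_nat (lk e i ^ Suc d))"
    if e: "ty e = L" "keys e \<subseteq> {..<N}" for e
  proof -
    have "lookup (Yh N i p) e - jalpha ^ Suc d * of_nat (lk e i ^ Suc d) =
      (lookup (Yop N i p) e - jalpha ^ Suc d * of_nat (lk e i ^ Suc d)) - of_int (int N) * lookup p e"
      unfolding Yh_def lookup_minus xconst_of_nat[symmetric] lookup_xconst_mult by simp
    from subst[OF this[symmetric], of "Ial (Suc d)", OF Ial_diff[OF Y[OF e] Ial_scale[OF I'[OF e]]]] show ?thesis .
  qed
  then show "diag_near N L (Suc d) i (Yh N i p)"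
    unfolding diag_near_def using tri_Yh[OF p] by blast
qed

lemma tri_rho_MM: "0 \<notin># L \<Longrightarrow> tri L (rho N (MM L))"
  by (auto simp: tri_def lookup_rho mon_MM dominated_refl split: if_splits)

lemma diag_near_Hop:
  assumes L: "0 \<notin># L" and i: "i < N"
  shows "diag_near N L (Suc k) i ((Yh N i ^^ k) (Yop N i (rho N (MM L))))"
proof (induction k)
  case 0
  have "diag_near N L 0 i (rho N (MM L))"
    using tri_rho_MM[OF L] L by (simp add: diag_near_def lookup_rho mon_MM)
  then show ?case using diag_near_Yop(1)[OF _ i] by simp
next
  case (Suc k) then show ?case using diag_near_Yop(2)[OF _ i] by simp
qed

lemma exponent_exists:
  assumes "0 \<notin># L"
  obtains e where "ty e = L" "keys e \<subseteq> {..<size L}"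
proof
  let ?e = "Poly_Mapping.nth (sorted_list_of_multiset L)"
  show "ty ?e = L" using assms by (simp add: ty_nth nz_id)
  show "keys ?e \<subseteq> {..<size L}"
  proof
    fix i assume "i \<in> keys ?e"
    then have "nth_default 0 (sorted_list_of_multiset L) i \<noteq> 0" by (simp only: in_keys_iff nth.rep_eq not_False_eq_True)
    then have "i < length (sorted_list_of_multiset L)" by (simp add: nth_default_def split: if_splits)
    then show "i \<in> {..<size L}" by (metis lessThan_iff mset_sorted_list_of_multiset size_mset)
  qed
qed

lemma mon_Hop:
  assumes "0 \<notin># L" "ty e = \<nu>" "keys e \<subseteq> {..<N}"
  shows "mon (Hop k (sum_mset L) (MM L)) \<nu> = (\<Sum>i<N. lookup ((Yh N i ^^ k) (Yop N i (rho N (MM L)))) e)"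
  using arg_cong[OF rho_Hop[OF hom_MM[OF assms(1)], of N k], of "\<lambda>p. lookup p e"] assms(2,3)
  by (simp add: lookup_rho lookup_sum)

lemma mon_Hop_triangular:
  assumes "0 \<notin># L" "0 \<notin># \<nu>" "mon (Hop k (sum_mset L) (MM L)) \<nu> \<noteq> 0"
  shows "dominated (Partition \<nu>) (Partition L)"
proof -
  obtain e where e: "ty e = \<nu>" "keys e \<subseteq> {..<size \<nu>}" using exponent_exists[OF assms(2)] .
  obtain i where "i < size \<nu>" "lookup ((Yh (size \<nu>) i ^^ k) (Yop (size \<nu>) i (rho (size \<nu>) (MM L)))) e \<noteq> 0"
    using assms(3) unfolding mon_Hop[OF assms(1) e] by (meson lessThan_iff sum.neutral)
  then show ?thesis using diag_near_Hop[OF assms(1), of i "size \<nu>" k] e(1) unfolding diag_near_def tri_def by metis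
qed

lemma mon_Hop_diagonal:
  assumes "0 \<notin># L"
  shows "Ial (Suc k) (mon (Hop k (sum_mset L) (MM L)) L - jalpha ^ Suc k * of_nat (sum_mset (image_mset (\<lambda>v. v ^ Suc k) L)))"
proof -
  obtain e where e: "ty e = L" "keys e \<subseteq> {..<size L}" using exponent_exists[OF assms] .
  have "sum_mset (image_mset (\<lambda>v. v ^ Suc k) L) = (\<Sum>i<size L. lk e i ^ Suc k)"
    unfolding e(1)[symmetric] sum_mset_ty
    by (rule sum.mono_neutral_left) (use e in \<open>auto simp: in_keys_iff\<close>)
  then have "mon (Hop k (sum_mset L) (MM L)) L - jalpha ^ Suc k * of_nat (sum_mset (image_mset (\<lambda>v. v ^ Suc k) L)) =
    (\<Sum>i<size L. lookup ((Yh (size L) i ^^ k) (Yop (size L) i (rho (size L) (MM L)))) e - jalpha ^ Suc k * of_nat (lk e i ^ Suc k))"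
    unfolding mon_Hop[OF assms e] by (simp only: sum_subtractf of_nat_sum sum_distrib_left)
  moreover have "Ial (Suc k) \<dots>"
    by (rule Ial_sum) (use diag_near_Hop[OF assms] e in \<open>auto simp: diag_near_def\<close>)
  ultimately show ?thesis by simp
qed

section \<open>Separation of partitions by power sums of their parts\<close>

lemma power_Suc_bound: "x ^ Suc K + K * x ^ K \<le> x * (x + 1) ^ K" for x :: nat
proof (induction K)
  case (Suc K)
  have "x * (x + 1) ^ Suc K = (x * (x + 1) ^ K) * (x + 1)" by (simp only: power_Suc mult_ac)
  also have "\<dots> \<ge> (x ^ Suc K + K * x ^ K) * (x + 1)" using Suc by (rule mult_right_mono) simp
  also have "(x ^ Suc K + K * x ^ K) * (x + 1) = x ^ Suc (Suc K) + Suc K * x ^ Suc K + K * x ^ K" by (simp add: algebra_simps)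
  finally show ?case by simp
qed simp

text \<open>The single part v outweighs all of \<open>B\<close>: a Bernoulli type inequality gives
  v^K > n (v - 1)^K for v > 1 once K > n^2, and \<open>B\<close> has at most n parts, each at most v
  - 1.\<close>

lemma sum_powers_less:
  assumes "v \<in># A" "\<And>w. w \<in># B \<Longrightarrow> w < v" "sum_mset A = n" "sum_mset B = n" "0 \<notin># A" "0 \<notin># B" "n * n < K"
  shows "sum_mset (image_mset (\<lambda>w. w ^ K) B) < sum_mset (image_mset (\<lambda>w. w ^ K) (A :: nms))"
proof -
  have "v ^ K \<in># image_mset (\<lambda>w. w ^ K) A" using assms(1) by simp
  then have A: "v ^ K \<le> sum_mset (image_mset (\<lambda>w. w ^ K) A)" by (rule elem_le_sum_mset)
  have v: "v \<le> n" using elem_le_sum_mset[OF assms(1)] assms(3) by simp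
  show ?thesis
  proof (cases "B = {#}")
    case True
    then have "n = 0" using assms(4) by simp
    then have "v = 0" using v by simp
    then show ?thesis using assms(1,5) by simp
  next
    case False
    then obtain w where w: "w \<in># B" by (meson multiset_nonemptyE)
    then have "w > 0" "w < v" using assms(2,6) by (auto intro: gr0I)
    then obtain x where x: "v = Suc x" "x > 0" by (cases v) auto
    have "sum_mset (image_mset (\<lambda>w. w ^ K) B) \<le> sum_mset (image_mset (\<lambda>w. x ^ K) B)"
    proof (rule sum_mset_mono)
      fix w assume "w \<in># B"
      then have "w < v" by (rule assms(2))
      then show "w ^ K \<le> x ^ K" using x by (intro power_mono) auto
    qed
    also have "\<dots> = size B * x ^ K" by simp
    also have "\<dots> \<le> n * x ^ K" using size_le_sum_mset[OF assms(6)] assms(4) by simp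
    also have "\<dots> < v ^ K"
    proof -
      have "x * (n * x ^ K) \<le> (n * n) * x ^ K" using v x by (simp add: mult.assoc[symmetric])
      also have "\<dots> < K * x ^ K" using assms(7) x by simp
      also have "\<dots> \<le> x * (x + 1) ^ K" using power_Suc_bound[of x K] by linarith
      finally show ?thesis using x by simp
    qed
    finally show ?thesis using A by linarith
  qed
qed

lemma Ial_power_eq_0:
  assumes "Ial K (of_int z * jalpha ^ K)"
  shows "z = 0"
proof -
  obtain c :: "nat \<Rightarrow> int" where c: "of_int z * jalpha ^ K = (\<Sum>i<K. of_int (c i) * jalpha ^ i)"
    using assms by (auto simp: Ial_def)
  have "(\<Sum>i<Suc K. of_int (if i < K then c i else - z) * jalpha ^ i) = 0" using c by simp
  from jalpha_transcendental[OF this, of K] show ?thesis by simp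
qed

text \<open>Common parts cancel; of the remaining ones the largest occurs on one side only and
  decides.\<close>

lemma sum_powers_inject:
  assumes "L \<in> multisets_of n" "M \<in> multisets_of n" "L \<noteq> M" "n * n < K"
  shows "sum_mset (image_mset (\<lambda>w. w ^ K) L) \<noteq> sum_mset (image_mset (\<lambda>w. w ^ K) M)"
proof -
  let ?A = "L - M" and ?B = "M - L"
  have LM: "L = L \<inter># M + ?A" "M = L \<inter># M + ?B"
    by (auto simp: multiset_eq_iff)
  have sums: "sum_mset L = sum_mset (L \<inter># M) + sum_mset ?A" "sum_mset M = sum_mset (L \<inter># M) + sum_mset ?B"
    using arg_cong[OF LM(1), of sum_mset] arg_cong[OF LM(2), of sum_mset] by simp_all
  have eq: "sum_mset L = n" "sum_mset M = n" "0 \<notin># ?A" "0 \<notin># ?B"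
    using assms(1,2) by (auto simp: multisets_of_def dest: in_diffD)
  have s: "sum_mset ?B = sum_mset ?A" "sum_mset ?A * sum_mset ?A < K"
  proof -
    show "sum_mset ?B = sum_mset ?A" using sums eq by linarith
    have "sum_mset ?A \<le> n" using sums eq by linarith
    then show "sum_mset ?A * sum_mset ?A < K" using assms(4) mult_le_mono by (metis le_less_trans)
  qed
  have ne: "set_mset (?A + ?B) \<noteq> {}"
  proof
    assume "set_mset (?A + ?B) = {}"
    then have "?A = {#}" "?B = {#}" by auto
    then show False using LM assms(3) by simp
  qed
  define v where "v = Max (set_mset (?A + ?B))"
  have v: "v \<in># ?A + ?B" "\<And>w. w \<in># ?A + ?B \<Longrightarrow> w \<le> v"
    unfolding v_def using ne by (auto intro: Max_in Max_ge simp del: set_mset_union)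
  have disj: "\<not> (w \<in># ?A \<and> w \<in># ?B)" for w
    by (auto simp: in_diff_count)
  have "sum_mset (image_mset (\<lambda>w. w ^ K) ?A) \<noteq> sum_mset (image_mset (\<lambda>w. w ^ K) ?B)"
  proof (cases "v \<in># ?A")
    case True
    have "w < v" if "w \<in># ?B" for w
    proof -
      have "w \<le> v" using v(2)[of w] that by simp
      moreover have "w \<noteq> v" using disj True that by blast
      ultimately show ?thesis by simp
    qed
    from sum_powers_less[OF True this refl s(1) eq(3,4) s(2)] show ?thesis by simp
  next
    case False
    then have vB: "v \<in># ?B" using v(1) by simp
    have "w < v" if "w \<in># ?A" for w
    proof -
      have "w \<le> v" using v(2)[of w] that by simp
      moreover have "w \<noteq> v" using False that by blast
      ultimately show ?thesis by simp
    qed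
    from sum_powers_less[OF vB this s(1) refl eq(4,3) s(2)] show ?thesis by simp
  qed
  moreover have "sum_mset (image_mset (\<lambda>w. w ^ K) L) = sum_mset (image_mset (\<lambda>w. w ^ K) (L \<inter># M)) + sum_mset (image_mset (\<lambda>w. w ^ K) ?A)"
    "sum_mset (image_mset (\<lambda>w. w ^ K) M) = sum_mset (image_mset (\<lambda>w. w ^ K) (L \<inter># M)) + sum_mset (image_mset (\<lambda>w. w ^ K) ?B)"
    using arg_cong[OF LM(1), of "\<lambda>X. sum_mset (image_mset (\<lambda>w. w ^ K) X)"]
      arg_cong[OF LM(2), of "\<lambda>X. sum_mset (image_mset (\<lambda>w. w ^ K) X)"] by simp_all
  ultimately show ?thesis by simp
qed

section \<open>Existence and uniqueness of Jack functions\<close>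

text \<open>With the exponent n^2 the leading term of the eigenvalue is alpha^(n^2+1) times a power
  sum of exponent n^2 + 1, which is large enough for the separation.\<close>

definition ev :: "nat \<Rightarrow> nms \<Rightarrow> ratfun" where
  "ev n L = mon (Hop (n * n) n (MM L)) L"

lemma multisets_ofD: "L \<in> multisets_of n \<Longrightarrow> 0 \<notin># L" "L \<in> multisets_of n \<Longrightarrow> sum_mset L = n"
  by (auto simp: multisets_of_def)

text \<open>Equal eigenvalues would have equal coefficients of alpha^(n^2+1), by transcendence, and
  these are the power sums of the parts.\<close>

lemma ev_inject:
  assumes "L \<in> multisets_of n" "M \<in> multisets_of n" "L \<noteq> M"
  shows "ev n L \<noteq> ev n M"
proof
  assume eq: "ev n L = ev n M"
  let ?K = "Suc (n * n)"
  let ?p = "\<lambda>L. sum_mset (image_mset (\<lambda>w. w ^ ?K) L)"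
  have I: "Ial ?K (ev n L - jalpha ^ ?K * of_nat (?p L))" if "L \<in> multisets_of n" for L
    using mon_Hop_diagonal[OF multisets_ofD(1)[OF that], of "n * n"] unfolding multisets_ofD(2)[OF that] ev_def .
  have "(ev n M - jalpha ^ ?K * of_nat (?p M)) - (ev n L - jalpha ^ ?K * of_nat (?p L)) = of_int (int (?p L) - int (?p M)) * jalpha ^ ?K"
  proof -
    have "(e - k * of_nat x) - (e - k * of_nat y) = of_int (int y - int x) * k" for e k :: ratfun and x y
      by (simp add: algebra_simps)
    then show ?thesis unfolding eq .
  qed
  then have "Ial ?K (of_int (int (?p L) - int (?p M)) * jalpha ^ ?K)" using Ial_diff[OF I[OF assms(2)] I[OF assms(1)]] by simp
  then have "int (?p L) - int (?p M) = 0" by (rule Ial_power_eq_0)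
  then have "?p L = ?p M" by linarith
  then show False using sum_powers_inject[OF assms, of ?K] by blast
qed

abbreviation dom :: "nms \<Rightarrow> nms \<Rightarrow> bool" where
  "dom M L \<equiv> dominated (Partition M) (Partition L)"

lemma dom_sum: "dom M L \<Longrightarrow> 0 \<notin># M \<Longrightarrow> 0 \<notin># L \<Longrightarrow> sum_mset M = sum_mset L"
  by (simp add: dominated_def psize_def)

lemma dom_antisym: "dom M L \<Longrightarrow> dom L M \<Longrightarrow> 0 \<notin># M \<Longrightarrow> 0 \<notin># L \<Longrightarrow> M = L"
  using dominated_antisym Partition_eq_iff by blast

text \<open>A rank that strictly increases along dominance, for inductions over this partial
  order.\<close>

definition rk :: "nat \<Rightarrow> nms \<Rightarrow> nat" where
  "rk n L = card {M \<in> multisets_of n. dom M L}"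

lemma rk_less:
  assumes "dom M L" "M \<noteq> L" "M \<in> multisets_of n" "L \<in> multisets_of n"
  shows "rk n M < rk n L"
  unfolding rk_def
proof (rule psubset_card_mono)
  show "finite {M \<in> multisets_of n. dom M L}" by (simp add: finite_multisets_of)
  have "{K \<in> multisets_of n. dom K M} \<subseteq> {K \<in> multisets_of n. dom K L}"
    using assms(1) dominated_trans by blast
  moreover have "L \<notin> {K \<in> multisets_of n. dom K M}"
    using dom_antisym[OF assms(1)] assms(2) multisets_ofD(1)[OF assms(3)] multisets_ofD(1)[OF assms(4)] by auto
  moreover have "L \<in> {K \<in> multisets_of n. dom K L}" using assms(4) dominated_refl by auto
  ultimately show "{K \<in> multisets_of n. dom K M} \<subset> {K \<in> multisets_of n. dom K L}" by blast
qed

definition utri :: "nms \<Rightarrow> fock \<Rightarrow> bool" where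
  "utri L f \<longleftrightarrow> hom (int (sum_mset L)) f \<and> mon f L = 1 \<and> (\<forall>\<nu>. 0 \<notin># \<nu> \<longrightarrow> mon f \<nu> \<noteq> 0 \<longrightarrow> dom \<nu> L)"

definition downset :: "nat \<Rightarrow> nms set \<Rightarrow> bool" where
  "downset n D \<longleftrightarrow> D \<subseteq> multisets_of n \<and> (\<forall>M\<in>D. \<forall>K\<in>multisets_of n. dom K M \<longrightarrow> K \<in> D)"

lemma downset_below: "L \<in> multisets_of n \<Longrightarrow> downset n {M \<in> multisets_of n. dom M L \<and> M \<noteq> L}"
  unfolding downset_def
  by (auto intro: dominated_trans) (metis dom_antisym multisets_ofD(1))

text \<open>A member of \<open>D\<close> of maximal rank lies below no other member, so it can be
  split off and the remaining set is again closed downwards.\<close>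

lemma unitriangular_span:
  assumes "downset n D" "\<And>M. M \<in> D \<Longrightarrow> utri M (g M)" "hom (int n) f" "\<And>\<nu>. 0 \<notin># \<nu> \<Longrightarrow> mon f \<nu> \<noteq> 0 \<Longrightarrow> \<nu> \<in> D"
  shows "\<exists>b. f = (\<Sum>M\<in>D. fscale (b M) (g M))"
  using assms
proof (induction "card D" arbitrary: D f rule: less_induct)
  case less
  have finD: "finite D" using less.prems(1) finite_multisets_of finite_subset unfolding downset_def by blast
  show ?case
  proof (cases "D = {}")
    case True
    then have "f = 0" using less.prems(4) by (intro mon_injective) blast
    then show ?thesis using True by simp
  next
    case False
    define r where "r = Max (rk n ` D)"
    have "r \<in> rk n ` D" unfolding r_def using finD False by (intro Max_in) auto
    then obtain M where M: "M \<in> D" "rk n M = r" by auto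
    have max: "rk n K \<le> rk n M" if "K \<in> D" for K unfolding M(2) r_def using finD that by (intro Max_ge) auto
    have Dn: "D \<subseteq> multisets_of n" using less.prems(1) by (simp add: downset_def)
    have M0: "0 \<notin># M" "sum_mset M = n" using Dn M(1) multisets_ofD by auto
    let ?f = "f - fscale (mon f M) (g M)"
    have gM: "utri M (g M)" by (rule less.prems(2)[OF M(1)])
    have "downset n (D - {M})"
      unfolding downset_def
    proof (intro conjI ballI impI)
      show "D - {M} \<subseteq> multisets_of n" using Dn by blast
      fix K J assume K: "K \<in> D - {M}" and J: "J \<in> multisets_of n" "dom J K"
      have "J \<in> D" using less.prems(1) K J unfolding downset_def by blast
      moreover have "J \<noteq> M"
      proof
        assume "J = M"
        then have "rk n M < rk n K" using rk_less[of M K n] J K Dn by auto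
        then show False using max[of K] K by auto
      qed
      ultimately show "J \<in> D - {M}" by simp
    qed
    moreover have "hom (int n) ?f"
      using less.prems(3) gM M0 by (intro hom_diff hom_scale) (simp_all add: utri_def del: of_nat_sum_mset)
    moreover have "\<nu> \<in> D - {M}" if "0 \<notin># \<nu>" "mon ?f \<nu> \<noteq> 0" for \<nu>
    proof -
      have "\<nu> \<noteq> M" using that(2) gM by (auto simp: mon_diff mon_scale utri_def)
      moreover have "\<nu> \<in> D"
      proof (cases "mon f \<nu> = 0")
        case True
        then have "mon (g M) \<nu> \<noteq> 0" using that(2) by (auto simp: mon_diff mon_scale)
        then have d: "dom \<nu> M" using gM that(1) by (simp add: utri_def)
        then have "\<nu> \<in> multisets_of n" using dom_sum[OF d that(1) M0(1)] M0 that(1) by (simp add: multisets_of_def)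
        then show ?thesis using less.prems(1) M(1) d unfolding downset_def by blast
      qed (use less.prems(4) that(1) in blast)
      ultimately show ?thesis by simp
    qed
    moreover have "card (D - {M}) < card D" using M(1) finD by (intro psubset_card_mono) auto
    ultimately obtain b where b: "?f = (\<Sum>K\<in>D - {M}. fscale (b K) (g K))"
      using less.hyps[of "D - {M}" ?f] less.prems(2) by blast
    have "f = fscale (mon f M) (g M) + ?f" by simp
    also have "\<dots> = (\<Sum>K\<in>D. fscale ((b(M := mon f M)) K) (g K))"
      unfolding b sum.remove[OF finD M(1)] by (intro arg_cong2[of _ _ _ _ "(+)"] sum.cong) auto
    finally show ?thesis by blast
  qed
qed

lemma downset_all: "downset n (multisets_of n)"
  by (auto simp: downset_def)

definition is_eig :: "nat \<Rightarrow> nms \<Rightarrow> fock \<Rightarrow> bool" where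
  "is_eig n L f \<longleftrightarrow> utri L f \<and> Hop (n * n) n f = fscale (ev n L) f"

text \<open>The failure of m_L to be an eigenvector lies in the span of the eigenvectors below;
  dividing its components by the differences of eigenvalues gives the correction.\<close>

lemma eigenvector_exists: "L \<in> multisets_of n \<Longrightarrow> \<exists>f. is_eig n L f"
proof (induction "rk n L" arbitrary: L rule: less_induct)
  case less
  let ?T = "Hop (n * n) n"
  let ?D = "{M \<in> multisets_of n. dom M L \<and> M \<noteq> L}"
  note L = multisets_ofD[OF less.prems]
  have "\<exists>f. is_eig n M f" if "M \<in> ?D" for M
    using less.hyps[of M] rk_less[of M L n] that less.prems by auto
  then obtain g where g: "\<And>M. M \<in> ?D \<Longrightarrow> is_eig n M (g M)" by metis
  let ?f = "?T (MM L) - fscale (ev n L) (MM L)"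
  have h: "hom (int n) (MM L)" using hom_MM[OF L(1)] unfolding L(2) .
  have hf: "hom (int n) ?f" by (intro hom_diff hom_Hop hom_scale h)
  have "\<nu> \<in> ?D" if "0 \<notin># \<nu>" "mon ?f \<nu> \<noteq> 0" for \<nu>
  proof -
    have "\<nu> \<noteq> L" using that L by (auto simp: mon_diff mon_scale mon_MM ev_def)
    moreover have "mon (?T (MM L)) \<nu> \<noteq> 0"
      using that calculation by (simp add: mon_diff mon_scale mon_MM[OF L(1) that(1)])
    then have "dom \<nu> L" using mon_Hop_triangular[OF L(1) that(1)] unfolding L(2) by blast
    moreover have "\<nu> \<in> multisets_of n" using hom_mon[OF hf that] that(1) by (simp only: of_nat_eq_iff multisets_of_def) simp
    ultimately show ?thesis by simp
  qed
  then obtain b where b: "?f = (\<Sum>M\<in>?D. fscale (b M) (g M))"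
    using unitriangular_span[OF downset_below[OF less.prems], of g ?f] g hf unfolding is_eig_def by blast
  let ?P = "MM L + (\<Sum>M\<in>?D. fscale (b M / (ev n L - ev n M)) (g M))"
  have ne: "ev n L - ev n M \<noteq> 0" if "M \<in> ?D" for M using ev_inject[of L n M] less.prems that by auto
  have "?T ?P = ?T (MM L) + (\<Sum>M\<in>?D. fscale (b M / (ev n L - ev n M) * ev n M) (g M))"
    using g by (simp add: flinear_add[OF flinear_Hop] flinear_sum[OF flinear_Hop] flinear_scale[OF flinear_Hop] is_eig_def)
  also have "?T (MM L) = fscale (ev n L) (MM L) + ?f" by simp
  also have "fscale (ev n L) (MM L) + ?f + (\<Sum>M\<in>?D. fscale (b M / (ev n L - ev n M) * ev n M) (g M)) =
     fscale (ev n L) (MM L) + (\<Sum>M\<in>?D. fscale (b M) (g M) + fscale (b M / (ev n L - ev n M) * ev n M) (g M))"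
    unfolding b sum.distrib by (simp only: add.assoc)
  also have "(\<Sum>M\<in>?D. fscale (b M) (g M) + fscale (b M / (ev n L - ev n M) * ev n M) (g M)) =
     (\<Sum>M\<in>?D. fscale (ev n L) (fscale (b M / (ev n L - ev n M)) (g M)))"
  proof (rule sum.cong[OF refl])
    fix M assume M: "M \<in> ?D"
    have "b M + b M / (ev n L - ev n M) * ev n M = ev n L * (b M / (ev n L - ev n M))"
      using ne[OF M] by (simp add: field_simps)
    then show "fscale (b M) (g M) + fscale (b M / (ev n L - ev n M) * ev n M) (g M) = fscale (ev n L) (fscale (b M / (ev n L - ev n M)) (g M))"
      by (simp only: fock.scale_left_distrib[symmetric] fock.scale_scale)
  qed
  also have "fscale (ev n L) (MM L) + \<dots> = fscale (ev n L) ?P"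
    by (simp only: fock.scale_right_distrib fock.scale_sum_right)
  finally have T: "?T ?P = fscale (ev n L) ?P" .
  have dg: "dom \<nu> M" if "M \<in> ?D" "0 \<notin># \<nu>" "mon (g M) \<nu> \<noteq> 0" for M \<nu>
    using g[OF that(1)] that(2,3) by (simp add: is_eig_def utri_def)
  have "hom (int n) (g M)" if "M \<in> ?D" for M
  proof -
    have "sum_mset M = n" using that multisets_ofD(2) by blast
    then show ?thesis using g[OF that] unfolding is_eig_def utri_def by (simp del: of_nat_sum_mset)
  qed
  then have "hom (int n) ?P" by (intro hom_add h hom_sum hom_scale)
  moreover have "mon ?P L = 1"
  proof -
    have "mon (g M) L = 0" if "M \<in> ?D" for M
    proof (rule ccontr)
      assume "mon (g M) L \<noteq> 0"
      then have "dom L M" using dg[OF that L(1)] by blast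
      then show False using that dom_antisym[of L M] L(1) multisets_ofD(1) by auto
    qed
    then show ?thesis using L(1) by (simp add: mon_add mon_sum mon_scale mon_MM)
  qed
  moreover have "dom \<nu> L" if "0 \<notin># \<nu>" "mon ?P \<nu> \<noteq> 0" for \<nu>
  proof (cases "\<nu> = L")
    case False
    then have "(\<Sum>M\<in>?D. b M / (ev n L - ev n M) * mon (g M) \<nu>) \<noteq> 0"
      using that(2) by (simp add: mon_add mon_sum mon_scale mon_MM[OF L(1) that(1)])
    then obtain M where "M \<in> ?D" "mon (g M) \<nu> \<noteq> 0" by (metis (mono_tags, lifting) mult_zero_right sum.neutral)
    then show ?thesis using dg[OF _ that(1)] dominated_trans by blast
  qed (simp add: dominated_refl)
  ultimately have "is_eig n L ?P" using T L(2) by (simp add: is_eig_def utri_def del: of_nat_sum_mset)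
  then show ?case by blast
qed

definition orth_family :: "(nms \<Rightarrow> fock) \<Rightarrow> bool" where
  "orth_family g \<longleftrightarrow> (\<forall>L. 0 \<notin># L \<longrightarrow> utri L (g L)) \<and> (\<forall>L M. 0 \<notin># L \<longrightarrow> 0 \<notin># M \<longrightarrow> L \<noteq> M \<longrightarrow> jf (g L) (g M) = 0)"

text \<open>Eigenvectors of a self-adjoint operator for distinct eigenvalues are orthogonal, and so
  are vectors of different degrees.\<close>

lemma orth_family_exists: "\<exists>g. orth_family g"
proof -
  have "\<exists>f. is_eig (sum_mset L) L f" if "0 \<notin># L" for L
    by (rule eigenvector_exists) (use that in \<open>simp add: multisets_of_def\<close>)
  then obtain g where g: "\<And>L. 0 \<notin># L \<Longrightarrow> is_eig (sum_mset L) L (g L)" by metis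
  have "jf (g L) (g M) = 0" if LM: "0 \<notin># L" "0 \<notin># M" "L \<noteq> M" for L M
  proof (cases "sum_mset L = sum_mset M")
    case True
    let ?n = "sum_mset M"
    have gL: "is_eig ?n L (g L)" using g[OF LM(1)] unfolding True .
    have "ev ?n L * jf (g L) (g M) = jf (Hop (?n * ?n) ?n (g L)) (g M)"
      using gL by (simp add: is_eig_def jf_scale_left)
    also have "\<dots> = ev ?n M * jf (g L) (g M)"
      unfolding jf_Hop using g[OF LM(2)] by (simp add: is_eig_def jf_scale_right)
    finally have "ev ?n L = ev ?n M \<or> jf (g L) (g M) = 0" unfolding mult_cancel_right by blast
    moreover have "ev ?n L \<noteq> ev ?n M" by (rule ev_inject) (use LM True in \<open>simp_all add: multisets_of_def\<close>)
    ultimately show ?thesis by simp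
  next
    case False
    show ?thesis
    proof (rule jf_hom_0)
      show "hom (int (sum_mset L)) (g L)" "hom (int (sum_mset M)) (g M)"
        using g[OF LM(1)] g[OF LM(2)] by (simp_all only: is_eig_def utri_def)
      show "int (sum_mset L) \<noteq> int (sum_mset M)" using False by (simp only: of_nat_eq_iff not_False_eq_True)
    qed
  qed
  then show ?thesis using g unfolding orth_family_def is_eig_def by blast
qed

lemma orth_family_coefficient:
  assumes g: "orth_family g" and D: "D \<subseteq> multisets_of n" and M: "M \<in> D"
  shows "jf (\<Sum>K\<in>D. fscale (b K) (g K)) (g M) = b M * jf (g M) (g M)"
proof -
  have fin: "finite D" using D finite_multisets_of finite_subset by blast
  have "jf (\<Sum>K\<in>D. fscale (b K) (g K)) (g M) = (\<Sum>K\<in>D. if K = M then b M * jf (g M) (g M) else 0)"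
    unfolding jf_sum_left jf_scale_left
  proof (rule sum.cong[OF refl])
    fix K assume "K \<in> D"
    then have "0 \<notin># K" "0 \<notin># M" using D M multisets_ofD(1) by blast+
    then show "b K * jf (g K) (g M) = (if K = M then b M * jf (g M) (g M) else 0)" using g by (auto simp: orth_family_def)
  qed
  then show ?thesis using fin M by simp
qed

lemma orth_family_span:
  assumes "orth_family g" "hom (int n) f"
  shows "\<exists>b. f = (\<Sum>M\<in>multisets_of n. fscale (b M) (g M))"
proof (rule unitriangular_span[OF downset_all])
  show "utri M (g M)" if "M \<in> multisets_of n" for M using assms(1) that multisets_ofD(1) by (auto simp: orth_family_def)
  show "\<nu> \<in> multisets_of n" if "0 \<notin># \<nu>" "mon f \<nu> \<noteq> 0" for \<nu>
    using hom_mon[OF assms(2) that] that(1) by (simp only: of_nat_eq_iff multisets_of_def) simp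
qed (rule assms(2))

text \<open>Over this field nonzero vectors may be isotropic. A member of norm 0 would be orthogonal
  to its whole degree and hence to everything, against nondegeneracy.\<close>

lemma orth_family_norm:
  assumes g: "orth_family g" and L: "0 \<notin># L"
  shows "jf (g L) (g L) \<noteq> 0"
proof
  assume 0: "jf (g L) (g L) = 0"
  have u: "utri L (g L)" using g L by (simp add: orth_family_def)
  have "jf (g L) (pb M) = 0" if M: "0 \<notin># M" for M
  proof (cases "sum_mset M = sum_mset L")
    case True
    have "hom (int (sum_mset L)) (pb M)" by (rule hom_pb[OF M]) (simp only: True)
    then obtain b where b: "pb M = (\<Sum>K\<in>multisets_of (sum_mset L). fscale (b K) (g K))" using orth_family_span[OF g] by blast
    have "jf (pb M) (g L) = 0"
      unfolding b by (subst orth_family_coefficient[OF g order_refl]) (use L 0 in \<open>simp_all add: multisets_of_def\<close>)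
    then show ?thesis by (simp add: jf_commute)
  next
    case False
    show ?thesis
    proof (rule jf_hom_0)
      show "hom (int (sum_mset L)) (g L)" using u by (simp only: utri_def)
      show "hom (int (sum_mset M)) (pb M)" using M by (intro hom_pb refl)
      show "int (sum_mset L) \<noteq> int (sum_mset M)" using False by (simp only: of_nat_eq_iff not_False_eq_True)
    qed
  qed
  then have "g L = 0" by (rule jf_nondegenerate)
  then show False using u by (simp add: utri_def)
qed

text \<open>The difference of two candidates lies in the span of the lower members, which agree by
  induction, and is orthogonal to each of them.\<close>

lemma orth_family_unique:
  assumes g: "orth_family g" and h: "orth_family h"
  shows "L \<in> multisets_of n \<Longrightarrow> h L = g L"
proof (induction "rk n L" arbitrary: L rule: less_induct)
  case less
  let ?D = "{M \<in> multisets_of n. dom M L \<and> M \<noteq> L}"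
  note L = multisets_ofD[OF less.prems]
  have uL: "utri L (g L)" "utri L (h L)" using g h L by (simp_all add: orth_family_def)
  have eq: "h M = g M" if "M \<in> ?D" for M using less.hyps[of M] rk_less[of M L n] that less.prems by auto
  let ?f = "h L - g L"
  have hf: "hom (int n) ?f" using uL unfolding utri_def L(2) by (intro hom_diff) blast+
  have "\<nu> \<in> ?D" if "0 \<notin># \<nu>" "mon ?f \<nu> \<noteq> 0" for \<nu>
  proof -
    have "\<nu> \<noteq> L" using that uL by (auto simp: mon_diff utri_def)
    moreover have "mon (h L) \<nu> \<noteq> 0 \<or> mon (g L) \<nu> \<noteq> 0" using that by (auto simp: mon_diff)
    then have "dom \<nu> L" using uL that(1) unfolding utri_def by blast
    moreover have "\<nu> \<in> multisets_of n" using hom_mon[OF hf that] that(1) by (simp only: of_nat_eq_iff multisets_of_def) simp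
    ultimately show ?thesis by simp
  qed
  moreover have "utri M (g M)" if "M \<in> ?D" for M using g that multisets_ofD(1) by (auto simp: orth_family_def)
  ultimately obtain b where b: "?f = (\<Sum>M\<in>?D. fscale (b M) (g M))"
    using unitriangular_span[OF downset_below[OF less.prems], of g ?f] hf by blast
  have "b M = 0" if M: "M \<in> ?D" for M
  proof -
    have M0: "0 \<notin># M" "M \<noteq> L" using M multisets_ofD(1) by auto
    have "jf ?f (g M) = jf (h L) (h M) - jf (g L) (g M)"
      using eq[OF M] jf_add_left[of ?f "g L" "g M"] by simp
    also have "\<dots> = 0" using g h M0 L by (simp add: orth_family_def)
    finally have "b M * jf (g M) (g M) = 0"
      using orth_family_coefficient[OF g _ M, of n b] unfolding b by simp
    then show ?thesis using orth_family_norm[OF g M0(1)] by simp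
  qed
  then have "?f = 0" unfolding b by (intro sum.neutral) simp
  then show ?case by simp
qed

text \<open>Identities in every number of variables become identities of coefficients: a type is
  read off in as many variables as it has parts.\<close>

lemma is_jackP_family_iff:
  "is_jackP_family jalpha P \<longleftrightarrow> orth_family (\<lambda>L. P (Partition L))"
proof -
  let ?E = "\<lambda>N l u. monomial_sym N l + (\<Sum>m | dominated m l \<and> m \<noteq> l. xconst (u m) * monomial_sym N m)"
  have fin: "finite {m. dominated m l \<and> m \<noteq> l}" for l
  proof (rule finite_subset)
    show "{m. dominated m l \<and> m \<noteq> l} \<subseteq> Partition ` multisets_of (psize l)"
    proof
      fix m assume "m \<in> {m. dominated m l \<and> m \<noteq> l}"
      then have "parts m \<in> multisets_of (psize l)" by (simp add: dominated_def psize_def multisets_of_def)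
      then show "m \<in> Partition ` multisets_of (psize l)" by (metis Partition_parts image_eqI)
    qed
  qed (simp add: finite_multisets_of)
  have lk: "lookup (?E N l u) e =
     (if keys e \<subseteq> {..<N} then (if ty e = parts l then 1 else if dominated (Partition (ty e)) l then u (Partition (ty e)) else 0) else 0)" for N l u e
  proof (cases "keys e \<subseteq> {..<N}")
    case True
    have iff: "ty e = parts m \<longleftrightarrow> m = Partition (ty e)" for m
      by (metis Partition_parts parts_Partition zero_notin_ty)
    have "(\<Sum>m | dominated m l \<and> m \<noteq> l. u m * (if ty e = parts m then 1 else 0)) =
        (\<Sum>m | dominated m l \<and> m \<noteq> l. if m = Partition (ty e) then u (Partition (ty e)) else 0)"
      by (intro sum.cong refl) (auto simp: iff)
    also have "\<dots> = (if dominated (Partition (ty e)) l \<and> Partition (ty e) \<noteq> l then u (Partition (ty e)) else 0)"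
      using fin[of l] by simp
    finally show ?thesis using True
      by (auto simp: lookup_add lookup_sum lookup_monomial_sym iff)
  qed (simp add: lookup_add lookup_sum lookup_monomial_sym)
  have utri_iff: "(\<exists>u. \<forall>N. rho N (P l) = ?E N l u) \<longleftrightarrow> utri (parts l) (P l)" for l
  proof
    assume "\<exists>u. \<forall>N. rho N (P l) = ?E N l u"
    then obtain u where u: "\<And>N. rho N (P l) = ?E N l u" by blast
    have m: "mon (P l) \<nu> = (if \<nu> = parts l then 1 else if dominated (Partition \<nu>) l then u (Partition \<nu>) else 0)" if "0 \<notin># \<nu>" for \<nu>
    proof -
      note \<nu> = that
      obtain e where e: "ty e = \<nu>" "keys e \<subseteq> {..<size \<nu>}" using exponent_exists[OF \<nu>] .
      show ?thesis using arg_cong[OF u[of "size \<nu>"], of "\<lambda>p. lookup p e"] unfolding lk lookup_rho using e by simp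
    qed
    have d: "dominated (Partition \<nu>) l" if "0 \<notin># \<nu>" "mon (P l) \<nu> \<noteq> 0" for \<nu>
      using that m[OF that(1)] dominated_refl by (auto split: if_splits)
    \<comment> \<open>Homogeneity has to be derived: the monomial expansion contains only types
      dominated by \<open>l\<close>, and these have the size of \<open>l\<close>.\<close>
    have "P l = (\<Sum>\<nu>\<in>multisets_of (psize l). fscale (mon (P l) \<nu>) (MM \<nu>))"
    proof (rule mon_eqI)
      fix \<nu> :: "nms" assume n: "0 \<notin># \<nu>"
      have "mon (\<Sum>\<mu>\<in>multisets_of (psize l). fscale (mon (P l) \<mu>) (MM \<mu>)) \<nu> = (\<Sum>\<mu>\<in>multisets_of (psize l). if \<mu> = \<nu> then mon (P l) \<nu> else 0)"
        unfolding mon_sum mon_scale by (intro sum.cong refl) (auto simp: mon_MM[OF _ n] multisets_of_def)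
      also have "\<dots> = (if \<nu> \<in> multisets_of (psize l) then mon (P l) \<nu> else 0)" by (simp add: finite_multisets_of)
      also have "\<dots> = mon (P l) \<nu>"
        using d[OF n] n by (auto simp: dominated_def psize_def multisets_of_def)
      finally show "mon (P l) \<nu> = mon (\<Sum>\<mu>\<in>multisets_of (psize l). fscale (mon (P l) \<mu>) (MM \<mu>)) \<nu>" by simp
    qed
    moreover have "hom (int (psize l)) (\<Sum>\<nu>\<in>multisets_of (psize l). fscale (mon (P l) \<nu>) (MM \<nu>))"
    proof (intro hom_sum hom_scale)
      fix \<nu> assume "\<nu> \<in> multisets_of (psize l)"
      then show "hom (int (psize l)) (MM \<nu>)" using hom_MM[OF multisets_ofD(1)] multisets_ofD(2) by metis
    qed
    ultimately have "hom (int (sum_mset (parts l))) (P l)" by (metis psize_def)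
    then show "utri (parts l) (P l)" using m[of "parts l"] d by (simp add: utri_def del: of_nat_sum_mset)
  next
    assume u: "utri (parts l) (P l)"
    let ?u = "\<lambda>m. mon (P l) (parts m)"
    have "rho N (P l) = ?E N l ?u" for N
    proof (rule poly_mapping_eqI)
      fix e
      have m: "mon (P l) (ty e) = (if ty e = parts l then 1 else if dominated (Partition (ty e)) l then mon (P l) (ty e) else 0)"
      proof -
        have "mon (P l) (ty e) = 0" if "\<not> dominated (Partition (ty e)) l"
          using u that zero_notin_ty[of e] unfolding utri_def Partition_parts by blast
        then show ?thesis using u unfolding utri_def by metis
      qed
      show "lookup (rho N (P l)) e = lookup (?E N l ?u) e"
        unfolding lk lookup_rho parts_Partition[OF zero_notin_ty] by (rule if_cong[OF refl m refl])
    qed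
    then show "\<exists>u. \<forall>N. rho N (P l) = ?E N l u" by (intro exI[of _ "\<lambda>m. mon (P l) (parts m)"]) simp
  qed
  show ?thesis
  proof
    assume "is_jackP_family jalpha P"
    then show "orth_family (\<lambda>L. P (Partition L))"
      unfolding is_jackP_family_def utri_iff orth_family_def by (metis Partition_eq_iff parts_Partition)
  next
    assume "orth_family (\<lambda>L. P (Partition L))"
    then show "is_jackP_family jalpha P"
      unfolding is_jackP_family_def utri_iff orth_family_def by (metis Partition_parts zero_notin_parts)
  qed
qed

text \<open>Existence and uniqueness together give the description \<open>jackP\<close> its
  meaning.\<close>

lemma orth_family_jackP: "orth_family (\<lambda>L. jackP jalpha (Partition L))"
proof -
  obtain g where g: "orth_family g" using orth_family_exists by blast
  have "orth_family (\<lambda>L. g (parts (Partition L)))" using g by (simp add: orth_family_def)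
  then have ex: "is_jackP_family jalpha (\<lambda>l. g (parts l))" by (simp only: is_jackP_family_iff)
  have "Q = (\<lambda>l. g (parts l))" if Q: "is_jackP_family jalpha Q" for Q
  proof
    fix l
    show "Q l = g (parts l)"
      using orth_family_unique[OF g Q[unfolded is_jackP_family_iff], of "parts l" "psize l"]
      by (simp add: multisets_of_def psize_def)
  qed
  then have "is_jackP_family jalpha (jackP jalpha)"
    unfolding jackP_def using ex by (intro theI[of "is_jackP_family jalpha"]) blast+
  then show ?thesis by (simp only: is_jackP_family_iff)
qed

text \<open>The lower coefficients of \<open>S P\<^sub>L\<close> are multiples of \<open>\<langle>P\<^sub>L, S P\<^sub>M\<rangle>\<close> with \<open>M < L\<close>, which vanish since
  \<open>S P\<^sub>M\<close> is a combination of the \<open>P\<^sub>K\<close> with \<open>K \<le> M\<close>.\<close>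

lemma orth_family_eigen:
  assumes g: "orth_family g" and S: "flinear S" "\<And>f. hom (int n) f \<Longrightarrow> hom (int n) (S f)"
    and sa: "\<And>f h. jf (S f) h = jf f (S h)"
    and tr: "\<And>M \<nu>. M \<in> multisets_of n \<Longrightarrow> 0 \<notin># \<nu> \<Longrightarrow> mon (S (MM M)) \<nu> \<noteq> 0 \<Longrightarrow> dom \<nu> M"
    and L: "L \<in> multisets_of n"
  shows "S (g L) = fscale (mon (S (MM L)) L) (g L)"
proof -
  let ?c = "mon (S (MM L)) L"
  let ?D = "\<lambda>L. {M \<in> multisets_of n. dom M L \<and> M \<noteq> L}"
  have u: "utri M (g M)" if "M \<in> multisets_of n" for M using g that multisets_ofD(1) by (auto simp: orth_family_def)
  have hg: "hom (int n) (g M)" if "M \<in> multisets_of n" for M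
    using u[OF that] unfolding utri_def multisets_ofD(2)[OF that] by blast
  have Sg: "mon (S (g M)) \<nu> = (\<Sum>K\<in>multisets_of n. mon (g M) K * mon (S (MM K)) \<nu>)" if "M \<in> multisets_of n" for M \<nu>
    by (subst MM_expansion[OF hg[OF that]]) (simp add: flinear_sum[OF S(1)] flinear_scale[OF S(1)] mon_sum mon_scale)
  have trg: "dom \<nu> M" if "M \<in> multisets_of n" "0 \<notin># \<nu>" "mon (S (g M)) \<nu> \<noteq> 0" for M \<nu>
  proof -
    note M = that
    obtain K where K: "K \<in> multisets_of n" "mon (g M) K * mon (S (MM K)) \<nu> \<noteq> 0"
      using M(3) unfolding Sg[OF M(1)] by (meson sum.neutral)
    have "dom K M" using u[OF that(1)] K multisets_ofD(1)[OF K(1)] by (auto simp: utri_def)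
    moreover have "dom \<nu> K" using tr[OF K(1) that(2)] K(2) by auto
    ultimately show ?thesis using dominated_trans by blast
  qed
  have inn: "\<nu> \<in> multisets_of n" if "hom (int n) f" "0 \<notin># \<nu>" "mon f \<nu> \<noteq> 0" for f \<nu>
    using hom_mon[OF that] that(2) by (simp only: of_nat_eq_iff multisets_of_def) simp
  have diag: "mon (S (g L)) L = ?c"
  proof -
    have "mon (S (g L)) L = (\<Sum>K\<in>multisets_of n. if K = L then ?c else 0)"
      unfolding Sg[OF L]
    proof (rule sum.cong[OF refl])
      fix K assume K: "K \<in> multisets_of n"
      have "mon (g L) K * mon (S (MM K)) L = 0" if "K \<noteq> L"
      proof (rule ccontr)
        assume a: "mon (g L) K * mon (S (MM K)) L \<noteq> 0"
        then have "dom K L" using u[OF L] multisets_ofD(1)[OF K] by (auto simp: utri_def)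
        moreover have "dom L K" using tr[OF K multisets_ofD(1)[OF L]] a by auto
        ultimately show False using that dom_antisym multisets_ofD(1)[OF K] multisets_ofD(1)[OF L] by blast
      qed
      moreover have "mon (g L) L = 1" using u[OF L] by (simp add: utri_def)
      ultimately show "mon (g L) K * mon (S (MM K)) L = (if K = L then ?c else 0)" by auto
    qed
    then show ?thesis using L by (simp add: finite_multisets_of)
  qed
  let ?f = "S (g L) - fscale ?c (g L)"
  have hf: "hom (int n) ?f" by (intro hom_diff S(2) hom_scale hg L)
  have "\<nu> \<in> ?D L" if n: "0 \<notin># \<nu>" "mon ?f \<nu> \<noteq> 0" for \<nu>
  proof -
    have "\<nu> \<noteq> L" using n(2) diag u[OF L] by (auto simp: mon_diff mon_scale utri_def)
    moreover have "mon (S (g L)) \<nu> \<noteq> 0 \<or> mon (g L) \<nu> \<noteq> 0" using n by (auto simp: mon_diff mon_scale)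
    then have "dom \<nu> L" using u[OF L] n(1) trg[OF L n(1)] unfolding utri_def by blast
    ultimately show ?thesis using inn[OF hf n] by simp
  qed
  then obtain b where b: "?f = (\<Sum>M\<in>?D L. fscale (b M) (g M))"
    using unitriangular_span[OF downset_below[OF L], of g ?f] hf u by blast
  have "b M = 0" if M: "M \<in> ?D L" for M
  proof -
    have M': "M \<in> multisets_of n" "M \<noteq> L" "dom M L" "0 \<notin># M" using M multisets_ofD(1) by auto
    have L0: "0 \<notin># L" using L multisets_ofD(1) by blast
    let ?E = "{K \<in> multisets_of n. dom K M}"
    have "downset n ?E" unfolding downset_def using dominated_trans by blast
    moreover have "\<nu> \<in> ?E" if "0 \<notin># \<nu>" "mon (S (g M)) \<nu> \<noteq> 0" for \<nu>
      using inn[OF S(2)[OF hg[OF M'(1)]] that] trg[OF M'(1) that] by simp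
    ultimately obtain d where d: "S (g M) = (\<Sum>K\<in>?E. fscale (d K) (g K))"
      using unitriangular_span[of n ?E g "S (g M)"] S(2)[OF hg[OF M'(1)]] u by blast
    have "jf (g L) (g K) = 0" if "K \<in> ?E" for K
    proof -
      have "K \<noteq> L" using that M' dom_antisym[of L M] L0 by auto
      then show ?thesis using g that L0 multisets_ofD(1) unfolding orth_family_def by blast
    qed
    then have "jf (g L) (S (g M)) = 0" unfolding d jf_sum_right jf_scale_right by (intro sum.neutral) simp
    moreover have "jf (g L) (g M) = 0" using g M' L0 by (simp add: orth_family_def)
    ultimately have "jf ?f (g M) = 0"
      using jf_add_left[of ?f "fscale ?c (g L)" "g M"] by (simp add: sa jf_scale_left)
    then have "b M * jf (g M) (g M) = 0"
      using orth_family_coefficient[OF g _ M, of n b] unfolding b by simp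
    then show ?thesis using orth_family_norm[OF g M'(4)] by simp
  qed
  then have "?f = 0" unfolding b by (intro sum.neutral) simp
  then show ?thesis by simp
qed

section \<open>The Laplace-Beltrami operator and \<open>\<GG>\<^sub>1\<close>\<close>

text \<open>The Laplace-Beltrami operator. The multiple of the degree and the factor are chosen so
  that the eigenvalue on P_l becomes \<open>content_sum l\<close>.\<close>

definition Dop :: "fock \<Rightarrow> fock" where
  "Dop = lin_ext (\<lambda>l. fscale (1 / (2 * jalpha))
     (Hop 1 (psize l) (pbasis l) - fscale (jalpha * (jalpha - 1) * of_nat (psize l)) (pbasis l)))"

lemma flinear_Dop: "flinear Dop"
  unfolding Dop_def by (rule linear_lin_ext)

lemma Dop_hom:
  assumes "hom (int n) f"
  shows "Dop f = fscale (1 / (2 * jalpha)) (Hop 1 n f - fscale (jalpha * (jalpha - 1) * of_nat n) f)"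
  using assms
proof (induction rule: hom_induct)
  case zero show ?case by (simp add: flinear_0[OF flinear_Dop] flinear_0[OF flinear_Hop])
next
  case (add f g)
  then show ?case
    by (simp add: flinear_add[OF flinear_Dop] flinear_add[OF flinear_Hop] fock.scale_right_distrib fock.scale_right_diff_distrib)
next
  case (scale c f)
  then show ?case
    by (simp add: flinear_scale[OF flinear_Dop] flinear_scale[OF flinear_Hop] fock.scale_right_diff_distrib mult_ac)
next
  case (pb L)
  have "sum_mset L = n" by (rule of_nat_eq_iff[THEN iffD1, OF pb(2)])
  then have "psize (Partition L) = n" using pb(1) by (simp add: psize_def)
  then show ?case by (simp add: Dop_def)
qed

text \<open>The coefficient is read at the decreasingly sorted exponent, where j contributes to the
  exchange terms of i only for i < j.\<close>

lemma mon_Hop_1: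
  "mon (Hop 1 (psize l) (MM (parts l))) (parts l) =
    (\<Sum>i<length (rows l). jalpha ^ 2 * of_nat (rows l ! i) ^ 2 - jalpha * of_nat (rows l ! i) - 2 * jalpha * of_nat i * of_nat (rows l ! i))"
proof -
  let ?xs = "rows l" and ?L = "parts l"
  let ?N = "length ?xs" and ?e = "Poly_Mapping.nth (rows l)" and ?x = "\<lambda>i. of_nat (rows l ! i) :: ratfun"
  have te: "ty ?e = ?L" by (simp add: ty_nth mset_rows nz_id)
  have lke: "lk ?e i = (if i < ?N then ?xs ! i else 0)" for i by (simp add: nth.rep_eq nth_default_def)
  have ke: "keys ?e \<subseteq> {..<?N}"
  proof
    fix i assume "i \<in> keys ?e"
    then have "lk ?e i \<noteq> 0" by (simp only: in_keys_iff not_False_eq_True)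
    then show "i \<in> {..<?N}" unfolding lke by (simp split: if_splits)
  qed
  let ?p = "rho ?N (MM ?L)"
  let ?T = "\<lambda>i. \<Sum>j<?N. if i < j then jalpha * ?x i - jalpha * ?x j else 0"
  let ?Z = "\<lambda>i. \<Sum>j\<in>{..<?N} - {i}. if lk ?e j < lk ?e i then lookup (Yop ?N i ?p) ?e - lookup (Yop ?N i ?p) (upd i j (lk ?e j) (lk ?e i) ?e) else 0"
  have tp: "tri ?L ?p" by (rule tri_rho_MM) simp
  \<comment> \<open>All coefficients of m_L at its own type are 1, so the exchange terms cancel in
    the first application and alpha e_i remains.\<close>
  have q: "lookup (Yop ?N i ?p) e = jalpha * of_nat (lk e i)"
    if e: "ty e = ?L" "keys e \<subseteq> {..<?N}" and i: "i < ?N" for e i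
  proof -
    have 1: "lookup ?p e' = 1" if "ty e' = ?L" "keys e' \<subseteq> {..<?N}" for e'
      using that by (simp add: lookup_rho mon_MM)
    have "lookup ?p (upd i j (lk e j) (lk e i) e) = 1" if "j \<in> {..<?N} - {i}" for j
    proof (rule 1)
      show "ty (upd i j (lk e j) (lk e i) e) = ?L" using ty_swap[of i j e] that e by auto
      show "keys (upd i j (lk e j) (lk e i) e) \<subseteq> {..<?N}" by (rule keys_upd) (use that e i in auto)
    qed
    then have "(\<Sum>j\<in>{..<?N} - {i}. if lk e j < lk e i then lookup ?p e - lookup ?p (upd i j (lk e j) (lk e i) e) else 0) = 0"
      using 1[OF e] by (intro sum.neutral) simp
    then show ?thesis unfolding lookup_Yop_diagonal[OF tp e(1)] using 1[OF e] by simp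
  qed
  have dec: "?xs ! j \<le> ?xs ! i" if "i < j" "j < ?N" for i j
    using sorted_rows[of l] that by (simp add: sorted_wrt_iff_nth_less)
  have Y: "lookup (Yh ?N i (Yop ?N i ?p)) ?e = jalpha ^ 2 * ?x i ^ 2 - of_nat ?N * (jalpha * ?x i) +
      ?T i" if i: "i < ?N" for i
  proof -
    have s: "?Z i
      = (\<Sum>j\<in>{..<?N} - {i}. if i < j then jalpha * ?x i - jalpha * ?x j else 0)"
    proof (rule sum.cong[OF refl])
      fix j assume j: "j \<in> {..<?N} - {i}"
      then have jN: "j < ?N" "j \<noteq> i" by auto
      have "lookup (Yop ?N i ?p) (upd i j (lk ?e j) (lk ?e i) ?e) = jalpha * of_nat (lk (upd i j (lk ?e j) (lk ?e i) ?e) i)"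
      proof (rule q[OF _ _ i])
        show "ty (upd i j (lk ?e j) (lk ?e i) ?e) = ?L" using ty_swap[of i j ?e] jN te by simp
        show "keys (upd i j (lk ?e j) (lk ?e i) ?e) \<subseteq> {..<?N}" by (rule keys_upd[OF ke]) (use jN i in auto)
      qed
      then have u: "lookup (Yop ?N i ?p) (upd i j (lk ?e j) (lk ?e i) ?e) = jalpha * ?x j"
        using jN by (simp add: lookup_upd lke nth_default_def)
      have u': "lookup (Yop ?N i ?p) ?e = jalpha * ?x i" using q[OF te ke i] i by (simp add: lke nth_default_def)
      have l: "lk ?e j = ?xs ! j" "lk ?e i = ?xs ! i" using jN i by (simp_all add: lke nth_default_def)
      show "(if lk ?e j < lk ?e i then lookup (Yop ?N i ?p) ?e - lookup (Yop ?N i ?p) (upd i j (lk ?e j) (lk ?e i) ?e) else 0)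
        = (if i < j then jalpha * ?x i - jalpha * ?x j else 0)"
      proof (cases "i < j")
        case True
        then show ?thesis unfolding u u' unfolding l using dec[OF True jN(1)] by (cases "?xs ! j = ?xs ! i") auto
      next
        case False
        then have "j < i" using jN by simp
        then show ?thesis unfolding l using dec[OF \<open>j < i\<close> i] False by (auto simp: not_less)
      qed
    qed
    also have "\<dots> = ?T i"
      by (rule sum.mono_neutral_left) auto
    finally have s': "?Z i
      = ?T i" .
    have u': "lookup (Yop ?N i ?p) ?e = jalpha * ?x i" using q[OF te ke i] i by (simp add: lke nth_default_def)
    have l: "lk ?e i = ?xs ! i" using i by (simp add: lke nth_default_def)
    show ?thesis
      unfolding Yh_def lookup_minus xconst_of_nat[symmetric] lookup_xconst_mult lookup_Yop_diagonal[OF tri_Yop[OF tp] te]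
      unfolding s' unfolding u' l
      by (simp add: power2_eq_square mult_ac)
  qed
  \<comment> \<open>Summed over pairs, the i-th row, counted from 0, occurs N - 1 - i times with
    sign + and i times with sign -.\<close>
  have swap: "(\<Sum>i<?N. ?T i) =
    (\<Sum>i<?N. jalpha * (of_nat ?N - 1 - 2 * of_nat i) * ?x i)"
  proof -
    have c1: "(\<Sum>j<?N. if i < j then jalpha * ?x i else 0) = of_nat (?N - Suc i) * (jalpha * ?x i)" for i
    proof -
      have "{..<?N} \<inter> {j. i < j} = {Suc i..<?N}" by auto
      then show ?thesis by (simp add: sum.If_cases)
    qed
    have c2: "(\<Sum>i<?N. if i < j then jalpha * ?x j else 0) = of_nat j * (jalpha * ?x j)" if "j < ?N" for j
    proof -
      have "{..<?N} \<inter> {i. i < j} = {..<j}" using that by auto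
      then show ?thesis by (simp add: sum.If_cases)
    qed
    have "(\<Sum>i<?N. ?T i) =
      (\<Sum>i<?N. \<Sum>j<?N. if i < j then jalpha * ?x i else 0) - (\<Sum>i<?N. \<Sum>j<?N. if i < j then jalpha * ?x j else 0)"
      by (simp only: sum_subtractf[symmetric]) (intro sum.cong refl, simp)
    also have "(\<Sum>i<?N. \<Sum>j<?N. if i < j then jalpha * ?x j else 0) = (\<Sum>j<?N. \<Sum>i<?N. if i < j then jalpha * ?x j else 0)"
      by (rule sum.swap)
    also have "\<dots> = (\<Sum>j<?N. of_nat j * (jalpha * ?x j))" by (intro sum.cong refl c2) simp
    finally show ?thesis unfolding c1 sum_subtractf[symmetric]
    proof (rule trans, intro sum.cong refl)
      fix i assume "i \<in> {..<?N}"
      then have "(of_nat (?N - Suc i) :: ratfun) = of_nat ?N - 1 - of_nat i" by (simp add: of_nat_diff)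
      then show "of_nat (?N - Suc i) * (jalpha * ?x i) - of_nat i * (jalpha * ?x i) = jalpha * (of_nat ?N - 1 - 2 * of_nat i) * ?x i"
        by (simp only:) (simp add: algebra_simps)
    qed
  qed
  have "mon (Hop 1 (psize l) (MM ?L)) ?L = (\<Sum>i<?N. lookup (Yh ?N i (Yop ?N i ?p)) ?e)"
    using mon_Hop[OF zero_notin_parts te ke, of 1] by (simp add: psize_def)
  also have "\<dots> = (\<Sum>i<?N. jalpha ^ 2 * ?x i ^ 2 - of_nat ?N * (jalpha * ?x i) +
      ?T i)"
    by (intro sum.cong refl Y) simp
  also have "\<dots> = (\<Sum>i<?N. jalpha ^ 2 * ?x i ^ 2 - of_nat ?N * (jalpha * ?x i) + jalpha * (of_nat ?N - 1 - 2 * of_nat i) * ?x i)"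
    unfolding sum.distrib swap ..
  also have "\<dots> = (\<Sum>i<?N. jalpha ^ 2 * ?x i ^ 2 - jalpha * ?x i - 2 * jalpha * of_nat i * ?x i)"
    by (intro sum.cong refl) (simp add: algebra_simps)
  finally show ?thesis .
qed

definition content_sum :: "partition \<Rightarrow> ratfun" where
  "content_sum l = (\<Sum>s\<in>cells l. jalpha * of_nat (coarm l s) - of_nat (coleg l s))"

text \<open>The coarms in a row are 0, 1, ..., so their Gauss sum gives the quadratic term; the
  coleg is constant along a row.\<close>

lemma content_sum_rows:
  "2 * content_sum l = (\<Sum>i<length (rows l). jalpha * (of_nat (rows l ! i) ^ 2 - of_nat (rows l ! i)) - 2 * of_nat i * of_nat (rows l ! i))"
proof -
  let ?xs = "rows l"
  let ?N = "length ?xs"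
  have cells: "cells l = (SIGMA i:{..<?N}. {..<?xs ! i})" by (auto simp: cells_def)
  have co: "coarm l (i, j) = j" "coleg l (i, j) = i" if "i < ?N" "j < ?xs ! i" for i j
  proof -
    have "{j'. j' < j \<and> (i, j') \<in> cells l} = {..<j}" using that by (auto simp: cells)
    then show "coarm l (i, j) = j" by (simp add: coarm_def)
    have "(i', j) \<in> cells l" if "i' < i" for i'
    proof -
      have "?xs ! i \<le> ?xs ! i'" using sorted_rows[of l] that \<open>i < ?N\<close> by (simp add: sorted_wrt_iff_nth_less)
      then show ?thesis using \<open>i < ?N\<close> \<open>j < ?xs ! i\<close> that by (simp add: cells)
    qed
    then have "{i'. i' < i \<and> (i', j) \<in> cells l} = {..<i}" by auto
    then show "coleg l (i, j) = i" by (simp add: coleg_def)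
  qed
  have gauss: "2 * (\<Sum>j<x. of_nat j :: ratfun) = of_nat x ^ 2 - of_nat x" for x
    by (induction x) (simp_all add: algebra_simps power2_eq_square)
  have "content_sum l = (\<Sum>i<?N. \<Sum>j<?xs ! i. jalpha * of_nat (coarm l (i, j)) - of_nat (coleg l (i, j)))"
    unfolding content_sum_def cells by (subst sum.Sigma) auto
  also have "\<dots> = (\<Sum>i<?N. \<Sum>j<?xs ! i. jalpha * of_nat j - of_nat i)"
    by (intro sum.cong refl) (simp add: co)
  also have "\<dots> = (\<Sum>i<?N. jalpha * (\<Sum>j<?xs ! i. of_nat j) - of_nat (?xs ! i) * of_nat i)"
    by (simp add: sum_subtractf sum_distrib_left)
  finally have "2 * content_sum l = (\<Sum>i<?N. jalpha * (2 * (\<Sum>j<?xs ! i. of_nat j)) - 2 * of_nat i * of_nat (?xs ! i))"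
    by (simp add: sum_distrib_left right_diff_distrib mult_ac)
  then show ?thesis unfolding gauss .
qed

lemma Dop_jackP: "Dop (jackP jalpha l) = fscale (content_sum l) (jackP jalpha l)"
proof -
  let ?L = "parts l" and ?n = "psize l"
  have L: "?L \<in> multisets_of ?n" by (simp add: multisets_of_def psize_def)
  have dm: "dom \<nu> M" if "M \<in> multisets_of ?n" "0 \<notin># \<nu>" "mon (Hop 1 ?n (MM M)) \<nu> \<noteq> 0" for M \<nu>
    using mon_Hop_triangular[OF multisets_ofD(1)[OF that(1)] that(2), of 1] that(3) unfolding multisets_ofD(2)[OF that(1)] by blast
  have H: "Hop 1 ?n (jackP jalpha l) = fscale (mon (Hop 1 ?n (MM ?L)) ?L) (jackP jalpha l)"
    using orth_family_eigen[OF orth_family_jackP flinear_Hop hom_Hop jf_Hop dm L] by simp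
  have hom: "hom (int ?n) (jackP jalpha l)"
    using orth_family_jackP unfolding orth_family_def utri_def psize_def by (metis Partition_parts zero_notin_parts)
  have n: "of_nat ?n = (\<Sum>i<length (rows l). of_nat (rows l ! i) :: ratfun)"
    by (simp add: psize_eq_sum_rows sum_list_sum_nth atLeast0LessThan)
  have "mon (Hop 1 ?n (MM ?L)) ?L - jalpha * (jalpha - 1) * of_nat ?n = jalpha * (2 * content_sum l)"
    unfolding mon_Hop_1 n content_sum_rows sum_distrib_left sum_subtractf[symmetric]
    by (intro sum.cong refl) (simp add: algebra_simps power2_eq_square)
  then have e: "1 / (2 * jalpha) * (mon (Hop 1 ?n (MM ?L)) ?L - jalpha * (jalpha - 1) * of_nat ?n) = content_sum l"
    using jalpha_neq_0 by simp
  show ?thesis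
    unfolding Dop_hom[OF hom] H fock.scale_left_diff_distrib[symmetric] fock.scale_scale e ..
qed

section \<open>Identification of the operator G1\<close>

definition t1_scale :: "(nat \<Rightarrow> ratfun) \<Rightarrow> fock \<Rightarrow> fock" where
  "t1_scale c v = Poly_Mapping.mapp (\<lambda>l x. c (plen l) * x) v"

lemma lookup_t1_scale: "lookup (t1_scale c v) l = c (plen l) * lookup v l"
  by (simp add: t1_scale_def lookup_mapp when_def in_keys_iff)

lemma t1_len_eq: "t1_len = t1_scale (\<lambda>k. t1 ^ k)"
  by (rule ext) (simp add: t1_len_def t1_scale_def)

lemma flinear_t1_scale: "flinear (t1_scale c)"
  by (rule flinearI) (auto intro!: poly_mapping_eqI simp: lookup_t1_scale lookup_add algebra_simps)

lemma t1_scale_inverse: "t1_scale (\<lambda>k. inverse (t1 ^ k)) (t1_len v) = v"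
  using t1_neq_0 by (intro poly_mapping_eqI) (simp add: t1_len_eq lookup_t1_scale)

text \<open>Scaling p_M by t1 to the number of its parts carries the Jack functions to the fixed
  point classes up to scalars, so conjugation by it turns Laplace-Beltrami into a candidate for
  \<open>G1\<close>.\<close>

definition G1_model :: "fock \<Rightarrow> fock" where
  "G1_model v = fscale t2 (t1_len (Dop (t1_scale (\<lambda>k. inverse (t1 ^ k)) v)))"

lemma flinear_G1_model: "flinear G1_model"
  by (rule flinearI) (simp_all add: G1_model_def t1_len_eq flinear_add[OF flinear_t1_scale] flinear_scale[OF flinear_t1_scale]
      flinear_add[OF flinear_Dop] flinear_scale[OF flinear_Dop] fock.scale_right_distrib mult.commute)

definition fpc_const :: "partition \<Rightarrow> ratfun" where
  "fpc_const l = t2 ^ psize l * (\<Prod>s\<in>cells l. jalpha * of_nat (arm l s) + of_nat (leg l s) + 1)"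

lemma fixed_point_class_eq: "fixed_point_class l = fscale (fpc_const l) (t1_len (jackP jalpha l))"
  by (simp add: fixed_point_class_def jackJ_def fpc_const_def t1_len_eq flinear_scale[OF flinear_t1_scale])

text \<open>A vanishing factor would be a polynomial relation for alpha with constant term b +
  1.\<close>

lemma fpc_const_neq_0: "fpc_const l \<noteq> 0"
proof -
  have fin: "finite (cells l)"
  proof (rule finite_subset)
    show "cells l \<subseteq> (SIGMA i:{..<length (rows l)}. {..<rows l ! i})" by (auto simp: cells_def)
  qed simp
  have "jalpha * of_nat a + of_nat b + 1 \<noteq> 0" for a b
  proof
    assume "jalpha * of_nat a + of_nat b + 1 = 0"
    then have "(\<Sum>i<2. of_int (if i = 0 then int b + 1 else int a) * jalpha ^ i) = 0"
      by (simp add: numeral_2_eq_2 algebra_simps)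
    from jalpha_transcendental[OF this, of 0] show False by simp
  qed
  then show ?thesis using fin t2_neq_0 by (simp add: fpc_const_def)
qed

text \<open>Since t2 alpha = -t1, multiplication by t2 turns the content alpha a' - l' into -(a' t1
  + l' t2).\<close>

lemma G1_model_fixed_point:
  "G1_model (fixed_point_class l) =
    fscale (- (\<Sum>s\<in>cells l. of_nat (coarm l s) * t1 + of_nat (coleg l s) * t2)) (fixed_point_class l)"
proof -
  have "t2 * jalpha = - t1" using t2_neq_0 by (simp add: jalpha_def)
  then have f: "t2 * (jalpha * of_nat a - of_nat b) = - (of_nat a * t1 + of_nat b * t2)" for a b
    by (simp add: right_diff_distrib mult.assoc[symmetric] mult.commute)
  then have c: "t2 * content_sum l = - (\<Sum>s\<in>cells l. of_nat (coarm l s) * t1 + of_nat (coleg l s) * t2)"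
    unfolding content_sum_def sum_distrib_left sum_negf[symmetric] by (intro sum.cong refl f)
  have "G1_model (t1_len v) = fscale t2 (t1_len (Dop v))" for v
    by (simp add: G1_model_def t1_scale_inverse)
  then have "G1_model (t1_len (jackP jalpha l)) = fscale (t2 * content_sum l) (t1_len (jackP jalpha l))"
    by (simp add: Dop_jackP t1_len_eq flinear_scale[OF flinear_t1_scale])
  then show ?thesis
    unfolding fixed_point_class_eq flinear_scale[OF flinear_G1_model] c by (simp only: fock.scale_scale mult.commute)
qed

text \<open>The fixed point classes span because the Jack functions do and the scaling by powers of
  t1 is invertible.\<close>

lemma flinear_eq_on_fixed_points:
  assumes "flinear S" "flinear T" "\<And>l. S (fixed_point_class l) = T (fixed_point_class l)"
  shows "S = T"
proof (rule flinear_eqI[OF assms(1,2)])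
  fix M :: "nms" assume M: "0 \<notin># M"
  have P: "S (t1_len (jackP jalpha l)) = T (t1_len (jackP jalpha l))" for l
    using assms(3)[of l] fpc_const_neq_0[of l]
    by (simp add: fixed_point_class_eq flinear_scale[OF assms(1)] flinear_scale[OF assms(2)])
  obtain b where b: "pb M = (\<Sum>K\<in>multisets_of (sum_mset M). fscale (b K) (jackP jalpha (Partition K)))"
    using orth_family_span[OF orth_family_jackP hom_pb[OF M refl]] by blast
  have t: "flinear t1_len" unfolding t1_len_eq by (rule flinear_t1_scale)
  have "S (t1_len (pb M)) = T (t1_len (pb M))"
    unfolding b flinear_sum[OF t] flinear_scale[OF t] flinear_sum[OF assms(1)] flinear_sum[OF assms(2)]
      flinear_scale[OF assms(1)] flinear_scale[OF assms(2)] P ..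
  moreover have "t1_len (pb M) = fscale (t1 ^ size M) (pb M)"
    by (rule poly_mapping_eqI) (use M in \<open>auto simp: t1_len_eq lookup_t1_scale pbasis_def lookup_single when_def plen_def\<close>)
  ultimately show "S (pb M) = T (pb M)"
    using t1_neq_0 by (simp add: flinear_scale[OF assms(1)] flinear_scale[OF assms(2)])
qed

lemma G1_eq: "G1 = G1_model"
  unfolding G1_def
proof (rule the_equality)
  show "flinear G1_model \<and> (\<forall>l. G1_model (fixed_point_class l) =
    fscale (- (\<Sum>s\<in>cells l. of_nat (coarm l s) * t1 + of_nat (coleg l s) * t2)) (fixed_point_class l))"
    using flinear_G1_model G1_model_fixed_point by blast
next
  fix G assume "flinear G \<and> (\<forall>l. G (fixed_point_class l) =
    fscale (- (\<Sum>s\<in>cells l. of_nat (coarm l s) * t1 + of_nat (coleg l s) * t2)) (fixed_point_class l))"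
  then show "G = G1_model"
    by (intro flinear_eq_on_fixed_points flinear_G1_model) (simp_all add: G1_model_fixed_point)
qed

lemma flinear_G1: "flinear G1"
  unfolding G1_eq by (rule flinear_G1_model)

lemma coef_G1:
  assumes "0 \<notin># L" "0 \<notin># N"
  shows "coef (G1 (pb L)) N = t2 * tpow L N * coef (Dop (pb L)) N"
proof -
  have "t1_scale (\<lambda>k. inverse (t1 ^ k)) (pb L) = fscale (inverse (t1 ^ size L)) (pb L)"
    by (rule poly_mapping_eqI) (use assms(1) in \<open>auto simp: lookup_t1_scale pbasis_def lookup_single when_def plen_def\<close>)
  moreover have "tpow L N = t1 ^ size N * inverse (t1 ^ size L)"
    using t1_neq_0 by (simp add: power_int_diff divide_inverse)
  ultimately show ?thesis
    using assms(2) by (simp add: G1_eq G1_model_def flinear_scale[OF flinear_Dop] t1_len_eq lookup_t1_scale plen_def mult_ac)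
qed

section \<open>The matrix elements of a single vertex operator\<close>

text \<open>Both factors of the denominator vanish to first order at s = 0; \<open>A\<close> and
  \<open>B\<close> are their quotients by s.\<close>

lemma Phi_expansion:
  obtains U :: "ratfun fps" where "Phi = fls_shift 2 (fps_to_fls U)" "fps_nth U 0 = - 1 / jalpha" "fps_nth U 1 = (jalpha - 1) / (2 * jalpha)"
proof
  define A B :: "ratfun fps" where "A = fps_shift 1 (1 - fps_exp jalpha)" and "B = fps_shift 1 (1 - fps_exp (- 1))"
  let ?V = "A * B"
  let ?U = "inverse ?V"
  have A: "1 - fps_exp jalpha = A * fps_X" and B: "1 - fps_exp (- 1) = B * fps_X"
    by (rule fps_ext, simp add: A_def B_def)+
  have V0: "fps_nth ?V 0 = - jalpha" by (simp add: A_def B_def)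
  have V1: "fps_nth ?V 1 = jalpha * (1 - jalpha) / 2"
    by (simp add: A_def B_def fps_mult_nth fact_numeral power2_eq_square field_simps numeral_2_eq_2)
  have UV: "?U * ?V = 1" by (rule inverse_mult_eq_1) (use V0 jalpha_neq_0 in simp)
  have U0: "fps_nth ?U 0 = - 1 / jalpha" using V0 by (simp add: divide_inverse)
  show "fps_nth ?U 0 = - 1 / jalpha" by (rule U0)
  have "fps_nth (?U * ?V) 1 = 0" unfolding UV by simp
  then have "fps_nth ?U 0 * fps_nth ?V 1 + fps_nth ?U 1 * fps_nth ?V 0 = 0" by (simp add: fps_mult_nth)
  then have "fps_nth ?U 1 * jalpha = - (1 / jalpha) * (jalpha * (1 - jalpha) / 2)" unfolding U0 V0 V1 by (simp add: algebra_simps)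
  also have "\<dots> = (jalpha - 1) / 2" using jalpha_neq_0 by (simp add: field_simps)
  finally have "fps_nth ?U 1 * (2 * jalpha) = jalpha - 1" by (simp add: mult_ac)
  then show "fps_nth ?U 1 = (jalpha - 1) / (2 * jalpha)"
    using jalpha_neq_0 by (subst nonzero_eq_divide_eq) simp_all
  have T: "inverse T_ser = fps_to_fls (fps_exp (- 1))"
  proof -
    have "fps_exp 1 * fps_exp (- 1) = (1 :: ratfun fps)" by (simp flip: fps_exp_add_mult)
    then have "T_ser * fps_to_fls (fps_exp (- 1)) = 1" unfolding T_ser_def by (simp flip: fls_times_fps_to_fls)
    then show ?thesis by (rule inverse_unique)
  qed
  have "(1 - Q_ser) * (1 - inverse T_ser) = fps_to_fls ((1 - fps_exp jalpha) * (1 - fps_exp (- 1)))"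
    unfolding T Q_ser_def by (simp add: fls_times_fps_to_fls)
  also have "(1 - fps_exp jalpha) * (1 - fps_exp (- 1)) = ?V * fps_X ^ 2" unfolding A B by (simp add: power2_eq_square mult_ac)
  also have "fps_to_fls (?V * fps_X ^ 2) = fls_shift (- 2) (fps_to_fls ?V)"
    by (simp add: fls_times_fps_to_fls fps_to_fls_power fls_X_power_times_conv_shift)
  finally have D: "(1 - Q_ser) * (1 - inverse T_ser) = fls_shift (- 2) (fps_to_fls ?V)" .
  have "fls_shift 2 (fps_to_fls ?U) * fls_shift (- 2) (fps_to_fls ?V) = fps_to_fls (?U * ?V)"
    by (simp add: fls_times_both_shifted_simp fls_times_fps_to_fls)
  then have "fls_shift 2 (fps_to_fls ?U) * ((1 - Q_ser) * (1 - inverse T_ser)) = 1" unfolding D UV by simp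
  then have "inverse ((1 - Q_ser) * (1 - inverse T_ser)) = fls_shift 2 (fps_to_fls ?U)"
    by (intro inverse_unique) (simp only: mult.commute)
  then show "Phi = fls_shift 2 (fps_to_fls ?U)" by (simp only: Phi_def divide_inverse mult_1_left)
qed

text \<open>The double pole pairs c^d / d! with the coefficient of \<open>U\<close> of order 3 - d.
  The numbers q0, q1 stay unspecified because the moments of order 0 and 1 vanish where the formula
  is applied.\<close>

lemma psi_cubic:
  "\<exists>q0 q1. \<forall>c. psi c = q0 + q1 * c + (jalpha - 1) / (4 * jalpha) * c ^ 2 - 1 / (6 * jalpha) * c ^ 3"
proof -
  obtain U :: "ratfun fps" where U: "Phi = fls_shift 2 (fps_to_fls U)" "fps_nth U 0 = - 1 / jalpha" "fps_nth U 1 = (jalpha - 1) / (2 * jalpha)"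
    using Phi_expansion .
  have "psi c = fps_nth U 3 + fps_nth U 2 * c + (jalpha - 1) / (4 * jalpha) * c ^ 2 - 1 / (6 * jalpha) * c ^ 3" for c
  proof -
    have "Phi * fps_to_fls (fps_exp c) = fls_shift 2 (fps_to_fls (U * fps_exp c))"
      unfolding U(1) by (simp add: fls_times_fps_to_fls fls_shifted_times_simps)
    then have "psi c = fps_nth (U * fps_exp c) 3" by (simp add: psi_def)
    also have "\<dots> = fps_nth U 0 * (c ^ 3 / 6) + fps_nth U 1 * (c ^ 2 / 2) + fps_nth U 2 * c + fps_nth U 3"
      by (simp add: fps_mult_nth eval_nat_numeral fact_numeral)
    finally show ?thesis unfolding U(2,3) by (simp add: field_simps)
  qed
  then show ?thesis by blast
qed

text \<open>The functional \<open>\<psi>\<close> is a cubic polynomial in the exponent, so that it is determined by the moments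
  of order at most 3; a product of four factors \<open>xx\<close>, \<open>yy\<close> has no such moments.\<close>

definition mu :: "nat \<Rightarrow> nat \<Rightarrow> lring \<Rightarrow> ratfun" where
  "mu v d g = (\<Sum>e\<in>keys g. lookup g e * lookup (fst e) v ^ d)"

lemma mu_superset:
  assumes "finite S" "keys g \<subseteq> S"
  shows "mu v d g = (\<Sum>e\<in>S. lookup g e * lookup (fst e) v ^ d)"
  unfolding mu_def by (rule sum.mono_neutral_left) (use assms in \<open>auto simp: in_keys_iff\<close>)

lemma mu_add: "mu v d (g + h) = mu v d g + mu v d h"
  using keys_add[of g h]
  by (simp add: mu_superset[of "keys g \<union> keys h"] lookup_add
      distrib_right sum.distrib)

lemma mu_diff: "mu v d (g - h) = mu v d g - mu v d h"
  using mu_add[of v d "g - h" h] by simp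

lemma mu_sum: "mu v d (\<Sum>a\<in>A. g a) = (\<Sum>a\<in>A. mu v d (g a))"
  by (induction A rule: infinite_finite_induct) (simp_all add: mu_add, simp_all add: mu_def)

lemma mu_single: "mu v d (single e c) = c * lookup (fst e) v ^ d"
  by (simp add: mu_def)

lemma mu_lconst_mult: "mu v d (lconst c * g) = c * mu v d g"
proof -
  have "keys (lconst c * g) \<subseteq> keys g" by (auto simp: in_keys_iff)
  then show ?thesis
    by (subst mu_superset[of "keys g"]) (simp_all add: mu_def sum_distrib_left mult.assoc)
qed

lemma mu_mult: "mu v d (g * h) = (\<Sum>j\<le>d. of_nat (d choose j) * mu v j g * mu v (d - j) h)"
proof -
  let ?c = "\<lambda>e. lookup (fst e) v"
  have "mu v d (g * h) = (\<Sum>e\<in>keys g. \<Sum>e'\<in>keys h. \<Sum>j\<le>d.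
      of_nat (d choose j) * (lookup g e * ?c e ^ j) * (lookup h e' * ?c e' ^ (d - j)))"
    unfolding lring_mult_eq_sum mu_sum mu_single fst_add lookup_add binomial_ring sum_distrib_left
    by (intro sum.cong refl) (simp add: mult_ac)
  also have "\<dots> = (\<Sum>j\<le>d. \<Sum>e\<in>keys g. \<Sum>e'\<in>keys h.
      of_nat (d choose j) * (lookup g e * ?c e ^ j) * (lookup h e' * ?c e' ^ (d - j)))"
    by (subst sum.swap) (intro sum.cong refl sum.swap)
  also have "\<dots> = (\<Sum>j\<le>d. of_nat (d choose j) * mu v j g * mu v (d - j) h)"
    by (intro sum.cong refl) (simp add: mu_def sum_distrib_left sum_distrib_right mult_ac)
  finally show ?thesis .
qed

text \<open>At z = 1 the moments are the Taylor coefficients in s_v up to factorials, so this says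
  that g vanishes to order \<open>k\<close> at s_v = 0.\<close>

definition mord :: "nat \<Rightarrow> nat \<Rightarrow> lring \<Rightarrow> bool" where
  "mord v k g \<longleftrightarrow> (\<forall>d<k. mu v d g = 0)"

lemma mord_mult: "mord v k g \<Longrightarrow> mord v l h \<Longrightarrow> mord v (k + l) (g * h)"
  unfolding mord_def
proof (intro allI impI)
  fix d assume a: "\<forall>d<k. mu v d g = 0" "\<forall>d<l. mu v d h = 0" "d < k + l"
  have "of_nat (d choose j) * mu v j g * mu v (d - j) h = 0" if "j \<le> d" for j
  proof (cases "j < k")
    case False
    then have "d - j < l" using a(3) that by linarith
    then show ?thesis using a(2) by simp
  qed (use a(1) in simp)
  then show "mu v d (g * h) = 0" unfolding mu_mult by (intro sum.neutral) simp
qed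

lemma mu_xx: "mu v d (xx v m) = of_nat m ^ d - 0 ^ d"
  and mu_yy: "mu v d (yy v m) = (of_nat m * (jalpha - 1)) ^ d - (- of_nat m) ^ d"
  by (simp_all add: xx_def yy_def mu_diff mu_single)

lemma mord_prod:
  assumes "\<And>m. mord v 1 (x m)"
  shows "mord v (size M) (prod_mset (image_mset x M))"
proof (induction M)
  case (add m M)
  then show ?case using mord_mult[OF assms add.IH] by simp
qed (simp add: mord_def)

lemma mord_ee:
  assumes "\<And>m. mord v 1 (x m)"
  shows "mord v (size M) (ee x M)"
  using mord_prod[OF assms, of M] by (simp add: mord_def ee_def mu_lconst_mult)

definition zv :: "nat \<Rightarrow> int \<Rightarrow> lexpt set" where
  "zv v d = {e. snd e = single v d}"

lemma zv_add: "e \<in> zv v d \<Longrightarrow> e' \<in> zv v d' \<Longrightarrow> e + e' \<in> zv v (d + d')"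
  by (simp add: zv_def single_add)

lemma supp_zv_ee: "supp_in (zv v (int (sum_mset A))) (ee (xx v) A)" "supp_in (zv v (- int (sum_mset A))) (ee (yy v) A)"
proof -
  show "supp_in (zv v (int (sum_mset A))) (ee (xx v) A)"
  proof (rule supp_in_ee[of "\<lambda>m. zv v (int m)"])
    show "e + e' \<in> zv v (int (m + n))" if "e \<in> zv v (int m)" "e' \<in> zv v (int n)" for e e' m n
      using zv_add[OF that] by simp
    show "supp_in (zv v (int m)) (xx v m)" for m
      unfolding xx_def by (intro supp_in_diff supp_in_single) (simp_all add: zv_def)
  qed (simp add: zv_def)
  show "supp_in (zv v (- int (sum_mset A))) (ee (yy v) A)"
  proof (rule supp_in_ee[of "\<lambda>m. zv v (- int m)"])
    show "e + e' \<in> zv v (- int (m + n))" if "e \<in> zv v (- int m)" "e' \<in> zv v (- int n)" for e e' m n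
      using zv_add[OF that] by simp
    show "supp_in (zv v (- int m)) (yy v m)" for m
      unfolding yy_def by (intro supp_in_diff supp_in_single) (simp_all add: zv_def)
  qed (simp add: zv_def)
qed

definition WW :: "nat \<Rightarrow> nms \<Rightarrow> nms \<Rightarrow> ratfun" where
  "WW v A B = Psi {v} (ee (xx v) A * ee (yy v) B)"

lemma supp_zv_WW: "supp_in (zv v (int (sum_mset A) - int (sum_mset B))) (ee (xx v) A * ee (yy v) B)"
proof -
  have "supp_in (zv v (int (sum_mset A) + - int (sum_mset B))) (ee (xx v) A * ee (yy v) B)"
    by (rule supp_in_mult[OF supp_zv_ee(1) supp_zv_ee(2)]) (rule zv_add)
  then show ?thesis by (simp only: add_uminus_conv_diff)
qed

lemma WW_degree:
  assumes "sum_mset A \<noteq> sum_mset B"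
  shows "WW v A B = 0"
  unfolding WW_def Psi_def
proof (rule sum.neutral, rule ballI)
  fix e assume "e \<in> keys (ee (xx v) A * ee (yy v) B)"
  then have "snd e = single v (int (sum_mset A) - int (sum_mset B))"
    using supp_zv_WW[of v A B] by (auto simp: supp_in_def zv_def simp del: of_nat_sum_mset)
  moreover have "int (sum_mset A) - int (sum_mset B) \<noteq> 0" using assms by linarith
  ultimately have "snd e \<noteq> 0" by (metis lookup_single_eq lookup_zero)
  then show "lookup (ee (xx v) A * ee (yy v) B) e * Psi_mon {v} e = 0" by (simp add: Psi_mon_def)
qed

text \<open>Two or more factors kill the moments of order 0 and 1, and equal sums make the exponent
  of z vanish on the whole support.\<close>

lemma WW_eq:
  assumes "sum_mset A = sum_mset B" "size A + size B \<ge> 2"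
  shows "WW v A B = (jalpha - 1) / (4 * jalpha) * mu v 2 (ee (xx v) A * ee (yy v) B) - 1 / (6 * jalpha) * mu v 3 (ee (xx v) A * ee (yy v) B)"
proof -
  let ?g = "ee (xx v) A * ee (yy v) B" and ?c = "\<lambda>e. lookup (fst e) v"
  obtain q0 q1 where psi: "\<And>c. psi c = q0 + q1 * c + (jalpha - 1) / (4 * jalpha) * c ^ 2 - 1 / (6 * jalpha) * c ^ 3"
    using psi_cubic by blast
  have "mord v (size A + size B) ?g"
    by (intro mord_mult mord_ee) (simp_all add: mord_def mu_xx mu_yy)
  then have m: "\<forall>d<size A + size B. mu v d ?g = 0" by (simp only: mord_def)
  have o: "mu v 0 ?g = 0" "mu v 1 ?g = 0" by (rule m[rule_format], use assms(2) in linarith)+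
  have "WW v A B = (\<Sum>e\<in>keys ?g. lookup ?g e * psi (?c e))"
    unfolding WW_def Psi_def
  proof (rule sum.cong[OF refl])
    fix e assume "e \<in> keys ?g"
    then have "snd e = 0" using supp_zv_WW[of v A B] assms(1) by (auto simp: supp_in_def zv_def)
    then show "lookup ?g e * Psi_mon {v} e = lookup ?g e * psi (?c e)" by (simp add: Psi_mon_def)
  qed
  also have "\<dots> = (\<Sum>e\<in>keys ?g. q0 * (lookup ?g e * ?c e ^ 0) + q1 * (lookup ?g e * ?c e ^ 1)
     + (jalpha - 1) / (4 * jalpha) * (lookup ?g e * ?c e ^ 2) - 1 / (6 * jalpha) * (lookup ?g e * ?c e ^ 3))"
    by (rule sum.cong[OF refl]) (simp add: psi algebra_simps)
  also have "\<dots> = q0 * mu v 0 ?g + q1 * mu v 1 ?g + (jalpha - 1) / (4 * jalpha) * mu v 2 ?g - 1 / (6 * jalpha) * mu v 3 ?g"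
    unfolding sum_subtractf sum.distrib sum_distrib_left[symmetric] mu_def ..
  finally show ?thesis using o by simp
qed

lemma WW_large:
  assumes "size A + size B \<ge> 4"
  shows "WW v A B = 0"
proof (cases "sum_mset A = sum_mset B")
  case True
  have "mord v (size A + size B) (ee (xx v) A * ee (yy v) B)"
    by (intro mord_mult mord_ee) (simp_all add: mord_def mu_xx mu_yy)
  then have m: "\<forall>d<size A + size B. mu v d (ee (xx v) A * ee (yy v) B) = 0" by (simp only: mord_def)
  have "mu v 2 (ee (xx v) A * ee (yy v) B) = 0" "mu v 3 (ee (xx v) A * ee (yy v) B) = 0"
    by (rule m[rule_format], use assms in linarith)+
  then show ?thesis using WW_eq[OF True] assms by simp
qed (rule WW_degree)

lemma ee_single: "ee x {#i#} = lconst (1 / of_nat i) * x i"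
  by (simp add: ee_def zmset_add_mset)

lemma ee_pair: "ee x {#a, b#} = lconst (1 / of_nat (if a = b then 2 * a * b else a * b)) * (x a * x b)"
  by (simp add: ee_def zmset_add_mset mult_ac)

lemma WW_empty: "WW v {#} {#} = psi 0"
proof -
  have "WW v {#} {#} = Psi {v} (single 0 1)" by (simp add: WW_def)
  then show ?thesis by (simp only: Psi_single) (simp add: Psi_mon_def)
qed

lemma mu_lconst_product: "mu v d ((lconst c * g) * (lconst c' * h)) = c * c' * mu v d (g * h)"
proof -
  have "(lconst c * g) * (lconst c' * h) = lconst (c * c') * (g * h)" by (simp add: lconst_mult mult_ac)
  then show ?thesis by (simp only: mu_lconst_mult)
qed

text \<open>Up to sign, this and the next two values are the coefficients of Laplace-Beltrami: the
  diagonal one, the splitting of a part and the merging of two. The factor 1/2 for a = b comes from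
  z of the pair.\<close>

lemma WW_1_1:
  assumes "i > 0"
  shows "WW v {#i#} {#i#} = - (jalpha - 1) * (of_nat i - 1) / 2"
proof -
  let ?i = "of_nat i :: ratfun"
  have 2: "mu v 2 (xx v i * yy v i) = 2 * ?i * (jalpha * ?i)"
    by (simp add: mu_mult mu_xx mu_yy eval_nat_numeral algebra_simps)
  have 3: "mu v 3 (xx v i * yy v i) = 3 * ?i ^ 3 * jalpha * (jalpha - 1)"
    by (simp add: mu_mult mu_xx mu_yy eval_nat_numeral algebra_simps)
  show ?thesis
    using assms jalpha_neq_0
    by (simp add: WW_eq ee_single mu_lconst_product 2 3 divide_simps) (simp add: algebra_simps eval_nat_numeral)
qed

lemma WW_2_1:
  assumes "a > 0" "b > 0"
  shows "WW v {#a, b#} {#a + b#} = (if a = b then - 1 / 2 else - 1)"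
proof -
  let ?g = "xx v a * xx v b * yy v (a + b)"
  have 2: "mu v 2 ?g = 0"
    by (simp add: mu_mult mu_xx mu_yy eval_nat_numeral algebra_simps)
  have 3: "mu v 3 ?g = 6 * of_nat a * of_nat b * (jalpha * of_nat (a + b))"
    by (simp add: mu_mult mu_xx mu_yy eval_nat_numeral algebra_simps)
  have nz: "of_nat (a + b) \<noteq> (0 :: ratfun)" "of_nat a \<noteq> (0 :: ratfun)" "of_nat b \<noteq> (0 :: ratfun)" using assms by (simp_all del: of_nat_add)
  show ?thesis
    using nz jalpha_neq_0
    by (simp add: WW_eq ee_single ee_pair mu_lconst_product 2 3 divide_simps del: of_nat_add)
qed

lemma WW_1_2:
  assumes "a > 0" "b > 0"
  shows "WW v {#a + b#} {#a, b#} = (if a = b then - jalpha / 2 else - jalpha)"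
proof -
  let ?g = "xx v (a + b) * (yy v a * yy v b)"
  have 2: "mu v 2 ?g = 0"
    by (simp add: mu_mult mu_xx mu_yy eval_nat_numeral algebra_simps)
  have 3: "mu v 3 ?g = 6 * of_nat (a + b) * (jalpha * of_nat a) * (jalpha * of_nat b)"
    by (simp add: mu_mult mu_xx mu_yy eval_nat_numeral algebra_simps)
  have nz: "of_nat (a + b) \<noteq> (0 :: ratfun)" "of_nat a \<noteq> (0 :: ratfun)" "of_nat b \<noteq> (0 :: ratfun)" using assms by (simp_all del: of_nat_add)
  show ?thesis
    using nz jalpha_neq_0
    by (simp add: WW_eq ee_single ee_pair mu_lconst_product 2 3 divide_simps del: of_nat_add)
qed

lemma Emat_eq:
  "Emat v L N = (\<Sum>M | M \<subseteq># N \<and> M \<subseteq># L. zq L M * WW v (N - M) (L - M))"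
  unfolding Emat_def GG_def Psi_sum WW_def
  by (rule sum.cong[OF refl]) (simp only: mult.left_commute[of "ee _ _"] Psi_lconst_mult)

section \<open>Normally ordered form of the Laplace-Beltrami operator\<close>

lemma annihilation_pb:
  assumes "m > 0" "0 \<notin># L"
  shows "heis (int m) (pb L) = (if m \<in># L then fscale (zq L (L - {#m#})) (pb (L - {#m#})) else 0)"
proof (cases "m \<in># L")
  case True
  have z: "zmset (L - {#m#}) > 0" using assms(2) by (intro zmset_pos) (metis in_diffD)
  have "count L m = Suc (count (L - {#m#}) m)" using True by (simp add: Suc_diff_1)
  then have "zmset L = m * count L m * zmset (L - {#m#})"
    using zmset_add_mset[of m "L - {#m#}"] True by simp
  then have "zq L (L - {#m#}) = (of_nat m * of_nat (count L m) :: ratfun)"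
    using z by simp
  then show ?thesis using heis_annihilation[OF assms(1), of "Partition L"] assms(2) True by simp
next
  case False
  then have "count L m = 0" by (simp add: not_in_iff)
  then show ?thesis using heis_annihilation[OF assms(1), of "Partition L"] assms(2) False by simp
qed

lemma creation_pb: "m > 0 \<Longrightarrow> 0 \<notin># L \<Longrightarrow> heis (- int m) (pb L) = pb (add_mset m L)"
  using heis_creation[of m "Partition L"] by simp

definition ind :: "bool \<Rightarrow> ratfun" where "ind b = (if b then 1 else 0)"

text \<open>The matrix element of the normally ordered product with creation part \<open>A\<close>
  and annihilation part \<open>B\<close>, written as a sum over \<open>M\<close> for termwise
  comparison with \<open>Emat_eq\<close>.\<close>

definition kern :: "nms \<Rightarrow> nms \<Rightarrow> nms \<Rightarrow> nms \<Rightarrow> ratfun" where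
  "kern A B L N = (\<Sum>M | M \<subseteq># N \<and> M \<subseteq># L. zq L M * ind (N - M = A \<and> L - M = B))"

lemma finite_common_submultisets: "finite {M. M \<subseteq># N \<and> M \<subseteq># (L :: nms)}"
  by (rule finite_subset[OF _ finite_submultisets[of N]]) auto

lemma kern_eq:
  "kern A B L N = (if B \<subseteq># L \<and> N = L - B + A then zq L (L - B) else 0)"
proof (cases "B \<subseteq># L \<and> N = L - B + A")
  case True
  have iff: "N - M = A \<and> L - M = B \<longleftrightarrow> M = L - B" if "M \<subseteq># L" for M
  proof
    assume "N - M = A \<and> L - M = B"
    then show "M = L - B" using diff_diff_submultiset[OF that] by simp
  next
    assume "M = L - B"
    then show "N - M = A \<and> L - M = B" using True diff_diff_submultiset[of B L] by simp
  qed
  have "kern A B L N = (\<Sum>M | M \<subseteq># N \<and> M \<subseteq># L. if M = L - B then zq L (L - B) else 0)"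
    unfolding kern_def by (rule sum.cong[OF refl]) (simp add: iff ind_def)
  also have "\<dots> = zq L (L - B)"
  proof -
    have "L - B \<subseteq># N" unfolding conjunct2[OF True] by (rule mset_subset_eq_add_left)
    moreover have "L - B \<subseteq># L" by simp
    ultimately have "L - B \<in> {M. M \<subseteq># N \<and> M \<subseteq># L}" by simp
    then show ?thesis using finite_common_submultisets[of N L] by simp
  qed
  finally show ?thesis using True by simp
next
  case False
  have "ind (N - M = A \<and> L - M = B) = 0" if M: "M \<subseteq># N" "M \<subseteq># L" for M
  proof (rule ccontr)
    assume "ind (N - M = A \<and> L - M = B) \<noteq> 0"
    then have *: "N - M = A" "L - M = B" by (auto simp: ind_def split: if_splits)
    have "L - B = M" using diff_diff_submultiset[OF M(2)] * by simp
    moreover have "N = M + A" using * M(1) by (metis subset_mset.add_diff_inverse)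
    moreover have "B \<subseteq># L" using *(2) by (metis diff_subset_eq_self)
    ultimately show False using False by simp
  qed
  then have "kern A B L N = 0" unfolding kern_def by (intro sum.neutral) simp
  then show ?thesis unfolding if_not_P[OF False] .
qed

lemma coef_kern_1_1:
  assumes "t > 0" "u > 0" "0 \<notin># L" "0 \<notin># N"
  shows "coef (heis (- int t) (heis (int u) (pb L))) N = kern {#t#} {#u#} L N"
proof -
  have "0 \<notin># L - {#u#}" using assms(3) by (metis in_diffD)
  then show ?thesis
    using assms by (auto simp: annihilation_pb creation_pb kern_eq flinear_scale[OF linear_heis] flinear_0[OF linear_heis] coef_pb)
qed

lemma coef_kern_2_1:
  assumes "t > 0" "s > 0" "u > 0" "0 \<notin># L" "0 \<notin># N"
  shows "coef (heis (- int t) (heis (- int s) (heis (int u) (pb L)))) N = kern {#t, s#} {#u#} L N"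
proof -
  have "0 \<notin># L - {#u#}" using assms(4) by (metis in_diffD)
  then show ?thesis
    using assms by (auto simp: annihilation_pb creation_pb kern_eq flinear_scale[OF linear_heis] flinear_0[OF linear_heis] coef_pb)
qed

lemma coef_kern_1_2:
  assumes "t > 0" "m > 0" "r > 0" "0 \<notin># L" "0 \<notin># N"
  shows "coef (heis (- int t) (heis (int m) (heis (int r) (pb L)))) N = kern {#t#} {#m, r#} L N"
proof -
  have 1: "0 \<notin># L - {#r#}" using assms(4) by (metis in_diffD)
  then have 2: "0 \<notin># L - {#r#} - {#m#}" by (metis in_diffD)
  have sub: "{#m, r#} \<subseteq># L \<longleftrightarrow> r \<in># L \<and> m \<in># L - {#r#}"
    unfolding add_mset_commute[of m r] by (simp only: insert_subset_eq_iff) simp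
  have d: "L - {#m, r#} = L - {#r#} - {#m#}" by (simp add: diff_diff_add_mset add_mset_commute)
  show ?thesis
  proof (cases "r \<in># L \<and> m \<in># L - {#r#}")
    case True
    have "heis (- int t) (heis (int m) (heis (int r) (pb L))) =
      fscale (zq L (L - {#r#})) (fscale (zq (L - {#r#}) (L - {#r#} - {#m#})) (pb (add_mset t (L - {#r#} - {#m#}))))"
      using True assms 1 2 by (simp add: annihilation_pb creation_pb flinear_scale[OF linear_heis])
    also have "\<dots> = fscale (zq L (L - {#r#} - {#m#})) (pb (add_mset t (L - {#r#} - {#m#})))"
      using zmset_pos[OF 1] by simp
    finally show ?thesis
      using True assms 2 unfolding kern_eq sub d by (auto simp: coef_pb)
  next
    case False
    then have "heis (int m) (heis (int r) (pb L)) = 0"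
      using assms 1 by (auto simp: annihilation_pb flinear_scale[OF linear_heis] flinear_0[OF linear_heis])
    moreover have "kern {#t#} {#m, r#} L N = 0" unfolding kern_eq sub by (rule if_not_P) (use False in blast)
    ultimately show ?thesis by (simp only: flinear_0[OF linear_heis] lookup_zero)
  qed
qed

text \<open>Each a_(-t) a_t multiplies p_L by t times the multiplicity of t; together they give the
  degree.\<close>

lemma sum_kern_1_1:
  assumes "0 \<notin># L"
  shows "(\<Sum>t=1..sum_mset L. kern {#t#} {#t#} L N) = of_nat (sum_mset L) * ind (N = L)"
proof -
  have "kern {#t#} {#t#} L N = of_nat (t * count L t) * ind (N = L)" for t
  proof (cases "t \<in># L")
    case True
    then have t: "t > 0" using assms by (auto intro: gr0I)
    have "kern {#t#} {#t#} L N = coef (heis (- int t) (heis (int t) (pb L))) L * ind (N = L)"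
      using True coef_kern_1_1[OF t t assms assms] by (simp add: kern_eq ind_def)
    also have "coef (heis (- int t) (heis (int t) (pb L))) L = of_nat (t * count L t)"
    proof -
      have "0 \<notin># L - {#t#}" using assms by (metis in_diffD)
      then have "heis (- int t) (heis (int t) (pb L)) = fscale (of_nat t * of_nat (count L t)) (pb L)"
        using heis_annihilation[OF t, of "Partition L"] True t assms by (simp add: flinear_scale[OF linear_heis] creation_pb)
      then show ?thesis using assms by (simp add: coef_pb)
    qed
    finally show ?thesis .
  next
    case False
    then have "count L t = 0" by (simp add: not_in_iff)
    then show ?thesis using False by (simp add: kern_eq)
  qed
  then have "(\<Sum>t=1..sum_mset L. kern {#t#} {#t#} L N) = of_nat (\<Sum>t=1..sum_mset L. t * count L t) * ind (N = L)"
    by (simp only: of_nat_sum sum_distrib_right)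
  also have "(\<Sum>t=1..sum_mset L. t * count L t) = sum_mset L"
  proof (rule sum_multiset_elements)
    show "set_mset L \<subseteq> {1..sum_mset L}"
    proof
      fix x assume x: "x \<in># L"
      then have "x > 0" using assms by (auto intro: gr0I)
      then show "x \<in> {1..sum_mset L}" using elem_le_sum_mset[OF x] by simp
    qed
  qed simp
  finally show ?thesis .
qed

text \<open>The coefficient of the normally ordered monomial (A, B) in Laplace-Beltrami. The shift
  in t - 1 comes from the multiple of the degree in \<open>Dop\<close>; the double sums run over
  ordered pairs.\<close>

definition wD :: "nat \<Rightarrow> nms \<Rightarrow> nms \<Rightarrow> ratfun" where
  "wD n A B = ((\<Sum>t=1..n. (jalpha - 1) * (of_nat t - 1) * ind (A = {#t#} \<and> B = {#t#}))
     + (\<Sum>(t, s)\<in>(SIGMA t:{1..n}. {1..n-t}). 1 * ind (A = {#t, s#} \<and> B = {#t + s#}))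
     + (\<Sum>(t, m)\<in>(SIGMA t:{1..n}. {1..<t}). jalpha * ind (A = {#t#} \<and> B = {#m, t - m#}))) / 2"

lemma sum_kern:
  "(\<Sum>a\<in>S. c a * kern (A a) (B a) L N) =
   (\<Sum>M | M \<subseteq># N \<and> M \<subseteq># L. zq L M * (\<Sum>a\<in>S. c a * ind (N - M = A a \<and> L - M = B a)))"
  unfolding kern_def sum_distrib_left
  by (subst sum.swap) (intro sum.cong refl, simp only: mult.left_commute)

lemma coef_Dop:
  assumes L: "0 \<notin># L" and N: "0 \<notin># N"
  shows "coef (Dop (pb L)) N = (\<Sum>M | M \<subseteq># N \<and> M \<subseteq># L. zq L M * wD (sum_mset L) (N - M) (L - M))"
proof -
  let ?n = "sum_mset L"
  have t: "coef (heis (- int t) (Lop ?n (Dvec (pb L)) t)) N =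
      jalpha * ((jalpha - 1) * of_nat t * kern {#t#} {#t#} L N + (\<Sum>s=1..?n-t. kern {#t, s#} {#t + s#} L N)
        + jalpha * (\<Sum>m=1..<t. kern {#t#} {#m, t - m#} L N))" if "t \<in> {1..?n}" for t
  proof -
    have t0: "t > 0" using that by simp
    have "heis (- int t) (Lop ?n (Dvec (pb L)) t) =
      fscale ((jalpha - 1) * of_nat t * jalpha) (heis (- int t) (heis (int t) (pb L)))
      + (\<Sum>s=1..?n-t. fscale jalpha (heis (- int t) (heis (- int s) (heis (int (t + s)) (pb L)))))
      + (\<Sum>m=1..<t. fscale (jalpha * jalpha) (heis (- int t) (heis (int m) (heis (int (t - m)) (pb L)))))"
      unfolding Lop_def Dvec_def flinear_add[OF linear_heis] flinear_scale[OF linear_heis] flinear_sum[OF linear_heis] fock.scale_sum_right fock.scale_scale ..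
    then have "coef (heis (- int t) (Lop ?n (Dvec (pb L)) t)) N =
      (jalpha - 1) * of_nat t * jalpha * coef (heis (- int t) (heis (int t) (pb L))) N
      + (\<Sum>s=1..?n-t. jalpha * coef (heis (- int t) (heis (- int s) (heis (int (t + s)) (pb L)))) N)
      + (\<Sum>m=1..<t. (jalpha * jalpha) * coef (heis (- int t) (heis (int m) (heis (int (t - m)) (pb L)))) N)"
      by (simp only: lookup_add lookup_sum fscale_lookup)
    also have "(\<Sum>s=1..?n-t. jalpha * coef (heis (- int t) (heis (- int s) (heis (int (t + s)) (pb L)))) N) = (\<Sum>s=1..?n-t. jalpha * kern {#t, s#} {#t + s#} L N)"
    proof (rule sum.cong[OF refl])
      fix s assume "s \<in> {1..?n-t}"
      then have s: "s > 0" "t + s > 0" by auto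
      show "jalpha * coef (heis (- int t) (heis (- int s) (heis (int (t + s)) (pb L)))) N = jalpha * kern {#t, s#} {#t + s#} L N"
        unfolding coef_kern_2_1[OF t0 s L N] ..
    qed
    also have "(\<Sum>m=1..<t. (jalpha * jalpha) * coef (heis (- int t) (heis (int m) (heis (int (t - m)) (pb L)))) N) = (\<Sum>m=1..<t. (jalpha * jalpha) * kern {#t#} {#m, t - m#} L N)"
    proof (rule sum.cong[OF refl])
      fix m assume "m \<in> {1..<t}"
      then have m: "m > 0" "t - m > 0" by auto
      show "(jalpha * jalpha) * coef (heis (- int t) (heis (int m) (heis (int (t - m)) (pb L)))) N = (jalpha * jalpha) * kern {#t#} {#m, t - m#} L N"
        unfolding coef_kern_1_2[OF t0 m L N] ..
    qed
    finally show ?thesis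
      unfolding coef_kern_1_1[OF t0 t0 L N] by (simp only: sum_distrib_left[symmetric] distrib_left mult_ac)
  qed
  have H: "coef (Hop 1 ?n (pb L)) N = jalpha * ((\<Sum>t=1..?n. (jalpha - 1) * of_nat t * kern {#t#} {#t#} L N)
     + (\<Sum>t=1..?n. \<Sum>s=1..?n-t. kern {#t, s#} {#t + s#} L N) + jalpha * (\<Sum>t=1..?n. \<Sum>m=1..<t. kern {#t#} {#m, t - m#} L N))"
  proof -
    have "coef (Hop 1 ?n (pb L)) N = (\<Sum>t=1..?n. coef (heis (- int t) (Lop ?n (Dvec (pb L)) t)) N)"
      by (simp add: Hop_def lookup_sum)
    also have "\<dots> = (\<Sum>t=1..?n. jalpha * ((jalpha - 1) * of_nat t * kern {#t#} {#t#} L N + (\<Sum>s=1..?n-t. kern {#t, s#} {#t + s#} L N)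
        + jalpha * (\<Sum>m=1..<t. kern {#t#} {#m, t - m#} L N)))"
      by (rule sum.cong[OF refl t])
    finally show ?thesis by (simp only: sum_distrib_left[symmetric] sum.distrib)
  qed
  have e: "(jalpha - 1) * of_nat ?n * coef (pb L) N = (\<Sum>t=1..?n. (jalpha - 1) * kern {#t#} {#t#} L N)"
    unfolding sum_distrib_left[symmetric] sum_kern_1_1[OF L] using coef_pb[OF L N] by (auto simp: ind_def)
  have "coef (Dop (pb L)) N = 1 / (2 * jalpha) * (coef (Hop 1 ?n (pb L)) N - jalpha * ((jalpha - 1) * of_nat ?n * coef (pb L) N))"
    using Dop_hom[OF hom_pb[OF L refl]] by (simp add: lookup_minus mult.assoc)
  also have "\<dots> = ((\<Sum>t=1..?n. (jalpha - 1) * of_nat t * kern {#t#} {#t#} L N) - (\<Sum>t=1..?n. (jalpha - 1) * kern {#t#} {#t#} L N)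
     + (\<Sum>t=1..?n. \<Sum>s=1..?n-t. kern {#t, s#} {#t + s#} L N) + jalpha * (\<Sum>t=1..?n. \<Sum>m=1..<t. kern {#t#} {#m, t - m#} L N)) / 2"
    unfolding H e right_diff_distrib[symmetric] using jalpha_neq_0 by simp
  also have "\<dots> = ((\<Sum>t=1..?n. (jalpha - 1) * (of_nat t - 1) * kern {#t#} {#t#} L N)
     + (\<Sum>(t, s)\<in>(SIGMA t:{1..?n}. {1..?n-t}). 1 * kern {#t, s#} {#t + s#} L N)
     + (\<Sum>(t, m)\<in>(SIGMA t:{1..?n}. {1..<t}). jalpha * kern {#t#} {#m, t - m#} L N)) / 2"
    by (simp add: sum.Sigma[symmetric] sum_distrib_left sum_subtractf[symmetric] algebra_simps)
  also have "\<dots> = (\<Sum>M | M \<subseteq># N \<and> M \<subseteq># L. zq L M * wD ?n (N - M) (L - M))"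
    unfolding case_prod_unfold sum_kern wD_def
    by (simp only: sum.distrib[symmetric] sum_divide_distrib) (intro sum.cong refl, simp only: distrib_left times_divide_eq_right add_divide_distrib)
  finally show ?thesis .
qed

lemma size_2E:
  assumes "size M = 2"
  obtains a b where "M = {#a, b#}"
proof -
  have "M \<noteq> {#}" using assms by auto
  then obtain a M' where M: "M = add_mset a M'" by (metis multi_nonempty_split)
  then have "size M' = 1" using assms by simp
  then obtain b where "M' = {#b#}" using size_1_singleton_mset by blast
  then show ?thesis using M that by simp
qed

lemma doubleton_eq: "{#a, b#} = {#c, d#} \<longleftrightarrow> (a = c \<and> b = d) \<or> (a = d \<and> b = c)"
  by (auto simp: add_eq_conv_ex)

text \<open>Both sides vanish for unequal sums and for four or more parts. This leaves the diagonal,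
  splitting and merging terms, and the empty term, where the constant \<open>psi 0\<close>
  compensates \<open>WW\<close>.\<close>

lemma wD_eq:
  assumes A: "0 \<notin># A" and B: "0 \<notin># B" and n: "sum_mset B \<le> n"
  shows "wD n A B = (if A = {#} \<and> B = {#} then psi 0 else 0) - WW v A B"
proof -
  let ?S1 = "\<Sum>t=1..n. (jalpha - 1) * (of_nat t - 1) * ind (A = {#t#} \<and> B = {#t#})"
  let ?S2 = "\<Sum>(t, s)\<in>(SIGMA t:{1..n}. {1..n-t}). 1 * ind (A = {#t, s#} \<and> B = {#t + s#})"
  let ?S3 = "\<Sum>(t, m)\<in>(SIGMA t:{1..n}. {1..<t}). jalpha * ind (A = {#t#} \<and> B = {#m, t - m#})"
  have z1: "?S1 = 0" if "\<And>t. \<not> (A = {#t#} \<and> B = {#t#})"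
  proof -
    have "ind (A = {#t#} \<and> B = {#t#}) = 0" for t using that[of t] unfolding ind_def by (rule if_not_P)
    then show ?thesis by simp
  qed
  have z2: "?S2 = 0" if "\<And>t s. \<not> (A = {#t, s#} \<and> B = {#t + s#})" using that by (intro sum.neutral) (simp add: ind_def)
  have z3: "?S3 = 0" if "\<And>t m. m < t \<Longrightarrow> \<not> (A = {#t#} \<and> B = {#m, t - m#})" using that by (intro sum.neutral) (auto simp: ind_def)
  consider (empty) "A = {#}" "B = {#}" | (one) i where "A = {#i#}" "B = {#i#}" "i > 0"
    | (two_one) a b where "A = {#a, b#}" "B = {#a + b#}" "a > 0" "b > 0"
    | (one_two) a b where "A = {#a + b#}" "B = {#a, b#}" "a > 0" "b > 0"
    | (other) "sum_mset A \<noteq> sum_mset B" | (large) "size A + size B \<ge> 4"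
  proof (cases "sum_mset A = sum_mset B \<and> size A + size B < 4")
    case True
    have ne: "A = {#} \<longleftrightarrow> B = {#}"
    proof
      assume "A = {#}"
      moreover have "size B \<le> sum_mset A" using size_le_sum_mset[OF B] conjunct1[OF True] by linarith
      ultimately have "size B = 0" by simp
      then show "B = {#}" by simp
    next
      assume "B = {#}"
      moreover have "size A \<le> sum_mset B" using size_le_sum_mset[OF A] conjunct1[OF True] by linarith
      ultimately have "size A = 0" by simp
      then show "A = {#}" by simp
    qed
    show ?thesis
    proof (cases "A = {#}")
      case True then show ?thesis using ne that(1) by simp
    next
      case False
      then have "A \<noteq> {#}" "B \<noteq> {#}" using ne by blast+
      then have "size A > 0" "size B > 0" by (simp_all only: nonempty_has_size)
      then consider "size A = 1" "size B = 1" | "size A = 2" "size B = 1" | "size A = 1" "size B = 2" using True by linarith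
      then show ?thesis
      proof cases
        case 1
        then obtain i j where "A = {#i#}" "B = {#j#}" by (meson size_1_singleton_mset)
        then show ?thesis using True A that(2)[of i] by simp
      next
        case 2
        then obtain a b c where "A = {#a, b#}" "B = {#c#}" by (metis size_1_singleton_mset size_2E)
        then show ?thesis using True A that(3)[of a b] by auto
      next
        case 3
        then obtain a b c where "A = {#c#}" "B = {#a, b#}" by (metis size_1_singleton_mset size_2E)
        then show ?thesis using True B that(4)[of a b] by auto
      qed
    qed
  next
    case False
    then show ?thesis using that(5,6) by linarith
  qed
  then show ?thesis
  proof cases
    case empty
    then show ?thesis by (simp add: wD_def ind_def WW_empty)
  next
    case one
    have "?S1 = (\<Sum>t=1..n. if t = i then (jalpha - 1) * (of_nat i - 1) else 0)"
      by (rule sum.cong[OF refl]) (auto simp: one ind_def)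
    also have "\<dots> = (jalpha - 1) * (of_nat i - 1)" using n one by simp
    finally have S1: "?S1 = (jalpha - 1) * (of_nat i - 1)" .
    have S2: "?S2 = 0" and S3: "?S3 = 0" by (rule z2, simp add: one, rule z3, simp add: one)
    show ?thesis unfolding wD_def S1 S2 S3 using WW_1_1[OF one(3), of v] one by (simp add: field_simps)
  next
    case two_one
    have S1: "?S1 = 0" and S3: "?S3 = 0" by (rule z1, simp add: two_one, rule z3, simp add: two_one)
    \<comment> \<open>The two orderings of {a, b} are different index pairs unless a = b; this
      matches the two cases of \<open>WW_2_1\<close>.\<close>
    have "?S2 = (\<Sum>p\<in>(SIGMA t:{1..n}. {1..n-t}). if p \<in> {(a, b), (b, a)} then 1 else 0)"
      by (rule sum.cong[OF refl]) (auto simp: two_one ind_def doubleton_eq split: if_splits)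
    also have "\<dots> = of_nat (card {(a, b), (b, a)})"
    proof -
      have "(SIGMA t:{1..n}. {1..n-t}) \<inter> {p. p \<in> {(a, b), (b, a)}} = {(a, b), (b, a)}" using n two_one by auto
      then show ?thesis by (simp add: sum.If_cases)
    qed
    also have "card {(a, b), (b, a)} = (if a = b then 1 else 2)" by auto
    finally have S2: "?S2 = of_nat (if a = b then 1 else 2)" .
    show ?thesis unfolding wD_def S1 S2 S3 using WW_2_1[OF two_one(3,4), of v] two_one by simp
  next
    case one_two
    have S1: "?S1 = 0" and S2: "?S2 = 0" by (rule z1, simp add: one_two, rule z2, simp add: one_two)
    have "?S3 = (\<Sum>p\<in>(SIGMA t:{1..n}. {1..<t}). if p \<in> {(a + b, a), (a + b, b)} then jalpha else 0)"
      by (rule sum.cong[OF refl]) (auto simp: one_two ind_def doubleton_eq split: if_splits)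
    also have "\<dots> = of_nat (card {(a + b, a), (a + b, b)}) * jalpha"
    proof -
      have "(SIGMA t:{1..n}. {1..<t}) \<inter> {p. p \<in> {(a + b, a), (a + b, b)}} = {(a + b, a), (a + b, b)}" using n one_two by auto
      then show ?thesis by (simp add: sum.If_cases)
    qed
    also have "card {(a + b, a), (a + b, b)} = (if a = b then 1 else 2)" by auto
    finally have S3: "?S3 = of_nat (if a = b then 1 else 2) * jalpha" .
    show ?thesis unfolding wD_def S1 S2 S3 using WW_1_2[OF one_two(3,4), of v] one_two by simp
  next
    case other
    have S1: "?S1 = 0" by (rule z1) (use other in auto)
    have S2: "?S2 = 0" by (rule z2) (use other in auto)
    have S3: "?S3 = 0" by (rule z3) (use other in auto)
    show ?thesis unfolding wD_def S1 S2 S3 using WW_degree[OF other] other by auto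
  next
    case large
    have S1: "?S1 = 0" by (rule z1) (use large in auto)
    have S2: "?S2 = 0" by (rule z2) (use large in auto)
    have S3: "?S3 = 0" by (rule z3) (use large in auto)
    show ?thesis unfolding wD_def S1 S2 S3 using WW_large[OF large] large by auto
  qed
qed

lemma coef_Dop_Emat:
  assumes L: "0 \<notin># L" and N: "0 \<notin># N"
  shows "coef (Dop (pb L)) N = (if L = N then psi 0 else 0) - Emat v L N"
proof -
  let ?S = "{M. M \<subseteq># N \<and> M \<subseteq># L}"
  have "coef (Dop (pb L)) N = (\<Sum>M\<in>?S. (if M = L then (if L = N then psi 0 else 0) else 0) - of_nat (zmset L) / of_nat (zmset M) * WW v (N - M) (L - M))"
    unfolding coef_Dop[OF L N]
  proof (rule sum.cong[OF refl])
    fix M assume "M \<in> ?S"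
    then have M: "M \<subseteq># N" "M \<subseteq># L" by auto
    have 0: "0 \<notin># N - M" "0 \<notin># L - M" using L N by (metis in_diffD)+
    have "sum_mset L = sum_mset M + sum_mset (L - M)" using M(2) by (metis subset_mset.add_diff_inverse sum_mset.union)
    then have le: "sum_mset (L - M) \<le> sum_mset L" by linarith
    have iff: "N - M = {#} \<and> L - M = {#} \<longleftrightarrow> M = L \<and> L = N"
    proof
      assume "N - M = {#} \<and> L - M = {#}"
      then have "N \<subseteq># M" "L \<subseteq># M" by (simp_all only: Diff_eq_empty_iff_mset)
      then show "M = L \<and> L = N" using M by (metis subset_mset.antisym)
    qed simp
    have "zq L L = (1 :: ratfun)" using zmset_pos[OF L] by simp
    then show "zq L M * wD (sum_mset L) (N - M) (L - M) =
      (if M = L then (if L = N then psi 0 else 0) else 0) - of_nat (zmset L) / of_nat (zmset M) * WW v (N - M) (L - M)"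
      unfolding wD_eq[OF 0 le, of v] iff by (auto simp: right_diff_distrib)
  qed
  also have "\<dots> = (\<Sum>M\<in>?S. if M = L then (if L = N then psi 0 else 0) else 0) - Emat v L N"
    by (simp only: sum_subtractf Emat_eq)
  also have "(\<Sum>M\<in>?S. if M = L then (if L = N then psi 0 else 0) else 0) = (if L = N then psi 0 else 0)"
    using finite_common_submultisets[of N L] by auto
  finally show ?thesis .
qed

text \<open>In \<open>coef_Dop_Emat\<close> the matrix element of \<open>Dop\<close> does not depend
  on v.\<close>

lemma Emat_variable: "0 \<notin># L \<Longrightarrow> 0 \<notin># N \<Longrightarrow> Emat v L N = Emat 1 L N"
  using coef_Dop_Emat[of L N v] coef_Dop_Emat[of L N 1] by simp

lemma coef_G1_Emat:
  "0 \<notin># L \<Longrightarrow> 0 \<notin># N \<Longrightarrow> coef (G1 (pb L)) N = t2 * tpow L N * ((if L = N then psi 0 else 0) - Emat 1 L N)"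
  using coef_G1[of L N] coef_Dop_Emat[of L N 1] by simp

section \<open>Conclusion\<close>

lemma filter_mset_all: "(\<And>x. x \<in># M \<Longrightarrow> P x) \<Longrightarrow> filter_mset P M = M"
  by (subst filter_mset_eq_conv) simp

lemma filter_mset_none: "(\<And>x. x \<in># M \<Longrightarrow> \<not> P x) \<Longrightarrow> filter_mset P M = {#}"
  by (subst filter_mset_eq_conv) simp

text \<open>Of all splittings only the one into negative and positive parts survives.\<close>

lemma Esg_gp:
  assumes "0 \<notin># A" "0 \<notin># B"
  shows "mconv (Esg (- 1) x) (Esg 1 y) (gp A B) = ee x A * ee y B"
proof -
  let ?N = "image_mset (\<lambda>j. - int j) A" and ?P = "image_mset int B"
  let ?f = "\<lambda>l1. Esg (- 1) x l1 * Esg 1 y (gp A B - l1)"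
  have N: "j < 0" if "j \<in># ?N" for j using that assms(1) by (auto intro: gr0I)
  have P: "j > 0" if "j \<in># ?P" for j using that assms(2) by (auto intro: gr0I)
  have "?f l1 = (if l1 = ?N then ee x A * ee y B else 0)" if l1: "l1 \<subseteq># gp A B" for l1
  proof (cases "(\<forall>j\<in>#l1. j < 0) \<and> (\<forall>j\<in>#gp A B - l1. j > 0)")
    case True
    have "filter_mset (\<lambda>j. j < 0) (gp A B) = filter_mset (\<lambda>j. j < 0) l1 + filter_mset (\<lambda>j. j < 0) (gp A B - l1)"
      using l1 by (metis filter_union_mset subset_mset.add_diff_inverse)
    moreover have "filter_mset (\<lambda>j. j < 0) l1 = l1" using True by (intro filter_mset_all) blast
    moreover have "filter_mset (\<lambda>j. j < 0) (gp A B - l1) = {#}"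
      by (rule filter_mset_none) (use True in fastforce)
    moreover have "filter_mset (\<lambda>j. j < 0) ?N = ?N" by (rule filter_mset_all[OF N])
    moreover have "filter_mset (\<lambda>j. j < 0) ?P = {#}" by (rule filter_mset_none) auto
    ultimately have l1N: "l1 = ?N" by (simp add: gp_def)
    have d: "gp A B - ?N = ?P" by (simp add: gp_def)
    have "Esg (- 1) x ?N = ee x A" using N by (simp add: Esg_def multiset.map_comp comp_def)
    moreover have "Esg 1 y ?P = ee y B" using P by (simp add: Esg_def multiset.map_comp comp_def)
    ultimately show ?thesis unfolding l1N d by simp
  next
    case False
    then have "?f l1 = 0" by (auto simp: Esg_def)
    moreover have "l1 \<noteq> ?N"
    proof
      assume "l1 = ?N"
      then have "gp A B - l1 = ?P" by (simp add: gp_def)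
      moreover have "\<forall>j\<in>#l1. j < 0" unfolding \<open>l1 = ?N\<close> using N by blast
      ultimately show False using False P by fastforce
    qed
    ultimately show ?thesis by simp
  qed
  then have "mconv (Esg (- 1) x) (Esg 1 y) (gp A B) = (\<Sum>l1 | l1 \<subseteq># gp A B. if l1 = ?N then ee x A * ee y B else 0)"
    unfolding mconv_def by (intro sum.cong refl) simp
  also have "\<dots> = ee x A * ee y B"
    using finite_submultisets[of "gp A B"] by (simp add: gp_def)
  finally show ?thesis .
qed

lemma Esg_zero:
  assumes "0 \<in># l"
  shows "mconv (Esg (- 1) x) (Esg 1 y) l = 0"
  unfolding mconv_def
proof (rule sum.neutral, rule ballI)
  fix l1 assume "l1 \<in> {l1. l1 \<subseteq># l}"
  then have "l = l1 + (l - l1)" by simp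
  then have "0 \<in># l1 \<or> 0 \<in># l - l1" using assms by (metis union_iff)
  then show "Esg (- 1) x l1 * Esg 1 y (l - l1) = 0" by (auto simp: Esg_def)
qed

lemma len_gp:
  assumes "0 \<notin># A" "0 \<notin># B"
  shows "len_neg (gp A B) = size A" "len_pos (gp A B) = size B"
proof -
  have N: "j < 0" if "j \<in># image_mset (\<lambda>j. - int j) A" for j using that assms(1) by (auto intro: gr0I)
  have P: "j > 0" if "j \<in># image_mset int B" for j using that assms(2) by (auto intro: gr0I)
  have "filter_mset (\<lambda>j. j < 0) (image_mset (\<lambda>j. - int j) A) = image_mset (\<lambda>j. - int j) A" by (rule filter_mset_all[OF N])
  moreover have "filter_mset (\<lambda>j. j > 0) (image_mset int B) = image_mset int B" by (rule filter_mset_all[OF P])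
  moreover have "filter_mset (\<lambda>j. j < 0) (image_mset int B) = {#}" by (rule filter_mset_none) auto
  moreover have "filter_mset (\<lambda>j. j > 0) (image_mset (\<lambda>j. - int j) A) = {#}" by (rule filter_mset_none) auto
  ultimately show "len_neg (gp A B) = size A" "len_pos (gp A B) = size B"
    by (simp_all add: len_neg_def len_pos_def gp_def)
qed

theorem theorem6p4:
  fixes n k :: nat
  assumes "n > 0" and "k \<ge> 1"
  shows "deriv_op k (heis (- int n)) =
    op_of_coeffs (\<lambda>l. (- t2) ^ k * inverse t1 * t1_delta (coeff_s_z0 k
      (in_s 1 ((Q_ser ^ n - 1) * inverse T_ser ^ n) \<star> zpow 1 (- int n)
         \<star> sprod (\<lambda>i. in_s i (1 / ((1 - Q_ser) * (1 - inverse T_ser)))) [1..<Suc k]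
       \<star> sprod (\<lambda>j. sprod (\<lambda>i. ff i j) [1..<j] - sprod (\<lambda>i. ff j i) [1..<j]) [2..<Suc k]
       \<star> sprod (\<lambda>i. Gamma_minus i T_ser \<star> Gamma_minus_inv i 1) [1..<Suc k]
       \<star> sprod (\<lambda>i. Gamma_plus i (inverse Q_ser * T_ser) \<star> Gamma_plus_inv i T_ser) [1..<Suc k])) l)"
    (is "_ = op_of_coeffs (\<lambda>l. ?a * t1_delta (coeff_s_z0 k ?F) l)")
proof -
  define C where "C = coeff_s_z0 k ?F"
  let ?c = "\<lambda>l. ?a * t1_delta C l"
  let ?V = "mconv (Esg (- 1) (XX k)) (Esg 1 (YY k))"
  have "\<forall>l. \<exists>M0. \<forall>M\<ge>M0. C l = Psi {1..k} (Xpre n k M * ?V l)"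
    unfolding C_def by (intro allI coeff_vertex_series[OF assms(2)])
  from choice[OF this] obtain m where m': "\<forall>l. \<forall>M\<ge>m l. C l = Psi {1..k} (Xpre n k M * ?V l)" ..
  have m: "C l = Psi {1..k} (Xpre n k M * ?V l)" if "M \<ge> m l" for l M
    using m' that by blast
  have C_gp: "C (gp A B) = Psi {1..k} (Xpre n k M * (ee (XX k) A * ee (YY k) B))"
    if "0 \<notin># A" "0 \<notin># B" "M \<ge> m (gp A B)" for A B M
    using m[OF that(3)] Esg_gp[OF that(1,2), of "XX k" "YY k"] by simp
  \<comment> \<open>The total z-degree -n + |A| - |B| must vanish for a nonzero coefficient, so the
    generalized partition has sum -n.\<close>
  interpret homogeneous_coeffs ?c n
  proof
    fix l assume "?c l \<noteq> 0"
    then have C: "C l \<noteq> 0" by (auto simp: t1_delta_def)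
    have l0: "0 \<notin># l"
    proof
      assume "0 \<in># l"
      then have "C l = 0" using m[OF order_refl, of l] Esg_zero[of l "XX k" "YY k"] by simp
      then show False using C by simp
    qed
    then obtain A B where AB: "0 \<notin># A" "0 \<notin># B" "l = gp A B" by (rule gp_cases)
    have "Psi {1..k} (Xpre n k (m l) * (ee (XX k) A * ee (YY k) B)) \<noteq> 0"
      using C_gp[OF AB(1,2), of "m l"] C unfolding AB(3) by simp
    moreover have "supp_in (tdeg (- int n + (int (sum_mset A) + - int (sum_mset B)))) (Xpre n k (m l) * (ee (XX k) A * ee (YY k) B))"
      by (intro supp_tdeg_mult supp_tdeg_Xpre supp_tdeg_ee)
    ultimately have "- int n + (int (sum_mset A) + - int (sum_mset B)) = 0" using Psi_tdeg by blast
    then have "sum_mset l = - int n" unfolding AB(3) sum_mset_gp by linarith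
    then show "0 \<notin># l \<and> sum_mset l = - int n" using l0 by blast
  qed
  note facts = flinear_G1 Emat_variable coef_G1_Emat
  show ?thesis
    unfolding C_def[symmetric]
  proof (rule flinear_eqI)
    show "flinear (deriv_op k (heis (- int n)))"
      by (rule flinear_deriv_op[OF facts])
    show "flinear (op_of_coeffs ?c)" by (rule flinear_op_of_coeffs)
    fix L :: "nms" assume L: "0 \<notin># L"
    show "deriv_op k (heis (- int n)) (pb L) = op_of_coeffs ?c (pb L)"
    proof (rule fock_eqI)
      fix N :: "nms" assume N: "0 \<notin># N"
      let ?S = "{M. M \<subseteq># N \<and> M \<subseteq># L}"
      let ?g = "\<lambda>M. gp (N - M) (L - M)"
      \<comment> \<open>One truncation beyond the thresholds of all the finitely many generalized
        partitions in this matrix element, and beyond both degrees.\<close>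
      let ?M = "sum_mset L + sum_mset N + (\<Sum>M\<in>?S. m (?g M))"
      let ?t = "tpow L N"
      have "coef (op_of_coeffs ?c (pb L)) N = (\<Sum>M\<in>?S. ?c (?g M) * (zq L M))"
        by (rule coef_op_of_coeffs[OF L N])
      also have "\<dots> = (\<Sum>M\<in>?S. ?a * ?t * Psi {1..k} (Xpre n k ?M * (ee (XX k) (N - M) * (lconst (zq L M) * ee (YY k) (L - M)))))"
      proof (rule sum.cong[OF refl])
        fix M assume M: "M \<in> ?S"
        have 0: "0 \<notin># N - M" "0 \<notin># L - M" using L N by (metis in_diffD)+
        have "m (?g M) \<le> (\<Sum>M\<in>?S. m (?g M))"
          by (rule member_le_sum[OF M]) (simp_all add: finite_common_submultisets)
        then have le: "?M \<ge> m (?g M)" by linarith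
        have "size N = size M + size (N - M)" "size L = size M + size (L - M)"
          using M by (metis mem_Collect_eq size_union subset_mset.add_diff_inverse)+
        \<comment> \<open>The untouched parts cancel in the difference, so t1^delta contributes the
          same power for every \<open>M\<close>.\<close>
        then have s: "int (size (N - M)) - int (size (L - M)) = int (size N) - int (size L)" by linarith
        have e1: "?c (?g M) = ?a * ?t * Psi {1..k} (Xpre n k ?M * (ee (XX k) (N - M) * ee (YY k) (L - M)))"
          unfolding t1_delta_def len_gp[OF 0] s C_gp[OF 0 le] by (simp only: mult.assoc)
        have e2: "Xpre n k ?M * (ee (XX k) (N - M) * (lconst (zq L M) * ee (YY k) (L - M))) =
          lconst (zq L M) * (Xpre n k ?M * (ee (XX k) (N - M) * ee (YY k) (L - M)))"
          by (simp only: mult_ac)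
        show "?c (?g M) * (zq L M) =
          ?a * ?t * Psi {1..k} (Xpre n k ?M * (ee (XX k) (N - M) * (lconst (zq L M) * ee (YY k) (L - M))))"
          unfolding e1 e2 Psi_lconst_mult by (simp only: mult_ac)
      qed
      also have "\<dots> = ?a * ?t * Psi {1..k} (Xpre n k ?M * GG (XX k) (YY k) L N)"
        unfolding GG_def sum_distrib_left Psi_sum ..
      also have "\<dots> = coef (deriv_op k (heis (- int n)) (pb L)) N"
      proof (rule coef_deriv_op[OF facts assms L N, symmetric])
        have "sum_mset L \<le> ?M" "sum_mset N \<le> ?M" by (simp_all only: add.assoc le_add1 le_add2 trans_le_add2)
        then show "max (sum_mset L) (sum_mset N) \<le> ?M" by (rule max.boundedI)
      qed
      finally show "coef (deriv_op k (heis (- int n)) (pb L)) N = coef (op_of_coeffs ?c (pb L)) N" ..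
    qed
  qed
qed

end
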